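(* Let $W$ be a weight function as in the context. For every $\epsilon>0$, and every $N\ge1$ and $Q\ge1$, with $\tau=N/Q$, there exist a constant $c_4$ and a subspace (of the space of complex sequences indexed by $\{1,\dots,N\}$) of dimension $\mathcal{O}(\tau^2/[\epsilon^2\log(1/\epsilon)])$ such that, for any $(\varphi_n)_{1\le n\le N}$ orthogonal to this subspace and when $\log Q>c_4\log^2(N/Q)$, we have $$(1-\epsilon)\sum_m|\varphi_m|^2\le\sum_{q\ge1}\frac{W(q/Q)}{qQ\,I_0(W)}\sum_{a\,\mathrm{mod}^*q}|S(\varphi,a/q)|^2\le(1+\epsilon)\sum_m|\varphi_m|^2 .$$ Moreover, when $\tau\asymp1$ and for every integer $K\ge1$, there exist $\epsilon_0>0$ depending only on $\tau$ and $K$, and $2K$ unitary sequences $(\alpha_k)_{k\le K}$ and $(\beta_k)_{k\le K}$, two by two almost orthogonal in the sense that $$\forall\gamma,\gamma'\in\{\alpha_k\}\cup\{\beta_k\},\quad[\gamma,\gamma']_N=\delta_{\gamma=\gamma'}+\mathcal{O}\bigl(\exp(-c_4\sqrt{\log N})\bigr),$$ and such that, on one side, $$\sum_{q\ge1}\frac{W(q/Q)}{qQ\,I_0(W)}\sum_{a\,\mathrm{mod}^*q}|S(\alpha_k,a/q)|^2>(1+\epsilon_0)\sum_m|\alpha_{k,m}|^2$$ while on the other side $$\sum_{q\ge1}\frac{W(q/Q)}{qQ\,I_0(W)}\sum_{a\,\mathrm{mod}^*q}|S(\beta_k,a/q)|^2<(1-\epsilon_0)\sum_m|\beta_{k,m}|^2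 .$$
   Context: $e(x)=\exp(2\pi i x)$ and $S(\varphi,\alpha)=\sum_{1\le n\le N}\varphi_n e(n\alpha)$. The notation $a\,\mathrm{mod}^*q$ means that $a$ runs over the reduced residue classes modulo $q$; $\phi$ is Euler's totient function. Orthogonality is with respect to the hermitian product $[\varphi,\psi]_N=\frac1N\sum_{1\le n\le N}\varphi_n\overline{\psi_n}$ on sequences indexed by $\{1,\dots,N\}$. The weight $W:\mathbb{R}\to\mathbb{R}$ is of class $C^3$ on $\mathbb{R}$ and piecewise $C^4$, it is even with support inside $[-2,-1]\cup[1,2]$, and $\int_0^\infty W(u)du\ne0$. One sets $I_0(W)=\sum_{q\ge1}\frac{\phi(q)W(q/Q)}{qQ}$ (this depends on $Q$).
   Formalization: The dimension bound is asserted only for ε<1 (for ε≥1 log(1/ε) is zero or negative), and the second part only for N large in terms of W, K and the bounds on τ (for N=1 the form equals |φ₁|² exactly, so no such sequences exist). *)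

theory Defs
  imports
    "HOL-Analysis.Analysis"
    "HOL-Library.Function_Algebras"
    "HOL-Number_Theory.Totient"
begin

section \<open>Weight functions\<close>

text \<open>Intended for open \<open>S\<close>, so that \<^const>\<open>deriv\<close> is determined by the values on \<open>S\<close>.\<close>

definition class_C_on :: "nat \<Rightarrow> real set \<Rightarrow> (real \<Rightarrow> real) \<Rightarrow> bool" where
  "class_C_on k S f \<longleftrightarrow>
     (\<forall>j<k. \<forall>x\<in>S. (deriv ^^ j) f differentiable (at x)) \<and>
     continuous_on S ((deriv ^^ k) f)"

text \<open>Off a finite set of break points the function is of class \<open>C\<^sup>k\<close>, and the \<open>k\<close>-th derivative
  has finite one-sided limits at the break points. For a continuous \<open>f\<close> this says that \<open>f\<close> is
  \<open>C\<^sup>k\<close> (with one-sided derivatives at the end points) on each closed piece.\<close>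

definition piecewise_class_C :: "nat \<Rightarrow> (real \<Rightarrow> real) \<Rightarrow> bool" where
  "piecewise_class_C k f \<longleftrightarrow> continuous_on UNIV f \<and>
     (\<exists>S. finite S \<and> class_C_on k (- S) f \<and>
        (\<forall>x\<in>S. (\<exists>l. ((deriv ^^ k) f \<longlongrightarrow> l) (at_left x)) \<and>
                (\<exists>r. ((deriv ^^ k) f \<longlongrightarrow> r) (at_right x))))"

definition weight :: "(real \<Rightarrow> real) \<Rightarrow> bool" where
  "weight W \<longleftrightarrow>
     class_C_on 3 UNIV W \<and> piecewise_class_C 4 W \<and>
     (\<forall>x. W (- x) = W x) \<and>
     (\<forall>x. x \<notin> {-2..-1} \<union> {1..2} \<longrightarrow> W x = 0) \<and>
     integral {0..} W \<noteq> 0"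

section \<open>Sequences indexed by 1, ..., N\<close>

text \<open>A sequence indexed by \<open>{1..N}\<close> is a function on \<^typ>\<open>nat\<close> vanishing outside \<open>{1..N}\<close>.\<close>

definition seq_space :: "nat \<Rightarrow> (nat \<Rightarrow> complex) set" where
  "seq_space N = {f. \<forall>n. n \<notin> {1..N} \<longrightarrow> f n = 0}"

definition seq_scale :: "complex \<Rightarrow> (nat \<Rightarrow> complex) \<Rightarrow> nat \<Rightarrow> complex" where
  "seq_scale c f = (\<lambda>n. c * f n)"

text \<open>Subspaces and dimensions below are over the complex numbers.\<close>

global_interpretation seq: vector_space seq_scale
  by unfold_locales (auto simp: seq_scale_def fun_eq_iff algebra_simps)

definition herm :: "nat \<Rightarrow> (nat \<Rightarrow> complex) \<Rightarrow> (nat \<Rightarrow> complex) \<Rightarrow> complex" where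
  "herm N \<phi> \<psi> = 1 / of_nat N * (\<Sum>n=1..N. \<phi> n * cnj (\<psi> n))"

definition sq_norm :: "nat \<Rightarrow> (nat \<Rightarrow> complex) \<Rightarrow> real" where
  "sq_norm N \<phi> = (\<Sum>m=1..N. (cmod (\<phi> m))\<^sup>2)"

section \<open>The weighted large sieve sum\<close>

definition add_char :: "real \<Rightarrow> complex" where
  "add_char x = exp (2 * of_real pi * \<i> * of_real x)"

definition trig_sum :: "nat \<Rightarrow> (nat \<Rightarrow> complex) \<Rightarrow> real \<Rightarrow> complex" where
  "trig_sum N \<phi> \<alpha> = (\<Sum>n=1..N. \<phi> n * add_char (real n * \<alpha>))"

text \<open>The sums over \<open>q\<close> have finite support, since \<open>W (q / Q) = 0\<close> for \<open>q > 2 * Q\<close>.\<close>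

definition I0 :: "(real \<Rightarrow> real) \<Rightarrow> real \<Rightarrow> real" where
  "I0 W Q = (\<Sum>\<^sub>\<infinity>q\<in>{1..}. real (totient q) * W (real q / Q) / (real q * Q))"

definition sieve_sum :: "(real \<Rightarrow> real) \<Rightarrow> nat \<Rightarrow> real \<Rightarrow> (nat \<Rightarrow> complex) \<Rightarrow> real" where
  "sieve_sum W N Q \<phi> =
     (\<Sum>\<^sub>\<infinity>q\<in>{1..}. W (real q / Q) / (real q * Q * I0 W Q) *
        (\<Sum>a\<in>totatives q. (cmod (trig_sum N \<phi> (real a / real q)))\<^sup>2))"

end

theory Submission
 imports Defs "HOL-Complex_Analysis.Complex_Analysis" "HOL-Number_Theory.Number_Theory"
  "HOL-Computational_Algebra.Squarefree" "HOL-Real_Asymp.Real_Asymp"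
begin

text \<open>
  Expanding the squares, the sieve sum is a quadratic form whose kernel at \<open>m - n = h\<close> is a weighted
  sum of Ramanujan sums. Since \<open>\<Sum>q dvd l. c_q(h)\<close> is \<open>l\<close> or \<open>0\<close> according to whether \<open>l\<close> divides
  \<open>h\<close>, Moebius inversion turns it into a sum over the divisors of \<open>h\<close> of the function
  \<open>f(x) = \<Sum>k. mu(k)/k W(k x)\<close>; the diagonal gives the main term exactly, by the choice of \<open>I0\<close>.
  Reflecting \<open>l\<close> to \<open>h/l\<close> gives \<open>\<Sum>l dvd h. f(h/(l Q))\<close> for \<open>h \<noteq> 0\<close>.

  The prime number theorem enters through the smallness of \<open>f\<close> near \<open>0\<close>: a zero-free region for zeta
  and Perron's formula give \<open>f(x) = O(log(1/x)^(-3))\<close> (\<open>riesz_bound\<close>, \<open>mobius_sum_bound\<close>). Hence the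
  divisors \<open>l > L\<close>, with \<open>L\<close> a small power of \<open>Q\<close>, contribute an operator of small Hilbert-Schmidt norm
  (\<open>tail_kernel_hs\<close>). The divisors \<open>l \<le> L\<close> are expanded back into additive characters: the result is a
  sum over Farey fractions \<open>a/q\<close> of a kernel \<open>g(h/(q Q))/q\<close> modulated by \<open>e(a h/q)\<close>, and these pieces are
  nearly orthogonal because \<open>L\<close> is small.

  For the first claim, the piece attached to \<open>q\<close> is replaced by a step function on cells of length
  proportional to \<open>q Q\<close> when \<open>q\<close> is small, at the cost of a finite rank, and is dropped otherwise. The
  remainder has squared Hilbert-Schmidt norm \<open>O(\<tau>^2/log(1/\<epsilon>))\<close>, so that outside a space of dimension
  \<open>O(\<tau>^2/(\<epsilon>^2 log(1/\<epsilon>)))\<close> its norm is at most \<open>\<epsilon>\<close> (\<open>large_sieve_exceptional_subspace\<close>).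

  For the second claim, \<open>\<plusminus>\<close>-combinations of two far apart intervals, modulated by \<open>e(b n/q)\<close> with \<open>q\<close> prime,
  resonate with the single fraction \<open>-b/q\<close> and shift the form by \<open>\<plusminus>G(y)\<close> times a constant, where \<open>G\<close> is
  the limit of the profiles \<open>g\<close> (\<open>resonant_waves\<close>). For this to be available for every \<open>\<tau>\<close>, \<open>G\<close> must not
  vanish identically near \<open>0\<close>; otherwise \<open>f\<close> would vanish there. Testing the identity
  \<open>\<Sum>k. f(k x)/k = W(x)\<close> against \<open>log(1 + x^2 w^2)/x^2\<close>, the product formula for sinh evaluates one side up
  to an exponentially small error, while the other is a series in \<open>w^(-2)\<close> whose coefficients are the moments
  of \<open>W\<close> against \<open>x^(-2 n - 2)\<close>. So all these moments vanish, and \<open>W = 0\<close> by Weierstrass approximation.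
\<close>

section \<open>The zeta function to the right of the line 0\<close>

definition zeta_term :: "nat => complex => complex" where
 "zeta_term n s = (s - 1) * of_nat (Suc n) powr (- s)
   + of_nat (Suc (Suc n)) powr (1 - s) - of_nat (Suc n) powr (1 - s)"

text \<open>The function \<open>(s - 1) \<zeta>(s)\<close>: subtracting from each term of the zeta series the corresponding integral makes the series converge for \<open>Re s > 0\<close>, and the factor \<open>s - 1\<close> removes the pole.\<close>
definition pzeta :: "complex => complex" where
 "pzeta s = 1 + (\<Sum>n. zeta_term n s)"

lemma norm_of_nat_powr: "n > 0 ==> cmod (of_nat n powr s) = real n powr Re s"
 using norm_powr_real_powr[of "of_nat n" s] by simp

lemma closed_segment_real_ge:
 assumes "x \<in> closed_segment (of_nat m) (of_nat (Suc m) :: complex)"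
 obtains u where "x = of_real u" "real m <= u" "u <= real (Suc m)"
proof -
 have "x \<in> closed_segment (complex_of_real (real m)) (complex_of_real (real (Suc m)))"
  using assms by (simp only: of_real_of_nat_eq)
 then have "x \<in> of_real ` closed_segment (real m) (real (Suc m))"
  by (simp only: closed_segment_of_real)
 then show ?thesis using that by (auto simp: closed_segment_eq_real_ivl)
qed

lemma powr_der:
 fixes z s :: complex
 assumes "z \<notin> \<real>\<^sub>\<le>\<^sub>0"
 shows "((%z. c * z powr s) has_field_derivative (c * s) * z powr (s - 1)) (at z within S)"
 using DERIV_cmult[OF has_field_derivative_at_within[OF has_field_derivative_powr[OF assms]], of c s S]
 by (simp add: mult.assoc)

lemma zeta_term_bound1:
 assumes "Re s > 0"
 shows "cmod (zeta_term n s) <= cmod (s - 1) * cmod s * real (Suc n) powr (- Re s - 1)"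
proof -
 define m where "m = Suc n"
 define f where "f = (%i. %z::complex. if i = (0::nat) then 1 * z powr (1 - s)
   else if i = 1 then (1 - s) * z powr (-s) else ((1-s) * (-s)) * z powr (-s-1))"
 let ?S = "closed_segment (of_nat m) (of_nat (Suc m)) :: complex set"
 have nn: "x \<notin> \<real>\<^sub>\<le>\<^sub>0" "cmod (f 2 x) <= cmod (s-1) * cmod s * real m powr (- Re s - 1)" if "x \<in> ?S" for x
 proof -
  obtain u where u: "x = of_real u" "real m <= u" using closed_segment_real_ge[OF \<open>x \<in> ?S\<close>] by metis
  have m1: "real m > 0" by (simp add: m_def)
  then have u0: "u > 0" using u by linarith
  show "x \<notin> \<real>\<^sub>\<le>\<^sub>0" using u u0 by (simp add: complex_nonpos_Reals_iff)
  have "cmod (x powr (-s-1)) = u powr (- Re s - 1)" using u u0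
   by (simp add: norm_powr_real_powr)
  also have "... <= real m powr (- Re s - 1)" using u m1 assms by (intro powr_mono2') auto
  finally have "cmod (x powr (-s-1)) <= real m powr (- Re s - 1)" .
  then show "cmod (f 2 x) <= cmod (s-1) * cmod s * real m powr (- Re s - 1)"
   by (simp add: f_def norm_mult norm_minus_commute mult_left_mono)
 qed
 have "norm (f 0 (of_nat (Suc m)) - (\<Sum>i\<le>1. f i (of_nat m) * (of_nat (Suc m) - of_nat m) ^ i / fact i))
   <= (cmod (s-1) * cmod s * real m powr (- Re s - 1)) * norm (of_nat (Suc m) - of_nat m :: complex) ^ Suc 1 / fact 1"
 proof (rule field_Taylor[of ?S])
  fix i x assume "x \<in> ?S" "i <= (1::nat)"
  then have "i = 0 \<or> i = 1" and x: "x \<notin> \<real>\<^sub>\<le>\<^sub>0" using nn by auto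
  then show "(f i has_field_derivative f (Suc i) x) (at x within ?S)"
   using powr_der[OF x, of 1 "1-s" ?S] powr_der[OF x, of "1-s" "-s" ?S]
   by (auto simp: f_def[abs_def] algebra_simps)
 qed (use nn in \<open>auto simp: numeral_2_eq_2\<close>)
 also have "f 0 (of_nat (Suc m)) - (\<Sum>i\<le>1. f i (of_nat m) * (of_nat (Suc m) - of_nat m) ^ i / fact i) = zeta_term n s"
  by (simp add: f_def zeta_term_def m_def algebra_simps)
 finally show ?thesis by (simp add: m_def)
qed

lemma zeta_term_bound0:
 assumes "Re s > 0"
 shows "cmod (zeta_term n s) <= 2 * cmod (s - 1) * real (Suc n) powr (- Re s)"
proof -
 define m where "m = Suc n"
 define f where "f = (%i. %z::complex. if i = (0::nat) then 1 * z powr (1 - s)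
   else (1 - s) * z powr (-s))"
 let ?S = "closed_segment (of_nat m) (of_nat (Suc m)) :: complex set"
 have nn: "x \<notin> \<real>\<^sub>\<le>\<^sub>0" "cmod (f 1 x) <= cmod (s-1) * real m powr (- Re s)" if "x \<in> ?S" for x
 proof -
  obtain u where u: "x = of_real u" "real m <= u" using closed_segment_real_ge[OF \<open>x \<in> ?S\<close>] by metis
  have m1: "real m > 0" by (simp add: m_def)
  then have u0: "u > 0" using u by linarith
  show "x \<notin> \<real>\<^sub>\<le>\<^sub>0" using u u0 by (simp add: complex_nonpos_Reals_iff)
  have "cmod (x powr (-s)) = u powr (- Re s)" using u u0
   by (simp add: norm_powr_real_powr)
  also have "... <= real m powr (- Re s)" using u m1 assms by (intro powr_mono2') auto
  finally have "cmod (x powr (-s)) <= real m powr (- Re s)" .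
  then show "cmod (f 1 x) <= cmod (s-1) * real m powr (- Re s)"
   by (simp add: f_def norm_mult norm_minus_commute mult_left_mono)
 qed
 have "norm (f 0 (of_nat (Suc m)) - (\<Sum>i\<le>0. f i (of_nat m) * (of_nat (Suc m) - of_nat m) ^ i / fact i))
   <= (cmod (s-1) * real m powr (- Re s)) * norm (of_nat (Suc m) - of_nat m :: complex) ^ Suc 0 / fact 0"
 proof (rule field_Taylor[of ?S])
  fix i x assume "x \<in> ?S" "i <= (0::nat)"
  then have "i = 0" and x: "x \<notin> \<real>\<^sub>\<le>\<^sub>0" using nn by auto
  then show "(f i has_field_derivative f (Suc i) x) (at x within ?S)"
   using powr_der[OF x, of 1 "1-s" ?S]
   by (auto simp: f_def[abs_def] algebra_simps)
 qed (use nn in \<open>auto\<close>)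
 then have b: "cmod (of_nat (Suc m) powr (1-s) - of_nat m powr (1-s)) <= cmod (s-1) * real m powr (- Re s)"
  by (simp add: f_def)
 have "zeta_term n s = (s-1) * of_nat m powr (-s) + (of_nat (Suc m) powr (1-s) - of_nat m powr (1-s))"
  by (simp add: zeta_term_def m_def)
 then have "cmod (zeta_term n s) <= cmod ((s-1) * of_nat m powr (-s)) + cmod (s-1) * real m powr (- Re s)"
  using b by (smt (verit) norm_triangle_ineq)
 also have "cmod ((s-1) * of_nat m powr (-s)) = cmod (s-1) * real m powr (- Re s)"
  by (simp add: norm_mult norm_of_nat_powr m_def del: of_nat_Suc)
 finally show ?thesis by (simp add: m_def)
qed

text \<open>Interpolation between the trivial bound and the one obtained from the derivative; the exponent \<open>th\<close> trades decay in \<open>n\<close> against growth in \<open>s\<close>.\<close>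
lemma zeta_term_bound:
 assumes "Re s > 0" "0 <= th" "th <= 1"
 shows "cmod (zeta_term n s) <= 2 * cmod (s - 1) * cmod s powr th * real (Suc n) powr (- Re s - th)"
proof -
 let ?m = "real (Suc n)"
 have s0: "cmod s > 0" using assms by auto
 have *: "cmod s powr th * ?m powr (- Re s - th) = (cmod s / ?m) powr th * ?m powr (- Re s)"
  using s0 by (simp add: powr_divide powr_diff)
 show ?thesis
 proof (cases "cmod s <= ?m")
  case True
  have "cmod (zeta_term n s) <= cmod (s - 1) * ((cmod s / ?m) * ?m powr (- Re s))"
   using zeta_term_bound1[OF assms(1), of n] by (simp add: powr_diff)
  also have "cmod s / ?m <= (cmod s / ?m) powr th"
   using powr_mono'[of th 1 "cmod s / ?m"] True s0 assms by (simp add: field_simps)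
  finally have "cmod (zeta_term n s) <= cmod (s - 1) * ((cmod s / ?m) powr th * ?m powr (- Re s))"
   by (simp add: mult_left_mono mult_right_mono)
  also have "... <= 2 * ..." by simp
  finally show ?thesis using * by (simp add: mult.assoc)
 next
  case False
  have "1 <= (cmod s / ?m) powr th" using False assms by (intro ge_one_powr_ge_zero) auto
  then have "2 * cmod (s - 1) * (1 * ?m powr (- Re s)) <= 2 * cmod (s - 1) * ((cmod s / ?m) powr th * ?m powr (- Re s))"
   by (intro mult_left_mono mult_right_mono) auto
  then show ?thesis using zeta_term_bound0[OF assms(1), of n] * by (simp add: mult.assoc)
 qed
qed

lemma summable_Suc_powr: "b < -1 ==> summable (%n. real (Suc n) powr b)"
 by (subst summable_Suc_iff) (simp add: summable_real_powr_iff)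

lemma summable_zeta_term: "Re s > 0 ==> summable (%n. norm (zeta_term n s))"
 by (rule summable_comparison_test'[OF summable_mult[OF summable_Suc_powr], of "- Re s - 1" 0 _ "cmod (s - 1) * cmod s"])
   (auto intro: zeta_term_bound1 simp del: of_nat_Suc)

lemma zeta_term_holomorphic: "zeta_term n holomorphic_on S"
proof -
 have "of_nat (Suc n) ~= (0::complex)" "of_nat (Suc (Suc n)) ~= (0::complex)"
  by (metis of_nat_eq_0_iff nat.distinct(1))+
 then show ?thesis
 unfolding zeta_term_def[abs_def] by (auto intro!: holomorphic_intros simp del: of_nat_Suc)
qed

lemma pzeta_holomorphic: "pzeta holomorphic_on {s. Re s > 0}"
proof -
 have "(%s. \<Sum>n. zeta_term n s) holomorphic_on {s. Re s > 0}"
 proof (rule holomorphic_uniform_sequence[where f = "%N s. \<Sum>n<N. zeta_term n s"])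
  show "open {s. Re s > 0}" by (rule open_halfspace_Re_gt)
  show "(%s. \<Sum>n<N. zeta_term n s) holomorphic_on {s. Re s > 0}" for N
   by (intro holomorphic_intros zeta_term_holomorphic)
  fix x assume "x \<in> {s. Re s > 0}"
  then have x: "Re x > 0" by simp
  define d where "d = Re x / 2"
  have sub: "Re s >= d & cmod s <= cmod x + d" if "s \<in> cball x d" for s
  proof -
   have "cmod (x - s) <= d" using that by (simp add: dist_norm)
   then have "Re (x - s) <= d" "cmod s <= cmod x + d"
    using complex_Re_le_cmod[of "x - s"] norm_triangle_sub[of s x] by (auto simp: norm_minus_commute)
   then show ?thesis by (simp add: d_def)
  qed
  have d0: "d > 0" using x by (simp add: d_def)
  have "uniform_limit (cball x d) (%N s. \<Sum>n<N. zeta_term n s) (%s. \<Sum>n. zeta_term n s) sequentially"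
  proof (rule Weierstrass_m_test[where M = "%n. (cmod x + d + 1) * (cmod x + d) * real (Suc n) powr (- d - 1)"])
   show "summable (%n. (cmod x + d + 1) * (cmod x + d) * real (Suc n) powr (- d - 1))"
    using d0 by (intro summable_mult summable_Suc_powr) auto
   fix n s assume s: "s \<in> cball x d"
   have "cmod (zeta_term n s) <= cmod (s - 1) * cmod s * real (Suc n) powr (- Re s - 1)"
    using sub[OF s] d0 by (intro zeta_term_bound1) auto
   also have "... <= (cmod x + d + 1) * (cmod x + d) * real (Suc n) powr (- d - 1)"
    using sub[OF s] d0 norm_triangle_ineq4[of s 1] by (intro mult_mono powr_mono) auto
   finally show "cmod (zeta_term n s) <= (cmod x + d + 1) * (cmod x + d) * real (Suc n) powr (- d - 1)" .
  qed
  moreover have "cball x d \<subseteq> {s. Re s > 0}" using sub d0 by force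
  ultimately show "\<exists>d>0. cball x d \<subseteq> {s. Re s > 0} & uniform_limit (cball x d) (%N s. \<Sum>n<N. zeta_term n s) (%s. \<Sum>n. zeta_term n s) sequentially"
   using d0 by blast
 qed
 then show ?thesis unfolding pzeta_def[abs_def] by (intro holomorphic_intros)
qed

lemma pzeta_1: "pzeta 1 = 1"
proof -
 have "zeta_term n 1 = 0" for n
  by (simp add: zeta_term_def powr_def del: of_nat_Suc)
 then show ?thesis by (simp add: pzeta_def)
qed

lemma pzeta_eq:
 assumes "Re s > 1"
 shows "summable (%n. of_nat (Suc n) powr (-s))"
    "pzeta s = (s - 1) * (\<Sum>n. of_nat (Suc n) powr (-s))"
proof -
 have "summable (%n. norm (of_nat (Suc n) powr (-s)))"
  unfolding norm_of_nat_powr[OF zero_less_Suc] using assms by (intro summable_Suc_powr) auto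
 then show sm: "summable (%n. of_nat (Suc n) powr (-s))" by (rule summable_norm_cancel)
 have "(%n. real (Suc n) powr (1 - Re s)) \<longlonglongrightarrow> 0"
  using assms by (intro LIMSEQ_Suc tendsto_neg_powr filterlim_real_sequentially) auto
 moreover have "(%n. norm (of_nat (Suc n) powr (1 - s))) = (%n. real (Suc n) powr (1 - Re s))"
  by (rule ext) (subst norm_of_nat_powr, auto)
 ultimately have "(%n. norm (of_nat (Suc n) powr (1 - s))) \<longlonglongrightarrow> 0" by (simp only:)
 then have "(%n. of_nat (Suc n) powr (1 - s)) \<longlonglongrightarrow> 0"
  by (rule tendsto_norm_zero_cancel)
 then have "(%n. of_nat (Suc (Suc n)) powr (1 - s) - of_nat (Suc n) powr (1 - s)) sums (0 - of_nat (Suc 0) powr (1-s))"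
  by (rule telescope_sums)
 then have "(%n. (s-1) * of_nat (Suc n) powr (-s) + (of_nat (Suc (Suc n)) powr (1 - s) - of_nat (Suc n) powr (1 - s)))
   sums ((s - 1) * (\<Sum>n. of_nat (Suc n) powr (-s)) + (0 - of_nat (Suc 0) powr (1-s)))"
  by (intro sums_add sums_mult summable_sums sm)
 then have "(%n. zeta_term n s) sums ((s - 1) * (\<Sum>n. of_nat (Suc n) powr (-s)) - 1)"
  by (simp add: zeta_term_def[abs_def] algebra_simps)
 then show "pzeta s = (s - 1) * (\<Sum>n. of_nat (Suc n) powr (-s))"
  by (simp add: pzeta_def sums_iff)
qed

lemma pzeta_growth:
 obtains C where "C > 0" "!!s. Re s >= 99/100 ==> cmod (pzeta s) <= C * (1 + cmod s) powr (1 + 1/50)"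
proof -
 define S where "S = (\<Sum>n. real (Suc n) powr (- 101/100))"
 have sm: "summable (%n. real (Suc n) powr (- 101/100))" by (rule summable_Suc_powr) simp
 have S0: "S >= 0" unfolding S_def by (intro suminf_nonneg sm) auto
 show ?thesis
 proof (rule that[of "1 + 2 * S"])
  show "1 + 2 * S > 0" using S0 by simp
  fix s assume s: "Re s >= 99/100"
  then have "Re s > 0" by simp
  have b: "cmod (zeta_term n s) <= 2 * cmod (s - 1) * cmod s powr (1/50) * real (Suc n) powr (- 101/100)" for n
  proof -
   have "real (Suc n) powr (- Re s - 1/50) <= real (Suc n) powr (- 101/100)"
    using s by (intro powr_mono) auto
   then have "2 * cmod (s - 1) * cmod s powr (1/50) * real (Suc n) powr (- Re s - 1/50)
     <= 2 * cmod (s - 1) * cmod s powr (1/50) * real (Suc n) powr (- 101/100)"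
    by (intro mult_left_mono) auto
   then show ?thesis using zeta_term_bound[OF \<open>Re s > 0\<close>, of "1/50" n] by linarith
  qed
  have "cmod (\<Sum>n. zeta_term n s) <= (\<Sum>n. 2 * cmod (s - 1) * cmod s powr (1/50) * real (Suc n) powr (- 101/100))"
   by (rule order_trans[OF summable_norm suminf_le])
     (use b sm summable_zeta_term[OF \<open>Re s > 0\<close>] in \<open>auto intro!: summable_mult simp del: of_nat_Suc\<close>)
  also have "... = 2 * cmod (s - 1) * cmod s powr (1/50) * S"
   unfolding S_def using sm by (simp add: suminf_mult del: of_nat_Suc)
  also have "... <= 2 * (1 + cmod s) * (1 + cmod s) powr (1/50) * S"
   using S0 norm_triangle_ineq4[of s 1] by (intro mult_mono powr_mono2) auto
  finally have "cmod (\<Sum>n. zeta_term n s) <= 2 * S * ((1 + cmod s) * (1 + cmod s) powr (1/50))"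
   by (simp only: mult_ac)
  then have "cmod (pzeta s) <= 1 + 2 * S * ((1 + cmod s) * (1 + cmod s) powr (1/50))"
   unfolding pzeta_def using norm_triangle_ineq[of 1 "\<Sum>n. zeta_term n s"] by simp
  also have "(1 + cmod s) * (1 + cmod s) powr (1/50) = (1 + cmod s) powr (1 + 1/50)"
   by (subst powr_add) (simp add: add_nonneg_pos)
  finally have "cmod (pzeta s) <= 1 + 2 * S * (1 + cmod s) powr (1 + 1/50)" .
  moreover have "1 <= (1 + cmod s) powr (1 + 1/50)" by (intro ge_one_powr_ge_zero) auto
  moreover have "(1 + 2 * S) * (1 + cmod s) powr (1 + 1/50) = (1 + cmod s) powr (1 + 1/50) + 2 * S * (1 + cmod s) powr (1 + 1/50)"
   by (simp only: distrib_right mult_1)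
  ultimately show "cmod (pzeta s) <= (1 + 2 * S) * (1 + cmod s) powr (1 + 1/50)" by linarith
 qed
qed

lemma pzeta_deriv_growth:
 obtains C where "C > 0" "!!s. Re s >= 199/200 ==> cmod (deriv pzeta s) <= C * (1 + cmod s) powr (1 + 1/50)"
proof -
 obtain C where C: "C > 0" "!!s. Re s >= 99/100 ==> cmod (pzeta s) <= C * (1 + cmod s) powr (1 + 1/50)"
  using pzeta_growth by blast
 show ?thesis
 proof (rule that[of "C * 2 powr (1 + 1/50) * 200"])
  fix s assume s: "Re s >= 199/200"
  have near: "Re z >= 99/100 & cmod z <= cmod s + 1" if "cmod (s - z) <= 1/200" for z
  proof -
   have "Re (s - z) <= 1/200" using complex_Re_le_cmod[of "s - z"] that by linarith
   then show ?thesis using s that norm_triangle_sub[of z s] by (simp add: norm_minus_commute)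
  qed
  have sub: "cball s (1/200) \<subseteq> {s. Re s > 0}" using near by (force simp: dist_norm)
  have "cmod ((deriv ^^ 1) pzeta s) <= fact 1 * (C * 2 powr (1 + 1/50) * (1 + cmod s) powr (1 + 1/50)) / (1/200) ^ 1"
  proof (rule Cauchy_inequality)
   show "pzeta holomorphic_on ball s (1/200)"
    by (rule holomorphic_on_subset[OF pzeta_holomorphic]) (use sub ball_subset_cball in blast)
   show "continuous_on (cball s (1/200)) pzeta"
    by (rule holomorphic_on_imp_continuous_on, rule holomorphic_on_subset[OF pzeta_holomorphic]) (use sub in auto)
   fix z assume z: "cmod (s - z) = 1/200"
   have "cmod (pzeta z) <= C * (1 + cmod z) powr (1 + 1/50)" using near[of z] z C by auto
   also have "... <= C * (2 * (1 + cmod s)) powr (1 + 1/50)" using near[of z] z C norm_ge_zero[of s] norm_ge_zero[of z]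
    by (intro mult_left_mono powr_mono2) (auto simp del: norm_ge_zero)
   also have "... = C * 2 powr (1 + 1/50) * (1 + cmod s) powr (1 + 1/50)"
    by (subst powr_mult) auto
   finally show "cmod (pzeta z) <= C * 2 powr (1 + 1/50) * (1 + cmod s) powr (1 + 1/50)" .
  qed auto
  then show "cmod (deriv pzeta s) <= C * 2 powr (1 + 1/50) * 200 * (1 + cmod s) powr (1 + 1/50)"
   by (simp add: mult_ac)
 qed (use C in auto)
qed

section \<open>Dirichlet series of the Moebius function and the 3-4-1 inequality\<close>

definition mu :: "nat => real" where
 "mu n = (if squarefree n then (- 1) ^ card (prime_factors n) else 0)"

lemma abs_mu_le: "\<bar>mu n\<bar> <= 1"
 by (simp add: mu_def power_abs)

lemma mu_1 [simp]: "mu (Suc 0) = 1"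
 by (simp add: mu_def)

lemma mu_prime_mult:
 assumes "prime p" "\<not> p dvd d"
 shows "mu (p * d) = - mu d"
proof -
 have d0: "d ~= 0" "p ~= 0" using assms by (auto intro: Nat.gr0I)
 have cop: "coprime p d" using assms by (simp add: prime_imp_coprime)
 have sq: "squarefree (p * d) \<longleftrightarrow> squarefree d"
  using squarefree_mult_coprime[OF cop squarefree_prime[OF assms(1)]] squarefree_multD(2) by blast
 have "prime_factors (p * d) = insert p (prime_factors d)"
  using prime_factors_product[OF d0(2,1)] assms(1) by (simp add: prime_prime_factors)
 moreover have "p \<notin> prime_factors d" using assms by auto
 ultimately have "card (prime_factors (p * d)) = Suc (card (prime_factors d))" by simp
 then show ?thesis by (simp add: mu_def sq)
qed

lemma sum_mu_dvd:
 assumes "n > 0"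
 shows "(\<Sum>d | d dvd n. mu d) = of_bool (n = 1)"
proof (cases "n = 1")
 case False
 then obtain p where p: "prime p" "p dvd n" using prime_factor_nat by blast
 define D where "D = {d. d dvd n & \<not> p dvd d & squarefree d}"
 have p0: "p > 0" using p by (simp add: prime_gt_0_nat)
 have fin: "finite D" unfolding D_def by (rule finite_subset[OF _ finite_divisors_nat[OF assms]]) auto
 have pd: "p * d dvd n" if "d \<in> D" for d
  using that p by (auto simp: D_def intro!: divides_mult prime_imp_coprime)
 have "(\<Sum>d | d dvd n. mu d) = (\<Sum>d\<in>D \<union> (*) p ` D. mu d)"
 proof (rule sum.mono_neutral_right)
  show "finite {d. d dvd n}" using assms by (simp add: finite_divisors_nat)
  show "D \<union> (*) p ` D \<subseteq> {d. d dvd n}" using pd by (auto simp: D_def)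
  show "\<forall>i\<in>{d. d dvd n} - (D \<union> (*) p ` D). mu i = 0"
  proof (rule ballI, rule ccontr)
   fix i assume i: "i \<in> {d. d dvd n} - (D \<union> (*) p ` D)" and "mu i ~= 0"
   then have sq: "squarefree i" and "i dvd n" by (auto simp: mu_def split: if_splits)
   then have "p dvd i" using i by (auto simp: D_def)
   then obtain e where e: "i = p * e" by blast
   have "\<not> p dvd e"
   proof
    assume "p dvd e"
    then have "p ^ 2 dvd i" using e by (auto simp: power2_eq_square)
    then have "is_unit p" using sq by (simp add: squarefree_def)
    then show False using p by auto
   qed
   moreover have "squarefree e" using sq e squarefree_multD(2) by blast
   moreover have "e dvd n" using \<open>i dvd n\<close> e by (meson dvd_mult_right)
   ultimately show False using i e by (auto simp: D_def)
  qed
 qed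
 also have "... = (\<Sum>d\<in>D. mu d) + (\<Sum>d\<in>(*) p ` D. mu d)"
  using fin by (intro sum.union_disjoint) (auto simp: D_def)
 also have "(\<Sum>d\<in>(*) p ` D. mu d) = (\<Sum>d\<in>D. mu (p * d))"
  using p0 by (subst sum.reindex) (auto intro!: inj_onI)
 also have "... = (\<Sum>d\<in>D. - mu d)"
  using p by (intro sum.cong) (auto simp: D_def mu_prime_mult)
 finally show ?thesis using False by (simp add: sum_negf)
qed auto

lemma norm_nat_powr: "cmod (of_nat n powr s) = real n powr Re s"
 using norm_of_nat_powr[of n s] by (cases "n = 0") auto

lemma nat_mult_powr: "of_nat (m * n) powr (s::complex) = of_nat m powr s * of_nat n powr s"
 by (simp add: powr_times_real)

definition dsum :: "nat set => complex => complex" where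
 "dsum A s = (\<Sum>\<^sub>\<infinity>n\<in>A. of_nat n powr (- s))"

lemma abs_summable_nat_powr:
 assumes "Re s > 1"
 shows "(%n. norm (of_nat n powr (- s))) summable_on A"
proof -
 have "summable (%n. norm (real n powr (- Re s)))"
  using assms by (simp add: summable_real_powr_iff)
 then have "(%n. real n powr (- Re s)) summable_on UNIV" by (rule norm_summable_imp_summable_on)
 then have "(%n. real n powr (- Re s)) summable_on A" by (rule summable_on_subset_banach) auto
 then show ?thesis by (simp add: norm_nat_powr)
qed

lemma pzeta_dsum:
 assumes "Re s > 1"
 shows "pzeta s = (s - 1) * dsum {1..} s"
proof -
 have a: "summable (%n. norm (of_nat n powr (- s)))"
  using assms by (simp add: norm_nat_powr summable_real_powr_iff)
 have "((%n. of_nat n powr (- s)) has_sum (\<Sum>n. of_nat n powr (- s))) UNIV"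
  by (rule norm_summable_imp_has_sum[OF a summable_sums[OF summable_norm_cancel[OF a]]])
 then have "(\<Sum>n. of_nat n powr (- s)) = (\<Sum>\<^sub>\<infinity>n. of_nat n powr (- s))"
  by (simp add: infsumI)
 also have "... = dsum {1..} s" unfolding dsum_def
 proof (rule infsum_cong_neutral)
  fix x :: nat assume "x \<in> UNIV - {1..}"
  then have "x = 0" by auto
  then show "of_nat x powr - s = 0" by simp
 qed simp_all
 finally have "(\<Sum>n. of_nat (Suc n) powr (- s)) = dsum {1..} s"
  using suminf_split_head[OF summable_norm_cancel[OF a]] by simp
 then show ?thesis using pzeta_eq(2)[OF assms] by simp
qed

lemma dsum_sieve_step:
 assumes s: "Re s > 1" and p: "p > 0" and A: "!!m. p * m \<in> A \<longleftrightarrow> m \<in> A"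
 shows "dsum {n\<in>A. \<not> p dvd n} s = (1 - of_nat p powr (- s)) * dsum A s"
proof -
 have eq: "{n\<in>A. p dvd n} = (*) p ` A" using A by (auto elim!: dvdE)
 have "dsum A s = dsum ({n\<in>A. \<not> p dvd n} \<union> {n\<in>A. p dvd n}) s"
  by (rule arg_cong[where f = "%A. dsum A s"]) auto
 also have "... = dsum {n\<in>A. \<not> p dvd n} s + dsum {n\<in>A. p dvd n} s"
  unfolding dsum_def by (rule infsum_Un_disjoint) (auto intro: abs_summable_summable abs_summable_nat_powr s)
 also have "dsum {n\<in>A. p dvd n} s = of_nat p powr (- s) * dsum A s"
  unfolding eq dsum_def using p
  by (subst infsum_reindex) (auto simp: inj_on_def o_def nat_mult_powr infsum_cmult_right' simp del: of_nat_mult)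
 finally show ?thesis by (simp add: algebra_simps)
qed

text \<open>Removing the multiples of one prime at a time multiplies the sum by the corresponding Euler factor.\<close>
lemma dsum_sieve:
 assumes s: "Re s > 1" and "finite P" "\<forall>p\<in>P. prime p"
 shows "dsum {n\<in>{1..}. \<forall>p\<in>P. \<not> p dvd n} s = (\<Prod>p\<in>P. 1 - of_nat p powr (- s)) * dsum {1..} s"
 using assms(2,3)
proof (induction P rule: finite_induct)
 case (insert q P)
 let ?A = "{n\<in>{1..}. \<forall>p\<in>P. \<not> p dvd n}"
 have q: "prime q" using insert.prems by auto
 have "q * m \<in> ?A \<longleftrightarrow> m \<in> ?A" for m
 proof -
  have "p dvd q * m \<longleftrightarrow> p dvd m" if "p \<in> P" for p
  proof -
   have "prime p" "p ~= q" using that insert by auto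
   then have "coprime p q" using q by (simp add: primes_coprime)
   then show ?thesis by (simp add: coprime_dvd_mult_right_iff)
  qed
  moreover have "1 <= q * m \<longleftrightarrow> 1 <= m" using q by (auto simp: Suc_le_eq prime_gt_0_nat)
  ultimately show ?thesis by auto
 qed
 then have "dsum {n\<in>?A. \<not> q dvd n} s = (1 - of_nat q powr (- s)) * dsum ?A s"
  using q by (intro dsum_sieve_step s) (auto simp: prime_gt_0_nat)
 also have "{n\<in>?A. \<not> q dvd n} = {n\<in>{1..}. \<forall>p\<in>insert q P. \<not> p dvd n}" by auto
 finally show ?case using insert by simp
qed (simp add: atLeast_def)

lemma dsum_sieve_limit:
 assumes s: "Re s > 1"
 shows "(%M. dsum {n\<in>{1..}. \<forall>p\<in>{p. prime p & p <= M}. \<not> p dvd n} s) \<longlonglongrightarrow> 1"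
proof -
 let ?g = "%n. real n powr (- Re s)"
 have sm: "?g summable_on A" for A
  using abs_summable_nat_powr[OF s, of A] by (simp add: norm_nat_powr)
 have "(?g has_sum (infsum ?g UNIV)) UNIV" using sm by simp
 then have "?g sums infsum ?g UNIV" by (rule has_sum_imp_sums)
 then have "(%M. infsum ?g UNIV - (\<Sum>n<Suc M. ?g n)) \<longlonglongrightarrow> infsum ?g UNIV - infsum ?g UNIV"
  unfolding sums_def by (intro tendsto_diff tendsto_const LIMSEQ_Suc)
 then have lim: "(%M. infsum ?g UNIV - (\<Sum>n<Suc M. ?g n)) \<longlonglongrightarrow> 0" by simp
 have tail: "infsum ?g UNIV - (\<Sum>n<Suc M. ?g n) = infsum ?g {Suc M..}" for M
 proof -
  have "infsum ?g ({..<Suc M} \<union> {Suc M..}) = infsum ?g {..<Suc M} + infsum ?g {Suc M..}"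
   by (rule infsum_Un_disjoint) (auto intro: sm)
  moreover have "{..<Suc M} \<union> {Suc M..} = UNIV" by auto
  ultimately show ?thesis by simp
 qed
 have "(%M. dsum {n\<in>{1..}. \<forall>p\<in>{p. prime p & p <= M}. \<not> p dvd n} s - 1) \<longlonglongrightarrow> 0"
 proof (rule Lim_null_comparison[OF _ lim], rule eventually_sequentiallyI)
  fix M :: nat assume "1 <= M"
  let ?A = "{n\<in>{1..}. \<forall>p\<in>{p. prime p & p <= M}. \<not> p dvd n}"
  have sub: "?A - {1} \<subseteq> {Suc M..}"
  proof
   fix n assume n: "n \<in> ?A - {1}"
   then obtain p where p: "prime p" "p dvd n" using prime_factor_nat by blast
   then have "p <= n" using n by (intro dvd_imp_le) auto
   then show "n \<in> {Suc M..}" using n p by (auto simp: not_less_eq_eq[symmetric])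
  qed
  have "dsum ?A s = dsum ({1} \<union> (?A - {1})) s"
   by (rule arg_cong[where f = "%A. dsum A s"]) (auto dest: prime_gt_1_nat)
  also have "... = dsum {1} s + dsum (?A - {1}) s"
   unfolding dsum_def by (rule infsum_Un_disjoint) (auto intro: abs_summable_summable abs_summable_nat_powr s)
  also have "dsum {1} s = 1" by (simp add: dsum_def)
  finally have "cmod (dsum ?A s - 1) = cmod (dsum (?A - {1}) s)" by simp
  also have "... <= infsum ?g (?A - {1})"
   unfolding dsum_def using norm_infsum_bound[OF abs_summable_nat_powr[OF s, of "?A - {1}"]] by (simp add: norm_nat_powr)
  also have "... <= infsum ?g {Suc M..}"
   by (rule infsum_mono_neutral) (use sub sm in auto)
  finally show "cmod (dsum ?A s - 1) <= infsum ?g UNIV - (\<Sum>n<Suc M. ?g n)" by (simp only: tail)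
 qed
 then show ?thesis by (subst (asm) LIM_zero_iff)
qed

text \<open>The Euler factor of \<open>3 + 4 cos \<theta> + cos 2\<theta> \<ge> 0\<close>.\<close>
lemma mertens_factor:
 assumes "0 <= r" "r < 1" "cmod z = 1"
 shows "cmod (1 - of_real r) ^ 3 * cmod (1 - of_real r * z) ^ 4 * cmod (1 - of_real r * z^2) <= 1"
proof -
 have L: "(%n. - (r^n * Re (w^n)) / real n) sums ln (cmod (1 - of_real r * w))" and nz: "cmod (1 - of_real r * w) > 0"
  if "cmod w = 1" for w
 proof -
  have lt: "cmod (- (of_real r * w)) < 1" using that assms by (simp add: norm_mult)
  then show n0: "cmod (1 - of_real r * w) > 0" by force
  have "(%n. - ((- (- (of_real r * w)))^n) / of_nat n) sums Ln (1 + (- (of_real r * w)))"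
   by (rule Ln_series'[OF lt])
  then have "(%n. Re (- ((of_real r * w)^n) / of_nat n)) sums Re (Ln (1 - of_real r * w))"
   by (intro sums_Re) simp
  moreover have "Re (- ((of_real r * w)^n) / of_nat n) = - (r^n * Re (w^n)) / real n" for n
   unfolding power_mult_distrib of_real_power[symmetric] by simp
  moreover have "Re (Ln (1 - of_real r * w)) = ln (cmod (1 - of_real r * w))"
   using n0 by (intro Re_Ln) auto
  ultimately show "(%n. - (r^n * Re (w^n)) / real n) sums ln (cmod (1 - of_real r * w))" by (simp only:)
 qed
 have z2: "cmod (z^2) = 1" using assms by (simp add: norm_power)
 have sm: "(%n. 3 * (- (r^n * Re (1^n)) / real n) + 4 * (- (r^n * Re (z^n)) / real n) + (- (r^n * Re ((z^2)^n)) / real n))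
   sums (3 * ln (cmod (1 - of_real r * 1)) + 4 * ln (cmod (1 - of_real r * z)) + ln (cmod (1 - of_real r * z^2)))"
  by (intro sums_add sums_mult L assms z2) simp
 have le: "3 * (- (r^n * Re (1^n)) / real n) + 4 * (- (r^n * Re (z^n)) / real n) + (- (r^n * Re ((z^2)^n)) / real n) <= 0" for n
 proof -
  have "(z^2)^n = (z^n)^2" by (simp add: power_mult[symmetric] mult.commute)
  then have "Re ((z^2)^n) = (Re (z^n))^2 - (Im (z^n))^2" by (simp add: power2_eq_square)
  also have "(Im (z^n))^2 = 1 - (Re (z^n))^2"
  proof -
   have "(cmod (z^n))^2 = 1" using assms by (simp add: norm_power)
   then show ?thesis by (simp add: cmod_power2)
  qed
  finally have "3 + 4 * Re (z^n) + Re ((z^2)^n) = 2 * (1 + Re (z^n))^2" by (simp add: power2_eq_square algebra_simps)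
  then have "0 <= (r^n / real n) * (3 + 4 * Re (z^n) + Re ((z^2)^n))" using assms by simp
  then show ?thesis by (simp add: distrib_left algebra_simps add_divide_distrib)
 qed
 have "3 * ln (cmod (1 - of_real r * 1)) + 4 * ln (cmod (1 - of_real r * z)) + ln (cmod (1 - of_real r * z^2)) <= 0"
  by (rule sums_le[OF le sm sums_zero])
 moreover have "ln (cmod (1 - of_real r) ^ 3 * cmod (1 - of_real r * z) ^ 4 * cmod (1 - of_real r * z^2))
   = 3 * ln (cmod (1 - of_real r * 1)) + 4 * ln (cmod (1 - of_real r * z)) + ln (cmod (1 - of_real r * z^2))"
  using nz[of 1] nz[OF assms(3)] nz[OF z2] by (simp add: ln_mult ln_realpow)
 moreover have "0 < cmod (1 - of_real r) ^ 3 * cmod (1 - of_real r * z) ^ 4 * cmod (1 - of_real r * z^2)"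
  using nz[of 1] nz[OF assms(3)] nz[OF z2] by simp
 ultimately show ?thesis by (metis ln_le_zero_iff)
qed

lemma dsum_341:
 assumes "x > 1"
 shows "1 <= cmod (dsum {1..} (of_real x)) ^ 3 * cmod (dsum {1..} (Complex x t)) ^ 4 * cmod (dsum {1..} (Complex x (2 * t)))"
proof -
 define D where "D = (%M s. dsum {n\<in>{1..}. \<forall>p\<in>{p. prime p & p <= M}. \<not> p dvd n} s)"
 have lim: "(%M. cmod (D M (of_real x)) ^ 3 * cmod (D M (Complex x t)) ^ 4 * cmod (D M (Complex x (2 * t))))
   \<longlonglongrightarrow> cmod 1 ^ 3 * cmod 1 ^ 4 * cmod 1"
  unfolding D_def by (intro tendsto_mult tendsto_power tendsto_norm dsum_sieve_limit) (use assms in auto)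
 have "cmod (D M (of_real x)) ^ 3 * cmod (D M (Complex x t)) ^ 4 * cmod (D M (Complex x (2 * t)))
   <= cmod (dsum {1..} (of_real x)) ^ 3 * cmod (dsum {1..} (Complex x t)) ^ 4 * cmod (dsum {1..} (Complex x (2 * t)))" for M
 proof -
  let ?P = "{p::nat. prime p & p <= M}"
  have fin: "finite ?P" by simp
  have DM: "D M s = (\<Prod>p\<in>?P. 1 - of_nat p powr (- s)) * dsum {1..} s" if "Re s > 1" for s
   unfolding D_def using that by (intro dsum_sieve fin) auto
  let ?a = "cmod (\<Prod>p\<in>?P. 1 - of_nat p powr (- (of_real x)))"
  let ?b = "cmod (\<Prod>p\<in>?P. 1 - of_nat p powr (- Complex x t))"
  let ?c = "cmod (\<Prod>p\<in>?P. 1 - of_nat p powr (- Complex x (2 * t)))"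
  have "?a ^ 3 * ?b ^ 4 * ?c = (\<Prod>p\<in>?P. cmod (1 - of_nat p powr (- (of_real x))) ^ 3 *
    cmod (1 - of_nat p powr (- Complex x t)) ^ 4 * cmod (1 - of_nat p powr (- Complex x (2 * t))))"
   by (simp add: prod_norm[symmetric] prod_power_distrib prod.distrib)
  also have "... <= 1"
  proof (intro prod_le_1 conjI)
   fix p assume "p \<in> ?P"
   then have p: "p > 1" by (auto dest: prime_gt_1_nat)
   define r where "r = real p powr (- x)"
   define z where "z = exp (- \<i> * of_real (t * ln (real p)))"
   have e: "of_nat p powr (- Complex x u) = of_real r * exp (- \<i> * of_real (u * ln (real p)))" for u
   proof -
    have "of_nat p powr (- Complex x u) = exp (- Complex x u * of_real (ln (real p)))"
     using p by (simp add: powr_def Ln_of_nat)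
    also have "- Complex x u * of_real (ln (real p)) = of_real (- x * ln (real p)) + - \<i> * of_real (u * ln (real p))"
     by (simp add: complex_eq_iff)
    also have "exp ... = of_real r * exp (- \<i> * of_real (u * ln (real p)))"
     unfolding exp_add r_def using p by (simp add: powr_def flip: exp_of_real)
    finally show ?thesis .
   qed
   have z2: "exp (- \<i> * of_real (2 * t * ln (real p))) = z^2"
    unfolding z_def exp_of_nat_mult[symmetric] by (simp add: mult_ac)
   have r: "of_nat p powr (- (complex_of_real x)) = of_real r"
    using e[of 0] by (simp add: complex_of_real_def[of x])
   have "real p powr (-x) < real p powr 0" using p assms by (intro powr_less_mono) auto
   then have "real p powr (-x) < 1" using p by simp
   then have "0 <= r" "r < 1" by (auto simp: r_def)
   moreover have "cmod z = 1" by (simp add: z_def)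
   ultimately show "cmod (1 - of_nat p powr (- (of_real x))) ^ 3 *
    cmod (1 - of_nat p powr (- Complex x t)) ^ 4 * cmod (1 - of_nat p powr (- Complex x (2 * t))) <= 1"
    using mertens_factor[of r z] unfolding e r z2 by (simp add: z_def)
  qed auto
  finally have "?a ^ 3 * ?b ^ 4 * ?c <= 1" .
  then have "(?a ^ 3 * ?b ^ 4 * ?c) * (cmod (dsum {1..} (of_real x)) ^ 3 * cmod (dsum {1..} (Complex x t)) ^ 4 * cmod (dsum {1..} (Complex x (2 * t))))
    <= 1 * (cmod (dsum {1..} (of_real x)) ^ 3 * cmod (dsum {1..} (Complex x t)) ^ 4 * cmod (dsum {1..} (Complex x (2 * t))))"
   by (intro mult_right_mono) auto
  then show ?thesis using assms by (simp add: DM norm_mult power_mult_distrib mult_ac)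
 qed
 then show ?thesis using LIMSEQ_le_const2[OF lim] by auto
qed

lemma dsum_mu:
 assumes s: "Re s > 1"
 shows "(%n. norm (of_real (mu n) * of_nat n powr (- s))) summable_on {1..}"
    "(\<Sum>\<^sub>\<infinity>n\<in>{1..}. of_real (mu n) * of_nat n powr (- s)) * dsum {1..} s = 1"
proof -
 let ?f = "%n. of_real (mu n) * of_nat n powr (- s)" and ?g = "%n. of_nat n powr (- s)"
 have sg: "(%n. norm (?g n)) summable_on {1..}" by (rule abs_summable_nat_powr[OF s])
 have le: "cmod (?f n) <= cmod (?g n)" for n
  using mult_right_mono[OF abs_mu_le[of n], of "cmod (?g n)"] by (simp add: norm_mult)
 show sf: "(%n. norm (?f n)) summable_on {1..}"
  by (rule Infinite_Sum.abs_summable_on_comparison_test[OF sg]) (use le in auto)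
 have sfg: "(%x. norm ((%(m, n). ?f m * ?g n) x)) summable_on {1..} \<times> {1..}"
  unfolding Infinite_Sum.abs_summable_on_Sigma_iff
  using sf sg by (auto simp: norm_mult infsum_cmult_right' summable_on_cmult_right summable_on_cmult_left infsum_nonneg)
 have "infsum ?f {1..} * dsum {1..} s = (\<Sum>\<^sub>\<infinity>m\<in>{1..}. \<Sum>\<^sub>\<infinity>n\<in>{1..}. ?f m * ?g n)"
  by (simp add: infsum_cmult_left' infsum_cmult_right' dsum_def)
 also have "... = (\<Sum>\<^sub>\<infinity>(m, n)\<in>{1..} \<times> {1..}. ?f m * ?g n)"
  by (rule infsum_Sigma'_banach) (rule abs_summable_summable[OF sfg])
 also have "... = (\<Sum>\<^sub>\<infinity>(k, d)\<in>Sigma {1..} (%k. {d. d dvd k}). of_real (mu d) * ?g k)"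
  by (rule infsum_reindex_bij_witness[where j = "%(m, n). (m * n, m)" and i = "%(k, d). (d, k div d)"])
    (auto simp: nat_mult_powr Suc_le_eq simp del: of_nat_mult elim!: dvdE)
 also have "... = (\<Sum>\<^sub>\<infinity>k\<in>{1..}. \<Sum>\<^sub>\<infinity>d\<in>{d. d dvd k}. of_real (mu d) * ?g k)"
 proof (rule infsum_Sigma'_banach[symmetric])
  have "(%(m, n). ?f m * ?g n) summable_on {1..} \<times> {1..}" by (rule abs_summable_summable[OF sfg])
  also have "?this \<longleftrightarrow> (%(k, d). of_real (mu d) * ?g k) summable_on Sigma {1..} (%k. {d. d dvd k})"
   by (rule summable_on_reindex_bij_witness[where j = "%(m, n). (m * n, m)" and i = "%(k, d). (d, k div d)"])
     (auto simp: nat_mult_powr Suc_le_eq simp del: of_nat_mult elim!: dvdE)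
  finally show "(%(k, d). of_real (mu d) * ?g k) summable_on Sigma {1..} (%k. {d. d dvd k})" .
 qed
 also have "... = (\<Sum>\<^sub>\<infinity>k\<in>{1::nat..}. if k = 1 then 1 else 0)"
 proof (rule infsum_cong)
  fix k :: nat assume k: "k \<in> {1..}"
  then have fin: "finite {d. d dvd k}" by (simp add: finite_divisors_nat)
  have "(\<Sum>\<^sub>\<infinity>d\<in>{d. d dvd k}. of_real (mu d) * ?g k) = of_real (\<Sum>d | d dvd k. mu d) * ?g k"
   using fin by (simp add: sum_distrib_right)
  also have "(\<Sum>d | d dvd k. mu d) = of_bool (k = 1)" using k by (intro sum_mu_dvd) auto
  finally show "(\<Sum>\<^sub>\<infinity>d\<in>{d. d dvd k}. of_real (mu d) * ?g k) = (if k = 1 then 1 else 0)" by simp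
 qed
 also have "... = (\<Sum>\<^sub>\<infinity>k\<in>{1::nat}. 1)" by (rule infsum_cong_neutral) auto
 finally show "infsum ?f {1..} * dsum {1..} s = 1" by simp
qed

section \<open>A zero-free region\<close>

lemma isCont_pzeta_1: "isCont pzeta 1"
proof -
 have "continuous_on {s. Re s > 0} pzeta" using pzeta_holomorphic by (rule holomorphic_on_imp_continuous_on)
 then show ?thesis by (rule continuous_on_interior) (simp add: interior_open open_halfspace_Re_gt)
qed

lemma one_plus_cmod_le: "0 <= x ==> x <= 2 ==> 1 + cmod (Complex x t) <= 3 * (1 + \<bar>t\<bar>)"
 using cmod_le[of "Complex x t"] by simp

text \<open>From the 3-4-1 inequality and the growth of zeta at the doubled ordinate.\<close>
lemma pzeta_lower_right:
 assumes "t0 > 0"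
 obtains c where "c > 0" "!!x t. 1 < x ==> x <= 2 ==> \<bar>t\<bar> >= t0 ==>
   c * (1 + \<bar>t\<bar>) powr (4 - 1/50) * (x - 1) ^ 3 <= cmod (pzeta (Complex x t)) ^ 4"
proof -
 obtain C where C: "C > 0" "!!s. Re s >= 99/100 ==> cmod (pzeta s) <= C * (1 + cmod s) powr (1 + 1/50)"
  using pzeta_growth by blast
 define b where "b = t0 / (1 + t0)"
 have b: "b > 0" using assms by (simp add: b_def)
 have grow: "cmod (pzeta (Complex x t)) <= C * 9 * (1 + \<bar>t\<bar>) powr (1 + 1/50)" if "1 <= x" "x <= 2" for x t
 proof -
  have "cmod (pzeta (Complex x t)) <= C * (1 + cmod (Complex x t)) powr (1 + 1/50)" using that by (intro C) auto
  also have "... <= C * (3 * (1 + \<bar>t\<bar>)) powr (1 + 1/50)"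
   using that one_plus_cmod_le[of x t] C by (intro mult_left_mono powr_mono2) (auto simp: add_nonneg_nonneg)
  also have "(3 * (1 + \<bar>t\<bar>)) powr (1 + 1/50) = 3 powr (1 + 1/50) * (1 + \<bar>t\<bar>) powr (1 + 1/50)"
   by (rule powr_mult)
  also have "(3::real) powr (1 + 1/50) <= 3 powr 2" by (rule powr_mono) auto
  also have "(3::real) powr 2 = 9" by simp
  finally show ?thesis using C by (simp add: mult.assoc mult_left_mono mult_right_mono)
 qed
 define c where "c = b ^ 4 * (b / ((9 * C) ^ 3 * (18 * C)))"
 show ?thesis
 proof (rule that[of c])
  show "c > 0" using b C by (simp add: c_def)
  fix x t :: real assume x: "1 < x" "x <= 2" and t: "t0 <= \<bar>t\<bar>"
  define u where "u = 1 + \<bar>t\<bar>"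
  have u: "u >= 1" by (simp add: u_def)
  have tb: "b * u <= \<bar>t\<bar>" using t assms by (simp add: b_def u_def field_simps)
  have t0': "\<bar>t\<bar> > 0" using t assms by linarith
  define Z1 Z2 Z3 where "Z1 = cmod (dsum {1..} (of_real x))" and "Z2 = cmod (dsum {1..} (Complex x t))"
   and "Z3 = cmod (dsum {1..} (Complex x (2 * t)))"
  have H: "cmod (pzeta (Complex x y)) = cmod (Complex (x - 1) y) * cmod (dsum {1..} (Complex x y))" for y
  proof -
   have "Complex x y - 1 = Complex (x - 1) y" by (simp add: complex_eq_iff)
   then show ?thesis using pzeta_dsum[of "Complex x y"] x by (simp add: norm_mult)
  qed
  have "(x - 1) * Z1 <= 9 * C"
   using H[of 0] grow[of x 0] x by (simp add: Z1_def complex_of_real_def cmod_def)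
  then have Z1: "Z1 <= 9 * C / (x - 1)" using x by (simp add: field_simps)
  have "(2 * \<bar>t\<bar>) * Z3 <= cmod (Complex (x - 1) (2 * t)) * Z3"
   using abs_Im_le_cmod[of "Complex (x - 1) (2 * t)"] by (intro mult_right_mono) (auto simp: Z3_def)
  also have "... <= C * 9 * (1 + \<bar>2 * t\<bar>) powr (1 + 1/50)" using H[of "2 * t"] grow[of x "2 * t"] x by (simp add: Z3_def)
  also have "... <= C * 9 * (2 * u) powr (1 + 1/50)" using C by (intro mult_left_mono powr_mono2) (auto simp: u_def)
  also have "(2 * u) powr (1 + 1/50) = 2 powr (1 + 1/50) * u powr (1 + 1/50)" by (rule powr_mult)
  also have "(2::real) powr (1 + 1/50) <= 2 powr 2" by (rule powr_mono) auto
  also have "u powr (1 + 1/50) = u * u powr (1/50)" using u powr_add[of u 1 "1/50"] by simp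
  finally have "(2 * \<bar>t\<bar>) * Z3 <= 36 * C * (u * u powr (1/50))"
   using C u by (simp add: mult_right_mono mult_ac)
  moreover have "(2 * (b * u)) * Z3 <= (2 * \<bar>t\<bar>) * Z3" using tb by (intro mult_right_mono) (auto simp: Z3_def)
  ultimately have "u * (b * Z3) <= u * (18 * C * u powr (1/50))" by (simp add: mult_ac)
  then have Z3: "b * Z3 <= 18 * C * u powr (1/50)" using u by simp
  have "1 <= Z1 ^ 3 * Z2 ^ 4 * Z3" using dsum_341[of x t] x by (simp add: Z1_def Z2_def Z3_def)
  also have "... <= (9 * C / (x - 1)) ^ 3 * Z2 ^ 4 * (18 * C * u powr (1/50) / b)"
   using Z1 Z3 b x C by (intro mult_mono power_mono) (auto simp: Z1_def Z2_def Z3_def field_simps)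
  finally have "(x - 1) ^ 3 * b <= ((9 * C) ^ 3 * (18 * C)) * (u powr (1/50) * Z2 ^ 4)"
   using x b by (simp add: field_simps)
  then have "(x - 1) ^ 3 * (b / ((9 * C) ^ 3 * (18 * C))) <= u powr (1/50) * Z2 ^ 4"
   using C by (simp add: divide_le_eq mult_ac)
  then have "(b * u) ^ 4 * u powr (-1/50) * ((x - 1) ^ 3 * (b / ((9 * C) ^ 3 * (18 * C)))) <= (b * u) ^ 4 * u powr (-1/50) * (u powr (1/50) * Z2 ^ 4)"
   using b u by (intro mult_left_mono) auto
  also have "... = (b * u) ^ 4 * Z2 ^ 4" using u by (simp add: powr_minus field_simps)
  also have "... <= cmod (Complex (x - 1) t) ^ 4 * Z2 ^ 4"
   using tb abs_Im_le_cmod[of "Complex (x - 1) t"] b u by (intro mult_right_mono power_mono) auto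
  also have "... = cmod (pzeta (Complex x t)) ^ 4" by (simp add: H Z2_def power_mult_distrib)
  also have "(b * u) ^ 4 * u powr (-1/50) * ((x - 1) ^ 3 * (b / ((9 * C) ^ 3 * (18 * C)))) = c * (u ^ 4 * u powr (-1/50)) * (x - 1) ^ 3"
   by (simp add: c_def power_mult_distrib)
  also have "u ^ 4 * u powr (-1/50) = u powr (4 - 1/50)"
   using u powr_realpow[of u 4] powr_add[of u 4 "-1/50"] by simp
  finally show "c * (1 + \<bar>t\<bar>) powr (4 - 1/50) * (x - 1) ^ 3 <= cmod (pzeta (Complex x t)) ^ 4"
   by (simp add: u_def)
 qed
qed

text \<open>Moving left from the line bounded by the 3-4-1 inequality, the derivative bound keeps the value away from zero over a distance that is a small power of the height. Any such power suffices for the logarithmic savings used later.\<close>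
lemma pzeta_zero_free:
 obtains k c where "0 < k" "k <= 1/200" "0 < c"
  "!!x t. 1 - k * (1 + \<bar>t\<bar>) powr (- 1/10) <= x ==> x <= 1 + k ==> c <= cmod (pzeta (Complex x t))"
proof -
 obtain d where d: "d > 0" "!!s. cmod (s - 1) < d ==> cmod (pzeta s - 1) < 1/2"
  using isCont_pzeta_1 unfolding continuous_at_eps_delta dist_norm pzeta_1 by (metis half_gt_zero_iff zero_less_one)
 obtain D where D: "D > 0" "!!s. Re s >= 199/200 ==> cmod (deriv pzeta s) <= D * (1 + cmod s) powr (1 + 1/50)"
  using pzeta_deriv_growth by blast
 obtain c where c: "c > 0" "!!x t. 1 < x ==> x <= 2 ==> \<bar>t\<bar> >= d/2 ==>
   c * (1 + \<bar>t\<bar>) powr (4 - 1/50) * (x - 1) ^ 3 <= cmod (pzeta (Complex x t)) ^ 4"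
  using pzeta_lower_right[of "d/2"] d by auto
 define k where "k = min (1/200) (min (d/4) (c / (36 * D) ^ 4))"
 have k: "0 < k" "k <= 1/200" "k <= d/4" "k <= c / (36 * D) ^ 4" using d c D by (auto simp: k_def)
 show ?thesis
 proof (rule that[of k "min (1/2) (18 * D * k)"])
  show "0 < min (1/2) (18 * D * k)" using D k by simp
  fix x t assume x: "1 - k * (1 + \<bar>t\<bar>) powr (- 1/10) <= x" "x <= 1 + k"
  define u where "u = 1 + \<bar>t\<bar>"
  have u: "u >= 1" by (simp add: u_def)
  define de where "de = k * u powr (- 1/10)"
  have "u powr (- 1/10) <= u powr 0" using u by (intro powr_mono) auto
  then have de: "0 < de" "de <= k" using u k by (auto simp: de_def)
  have x': "1 - de <= x" using x by (simp add: de_def u_def)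
  show "min (1/2) (18 * D * k) <= cmod (pzeta (Complex x t))"
  proof (cases "\<bar>t\<bar> >= d/2")
   case False
   have "Complex x t - 1 = Complex (x - 1) t" by (simp add: complex_eq_iff)
   then have "cmod (Complex x t - 1) <= \<bar>x - 1\<bar> + \<bar>t\<bar>" using cmod_le[of "Complex (x-1) t"] by simp
   also have "... < d" using False x' x(2) de k by linarith
   finally have "cmod (pzeta (Complex x t) - 1) < 1/2" by (rule d)
   then have "1/2 <= cmod (pzeta (Complex x t))"
    using norm_triangle_ineq2[of 1 "pzeta (Complex x t)"] by (simp add: norm_minus_commute)
   then show ?thesis by simp
  next
   case True
   define v where "v = u powr (1 - 4/50)"
   have v: "v >= 1" using u by (auto simp: v_def intro!: ge_one_powr_ge_zero)
   have right: "36 * D * k * v <= cmod (pzeta (Complex y t))" if y: "1 + de <= y" "y <= 1 + k" for y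
   proof -
    have "(36 * D) ^ 4 * k ^ 4 <= c * k ^ 3"
     using k D mult_right_mono[of k "c / (36 * D) ^ 4" "(36 * D) ^ 4 * k ^ 3"]
     by (simp add: eval_nat_numeral mult_ac)
    then have "((36 * D) ^ 4 * k ^ 4) * v ^ 4 <= (c * k ^ 3) * v ^ 4" by (rule mult_right_mono) auto
    then have "(36 * D * k * v) ^ 4 <= c * (k ^ 3 * v ^ 4)"
     by (simp only: power_mult_distrib mult.assoc)
    also have "k ^ 3 * v ^ 4 = u powr (4 - 1/50) * de ^ 3"
    proof -
     have "v ^ 4 = u powr (4 * (1 - 4/50))" using u powr_realpow[of v 4] v by (simp add: v_def powr_powr)
     moreover have "de ^ 3 = k ^ 3 * u powr (3 * (-1/10))" using u powr_realpow[of "u powr (-1/10)" 3] by (simp add: de_def power_mult_distrib powr_powr)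
     ultimately show ?thesis by (simp flip: powr_add)
    qed
    finally have "(36 * D * k * v) ^ 4 <= c * u powr (4 - 1/50) * de ^ 3" by (simp add: mult_ac)
    also have "... <= c * u powr (4 - 1/50) * (y - 1) ^ 3" using y de c by (intro mult_left_mono power_mono) auto
    also have "... <= cmod (pzeta (Complex y t)) ^ 4" using c(2)[of y t] y de k True by (simp add: u_def)
    finally show ?thesis
     using power_le_imp_le_base[of "36 * D * k * v" 3 "cmod (pzeta (Complex y t))"] by simp
   qed
   show ?thesis
   proof (cases "1 + de <= x")
    case True
    have "18 * D * k <= 36 * D * k * v"
     using v D k mult_left_mono[OF v, of "36 * D * k"] by simp
    then show ?thesis using right[OF True x(2)] by linarith
   next
    case False
    let ?S = "closed_segment (Complex x t) (Complex (1 + de) t)"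
    have S: "Im z = t & x <= Re z & Re z <= 1 + de" if zS: "z \<in> ?S" for z
    proof -
     obtain w where w: "0 <= w" "w <= 1" "z = (1 - w) *\<^sub>R Complex x t + w *\<^sub>R Complex (1 + de) t"
      using zS by (auto simp: closed_segment_def)
     have "Re z = x + w * (1 + de - x)" "Im z = t" unfolding w(3) by (auto simp: algebra_simps)
     moreover have "0 <= w * (1 + de - x)" "w * (1 + de - x) <= 1 * (1 + de - x)"
      using w False by (auto intro!: mult_right_mono)
     ultimately show ?thesis by simp
    qed
    have "norm (pzeta (Complex (1 + de) t) - pzeta (Complex x t)) <= (D * 9 * u powr (1 + 1/50)) * norm (Complex (1 + de) t - Complex x t)"
    proof (rule field_differentiable_bound[of ?S])
     fix z assume z: "z \<in> ?S"
     have r: "Re z >= 199/200" "Re z <= 2" using S[OF z] x' de k by auto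
     then have "z \<in> {s. Re s > 0}" by simp
     then show "(pzeta has_field_derivative deriv pzeta z) (at z within ?S)"
      by (rule has_field_derivative_at_within[OF holomorphic_derivI[OF pzeta_holomorphic open_halfspace_Re_gt]])
     have "z = Complex (Re z) t" using S[OF z] by (simp add: complex_eq_iff)
     then have n: "1 + cmod z <= 3 * u" using one_plus_cmod_le[of "Re z" t] r by (simp add: u_def)
     have "norm (deriv pzeta z) <= D * (1 + cmod z) powr (1 + 1/50)" by (rule D) (use r in auto)
     also have "... <= D * (3 * u) powr (1 + 1/50)" using n D by (intro mult_left_mono powr_mono2) auto
     also have "(3 * u) powr (1 + 1/50) = 3 powr (1 + 1/50) * u powr (1 + 1/50)" by (rule powr_mult)
     also have "(3::real) powr (1 + 1/50) <= 3 powr 2" by (rule powr_mono) auto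
     also have "(3::real) powr 2 = 9" by simp
     finally show "norm (deriv pzeta z) <= D * 9 * u powr (1 + 1/50)" using D by (simp add: mult.assoc mult_left_mono mult_right_mono)
    qed auto
    also have "Complex (1 + de) t - Complex x t = of_real (1 + de - x)" by (simp add: complex_eq_iff)
    also have "norm (of_real (1 + de - x) :: complex) <= 2 * de" using False x' by (simp del: of_real_diff of_real_add)
    finally have "norm (pzeta (Complex (1 + de) t) - pzeta (Complex x t)) <= (D * 9 * u powr (1 + 1/50)) * (2 * de)"
     using D by (simp add: mult_left_mono)
    also have "... = 18 * D * k * (u powr (1 + 1/50) * u powr (- 1/10))" by (simp add: de_def)
    also have "u powr (1 + 1/50) * u powr (- 1/10) = v" by (simp add: v_def flip: powr_add)
    finally have 1: "norm (pzeta (Complex (1 + de) t) - pzeta (Complex x t)) <= 18 * D * k * v" .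
    have 2: "36 * D * k * v <= cmod (pzeta (Complex (1 + de) t))" using right[of "1 + de"] de by simp
    have "18 * D * k * v <= cmod (pzeta (Complex x t))"
     using 1 2 norm_triangle_ineq2[of "pzeta (Complex (1 + de) t)" "pzeta (Complex x t)"] by linarith
    moreover have "18 * D * k <= 18 * D * k * v" using v D k mult_left_mono[OF v, of "18 * D * k"] by simp
    ultimately show ?thesis by linarith
   qed
  qed
 qed (use k in auto)
qed

section \<open>A Perron kernel\<close>

lemma contour_integral_rectpath_split:
 assumes f: "continuous_on (path_image (rectpath (Complex x0 (-T)) (Complex x1 T))) f" and "x0 < x1" "T > 0"
  and J: "(f has_contour_integral J) (rectpath (Complex x0 (-T)) (Complex x1 T))"
  and B: "!!x y. x0 <= x ==> x <= x1 ==> \<bar>y\<bar> = T ==> cmod (f (Complex x y)) <= B"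
 shows "cmod (contour_integral (linepath (Complex x1 (-T)) (Complex x1 T)) f
   - contour_integral (linepath (Complex x0 (-T)) (Complex x0 T)) f - J) <= 2 * B * (x1 - x0)"
proof -
 let ?a = "Complex x0 (-T)" and ?b = "Complex x1 (-T)" and ?c = "Complex x1 T" and ?d = "Complex x0 T"
 have pim: "path_image (rectpath ?a ?c) = closed_segment ?a ?b \<union> (closed_segment ?b ?c \<union> (closed_segment ?c ?d \<union> closed_segment ?d ?a))"
  by (simp add: rectpath_def Let_def path_image_join)
 have int: "f contour_integrable_on linepath ?a ?b" "f contour_integrable_on linepath ?b ?c"
  "f contour_integrable_on linepath ?c ?d" "f contour_integrable_on linepath ?d ?a"
  using f unfolding pim by (auto intro!: contour_integrable_continuous_linepath elim!: continuous_on_subset)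
 have "(f has_contour_integral (contour_integral (linepath ?a ?b) f + (contour_integral (linepath ?b ?c) f +
   (contour_integral (linepath ?c ?d) f + contour_integral (linepath ?d ?a) f)))) (rectpath ?a ?c)"
  unfolding rectpath_def Let_def complex.sel
  by (intro has_contour_integral_join int[THEN has_contour_integral_integral] valid_path_linepath valid_path_join) auto
 then have J': "J = contour_integral (linepath ?a ?b) f + (contour_integral (linepath ?b ?c) f +
   (contour_integral (linepath ?c ?d) f + contour_integral (linepath ?d ?a) f))"
  using has_contour_integral_unique[OF J] by simp
 have rev: "contour_integral (linepath ?d ?a) f = - contour_integral (linepath ?a ?d) f"
  using contour_integral_reversepath[of "linepath ?a ?d" f] by simp
 have B0: "B >= 0" using order_trans[OF norm_ge_zero B[of x0 T]] assms by simp
 have seg: "x0 <= Re z & Re z <= x1 & Im z = y" if "z \<in> closed_segment (Complex x0 y) (Complex x1 y) \<or> z \<in> closed_segment (Complex x1 y) (Complex x0 y)" for z y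
 proof -
  have "z \<in> closed_segment (Complex x0 y) (Complex x1 y)" using that by (metis closed_segment_commute)
  then obtain w where w: "0 <= w" "w <= 1" "z = (1 - w) *\<^sub>R Complex x0 y + w *\<^sub>R Complex x1 y"
   by (auto simp: closed_segment_def)
  have "Re z = x0 + w * (x1 - x0)" "Im z = y" unfolding w(3) by (auto simp: algebra_simps)
  moreover have "0 <= w * (x1 - x0)" "w * (x1 - x0) <= 1 * (x1 - x0)" using w assms(2) by (auto intro!: mult_right_mono)
  ultimately show ?thesis by simp
 qed
 have Bz: "cmod (f z) <= B" if "z \<in> closed_segment (Complex x0 y) (Complex x1 y) \<or> z \<in> closed_segment (Complex x1 y) (Complex x0 y)" "\<bar>y\<bar> = T" for z y
 proof -
  have "z = Complex (Re z) y" using seg[OF that(1)] by (simp add: complex_eq_iff)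
  then show ?thesis using B[of "Re z" y] seg[OF that(1)] that(2) by metis
 qed
 have h1: "cmod (contour_integral (linepath ?a ?b) f) <= B * cmod (?b - ?a)"
  by (rule contour_integral_bound_linepath[OF int(1) B0]) (use Bz[of _ "-T"] assms in auto)
 have h2: "cmod (contour_integral (linepath ?c ?d) f) <= B * cmod (?d - ?c)"
  by (rule contour_integral_bound_linepath[OF int(3) B0]) (use Bz[of _ "T"] assms in auto)
 have n: "cmod (?b - ?a) = x1 - x0" "cmod (?d - ?c) = x1 - x0" using assms by (auto simp: cmod_def)
 have "contour_integral (linepath ?b ?c) f - contour_integral (linepath ?a ?d) f - J
   = - (contour_integral (linepath ?a ?b) f + contour_integral (linepath ?c ?d) f)"
  using J' rev by simp
 then have "cmod (contour_integral (linepath ?b ?c) f - contour_integral (linepath ?a ?d) f - J)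
   = cmod (contour_integral (linepath ?a ?b) f + contour_integral (linepath ?c ?d) f)" by (simp only: norm_minus_cancel)
 also have "... <= B * (x1 - x0) + B * (x1 - x0)" using h1 h2 n norm_triangle_ineq by (smt (verit))
 finally show ?thesis by (simp add: algebra_simps)
qed

lemma vertical_bound:
 assumes f: "continuous_on (closed_segment (Complex x (-T)) (Complex x T)) f" and T: "T > 0"
  and B: "!!y. \<bar>y\<bar> <= T ==> cmod (f (Complex x y)) <= B"
 shows "cmod (contour_integral (linepath (Complex x (-T)) (Complex x T)) f) <= 2 * T * B"
proof -
 have "B >= 0" using order_trans[OF norm_ge_zero B[of 0]] T by simp
 moreover have "cmod (f z) <= B" if z: "z \<in> closed_segment (Complex x (-T)) (Complex x T)" for z
 proof -
  obtain w where w: "0 <= w" "w <= 1" "z = (1 - w) *\<^sub>R Complex x (-T) + w *\<^sub>R Complex x T"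
   using z by (auto simp: closed_segment_def)
  have "Re z = x" "Im z = -T + w * (2 * T)" unfolding w(3) by (auto simp: algebra_simps)
  moreover have "0 <= w * (2 * T)" "w * (2 * T) <= 1 * (2 * T)" using w T by (auto intro!: mult_right_mono)
  ultimately have "\<bar>Im z\<bar> <= T" by linarith
  moreover have "z = Complex x (Im z)" using \<open>Re z = x\<close> by (simp add: complex_eq_iff)
  ultimately show ?thesis using B[of "Im z"] by metis
 qed
 ultimately have "cmod (contour_integral (linepath (Complex x (-T)) (Complex x T)) f) <= B * cmod (Complex x T - Complex x (-T))"
  by (intro contour_integral_bound_linepath contour_integrable_continuous_linepath f) auto
 also have "Complex x T - Complex x (-T) = \<i> * of_real (2 * T)" by (simp add: complex_eq_iff)
 also have "cmod (\<i> * of_real (2 * T)) = 2 * T" using T by (simp add: norm_mult)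
 finally show ?thesis by (simp add: mult_ac)
qed

text \<open>The extra factor \<open>s + 1\<close>, compared with the classical kernel, corresponds to the Riesz weight \<open>1 - k/X\<close> and makes the integrals converge absolutely.\<close>
definition perron_kernel :: "real => complex => complex" where
 "perron_kernel y s = exp (s * of_real (ln y)) / (s * (s + 1))"

lemma norm_exp_ln: "y > 0 ==> cmod (exp (s * of_real (ln y))) = y powr Re s"
 by (simp add: norm_exp_eq_Re powr_def)

lemma norm_perron_kernel_le:
 assumes "y > 0" "a <= cmod s" "b <= cmod (s + 1)" "a > 0" "b > 0"
 shows "cmod (perron_kernel y s) <= y powr Re s / (a * b)"
 unfolding perron_kernel_def norm_divide norm_mult norm_exp_ln[OF assms(1)]
 using assms by (intro divide_left_mono mult_mono) (auto intro!: mult_pos_pos)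

lemma perron_kernel_integral:
 assumes y: "y > 0" and c: "0 < c" "c <= 1" and T: "T >= 2"
 shows "cmod (contour_integral (linepath (Complex c (-T)) (Complex c T)) (perron_kernel y)
   - 2 * of_real pi * \<i> * of_real (max 0 (1 - 1 / y))) <= 8 * y powr c / T"
proof (cases "y <= 1")
 case True
 let ?I = "%x. contour_integral (linepath (Complex x (-T)) (Complex x T)) (perron_kernel y)"
 have hol: "perron_kernel y holomorphic_on {s. Re s > 0}"
  unfolding perron_kernel_def by (intro holomorphic_intros) (auto simp: add_eq_0_iff2)
 have sub: "cbox (Complex c (-T)) (Complex (c + T) T) \<subseteq> {s. Re s > 0}"
  using c by (auto simp: in_cbox_complex_iff)
 have pimsub: "path_image (rectpath (Complex c (-T)) (Complex (c + T) T)) \<subseteq> cbox (Complex c (-T)) (Complex (c + T) T)"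
  using T by (intro path_image_rectpath_subset_cbox) auto
 have cont: "continuous_on (cbox (Complex c (-T)) (Complex (c + T) T)) (perron_kernel y)"
  by (rule continuous_on_subset[OF holomorphic_on_imp_continuous_on[OF hol] sub])
 have mono: "y powr x <= y powr c" if "c <= x" for x
  using that y True by (intro powr_mono') auto
 have "cmod (?I (c + T) - ?I c - 0) <= 2 * (y powr c / (T * T)) * (c + T - c)"
 proof (rule contour_integral_rectpath_split[OF continuous_on_subset[OF cont pimsub]])
  show "(perron_kernel y has_contour_integral 0) (rectpath (Complex c (-T)) (Complex (c + T) T))"
  proof (rule Cauchy_theorem_convex_simple[OF hol])
   show "path_image (rectpath (Complex c (-T)) (Complex (c + T) T)) \<subseteq> {s. Re s > 0}"
    using pimsub sub by blast
  qed (auto simp: convex_halfspace_Re_gt)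
  fix x v :: real assume x: "c <= x" and v: "\<bar>v\<bar> = T"
  have "cmod (perron_kernel y (Complex x v)) <= y powr Re (Complex x v) / (T * T)"
   using v T abs_Im_le_cmod[of "Complex x v"] abs_Im_le_cmod[of "Complex x v + 1"] y
   by (intro norm_perron_kernel_le) auto
  also have "... <= y powr c / (T * T)" using mono[OF x] T by (intro divide_right_mono) auto
  finally show "cmod (perron_kernel y (Complex x v)) <= y powr c / (T * T)" .
 qed (use T in auto)
 moreover have "cmod (?I (c + T)) <= 2 * T * (y powr c / (T * T))"
 proof (rule vertical_bound)
  have "closed_segment (Complex (c + T) (-T)) (Complex (c + T) T) \<subseteq> cbox (Complex c (-T)) (Complex (c + T) T)"
   using T by (intro closed_segment_subset convex_box) (auto simp: in_cbox_complex_iff)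
  then show "continuous_on (closed_segment (Complex (c + T) (-T)) (Complex (c + T) T)) (perron_kernel y)"
   by (rule continuous_on_subset[OF cont])
  fix v :: real
  have "cmod (perron_kernel y (Complex (c + T) v)) <= y powr Re (Complex (c + T) v) / (T * T)"
   using T c abs_Re_le_cmod[of "Complex (c + T) v"] abs_Re_le_cmod[of "Complex (c + T) v + 1"] y
   by (intro norm_perron_kernel_le) auto
  also have "... <= y powr c / (T * T)" using mono[of "c + T"] T by (intro divide_right_mono) auto
  finally show "cmod (perron_kernel y (Complex (c + T) v)) <= y powr c / (T * T)" .
 qed (use T in auto)
 ultimately have "cmod (?I c) <= 2 * T * (y powr c / (T * T)) + 2 * (y powr c / (T * T)) * T"
  using norm_triangle_ineq2[of "?I c" "?I (c + T)"] by (simp add: norm_minus_commute)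
 also have "... = 4 * y powr c / T" using T by (simp add: field_simps)
 also have "... <= 8 * y powr c / T" using T by (intro divide_right_mono) auto
 finally show ?thesis using True y by simp
next
 case False
 then have y1: "y > 1" by simp
 let ?I = "%x. contour_integral (linepath (Complex x (-T)) (Complex x T)) (perron_kernel y)"
 define g where "g = (%s::complex. exp (s * of_real (ln y)))"
 have pk: "perron_kernel y s = g s / (s - 0) - g s / (s - (-1))" if "s ~= 0" "s ~= -1" for s
 proof -
  have "s + 1 ~= 0" using that add_eq_0_iff2[of s 1] by auto
  then show ?thesis using that by (simp add: perron_kernel_def g_def field_simps)
 qed
 let ?R = "rectpath (Complex (-T) (-T)) (Complex c T)"
 have im: "path_image ?R = cbox (Complex (-T) (-T)) (Complex c T) - box (Complex (-T) (-T)) (Complex c T)"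
  using T c by (intro path_image_rectpath_cbox_minus_box) auto
 have in0: "0 \<in> box (Complex (-T) (-T)) (Complex c T)" "-1 \<in> box (Complex (-T) (-T)) (Complex c T)"
  using T c by (auto simp: in_box_complex_iff)
 have ghol: "g holomorphic_on UNIV" unfolding g_def by (intro holomorphic_intros)
 have CI: "((%w. g w / (w - z)) has_contour_integral (2 * pi * \<i> * winding_number ?R z * g z)) ?R"
  if "z \<in> box (Complex (-T) (-T)) (Complex c T)" for z
 proof (rule Cauchy_integral_formula_convex_simple[OF convex_UNIV ghol])
  show "path_image ?R \<subseteq> UNIV - {z}" using that unfolding im by blast
 qed simp_all
 have J: "(perron_kernel y has_contour_integral (2 * pi * \<i> * 1 * g 0 - 2 * pi * \<i> * 1 * g (-1))) ?R"
 proof (rule has_contour_integral_eq[OF has_contour_integral_diff])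
  show "((%w. g w / (w - 0)) has_contour_integral (2 * pi * \<i> * 1 * g 0)) ?R"
   using CI[OF in0(1)] winding_number_rectpath[OF in0(1)] by simp
  show "((%w. g w / (w - (-1))) has_contour_integral (2 * pi * \<i> * 1 * g (-1))) ?R"
   using CI[OF in0(2)] winding_number_rectpath[OF in0(2)] by simp
  fix z assume z: "z \<in> path_image ?R"
  have "z ~= 0" using z in0(1) unfolding im by blast
  moreover have "z ~= -1" using z in0(2) unfolding im by blast
  ultimately show "g z / (z - 0) - g z / (z - (-1)) = perron_kernel y z" using pk[of z] by simp
 qed
 have Jv: "2 * pi * \<i> * 1 * g 0 - 2 * pi * \<i> * 1 * g (-1) = 2 * of_real pi * \<i> * of_real (max 0 (1 - 1 / y))"
 proof -
  have "g (-1) = of_real (1 / y)" using y by (simp add: g_def exp_minus inverse_eq_divide exp_of_real)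
  then show ?thesis using y1 by (simp add: g_def algebra_simps)
 qed
 have mono: "y powr x <= y powr c" if "x <= c" for x
  using that y1 by (intro powr_mono) auto
 have "cmod (?I c - ?I (-T) - (2 * pi * \<i> * 1 * g 0 - 2 * pi * \<i> * 1 * g (-1))) <= 2 * (y powr c / (T * T)) * (c - (-T))"
 proof (rule contour_integral_rectpath_split[OF _ _ _ J])
  have "z ~= 0 & z ~= -1" if "z \<in> path_image ?R" for z using that in0 unfolding im by blast
  then show "continuous_on (path_image ?R) (perron_kernel y)"
   unfolding perron_kernel_def by (intro continuous_intros) (auto simp: add_eq_0_iff2)
  fix x v :: real assume x: "x <= c" and v: "\<bar>v\<bar> = T"
  have "cmod (perron_kernel y (Complex x v)) <= y powr Re (Complex x v) / (T * T)"
   using v T abs_Im_le_cmod[of "Complex x v"] abs_Im_le_cmod[of "Complex x v + 1"] y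
   by (intro norm_perron_kernel_le) auto
  also have "... <= y powr c / (T * T)" using mono[OF x] T by (intro divide_right_mono) auto
  finally show "cmod (perron_kernel y (Complex x v)) <= y powr c / (T * T)" .
 qed (use T c in auto)
 moreover have "cmod (?I (-T)) <= 2 * T * (y powr c / (T * (T / 2)))"
 proof (rule vertical_bound)
  have ne: "z ~= 0 & z ~= -1" if z: "z \<in> closed_segment (Complex (-T) (-T)) (Complex (-T) T)" for z
  proof -
   have "closed_segment (Complex (-T) (-T)) (Complex (-T) T) \<subseteq> {z. Re z <= -T}"
    by (intro closed_segment_subset convex_halfspace_Re_le) auto
   then show ?thesis using z T by auto
  qed
  then show "continuous_on (closed_segment (Complex (-T) (-T)) (Complex (-T) T)) (perron_kernel y)"
   unfolding perron_kernel_def by (intro continuous_intros) (auto simp: add_eq_0_iff2)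
  fix v :: real
  have "cmod (perron_kernel y (Complex (-T) v)) <= y powr Re (Complex (-T) v) / (T * (T / 2))"
   using T abs_Re_le_cmod[of "Complex (-T) v"] abs_Re_le_cmod[of "Complex (-T) v + 1"] y
   by (intro norm_perron_kernel_le) auto
  also have "... <= y powr c / (T * (T / 2))" using mono[of "-T"] T c by (intro divide_right_mono) auto
  finally show "cmod (perron_kernel y (Complex (-T) v)) <= y powr c / (T * (T / 2))" .
 qed (use T in auto)
 ultimately have "cmod (?I c - (2 * pi * \<i> * 1 * g 0 - 2 * pi * \<i> * 1 * g (-1))) <= 2 * T * (y powr c / (T * (T / 2))) + 2 * (y powr c / (T * T)) * (c + T)"
  using norm_triangle_ineq2[of "?I c - (2 * pi * \<i> * 1 * g 0 - 2 * pi * \<i> * 1 * g (-1))" "?I (-T)"] by (simp add: algebra_simps)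
 also have "... <= 2 * T * (y powr c / (T * (T / 2))) + 2 * (y powr c / (T * T)) * (2 * T)"
  using c T by (intro add_left_mono mult_left_mono) auto
 also have "... = 8 * y powr c / T" using T by (simp add: field_simps)
 finally show ?thesis by (simp only: Jv)
qed

section \<open>Riesz means of the Moebius function\<close>

definition riesz :: "real => real" where
 "riesz X = (\<Sum>k=1..nat \<lfloor>X\<rfloor>. mu k / real k * (1 - real k / X))"

lemma riesz_eq:
 assumes "X > 0" "X <= real K"
 shows "riesz X = (\<Sum>k=1..K. mu k / real k * max 0 (1 - real k / X))"
proof -
 have "riesz X = (\<Sum>k=1..nat \<lfloor>X\<rfloor>. mu k / real k * max 0 (1 - real k / X))"
  unfolding riesz_def
 proof (intro sum.cong refl)
  fix k assume "k \<in> {1..nat \<lfloor>X\<rfloor>}"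
  then have "real k <= real (nat \<lfloor>X\<rfloor>)" by simp
  also have "... <= X" using assms by (intro of_nat_floor) auto
  finally have "real k <= X" .
  then show "mu k / real k * (1 - real k / X) = mu k / real k * max 0 (1 - real k / X)"
   using assms by simp
 qed
 also have "... = (\<Sum>k=1..K. mu k / real k * max 0 (1 - real k / X))"
 proof (rule sum.mono_neutral_left)
  have "nat \<lfloor>X\<rfloor> <= K" using assms by (simp add: nat_le_iff floor_le_iff)
  then show "{1..nat \<lfloor>X\<rfloor>} \<subseteq> {1..K}" by auto
  show "\<forall>i\<in>{1..K} - {1..nat \<lfloor>X\<rfloor>}. mu i / real i * max 0 (1 - real i / X) = 0"
  proof
   fix i assume i: "i \<in> {1..K} - {1..nat \<lfloor>X\<rfloor>}"
   then have "\<lfloor>X\<rfloor> < int i" by auto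
   then have "X < real i" by (simp add: floor_less_iff)
   then show "mu i / real i * max 0 (1 - real i / X) = 0" using assms by simp
  qed
 qed auto
 finally show ?thesis .
qed

definition psi_z :: "complex => complex" where
 "psi_z s = 1 / ((s + 1) * pzeta (1 + s))"

lemma riesz_perron:
 obtains C where "C > 0" "!!X T c. X > 1 ==> T >= 2 ==> 0 < c ==> c <= 1 ==>
   cmod (contour_integral (linepath (Complex c (-T)) (Complex c T)) (%s. exp (s * of_real (ln X)) * psi_z s)
    - 2 * of_real pi * \<i> * of_real (riesz X)) <= C * X powr c / (c * T)"
proof -
 obtain C0 where C0: "C0 > 0" "!!s. Re s >= 99/100 ==> cmod (pzeta s) <= C0 * (1 + cmod s) powr (1 + 1/50)"
  using pzeta_growth by blast
 show ?thesis
 proof (rule that[of "8 * (C0 * 9) + 2"])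
  show "8 * (C0 * 9) + 2 > 0" using C0 by simp
  fix X T c :: real assume X: "X > 1" and T: "T >= 2" and c: "0 < c" "c <= 1"
  define g where "g = (%k. real k powr (- (1 + c)))"
  define S where "S = infsum g {1..}"
  have gs: "g summable_on A" for A
   using abs_summable_nat_powr[of "of_real (1 + c)" A] c by (simp add: norm_nat_powr g_def)
  have "S <= C0 * 9 / c"
  proof -
   have "dsum {1..} (of_real (1 + c)) = (\<Sum>\<^sub>\<infinity>k\<in>{1..}. of_real (g k))"
    unfolding dsum_def g_def by (intro infsum_cong) (simp add: powr_of_real[symmetric])
   also have "... = of_real S" unfolding S_def
    by (rule infsumI[OF has_sum_of_real[OF has_sum_infsum[OF gs]]])
   finally have "pzeta (of_real (1 + c)) = of_real c * of_real S"
    using pzeta_dsum[of "of_real (1 + c)"] c by simp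
   then have "c * S <= cmod (pzeta (of_real (1 + c)))" by (simp flip: of_real_mult)
   also have "... <= C0 * (1 + cmod (of_real (1 + c))) powr (1 + 1/50)" using c by (intro C0) auto
   also have "... <= C0 * 3 powr (1 + 1/50)" using c C0 by (intro mult_left_mono powr_mono2) (auto simp del: of_real_add)
   also have "... <= C0 * 3 powr 2" using C0 by (intro mult_left_mono powr_mono) auto
   finally show ?thesis using c by (simp add: field_simps)
  qed
  define \<delta> where "\<delta> = c / (X powr c * T\<^sup>2)"
  have \<delta>: "\<delta> > 0" using c X T by (simp add: \<delta>_def)
  have "\<exists>K. X <= real K & infsum g {Suc K..} <= \<delta>"
  proof -
   have "(g has_sum infsum g UNIV) UNIV" using gs by simp
   then have "g sums infsum g UNIV" by (rule has_sum_imp_sums)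
   then have "(%K. \<Sum>k<Suc K. g k) \<longlonglongrightarrow> infsum g UNIV" unfolding sums_def by (rule LIMSEQ_Suc)
   then have "eventually (%K. dist (\<Sum>k<Suc K. g k) (infsum g UNIV) < \<delta>) sequentially" using \<delta> by (rule tendstoD)
   moreover have "eventually (%K. X <= real K) sequentially" by real_asymp
   ultimately have "eventually (%K. dist (\<Sum>k<Suc K. g k) (infsum g UNIV) < \<delta> & X <= real K) sequentially"
    by (rule eventually_conj)
   then obtain K where K: "dist (\<Sum>k<Suc K. g k) (infsum g UNIV) < \<delta>" "X <= real K"
    unfolding eventually_sequentially by blast
   have "infsum g ({..<Suc K} \<union> {Suc K..}) = infsum g {..<Suc K} + infsum g {Suc K..}"
    by (rule infsum_Un_disjoint) (auto intro: gs)
   moreover have "{..<Suc K} \<union> {Suc K..} = UNIV" by auto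
   ultimately show ?thesis using K by (auto simp: dist_real_def)
  qed
  then obtain K where K: "X <= real K" "infsum g {Suc K..} <= \<delta>" by blast
  let ?L = "linepath (Complex c (-T)) (Complex c T)"
  have onseg: "Re z = c" if "z \<in> closed_segment (Complex c (-T)) (Complex c T)" for z
  proof -
   obtain w where w: "z = (1 - w) *\<^sub>R Complex c (-T) + w *\<^sub>R Complex c T"
    using \<open>z \<in> closed_segment (Complex c (-T)) (Complex c T)\<close> by (auto simp: closed_segment_def)
   show ?thesis unfolding w by (simp add: algebra_simps)
  qed
  have ne: "z ~= 0" "z + 1 ~= 0" "cmod z >= c" "cmod (z + 1) >= 1" if "Re z = c" for z
   using that c abs_Re_le_cmod[of z] abs_Re_le_cmod[of "z+1"] by (auto simp: complex_eq_iff)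
  have pkint: "perron_kernel y contour_integrable_on ?L" for y
   unfolding perron_kernel_def
   by (intro contour_integrable_continuous_linepath continuous_intros) (use onseg ne in auto)
  define h where "h = (%s. \<Sum>k=1..K. of_real (mu k / real k) * perron_kernel (X / real k) s)"
  have hint: "h contour_integrable_on ?L"
   unfolding h_def by (intro contour_integrable_sum contour_integrable_lmul pkint) auto
  have CIh: "contour_integral ?L h = (\<Sum>k=1..K. of_real (mu k / real k) * contour_integral ?L (perron_kernel (X / real k)))"
  proof -
   have "contour_integral ?L h = (\<Sum>k=1..K. contour_integral ?L (%s. of_real (mu k / real k) * perron_kernel (X / real k) s))"
    unfolding h_def by (rule contour_integral_sum) (intro finite_atLeastAtMost contour_integrable_lmul pkint)+
   also have "... = (\<Sum>k=1..K. of_real (mu k / real k) * contour_integral ?L (perron_kernel (X / real k)))"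
    by (intro sum.cong refl contour_integral_lmul pkint)
   finally show ?thesis .
  qed
  have R: "riesz X = (\<Sum>k=1..K. mu k / real k * max 0 (1 - 1 / (X / real k)))"
   using riesz_eq[of X K] X K by simp
  have e1: "cmod (contour_integral ?L h - 2 * of_real pi * \<i> * of_real (riesz X)) <= 8 * X powr c * S / T"
  proof -
   have eq: "contour_integral ?L h - 2 * of_real pi * \<i> * of_real (riesz X)
     = (\<Sum>k=1..K. of_real (mu k / real k) * (contour_integral ?L (perron_kernel (X / real k)) - 2 * of_real pi * \<i> * of_real (max 0 (1 - 1 / (X / real k)))))"
    unfolding CIh R by (simp add: sum_subtractf right_diff_distrib sum_distrib_left mult_ac)
   have "cmod (contour_integral ?L h - 2 * of_real pi * \<i> * of_real (riesz X)) <= (\<Sum>k=1..K. 8 * X powr c / T * g k)"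
    unfolding eq
   proof (rule sum_norm_le)
    fix k assume k: "k \<in> {1..K}"
    have "cmod (of_real (mu k / real k) * (contour_integral ?L (perron_kernel (X / real k)) - 2 * of_real pi * \<i> * of_real (max 0 (1 - 1 / (X / real k)))))
     <= (1 / real k) * (8 * (X / real k) powr c / T)"
     unfolding norm_mult
    proof (intro mult_mono perron_kernel_integral c T)
     show "cmod (of_real (mu k / real k)) <= 1 / real k" using abs_mu_le[of k] k by (simp add: norm_divide divide_right_mono)
    qed (use X k in auto)
    also have "... = 8 * X powr c / T * g k"
    proof -
     have "g k = (1 / real k) * (1 / real k powr c)" unfolding g_def powr_minus powr_add using k by (simp add: field_simps)
     moreover have "(X / real k) powr c = X powr c / real k powr c" by (rule powr_divide)
     ultimately show ?thesis by simp
    qed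
    finally show "cmod (of_real (mu k / real k) * (contour_integral ?L (perron_kernel (X / real k)) - 2 * of_real pi * \<i> * of_real (max 0 (1 - 1 / (X / real k))))) <= 8 * X powr c / T * g k" .
   qed
   also have "... = 8 * X powr c / T * (\<Sum>k=1..K. g k)" by (simp add: sum_distrib_left)
   finally have b: "cmod (contour_integral ?L h - 2 * of_real pi * \<i> * of_real (riesz X)) <= 8 * X powr c / T * (\<Sum>k=1..K. g k)" .
   have "(\<Sum>k=1..K. g k) <= S"
    unfolding S_def by (rule finite_sum_le_infsum[OF gs]) (auto simp: g_def)
   then have "8 * X powr c / T * (\<Sum>k=1..K. g k) <= 8 * X powr c / T * S"
    using T by (intro mult_left_mono) auto
   with b show ?thesis by simp
  qed
  let ?F = "%s. exp (s * of_real (ln X)) * psi_z s"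
  have diff: "cmod (?F s - h s) <= X powr c * \<delta> / c" if s: "Re s = c" for s
  proof -
   let ?m = "%k. of_real (mu k) * of_nat k powr (- (1 + s)) :: complex"
   have s1: "Re (1 + s) > 1" using s c by simp
   have sm: "?m summable_on A" if "A \<subseteq> {1..}" for A
    by (rule summable_on_subset_banach[OF abs_summable_summable[OF dsum_mu(1)[OF s1]] that])
   have pz: "pzeta (1 + s) = s * dsum {1..} (1 + s)" using pzeta_dsum[OF s1] by simp
   have D: "infsum ?m {1..} * dsum {1..} (1 + s) = 1" using dsum_mu(2)[OF s1] .
   then have d0: "dsum {1..} (1 + s) ~= 0" by (metis mult_zero_right zero_neq_one)
   have "infsum ?m {1..} = 1 / dsum {1..} (1 + s)" using eq_divide_imp[OF d0 D] .
   then have "1 / pzeta (1 + s) = infsum ?m {1..} / s" unfolding pz by (simp only: divide_divide_eq_left mult.commute)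
   moreover have "?F s = exp (s * of_real (ln X)) / (s + 1) * (1 / pzeta (1 + s))" unfolding psi_z_def by simp
   ultimately have "?F s = exp (s * of_real (ln X)) / (s + 1) * (infsum ?m {1..} / s)" by (simp only:)
   then have F: "?F s = exp (s * of_real (ln X)) / (s * (s + 1)) * infsum ?m {1..}"
    by (simp only: times_divide_times_eq times_divide_eq_left times_divide_eq_right divide_divide_eq_left mult.commute)
   have comm: "a / d * (E * p) = E / d * (a * p)" for a d E p :: complex by simp
   have "h s = (\<Sum>k=1..K. exp (s * of_real (ln X)) / (s * (s + 1)) * ?m k)"
    unfolding h_def
   proof (intro sum.cong refl)
    fix k assume k: "k \<in> {1..K}"
    have "of_real (1 / real k) * exp (s * of_real (ln (X / real k))) = exp (s * of_real (ln X)) * of_nat k powr (- (1 + s))"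
    proof -
     have "of_nat k powr (- (1 + s)) = exp (- of_real (ln (real k))) * exp (- (s * of_real (ln (real k))))"
      using k by (simp add: powr_def Ln_of_nat algebra_simps exp_add exp_diff exp_minus field_simps)
     also have "exp (- complex_of_real (ln (real k))) = of_real (1 / real k)"
      using k by (simp add: exp_minus inverse_eq_divide exp_of_real)
     finally show ?thesis
      using k X by (simp add: ln_div right_diff_distrib exp_diff exp_minus field_simps)
    qed
    moreover have "of_real (mu k / real k) * perron_kernel (X / real k) s
      = of_real (mu k) / (s * (s + 1)) * (of_real (1 / real k) * exp (s * of_real (ln (X / real k))))"
     by (simp add: perron_kernel_def)
    ultimately have "of_real (mu k / real k) * perron_kernel (X / real k) s
      = of_real (mu k) / (s * (s + 1)) * (exp (s * of_real (ln X)) * of_nat k powr (- (1 + s)))" by (simp only:)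
    then show "of_real (mu k / real k) * perron_kernel (X / real k) s = exp (s * of_real (ln X)) / (s * (s + 1)) * ?m k"
     using comm[of "of_real (mu k)"] by (rule trans)
   qed
   then have "?F s - h s = exp (s * of_real (ln X)) / (s * (s + 1)) * (infsum ?m {1..} - (\<Sum>k=1..K. ?m k))"
    unfolding F by (simp add: sum_distrib_left right_diff_distrib)
   also have "infsum ?m {1..} - (\<Sum>k=1..K. ?m k) = infsum ?m {Suc K..}"
   proof -
    have "infsum ?m ({1..K} \<union> {Suc K..}) = infsum ?m {1..K} + infsum ?m {Suc K..}"
     by (rule infsum_Un_disjoint[OF sm sm]) auto
    moreover have "{1..K} \<union> {Suc K..} = {1..}" by auto
    ultimately show ?thesis by simp
   qed
   also have "cmod (exp (s * of_real (ln X)) / (s * (s + 1)) * infsum ?m {Suc K..}) <= (X powr c / (c * 1)) * \<delta>"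
    unfolding norm_mult
   proof (rule mult_mono)
    show "cmod (exp (s * of_real (ln X)) / (s * (s + 1))) <= X powr c / (c * 1)"
     using norm_perron_kernel_le[of X c s 1] ne[OF s] X c s unfolding perron_kernel_def by simp
    have "(%k. norm (?m k)) summable_on {Suc K..}"
     using dsum_mu(1)[OF s1] by (rule summable_on_subset_banach) auto
    then have "cmod (infsum ?m {Suc K..}) <= infsum (%k. norm (?m k)) {Suc K..}" by (rule norm_infsum_bound)
    also have "... <= infsum g {Suc K..}"
    proof (rule infsum_mono)
     show "(%k. norm (?m k)) summable_on {Suc K..}" by fact
     fix k
     show "norm (?m k) <= g k" using mult_right_mono[OF abs_mu_le[of k], of "real k powr (-(1+c))"] s
      by (simp add: norm_mult norm_nat_powr g_def)
    qed (rule gs)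
    finally show "cmod (infsum ?m {Suc K..}) <= \<delta>" using K by simp
   qed (use X c in auto)
   finally show ?thesis by simp
  qed
  have psi_ne: "pzeta (1 + s) ~= 0" if "Re s = c" for s
   using dsum_mu(2)[of "1 + s"] pzeta_dsum[of "1 + s"] that c ne[OF that] by auto
  have contF: "continuous_on (closed_segment (Complex c (-T)) (Complex c T)) ?F"
  proof -
   have "continuous_on (closed_segment (Complex c (-T)) (Complex c T)) (%s. pzeta (1 + s))"
    by (rule continuous_on_compose2[OF holomorphic_on_imp_continuous_on[OF pzeta_holomorphic]])
      (use onseg c in \<open>auto intro!: continuous_intros\<close>)
   then show ?thesis unfolding psi_z_def
    by (intro continuous_intros) (use onseg ne psi_ne in auto)
  qed
  have conth: "continuous_on (closed_segment (Complex c (-T)) (Complex c T)) h"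
   unfolding h_def perron_kernel_def by (intro continuous_intros) (use onseg ne in auto)
  have e2: "cmod (contour_integral ?L (%s. ?F s - h s)) <= 2 * T * (X powr c * \<delta> / c)"
   by (rule vertical_bound[OF continuous_on_diff[OF contF conth]]) (use T diff in auto)
  have "contour_integral ?L (%s. ?F s - h s) = contour_integral ?L ?F - contour_integral ?L h"
   by (intro contour_integral_diff hint contour_integrable_continuous_linepath contF)
  then have "cmod (contour_integral ?L ?F - 2 * of_real pi * \<i> * of_real (riesz X)) <= 2 * T * (X powr c * \<delta> / c) + 8 * X powr c * S / T"
   using e1 e2 norm_triangle_ineq[of "contour_integral ?L ?F - contour_integral ?L h" "contour_integral ?L h - 2 * of_real pi * \<i> * of_real (riesz X)"] by simp
  also have "2 * T * (X powr c * \<delta> / c) = 2 * 1 / T" using T X c by (simp add: \<delta>_def power2_eq_square)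
  also have "... <= 2 * (X powr c / c) / T"
  proof -
   have "1 <= X powr c" using X c by (intro ge_one_powr_ge_zero) auto
   also have "... <= X powr c / c" using c X by (simp add: field_simps)
   finally show ?thesis using T by (intro divide_right_mono mult_left_mono) auto
  qed
  also have "8 * X powr c * S / T <= 8 * X powr c * (C0 * 9 / c) / T"
   using \<open>S <= C0 * 9 / c\<close> T by (intro divide_right_mono mult_left_mono) auto
  also have "2 * (X powr c / c) / T + 8 * X powr c * (C0 * 9 / c) / T = (8 * (C0 * 9) + 2) * X powr c / (c * T)"
   using T c by (simp add: field_simps)
  finally show "cmod (contour_integral ?L ?F - 2 * of_real pi * \<i> * of_real (riesz X)) <= (8 * (C0 * 9) + 2) * X powr c / (c * T)"
   by simp
 qed
qed

text \<open>Perron's formula on the line \<open>Re s = 1/log X\<close>, shifted into the zero-free region; the height \<open>T\<close> is a power of \<open>log X\<close>, which balances the truncation error and the gain \<open>X^(-k T^(-1/10))\<close>.\<close>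
lemma riesz_bound:
 obtains C where "C > 0" "!!X. X >= 1 ==> \<bar>riesz X\<bar> <= C / (1 + ln X) ^ 3"
proof -
 obtain C where C: "C > 0" "!!X T c. X > 1 ==> T >= 2 ==> 0 < c ==> c <= 1 ==>
   cmod (contour_integral (linepath (Complex c (-T)) (Complex c T)) (%s. exp (s * of_real (ln X)) * psi_z s)
    - 2 * of_real pi * \<i> * of_real (riesz X)) <= C * X powr c / (c * T)"
  using riesz_perron by blast
 obtain k b where kb: "0 < k" "k <= 1/200" "0 < b"
  "!!x t. 1 - k * (1 + \<bar>t\<bar>) powr (- 1/10) <= x ==> x <= 1 + k ==> b <= cmod (pzeta (Complex x t))"
  using pzeta_zero_free by blast
 have lim: "((%L. L ^ 7 * exp (- (k/2) * L * (2 + L^4) powr (-1/10))) \<longlongrightarrow> 0) at_top"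
  using kb by real_asymp
 then have "eventually (%L. L ^ 7 * exp (- (k/2) * L * (2 + L^4) powr (-1/10)) < 1) at_top"
  by (rule order_tendstoD) simp
 moreover have "eventually (%L. L >= 2 / k) at_top" by (rule eventually_ge_at_top)
 ultimately have "eventually (%L. L ^ 7 * exp (- (k/2) * L * (2 + L^4) powr (-1/10)) < 1 & L >= 2 / k) at_top"
  by (rule eventually_conj)
 then obtain L0 where L0: "!!L. L >= L0 ==> L ^ 7 * exp (- (k/2) * L * (2 + L^4) powr (-1/10)) < 1 & L >= 2 / k"
  unfolding eventually_at_top_linorder by blast
 define A where "A = C * exp 1 + 4 / b + 2 * exp 1 / b"
 have A: "A > 0" using C kb by (auto simp: A_def intro!: add_pos_nonneg)
 have large: "\<bar>riesz X\<bar> <= A / ln X ^ 3" if X: "X > 1" "ln X >= L0" for X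
 proof -
  define L where "L = ln X"
  have L: "L >= 2 / k" "L ^ 7 * exp (- (k/2) * L * (2 + L^4) powr (-1/10)) < 1" using L0 X by (auto simp: L_def)
  have "2 / k >= 400" using kb by (simp add: field_simps)
  then have L2: "L >= 400" using L by linarith
  define T where "T = L ^ 4"
  have T2: "T >= 2"
  proof -
   have "(2::real) <= 2 ^ 4" by simp
   also have "... <= L ^ 4" using L2 by (intro power_mono) auto
   finally show ?thesis by (simp add: T_def)
  qed
  define c where "c = 1 / L"
  have c: "0 < c" "c <= 1" "c < k" using L L2 kb by (auto simp: c_def field_simps)
  define r where "r = k * (2 + T) powr (- 1/10)"
  have "(2 + T) powr (- 1/10) <= 1" using T2 powr_mono[of "-1/10" 0 "2 + T"] by simp
  then have r: "0 < r" "r <= k" using kb T2 by (auto simp: r_def)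
  have Xc: "X powr c = exp 1" using X L2 by (simp add: powr_def c_def L_def)
  let ?F = "%s. exp (s * of_real (ln X)) * psi_z s"
  let ?Q = "box (Complex (-r) (-(1+T))) (Complex k (1+T))"
  have lower: "b <= cmod (pzeta (1 + s))" if "s \<in> ?Q" for s
  proof -
   have s: "-r < Re s" "Re s < k" "\<bar>Im s\<bar> < 1 + T" using that by (auto simp: in_box_complex_iff)
   have "(2 + T) powr (-1/10) <= (1 + \<bar>Im s\<bar>) powr (-1/10)" using s by (intro powr_mono2') auto
   then have "r <= k * (1 + \<bar>Im s\<bar>) powr (-1/10)" using kb by (simp add: r_def)
   then have "b <= cmod (pzeta (Complex (1 + Re s) (Im s)))" using s by (intro kb) auto
   also have "Complex (1 + Re s) (Im s) = 1 + s" by (simp add: complex_eq_iff)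
   finally show ?thesis .
  qed
  have Re1: "Re s > - 1/200" "Re (s + 1) >= 1/2" if "s \<in> ?Q" for s using that r kb by (auto simp: in_box_complex_iff)
  have ne: "s + 1 ~= 0" "pzeta (1 + s) ~= 0" if "s \<in> ?Q" for s
  proof -
   show "s + 1 ~= 0"
   proof
    assume "s + 1 = 0"
    then have "Re (s + 1) = 0" by (simp only: zero_complex.sel)
    then show False using Re1(2)[OF that] by linarith
   qed
   show "pzeta (1 + s) ~= 0" using lower[OF that] kb(3) by auto
  qed
  have hol: "?F holomorphic_on ?Q"
  proof -
   have "(pzeta \<circ> (%s. 1 + s)) holomorphic_on ?Q"
    by (rule holomorphic_on_compose_gen[OF _ pzeta_holomorphic]) (use Re1 in \<open>force intro!: holomorphic_intros\<close>)+
   then have "(%s. pzeta (1 + s)) holomorphic_on ?Q" by (simp add: o_def)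
   then show ?thesis unfolding psi_z_def by (intro holomorphic_intros) (use ne in auto)
  qed
  let ?x0 = "- (r / 2)"
  let ?R = "rectpath (Complex ?x0 (-T)) (Complex c T)"
  have "path_image ?R \<subseteq> cbox (Complex ?x0 (-T)) (Complex c T)"
   using r c T2 by (intro path_image_rectpath_subset_cbox) auto
  also have sub: "cbox (Complex ?x0 (-T)) (Complex c T) \<subseteq> ?Q"
   using r c by (auto simp: in_cbox_complex_iff in_box_complex_iff)
  finally have pim: "path_image ?R \<subseteq> ?Q" .
  have cont: "continuous_on ?Q ?F" using hol by (rule holomorphic_on_imp_continuous_on)
  let ?I = "%x. contour_integral (linepath (Complex x (-T)) (Complex x T)) ?F"
  have bd: "cmod (?F s) <= X powr Re s / (a * b)" if "s \<in> ?Q" "a <= cmod (s + 1)" "a > 0" for s a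
  proof -
   have "cmod (?F s) = X powr Re s / (cmod (s + 1) * cmod (pzeta (1 + s)))"
    using X by (simp add: psi_z_def norm_mult norm_divide powr_def)
   also have "... <= X powr Re s / (a * b)"
    using that lower[OF that(1)] kb by (intro divide_left_mono mult_mono mult_pos_pos) auto
   finally show ?thesis .
  qed
  have mono: "X powr x <= exp 1" if "x <= c" for x
   using that X unfolding Xc[symmetric] by (intro powr_mono) auto
  have e1: "cmod (?I c - ?I ?x0 - 0) <= 2 * (exp 1 / (T * b)) * (c - ?x0)"
  proof (rule contour_integral_rectpath_split[OF continuous_on_subset[OF cont pim]])
   show "(?F has_contour_integral 0) ?R"
    by (rule Cauchy_theorem_convex_simple[OF hol convex_box(2)]) (use pim in auto)
   fix x y :: real assume xy: "?x0 <= x" "x <= c" "\<bar>y\<bar> = T"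
   have "Complex x y \<in> ?Q" using xy r c by (auto simp: in_box_complex_iff)
   then have "cmod (?F (Complex x y)) <= X powr Re (Complex x y) / (T * b)"
    using xy T2 abs_Im_le_cmod[of "Complex x y + 1"] by (intro bd) auto
   also have "... <= exp 1 / (T * b)" using mono[of x] xy T2 kb by (intro divide_right_mono) auto
   finally show "cmod (?F (Complex x y)) <= exp 1 / (T * b)" .
  qed (use r c T2 in auto)
  have e2: "cmod (?I ?x0) <= 2 * T * (X powr ?x0 / (1/2 * b))"
  proof (rule vertical_bound)
   have "closed_segment (Complex ?x0 (-T)) (Complex ?x0 T) \<subseteq> cbox (Complex ?x0 (-T)) (Complex c T)"
    using T2 r c by (intro closed_segment_subset convex_box) (auto simp: in_cbox_complex_iff)
   then show "continuous_on (closed_segment (Complex ?x0 (-T)) (Complex ?x0 T)) ?F"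
    using sub by (intro continuous_on_subset[OF cont]) blast
   fix y assume y: "\<bar>y\<bar> <= T"
   have "Complex ?x0 y \<in> ?Q" using y r c by (auto simp: in_box_complex_iff)
   then have "cmod (?F (Complex ?x0 y)) <= X powr Re (Complex ?x0 y) / (1/2 * b)"
    using Re1 abs_Re_le_cmod[of "Complex ?x0 y + 1"] by (intro bd) force+
   then show "cmod (?F (Complex ?x0 y)) <= X powr ?x0 / (1/2 * b)" by simp
  qed (use T2 in auto)
  have "X powr ?x0 = exp (- (k/2) * L * (2 + L^4) powr (-1/10))"
   using X by (simp add: powr_def r_def L_def T_def)
  then have "L ^ 7 * X powr ?x0 <= 1" using L by simp
  then have "2 * T * (X powr ?x0 / (1/2 * b)) <= 4 / b / L ^ 3"
   using L2 kb by (simp add: T_def field_simps flip: power_add)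
  with e2 have e2': "cmod (?I ?x0) <= 4 / b / L ^ 3" by linarith
  have "2 * (exp 1 / (T * b)) * (c - ?x0) <= 2 * (exp 1 / (T * b)) * 1"
   using c r kb T2 by (intro mult_left_mono) auto
  also have "... <= 2 * exp 1 / b / L ^ 3"
  proof -
   have "L ^ 3 <= T" unfolding T_def using L2 by (intro power_increasing) auto
   then show ?thesis using kb L2 T2 by (simp add: frac_le field_simps)
  qed
  finally have e1': "cmod (?I c - ?I ?x0) <= 2 * exp 1 / b / L ^ 3" using e1 by simp
  have "cmod (?I c - 2 * of_real pi * \<i> * of_real (riesz X)) <= C * exp 1 / (c * T)"
   using C(2)[of X T c] X T2 c Xc by simp
  also have "c * T = L ^ 3" using L2 by (simp add: c_def T_def eval_nat_numeral)
  finally have e3: "cmod (?I c - 2 * of_real pi * \<i> * of_real (riesz X)) <= C * exp 1 / L ^ 3" .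
  have "\<bar>riesz X\<bar> <= 2 * pi * \<bar>riesz X\<bar>" using pi_gt3 mult_right_mono[of 1 "2 * pi" "\<bar>riesz X\<bar>"] by simp
  also have "... = cmod (2 * of_real pi * \<i> * of_real (riesz X))" by (simp add: norm_mult)
  also have "... <= C * exp 1 / L ^ 3 + (2 * exp 1 / b / L ^ 3 + 4 / b / L ^ 3)"
  proof -
   have "cmod w <= cmod (u - w) + (cmod (u - v) + cmod v)" for u v w :: complex
    by norm
   from this[of "2 * of_real pi * \<i> * of_real (riesz X)" "?I c" "?I ?x0"] show ?thesis using e1' e2' e3 by linarith
  qed
  also have "... = A / L ^ 3" by (simp add: A_def add_divide_distrib)
  finally show ?thesis by (simp add: L_def)
 qed
 define L1 where "L1 = max L0 1"
 have small: "\<bar>riesz X\<bar> <= exp L1" if X: "X >= 1" "ln X <= L1" for X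
 proof -
  have "\<bar>riesz X\<bar> <= (\<Sum>k=1..nat \<lfloor>X\<rfloor>. \<bar>mu k / real k * (1 - real k / X)\<bar>)" unfolding riesz_def by (rule sum_abs)
  also have "... <= (\<Sum>k=1..nat \<lfloor>X\<rfloor>. 1)"
  proof (rule sum_mono)
   fix k assume k: "k \<in> {1..nat \<lfloor>X\<rfloor>}"
   then have "real k <= real (nat \<lfloor>X\<rfloor>)" by simp
   also have "... <= X" using X by (intro of_nat_floor) auto
   finally have kX: "real k <= X" .
   have "\<bar>mu k / real k * (1 - real k / X)\<bar> = (\<bar>mu k\<bar> * (1 - real k / X)) / real k" using kX X by (simp add: abs_mult)
   also have "... <= (1 * 1) / 1" using abs_mu_le[of k] k kX X by (intro frac_le mult_mono) auto
   finally show "\<bar>mu k / real k * (1 - real k / X)\<bar> <= 1" by simp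
  qed
  also have "... = real (nat \<lfloor>X\<rfloor>)" by simp
  also have "... <= X" using X by (intro of_nat_floor) auto
  also have "X <= exp L1" using X by (metis exp_le_cancel_iff exp_ln less_le_trans zero_less_one)
  finally show ?thesis .
 qed
 show ?thesis
 proof (rule that[of "8 * A + exp L1 * (1 + L1) ^ 3"])
  show "0 < 8 * A + exp L1 * (1 + L1) ^ 3" using A by (intro add_pos_nonneg) (auto simp: L1_def)
  fix X :: real assume X: "X >= 1"
  have l0: "ln X >= 0" using X by simp
  show "\<bar>riesz X\<bar> <= (8 * A + exp L1 * (1 + L1) ^ 3) / (1 + ln X) ^ 3"
  proof (cases "ln X <= L1")
   case True
   have "\<bar>riesz X\<bar> * (1 + ln X) ^ 3 <= exp L1 * (1 + L1) ^ 3"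
    using small[OF X True] True l0 by (intro mult_mono power_mono) auto
   also have "... <= 8 * A + exp L1 * (1 + L1) ^ 3" using A by simp
   finally show ?thesis using l0 by (simp add: pos_le_divide_eq)
  next
   case False
   then have l1: "ln X >= 1" "ln X >= L0" by (auto simp: L1_def)
   then have "X > 1" using X by (cases "X = 1") auto
   have "\<bar>riesz X\<bar> <= A / ln X ^ 3" using large \<open>X > 1\<close> l1 by simp
   also have "... = 8 * A / (2 * ln X) ^ 3" by (simp add: power_mult_distrib)
   also have "... <= (8 * A + exp L1 * (1 + L1) ^ 3) / (1 + ln X) ^ 3"
    using l1 A by (intro frac_le power_mono) (auto simp: L1_def)
   finally show ?thesis .
  qed
 qed
qed

section \<open>Moebius-weighted dilates of the weight\<close>

text \<open>The decay scale of all the kernels: \<open>log(u)^(-k)\<close>, made bounded and monotone for small \<open>u\<close>.\<close>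
definition rho :: "nat => real => real" where
 "rho k u = 1 / (1 + max 0 (ln u)) ^ k"

lemma rho_nonneg [simp]: "0 <= rho k u" and rho_pos: "0 < rho k u" and rho_le_1: "rho k u <= 1"
 by (auto simp: rho_def add_pos_nonneg intro!: one_le_power divide_nonneg_nonneg)

lemma rho_antimono: "0 < u ==> u <= v ==> rho k v <= rho k u"
 unfolding rho_def by (intro divide_left_mono power_mono mult_pos_pos zero_less_power add_left_mono max.mono) (auto simp: add_pos_nonneg)

lemma rho_mono_exp: "m <= k ==> rho k u <= rho m u"
 unfolding rho_def by (intro divide_left_mono power_increasing mult_pos_pos zero_less_power) (auto simp: add_pos_nonneg)

definition mobius_sum :: "(real => real) => real => real" where
 "mobius_sum V x = (\<Sum>k=1..nat \<lfloor>2 / x\<rfloor>. mu k / real k * V (real k * x))"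

lemma mobius_sum_eq:
 assumes "x > 0" "2 / x <= real K" and V: "!!u. u > 2 ==> V u = 0"
 shows "mobius_sum V x = (\<Sum>k=1..K. mu k / real k * V (real k * x))"
 unfolding mobius_sum_def
proof (rule sum.mono_neutral_left)
 have "nat \<lfloor>2 / x\<rfloor> <= K" using assms by (simp add: nat_le_iff floor_le_iff)
 then show "{1..nat \<lfloor>2 / x\<rfloor>} \<subseteq> {1..K}" by auto
 show "\<forall>i\<in>{1..K} - {1..nat \<lfloor>2 / x\<rfloor>}. mu i / real i * V (real i * x) = 0"
 proof
  fix i assume "i \<in> {1..K} - {1..nat \<lfloor>2 / x\<rfloor>}"
  then have "\<lfloor>2 / x\<rfloor> < int i" by auto
  then have "2 / x < real i" by (simp add: floor_less_iff)
  then have "real i * x > 2" using assms by (simp add: field_simps)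
  then show "mu i / real i * V (real i * x) = 0" using V by simp
 qed
qed auto

lemma mobius_sum_zero: "x > 2 ==> mobius_sum V x = 0"
 by (simp add: mobius_sum_def floor_eq_iff)

lemma DERIV_zero_open:
 assumes "(f has_real_derivative d) (at x)" "open S" "x \<in> S" "!!y. y \<in> S ==> f y = 0"
 shows "d = 0"
proof -
 have "((%_. 0) has_real_derivative d) (at x)"
  by (rule has_field_derivative_transform_within_open[OF assms(1-3)]) (use assms(4) in auto)
 then show ?thesis using DERIV_unique DERIV_const by blast
qed

lemma cont_zero_limit_right:
 fixes f :: "real => real"
 assumes "isCont f a" "!!y. y > a ==> f y = 0"
 shows "f a = 0"
proof -
 have "(f \<longlongrightarrow> f a) (at_right a)" using assms(1) by (auto simp: continuous_at intro: tendsto_within_subset)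
 moreover have "(f \<longlongrightarrow> 0) (at_right a)"
  by (rule tendsto_eventually) (use assms(2) eventually_at_right_less[of a] in \<open>auto elim: eventually_mono\<close>)
 ultimately show ?thesis using tendsto_unique trivial_limit_at_right_real by blast
qed

text \<open>This writes a \<open>C\<^sup>2\<close> function as a superposition of Riesz weights, which reduces sums over \<open>mu\<close> weighted by it to Riesz means.\<close>
lemma second_order_taylor:
 fixes V V1 V2 :: "real => real"
 assumes V1: "!!u. (V has_real_derivative V1 u) (at u)" and V2: "!!u. (V1 has_real_derivative V2 u) (at u)"
  and "V 2 = 0" "V1 2 = 0" "!!u. u > 2 ==> V u = 0" and u: "u >= 0"
 shows "((%y. V2 y * max 0 (y - u)) has_integral V u) {0..2}"
proof (cases "u <= 2")
 case True
 have "((%y. V2 y * (y - u)) has_integral (((2 - u) * V1 2 - V 2) - ((u - u) * V1 u - V u))) {u..2}"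
 proof (rule fundamental_theorem_of_calculus)
  fix y
  have "((%y. (y - u) * V1 y - V y) has_real_derivative (1 * V1 y + V2 y * (y - u) - V1 y)) (at y within {u..2})"
   by (rule has_field_derivative_at_within) (auto intro!: derivative_eq_intros V1 V2 simp: algebra_simps)
  then show "((%y. (y - u) * V1 y - V y) has_vector_derivative V2 y * (y - u)) (at y within {u..2})"
   by (simp add: has_real_derivative_iff_has_vector_derivative)
 qed (use True in auto)
 then have "((%y. V2 y * (y - u)) has_integral V u) {u..2}" using assms by simp
 then have "((%y. V2 y * max 0 (y - u)) has_integral V u) {u..2}"
  by (rule has_integral_eq[rotated]) auto
 moreover have "((%y. V2 y * max 0 (y - u)) has_integral 0) {0..u}"
  by (rule has_integral_is_0) auto
 ultimately have "((%y. V2 y * max 0 (y - u)) has_integral (0 + V u)) {0..2}"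
  using True u by (intro has_integral_combine[of 0 u 2]) auto
 then show ?thesis by simp
next
 case False
 then have "V u = 0" using assms by simp
 moreover have "((%y. V2 y * max 0 (y - u)) has_integral 0) {0..2}"
  by (rule has_integral_is_0) (use False in auto)
 ultimately show ?thesis by simp
qed

lemma mobius_sum_bound:
 fixes V V1 V2 :: "real => real"
 assumes V1: "!!u. (V has_real_derivative V1 u) (at u)" and V2: "!!u. (V1 has_real_derivative V2 u) (at u)"
  and c2: "continuous_on UNIV V2"
  and z2: "!!u. u > 2 ==> V u = 0" and z1: "!!u. \<bar>u\<bar> < 1 ==> V u = 0"
 obtains C where "C > 0" "!!x. x > 0 ==> \<bar>mobius_sum V x\<bar> <= C * rho 3 (1 / x)"
proof -
 have V1z: "V1 u = 0" if "u > 2" for u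
  by (rule DERIV_zero_open[OF V1, of "{2<..}"]) (use that z2 in auto)
 have V20: "V 2 = 0" by (rule cont_zero_limit_right) (use z2 DERIV_isCont[OF V1] in auto)
 have V120: "V1 2 = 0" by (rule cont_zero_limit_right) (use V1z DERIV_isCont[OF V2] in auto)
 have V1z': "V1 u = 0" if "\<bar>u\<bar> < 1" for u
  by (rule DERIV_zero_open[OF V1, of "{-1<..<1}"]) (use that z1 in auto)
 have V2z: "V2 u = 0" if "\<bar>u\<bar> < 1" for u
  by (rule DERIV_zero_open[OF V2, of "{-1<..<1}"]) (use that V1z' in auto)
 obtain C where C: "C > 0" "!!X. X >= 1 ==> \<bar>riesz X\<bar> <= C / (1 + ln X) ^ 3" using riesz_bound by blast
 have "compact (V2 ` {0..2})" by (intro compact_continuous_image continuous_on_subset[OF c2]) auto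
 then have "bounded (V2 ` {0..2})" by (rule compact_imp_bounded)
 then obtain M where M: "M > 0" "!!y. y \<in> {0..2} ==> \<bar>V2 y\<bar> <= M" unfolding bounded_pos by auto
 have riesz_rho: "\<bar>riesz X\<bar> <= C * rho 3 X" if "X > 0" for X
 proof (cases "X >= 1")
  case True
  then show ?thesis using C by (simp add: rho_def)
 next
  case False
  then have "nat \<lfloor>X\<rfloor> = 0" using that by (simp add: floor_le_iff)
  then show ?thesis using C by (simp add: riesz_def)
 qed
 show ?thesis
 proof (rule that[of "4 * M * C"])
  show "4 * M * C > 0" using M C by simp
  fix x :: real assume x: "x > 0"
  obtain K where K: "2 / x <= real K" using real_arch_simple by blast
  have "((%y. \<Sum>k=1..K. mu k / real k * (V2 y * max 0 (y - real k * x))) has_integral (\<Sum>k=1..K. mu k / real k * V (real k * x))) {0..2}"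
   by (intro has_integral_sum has_integral_mult_right second_order_taylor[OF V1 V2 V20 V120 z2]) (use x in auto)
  then have "((%y. \<Sum>k=1..K. mu k / real k * (V2 y * max 0 (y - real k * x))) has_integral mobius_sum V x) {0..2}"
   using mobius_sum_eq[OF x K z2] by simp
  then have int: "((%y. V2 y * (y * riesz (y / x))) has_integral mobius_sum V x) {0..2}"
  proof (rule has_integral_eq[rotated])
   fix y :: real assume y: "y \<in> {0..2}"
   show "(\<Sum>k=1..K. mu k / real k * (V2 y * max 0 (y - real k * x))) = V2 y * (y * riesz (y / x))"
   proof (cases "y = 0")
    case True
    have "max 0 (y - real k * x) = 0" for k using True x by (intro max_absorb1) simp
    then show ?thesis using True by simp
   next
    case False
    then have y0: "y > 0" using y by simp
    have "y / x <= 2 / x" using y x by (intro divide_right_mono) auto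
    then have "riesz (y / x) = (\<Sum>k=1..K. mu k / real k * max 0 (1 - real k / (y / x)))"
     using K x y0 by (intro riesz_eq) auto
    moreover have "max 0 (y - real k * x) = y * max 0 (1 - real k / (y / x))" for k
     using y0 x by (auto simp: max_def field_simps)
    ultimately show ?thesis by (simp add: sum_distrib_left mult_ac)
   qed
  qed
  have "norm (mobius_sum V x) <= (2 * M * C * rho 3 (1 / x)) * measure lborel {0..2::real}"
  proof (rule has_integral_bound_real[OF _ finite.emptyI int])
   show "0 <= 2 * M * C * rho 3 (1 / x)" using M C by simp
   fix y :: real assume "y \<in> {0..2} - {}"
   then have y: "y \<in> {0..2}" by simp
   show "norm (V2 y * (y * riesz (y / x))) <= 2 * M * C * rho 3 (1 / x)"
   proof (cases "y < 1")
    case True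
    then show ?thesis using V2z[of y] y M C by simp
   next
    case False
    have "\<bar>riesz (y / x)\<bar> <= C * rho 3 (y / x)" using False x by (intro riesz_rho) auto
    also have "... <= C * rho 3 (1 / x)" using False x C by (intro mult_left_mono rho_antimono divide_right_mono) auto
    finally have "\<bar>V2 y\<bar> * (\<bar>y\<bar> * \<bar>riesz (y / x)\<bar>) <= M * (2 * (C * rho 3 (1 / x)))"
     using M(2)[OF y] M(1) C y by (intro mult_mono) auto
    then show ?thesis by (simp add: abs_mult mult_ac)
   qed
  qed
  then show "\<bar>mobius_sum V x\<bar> <= 4 * M * C * rho 3 (1 / x)" by simp
 qed
qed

lemma mobius_sum_DERIV:
 fixes V V1 :: "real => real"
 assumes V1: "!!u. (V has_real_derivative V1 u) (at u)" and z2: "!!u. u > 2 ==> V u = 0" and x: "x > 0"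
 shows "(mobius_sum V has_real_derivative (mobius_sum (%u. u * V1 u) x / x)) (at x)"
proof -
 have V1z: "V1 u = 0" if "u > 2" for u
  by (rule DERIV_zero_open[OF V1, of "{2<..}"]) (use that z2 in auto)
 obtain K where K: "4 / x <= real K" using real_arch_simple by blast
 have eq: "mobius_sum U y = (\<Sum>k=1..K. mu k / real k * U (real k * y))" if "y \<in> {x/2<..}" "!!u. u > 2 ==> U u = 0" for y U
 proof (rule mobius_sum_eq)
  show "y > 0" using that x by auto
  have "2 / y <= 2 / (x / 2)" using that x by (intro divide_left_mono mult_pos_pos) auto
  then show "2 / y <= real K" using K by simp
 qed (use that in auto)
 have "((%y. \<Sum>k=1..K. mu k / real k * V (real k * y)) has_real_derivative (\<Sum>k=1..K. mu k / real k * (V1 (real k * x) * real k))) (at x)"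
 proof (rule DERIV_sum)
  fix k
  have "((%y. real k * y) has_real_derivative real k) (at x)" by (auto intro!: derivative_eq_intros)
  from DERIV_cmult[OF DERIV_chain2[OF V1 this]]
  show "((%y. mu k / real k * V (real k * y)) has_real_derivative mu k / real k * (V1 (real k * x) * real k)) (at x)" .
 qed
 also have "(\<Sum>k=1..K. mu k / real k * (V1 (real k * x) * real k)) = mobius_sum (%u. u * V1 u) x / x"
 proof -
  have "mobius_sum (%u. u * V1 u) x = (\<Sum>k=1..K. mu k / real k * (real k * x * V1 (real k * x)))"
   by (rule eq) (use x V1z in auto)
  then have "mobius_sum (%u. u * V1 u) x / x = (\<Sum>k=1..K. mu k / real k * (real k * x * V1 (real k * x)) / x)"
   by (simp add: sum_divide_distrib)
  also have "... = (\<Sum>k=1..K. mu k / real k * (V1 (real k * x) * real k))"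
   by (intro sum.cong refl) (use x in simp)
  finally show ?thesis by simp
 qed
 finally show ?thesis
  by (rule has_field_derivative_transform_within_open[of _ _ _ "{x/2<..}"]) (use eq z2 x in auto)
qed

lemma rho_telescope:
 assumes "y > 0" "Z >= 1" "real Z * y >= 1" "Z <= Y"
 shows "(\<Sum>j=Suc Z..Y. rho 3 (real j * y) / real j) <= (rho 2 (real Z * y) - rho 2 (real Y * y)) / 2"
 using assms(4)
proof (induction Y rule: dec_induct)
 case (step Y)
 define a b where "a = 1 + ln (real Y * y)" and "b = 1 + ln (real (Suc Y) * y)"
 have Y0: "real Y >= 1" using step assms by simp
 have "1 <= real Z * y" by fact
 also have "... <= real Y * y" using step assms by (intro mult_right_mono) auto
 finally have Yy: "1 <= real Y * y" .
 moreover have "real Y * y <= real (Suc Y) * y" using assms by (intro mult_right_mono) auto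
 ultimately have SYy: "1 <= real (Suc Y) * y" by linarith
 have a: "a >= 1" using Yy by (simp add: a_def)
 have "b - a = - ln (real Y / real (Suc Y))" using Y0 assms by (simp add: a_def b_def ln_mult ln_div)
 also have "... >= 1 / real (Suc Y)"
  using ln_le_minus_one[of "real Y / real (Suc Y)"] Y0 by (simp add: field_simps)
 finally have ba: "b - a >= 1 / real (Suc Y)" .
 then have ab: "a <= b" "b >= 1" using a by (smt (verit) divide_nonneg_nonneg of_nat_0_le_iff)+
 have "2 / b ^ 3 <= (a + b) / (a ^ 2 * b ^ 2)"
 proof -
  have "2 * (a ^ 2 * b ^ 2) <= (a + b) * b ^ 3"
  proof -
   have "a * a <= b * b" using ab a by (intro mult_mono) auto
   moreover have "a * a <= a * b" using ab a by (intro mult_left_mono) auto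
   ultimately have "2 * (a * a) <= (a + b) * b" unfolding distrib_right by linarith
   then have "(2 * (a * a)) * (b * b) <= ((a + b) * b) * (b * b)" by (intro mult_right_mono) auto
   then show ?thesis by (simp add: eval_nat_numeral mult_ac)
  qed
  then show ?thesis using a ab by (simp add: divide_le_eq le_divide_eq mult_ac)
 qed
 then have "(1 / real (Suc Y)) * (2 / b ^ 3) <= (b - a) * ((a + b) / (a ^ 2 * b ^ 2))"
  using ba ab a by (intro mult_mono) auto
 also have "... = 1 / a ^ 2 - 1 / b ^ 2"
  using a ab by (simp add: field_simps power2_eq_square)
 finally have "rho 3 (real (Suc Y) * y) / real (Suc Y) <= (rho 2 (real Y * y) - rho 2 (real (Suc Y) * y)) / 2"
  using Yy SYy by (simp add: rho_def a_def b_def mult.commute del: of_nat_Suc)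
 then show ?case using step by (simp del: of_nat_Suc add: diff_divide_distrib)
qed simp

definition divisor_sum :: "(real => real) => nat => real => real" where
 "divisor_sum F Y x = (\<Sum>j=1..Y. F (x / real j) / real j)"

lemma divisor_sum_tail:
 assumes F: "!!x. x > 0 ==> \<bar>F x\<bar> <= C * rho 3 (1 / x)" and x: "x > 0" and Z: "Z >= 1" "x <= real Z"
 shows "(\<Sum>j=Suc Z..Y. \<bar>F (x / real j)\<bar> / real j) <= C * rho 2 (real Z / x)"
proof (cases "Z <= Y")
 case True
 have "0 <= C * rho 3 (1 / x)" using F[OF x] by linarith
 then have C0: "C >= 0" using rho_pos[of 3 "1/x"] by (simp add: zero_le_mult_iff)
 have "(\<Sum>j=Suc Z..Y. \<bar>F (x / real j)\<bar> / real j) <= (\<Sum>j=Suc Z..Y. C * (rho 3 (real j * (1 / x)) / real j))"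
 proof (rule sum_mono)
  fix j assume j: "j \<in> {Suc Z..Y}"
  show "\<bar>F (x / real j)\<bar> / real j <= C * (rho 3 (real j * (1 / x)) / real j)"
   using F[of "x / real j"] x j by (simp add: divide_right_mono)
 qed
 also have "... = C * (\<Sum>j=Suc Z..Y. rho 3 (real j * (1 / x)) / real j)" by (simp add: sum_distrib_left)
 also have "... <= C * ((rho 2 (real Z * (1/x)) - rho 2 (real Y * (1/x))) / 2)"
  using x Z True C0 by (intro mult_left_mono rho_telescope) auto
 also have "... <= C * rho 2 (real Z / x)"
  using C0 by (intro mult_left_mono) (auto intro: order_trans[OF _ rho_nonneg])
 finally show ?thesis .
next
 case False
 have "0 <= C * rho 3 (1 / x)" using F[OF x] by linarith
 then have C0: "C >= 0" using rho_pos[of 3 "1/x"] by (simp add: zero_le_mult_iff)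
 then show ?thesis using False by simp
qed

lemma divisor_sum_abs:
 assumes F: "!!x. x > 0 ==> \<bar>F x\<bar> <= C * rho 3 (1 / x)" and z: "!!x. x > 2 ==> F x = 0" and x: "x > 0"
 shows "(\<Sum>j=1..Y. \<bar>F (x / real j)\<bar> / real j) <= 5 * C * rho 2 (1 / x)"
proof -
 have "0 <= C * rho 3 (1 / x)" using F[OF x] by linarith
 then have C0: "C >= 0" using rho_pos[of 3 "1/x"] by (simp add: zero_le_mult_iff)
 define Z where "Z = nat \<lceil>max 1 x\<rceil>"
 have Z: "Z >= 1" "x <= real Z" "real Z <= max 1 x + 1" by (auto simp: Z_def le_nat_iff) linarith+
 have "(\<Sum>j=1..Y. \<bar>F (x / real j)\<bar> / real j) <= (\<Sum>j=1..Z + Y. \<bar>F (x / real j)\<bar> / real j)"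
  by (intro sum_mono2) auto
 also have "{1..Z + Y} = {1..Z} \<union> {Suc Z..Z+Y}" using Z by auto
 also have "(\<Sum>j\<in>{1..Z} \<union> {Suc Z..Z+Y}. \<bar>F (x / real j)\<bar> / real j)
   = (\<Sum>j=1..Z. \<bar>F (x / real j)\<bar> / real j) + (\<Sum>j=Suc Z..Z+Y. \<bar>F (x / real j)\<bar> / real j)"
  by (intro sum.union_disjoint) auto
 also have "(\<Sum>j=Suc Z..Z+Y. \<bar>F (x / real j)\<bar> / real j) <= C * rho 2 (real Z / x)"
  by (rule divisor_sum_tail[OF F x Z(1,2)])
 also have "... <= C * rho 2 (1 / x)"
  using Z x C0 by (intro mult_left_mono rho_antimono divide_right_mono) auto
 also have "(\<Sum>j=1..Z. \<bar>F (x / real j)\<bar> / real j) <= 4 * (C * rho 2 (1 / x))"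
 proof (cases "x <= 1")
  case True
  then have "Z = 1" by (simp add: Z_def)
  then have "(\<Sum>j=1..Z. \<bar>F (x / real j)\<bar> / real j) <= C * rho 3 (1 / x)" using F[OF x] by simp
  also have "... <= C * rho 2 (1/x)" using C0 by (intro mult_left_mono rho_mono_exp) auto
  also have "... <= 4 * (C * rho 2 (1/x))" using C0 by simp
  finally show ?thesis .
 next
  case False
  have "(\<Sum>j=1..Z. \<bar>F (x / real j)\<bar> / real j) <= (\<Sum>j=1..Z. C * (2 / x))"
  proof (rule sum_mono)
   fix j assume j: "j \<in> {1..Z}"
   show "\<bar>F (x / real j)\<bar> / real j <= C * (2 / x)"
   proof (cases "x / real j > 2")
    case True
    then show ?thesis using z C0 x by simp
   next
    case False
    have "\<bar>F (x / real j)\<bar> <= C * rho 3 (1 / (x / real j))" using x j by (intro F) auto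
    also have "... <= C * 1" using C0 rho_le_1 by (intro mult_left_mono) auto
    finally have "\<bar>F (x / real j)\<bar> <= C" by simp
    moreover have "1 / real j <= 2 / x" using False j x by (simp add: field_simps)
    ultimately have "\<bar>F (x / real j)\<bar> * (1 / real j) <= C * (2 / x)" using C0 by (intro mult_mono) auto
    then show ?thesis by simp
   qed
  qed
  also have "... = real Z * (C * (2 / x))" by simp
  also have "... <= (2 * x) * (C * (2 / x))" using Z False C0 by (intro mult_right_mono) auto
  also have "... = 4 * C" using x by simp
  also have "rho 2 (1/x) = 1" using False x by (simp add: rho_def max_def ln_div)
  then have "4 * C = 4 * (C * rho 2 (1 / x))" by simp
  finally show ?thesis .
 qed
 finally show ?thesis by (simp add: algebra_simps)
qed

lemma weight_derivs:
 assumes "weight W"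
 shows "(W has_real_derivative deriv W u) (at u)"
  and "(deriv W has_real_derivative deriv (deriv W) u) (at u)"
  and "(deriv (deriv W) has_real_derivative deriv (deriv (deriv W)) u) (at u)"
  and "continuous_on UNIV (deriv (deriv (deriv W)))"
  and "\<bar>u\<bar> > 2 ==> W u = 0" and "\<bar>u\<bar> < 1 ==> W u = 0" and "integral {0..} W ~= 0"
proof -
 have c: "class_C_on 3 UNIV W" using assms by (simp add: weight_def)
 then have d: "(deriv ^^ j) W differentiable (at x)" if "j < 3" for j x
  using that unfolding class_C_on_def by blast
 show "(W has_real_derivative deriv W u) (at u)" using d[of 0 u] by (simp add: DERIV_deriv_iff_real_differentiable)
 show "(deriv W has_real_derivative deriv (deriv W) u) (at u)" using d[of 1 u] by (simp add: DERIV_deriv_iff_real_differentiable)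
 show "(deriv (deriv W) has_real_derivative deriv (deriv (deriv W)) u) (at u)"
  using d[of 2 u] by (simp add: DERIV_deriv_iff_real_differentiable numeral_2_eq_2)
 show "continuous_on UNIV (deriv (deriv (deriv W)))" using c by (simp add: class_C_on_def numeral_3_eq_3)
 have W0: "W x = 0" if "x \<notin> {-2..-1} \<union> {1..2}" for x using assms that unfolding weight_def by blast
 show "W u = 0" if "\<bar>u\<bar> > 2" by (rule W0) (use that in auto)
 show "W u = 0" if "\<bar>u\<bar> < 1" by (rule W0) (use that in auto)
 show "integral {0..} W ~= 0" using assms by (simp add: weight_def)
qed

abbreviation weight' :: "(real => real) => real => real" where
 "weight' W \<equiv> (%u. u * deriv W u)"

lemma weight_mobius_sum_bounds:
 assumes "weight W"
 obtains C where "C >= 1" "!!x. x > 0 ==> \<bar>mobius_sum W x\<bar> <= C * rho 3 (1 / x)"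
  "!!x. x > 0 ==> \<bar>mobius_sum (weight' W) x\<bar> <= C * rho 3 (1 / x)"
proof -
 note w = weight_derivs[OF assms]
 have c2: "continuous_on UNIV (deriv (deriv W))"
  using DERIV_isCont[OF w(3)] by (auto intro: continuous_at_imp_continuous_on)
 obtain C1 where C1: "C1 > 0" "!!x. x > 0 ==> \<bar>mobius_sum W x\<bar> <= C1 * rho 3 (1 / x)"
  by (rule mobius_sum_bound[OF w(1) w(2) c2]) (use w in auto)
 have z: "deriv W u = 0" if "\<bar>u\<bar> > 2" for u
  by (rule DERIV_zero_open[OF w(1), of "{u. \<bar>u\<bar> > 2}"]) (use that w(5) in \<open>auto intro!: open_Collect_less continuous_intros\<close>)
 have z': "deriv W u = 0" if "\<bar>u\<bar> < 1" for u
  by (rule DERIV_zero_open[OF w(1), of "{u. \<bar>u\<bar> < 1}"]) (use that w(6) in \<open>auto intro!: open_Collect_less continuous_intros\<close>)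
 have d1: "(weight' W has_real_derivative (deriv W u + u * deriv (deriv W) u)) (at u)" for u
  by (auto intro!: derivative_eq_intros w(2) simp: algebra_simps)
 have d2: "((%u. deriv W u + u * deriv (deriv W) u) has_real_derivative (2 * deriv (deriv W) u + u * deriv (deriv (deriv W)) u)) (at u)" for u
  by (auto intro!: derivative_eq_intros w(2) w(3) simp: algebra_simps)
 obtain C2 where C2: "C2 > 0" "!!x. x > 0 ==> \<bar>mobius_sum (weight' W) x\<bar> <= C2 * rho 3 (1 / x)"
  by (rule mobius_sum_bound[OF d1 d2]) (use z z' in \<open>auto intro!: continuous_intros w(4) c2\<close>)
 show ?thesis
 proof (rule that[of "max 1 (max C1 C2)"])
  show "\<bar>mobius_sum W x\<bar> <= max 1 (max C1 C2) * rho 3 (1 / x)" if "x > 0" for x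
   by (rule order_trans[OF C1(2)[OF that]]) (intro mult_right_mono, auto)
  show "\<bar>mobius_sum (weight' W) x\<bar> <= max 1 (max C1 C2) * rho 3 (1 / x)" if "x > 0" for x
   by (rule order_trans[OF C2(2)[OF that]]) (intro mult_right_mono, auto)
 qed auto
qed

text \<open>The value at \<open>0\<close> is set to \<open>0\<close> so that the diagonal of the kernel can be kept in double sums.\<close>
definition gsum :: "(real => real) => nat => real => real" where
 "gsum W Y x = (if x = 0 then 0 else divisor_sum (mobius_sum W) Y x)"

text \<open>The Lipschitz bound comes from the derivative, which is again a Moebius sum, of the function \<open>u W'(u)\<close>; the tail bound follows by comparing the sum over \<open>j\<close> with a telescoping sum.\<close>
lemma weight_gsum_bounds:
 assumes "weight W"
 obtains C where "C >= 1" "!!x. x > 0 ==> \<bar>mobius_sum W x\<bar> <= C * rho 3 (1 / x)"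
  "!!Y x. x > 0 ==> \<bar>gsum W Y x\<bar> <= C * rho 2 (1 / x)"
  "!!Y x. \<bar>gsum W Y x\<bar> <= C"
  "!!Y x y. x > 0 ==> y > 0 ==> \<bar>gsum W Y x - gsum W Y y\<bar> <= C * \<bar>x - y\<bar> / min x y"
  "!!Y Z x. x > 0 ==> Z >= 1 ==> x <= real Z ==> Z <= Y ==> \<bar>gsum W Y x - gsum W Z x\<bar> <= C * rho 2 (real Z / x)"
proof -
 obtain C where C: "C >= 1" "!!x. x > 0 ==> \<bar>mobius_sum W x\<bar> <= C * rho 3 (1 / x)"
  "!!x. x > 0 ==> \<bar>mobius_sum (weight' W) x\<bar> <= C * rho 3 (1 / x)"
  using weight_mobius_sum_bounds[OF assms] by blast
 note w = weight_derivs[OF assms]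
 have z2: "W u = 0" if "u > 2" for u using w(5)[of u] that by simp
 have B: "\<bar>divisor_sum (mobius_sum V) Y x\<bar> <= 5 * C * rho 2 (1 / x)"
  if "!!x. x > 0 ==> \<bar>mobius_sum V x\<bar> <= C * rho 3 (1 / x)" "x > 0" for V Y x
 proof -
  have "\<bar>divisor_sum (mobius_sum V) Y x\<bar> <= (\<Sum>j=1..Y. \<bar>mobius_sum V (x / real j) / real j\<bar>)" unfolding divisor_sum_def by (rule sum_abs)
  also have "... = (\<Sum>j=1..Y. \<bar>mobius_sum V (x / real j)\<bar> / real j)" by simp
  also have "... <= 5 * C * rho 2 (1 / x)" by (rule divisor_sum_abs) (use that mobius_sum_zero in auto)
  finally show ?thesis .
 qed
 have D: "(divisor_sum (mobius_sum W) Y has_real_derivative (divisor_sum (mobius_sum (weight' W)) Y x / x)) (at x)" if x: "x > 0" for Y x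
 proof -
  have "((%x. \<Sum>j=1..Y. mobius_sum W (x / real j) / real j) has_real_derivative
    (\<Sum>j=1..Y. (mobius_sum (weight' W) (x / real j) / (x / real j) * (1 / real j)) / real j)) (at x)"
  proof (rule DERIV_sum)
   fix j assume j: "j \<in> {1..Y}"
   have a: "(mobius_sum W has_real_derivative (mobius_sum (weight' W) (x / real j) / (x / real j))) (at (x / real j))"
   proof (rule mobius_sum_DERIV[OF w(1) z2])
    show "x / real j > 0" using x j by simp
   qed
   have b: "((%x. x / real j) has_real_derivative 1 / real j) (at x)" by (rule DERIV_cdivide) (rule DERIV_ident)
   show "((%x. mobius_sum W (x / real j) / real j) has_real_derivative
     (mobius_sum (weight' W) (x / real j) / (x / real j) * (1 / real j)) / real j) (at x)"
    by (rule DERIV_cdivide[OF DERIV_chain2[OF a b]])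
  qed
  also have "(\<Sum>j=1..Y. (mobius_sum (weight' W) (x / real j) / (x / real j) * (1 / real j)) / real j) = divisor_sum (mobius_sum (weight' W)) Y x / x"
   unfolding divisor_sum_def sum_divide_distrib
  proof (intro sum.cong refl)
   fix j assume "j \<in> {1..Y}"
   then have "real j > 0" by simp
   then show "(mobius_sum (weight' W) (x / real j) / (x / real j) * (1 / real j)) / real j = mobius_sum (weight' W) (x / real j) / real j / x"
    using x by (simp add: field_simps)
  qed
  finally show ?thesis unfolding divisor_sum_def .
 qed
 have L: "\<bar>gsum W Y x - gsum W Y y\<bar> <= 5 * C * \<bar>x - y\<bar> / min x y" if xy: "x > 0" "y > 0" for Y x y
 proof -
  have *: "\<bar>gsum W Y x - gsum W Y y\<bar> <= 5 * C * \<bar>x - y\<bar> / min x y" if lt: "0 < x" "x < y" for x y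
  proof -
   obtain z where z: "z > x" "z < y" "divisor_sum (mobius_sum W) Y y - divisor_sum (mobius_sum W) Y x = (y - x) * (divisor_sum (mobius_sum (weight' W)) Y z / z)"
    using MVT2[OF lt(2), of "divisor_sum (mobius_sum W) Y" "%z. divisor_sum (mobius_sum (weight' W)) Y z / z"] D lt(1) by auto
   have "\<bar>divisor_sum (mobius_sum (weight' W)) Y z\<bar> <= 5 * C * rho 2 (1 / z)" using B[OF C(3)] z that by simp
   also have "... <= 5 * C * 1" using C(1) rho_le_1 by (intro mult_left_mono) auto
   finally have "\<bar>divisor_sum (mobius_sum (weight' W)) Y z\<bar> / z <= 5 * C / x" using z that C(1) by (intro frac_le) auto
   then have "\<bar>y - x\<bar> * (\<bar>divisor_sum (mobius_sum (weight' W)) Y z\<bar> / z) <= \<bar>y - x\<bar> * (5 * C / x)" by (intro mult_left_mono) auto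
   moreover have "\<bar>gsum W Y x - gsum W Y y\<bar> = \<bar>y - x\<bar> * (\<bar>divisor_sum (mobius_sum (weight' W)) Y z\<bar> / z)"
    using z that unfolding gsum_def by (simp add: abs_mult abs_minus_commute[of "divisor_sum (mobius_sum W) Y x"])
   ultimately show ?thesis using that by (simp add: mult_ac abs_minus_commute)
  qed
  consider "x < y" | "y < x" | "x = y" by linarith
  then show ?thesis using *[of x y] *[of y x] xy by cases (auto simp: abs_minus_commute min.commute)
 qed
 have G: "\<bar>gsum W Y x\<bar> <= 5 * C * rho 2 (1 / x)" if "x > 0" for Y x
  using B[OF C(2) that] that by (simp add: gsum_def)
 have pos: "(if x < 0 then x else x) = x" for x :: real by simp
 have neg: "gsum W Y x = 0" if "x < 0" for Y x
 proof -
  have "mobius_sum W (x / real j) = 0" for j using that by (simp add: mobius_sum_def divide_nonneg_neg floor_le_iff divide_less_0_iff)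
  then show ?thesis by (simp add: gsum_def divisor_sum_def)
 qed
 have G1: "\<bar>gsum W Y x\<bar> <= 5 * C" for Y x
 proof (cases "x > 0")
  case True
  have "5 * C * rho 2 (1 / x) <= 5 * C * 1" using C(1) rho_le_1 by (intro mult_left_mono) auto
  then show ?thesis using G[OF True, of Y] by simp
 next
  case False
  then have "gsum W Y x = 0" using neg[of x Y] by (cases "x = 0") (auto simp: gsum_def)
  then show ?thesis using C(1) by simp
 qed
 have T: "\<bar>gsum W Y x - gsum W Z x\<bar> <= C * rho 2 (real Z / x)" if "x > 0" "Z >= 1" "x <= real Z" "Z <= Y" for Y Z x
 proof -
  have "{1..Y} = {1..Z} \<union> {Suc Z..Y}" using that by auto
  then have "divisor_sum (mobius_sum W) Y x = divisor_sum (mobius_sum W) Z x + (\<Sum>j=Suc Z..Y. mobius_sum W (x / real j) / real j)"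
   unfolding divisor_sum_def by (simp add: sum.union_disjoint)
  then have "\<bar>gsum W Y x - gsum W Z x\<bar> <= (\<Sum>j=Suc Z..Y. \<bar>mobius_sum W (x / real j) / real j\<bar>)"
   using that by (simp add: gsum_def del: abs_divide)
  also have "... = (\<Sum>j=Suc Z..Y. \<bar>mobius_sum W (x / real j)\<bar> / real j)" by simp
  also have "... <= C * rho 2 (real Z / x)" by (rule divisor_sum_tail[OF C(2)]) (use that in auto)
  finally show ?thesis .
 qed
 show ?thesis
 proof (rule that[of "5 * C"])
  show "5 * C >= 1" using C(1) by simp
  show "\<bar>mobius_sum W x\<bar> <= 5 * C * rho 3 (1 / x)" if "x > 0" for x
   by (rule order_trans[OF C(2)[OF that]]) (use C(1) in \<open>auto intro!: mult_right_mono\<close>)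
  show "\<bar>gsum W Y x - gsum W Z x\<bar> <= 5 * C * rho 2 (real Z / x)" if "x > 0" "Z >= 1" "x <= real Z" "Z <= Y" for Y Z x
   by (rule order_trans[OF T[OF that]]) (use C(1) in \<open>auto intro!: mult_right_mono\<close>)
 qed (use G G1 L in auto)
qed

section \<open>The sieve sum as a quadratic form\<close>

lemma add_char_add: "add_char (x + y) = add_char x * add_char y"
 by (simp add: add_char_def algebra_simps exp_add)

lemma norm_add_char [simp]: "cmod (add_char x) = 1"
 by (simp add: add_char_def)

lemma cnj_add_char: "cnj (add_char x) = add_char (- x)"
 by (simp add: add_char_def exp_cnj)

lemma add_char_0 [simp]: "add_char 0 = 1"
 by (simp add: add_char_def)

lemma add_char_eq_1_iff: "add_char x = 1 \<longleftrightarrow> x \<in> \<int>"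
proof -
 have "add_char x = 1 \<longleftrightarrow> (\<exists>n::int. 2 * pi * x = of_int (2 * n) * pi)"
  by (simp add: add_char_def exp_eq_1)
 also have "... \<longleftrightarrow> (\<exists>n::int. x = of_int n)"
 proof -
  have "2 * pi * x = of_int (2 * n) * pi \<longleftrightarrow> x = of_int n" for n :: int by auto
  then show ?thesis by (simp only:)
 qed
 also have "... \<longleftrightarrow> x \<in> \<int>" by (auto simp: Ints_def)
 finally show ?thesis .
qed

lemma add_char_power: "add_char (real k * x) = add_char x ^ k"
 by (simp add: add_char_def exp_of_nat_mult[symmetric] algebra_simps)

lemma of_int_div_Ints_iff: "n > 0 ==> of_int h / real n \<in> \<int> \<longleftrightarrow> int n dvd h"
proof
 assume n: "n > 0" and "of_int h / real n \<in> \<int>"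
 then obtain k :: int where "of_int h / real n = of_int k" by (auto simp: Ints_def)
 then have "real_of_int h = of_int (k * int n)" using n by (simp add: field_simps)
 then have "h = k * int n" by (simp only: of_int_eq_iff)
 then show "int n dvd h" by simp
next
 assume n: "n > 0" and "int n dvd h"
 then obtain k where "h = int n * k" by blast
 then have "of_int h / real n = of_int k" using n by simp
 then show "of_int h / real n \<in> \<int>" by simp
qed

lemma sum_geometric_root:
 fixes z :: complex
 assumes "z ~= 1" "z ^ n = 1"
 shows "(\<Sum>a=1..n. z ^ a) = 0"
proof -
 have "(\<Sum>a=1..n. z ^ a) = z * (\<Sum>a<n. z ^ a)"
  unfolding sum_distrib_left by (rule sum.reindex_bij_witness[of _ "%a. Suc a" "%a. a - 1"]) (auto simp flip: power_Suc)
 also have "(\<Sum>a<n. z ^ a) = 0" using assms by (simp add: geometric_sum)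
 finally show ?thesis by simp
qed

lemma sum_add_char_complete:
 assumes "l > 0"
 shows "(\<Sum>a=1..l. add_char (of_int h * real a / real l)) = (if int l dvd h then of_nat l else 0)"
proof -
 define z where "z = add_char (of_int h / real l)"
 have e: "add_char (of_int h * real a / real l) = z ^ a" for a
  unfolding z_def add_char_power[symmetric] by (simp add: mult_ac)
 show ?thesis
 proof (cases "int l dvd h")
  case True
  then have "z = 1" unfolding z_def add_char_eq_1_iff of_int_div_Ints_iff[OF assms] .
  then show ?thesis using True by (simp add: e)
 next
  case False
  then have "z ~= 1" unfolding z_def add_char_eq_1_iff of_int_div_Ints_iff[OF assms] .
  moreover have "z ^ l = 1" unfolding e[symmetric] using assms by (simp add: add_char_eq_1_iff)
  ultimately show ?thesis using False sum_geometric_root by (simp add: e)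
 qed
qed

definition ramanujan :: "nat => int => complex" where
 "ramanujan q h = (\<Sum>a\<in>totatives q. add_char (of_int h * real a / real q))"

text \<open>The fractions \<open>b/l\<close> in lowest terms are exactly the fractions \<open>a/q\<close> with \<open>q dvd l\<close>.\<close>
lemma sum_ramanujan_dvd:
 assumes "l > 0"
 shows "(\<Sum>q | q dvd l. ramanujan q h) = (if int l dvd h then of_nat l else 0)"
proof -
 let ?g = "%a. add_char (of_int h * real a / real l)"
 have "(\<Sum>a=1..l. ?g a) = (\<Sum>d | d dvd l. \<Sum>a\<in>{a\<in>{0<..l}. gcd a l = d}. ?g a)"
  using assms by (subst sum.group) (auto simp: finite_divisors_nat atLeastSucAtMost_greaterThanAtMost)
 also have "... = (\<Sum>d | d dvd l. ramanujan (l div d) h)"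
 proof (intro sum.cong refl)
  fix d assume "d \<in> {d. d dvd l}"
  then obtain q where "l = d * q" by (auto elim: dvdE)
  then have q: "l = q * d" by (simp add: mult.commute)
  then have d0: "d > 0" using assms by auto
  have "bij_betw (%k. k * d) (totatives q) {k\<in>{0<..q * d}. gcd k (q * d) = d}"
   using d0 assms q bij_betw_totatives_gcd_eq[of d "q * d"] by simp
  then have "(\<Sum>a\<in>{a\<in>{0<..l}. gcd a l = d}. ?g a) = (\<Sum>k\<in>totatives q. ?g (k * d))"
   unfolding q by (rule sum.reindex_bij_betw[symmetric])
  also have "... = ramanujan q h" unfolding ramanujan_def q using d0 by (intro sum.cong) (auto simp: field_simps)
  also have "q = l div d" using q d0 by simp
  finally show "(\<Sum>a\<in>{a\<in>{0<..l}. gcd a l = d}. ?g a) = ramanujan (l div d) h" .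
 qed
 also have "... = (\<Sum>q | q dvd l. ramanujan q h)"
  by (rule sum.reindex_bij_witness[of _ "%q. l div q" "%d. l div d"]) (use assms in \<open>auto elim!: dvdE\<close>)
 finally show ?thesis using sum_add_char_complete[OF assms, of h] by simp
qed

lemma nat_le_of_mult_le:
 assumes "0 < a"
 shows "a * b <= T ==> (b::nat) <= T" "b * a <= T ==> b <= T"
proof -
 have "1 * b <= a * b" using assms by (intro mult_le_mono1) simp
 then have "b <= a * b" by (simp only: mult_1)
 then show "a * b <= T ==> b <= T" "b * a <= T ==> b <= T" by (metis le_trans mult.commute)+
qed

lemma sum_swap3: "(\<Sum>a\<in>A. \<Sum>m\<in>B. \<Sum>n\<in>C. f a m n) = (\<Sum>m\<in>B. \<Sum>n\<in>C. \<Sum>a\<in>A. f a m n)"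
 by (subst sum.swap) (rule sum.cong[OF refl], rule sum.swap)

lemma sum_dvd_swap:
 fixes H :: "nat => nat => 'a :: comm_monoid_add"
 shows "(\<Sum>l=1..L. \<Sum>q | q dvd l. H q l) = (\<Sum>q=1..L. \<Sum>j=1..L div q. H q (q * j))"
proof -
 have "(\<Sum>l=1..L. \<Sum>q | q dvd l. H q l) = (\<Sum>(l, q)\<in>Sigma {1..L} (%l. {q. q dvd l}). H q l)"
  by (intro sum.Sigma) (auto simp: finite_divisors_nat)
 also have "... = (\<Sum>(q, j)\<in>Sigma {1..L} (%q. {1..L div q}). H q (q * j))"
  by (rule sum.reindex_bij_witness[of _ "%(q, j). (q * j, q)" "%(l, q). (q, l div q)"])
    (auto simp: less_eq_div_iff_mult_less_eq mult.commute Suc_le_eq elim!: dvdE intro: nat_le_of_mult_le)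
 also have "... = (\<Sum>q=1..L. \<Sum>j=1..L div q. H q (q * j))"
  by (intro sum.Sigma[symmetric]) auto
 finally show ?thesis .
qed

lemma sum_hyperbola_swap:
 fixes H :: "nat => nat => 'a :: comm_monoid_add"
 shows "(\<Sum>m=1..T. \<Sum>k=1..T div m. H m k) = (\<Sum>k=1..T. \<Sum>m=1..T div k. H m k)"
proof -
 have "(\<Sum>m=1..T. \<Sum>k=1..T div m. H m k) = (\<Sum>(m, k)\<in>Sigma {1..T} (%m. {1..T div m}). H m k)"
  by (intro sum.Sigma) auto
 also have "... = (\<Sum>(k, m)\<in>Sigma {1..T} (%m. {1..T div m}). H m k)"
  by (rule sum.reindex_bij_witness[of _ "%(k, m). (m, k)" "%(m, k). (k, m)"])
    (auto simp: less_eq_div_iff_mult_less_eq mult.commute Suc_le_eq intro: nat_le_of_mult_le)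
 also have "... = (\<Sum>k=1..T. \<Sum>m=1..T div k. H m k)"
  by (intro sum.Sigma[symmetric]) auto
 finally show ?thesis .
qed

lemma mobius_inversion_sum:
 fixes r w :: "nat => complex"
 shows "(\<Sum>d=1..M. (\<Sum>e | e dvd d. r e) * (\<Sum>k=1..M div d. of_real (mu k) * w (d * k))) = (\<Sum>e=1..M. r e * w e)"
proof -
 have "(\<Sum>d=1..M. (\<Sum>e | e dvd d. r e) * (\<Sum>k=1..M div d. of_real (mu k) * w (d * k)))
   = (\<Sum>e=1..M. \<Sum>m=1..M div e. r e * (\<Sum>k=1..M div (e * m). of_real (mu k) * w (e * m * k)))"
  unfolding sum_distrib_right by (rule sum_dvd_swap)
 also have "... = (\<Sum>e=1..M. r e * w e)"
 proof (intro sum.cong refl)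
  fix e assume e: "e \<in> {1..M}"
  have "(\<Sum>m=1..M div e. r e * (\<Sum>k=1..M div (e * m). of_real (mu k) * w (e * m * k)))
    = r e * (\<Sum>m=1..M div e. \<Sum>k=1..(M div e) div m. of_real (mu k) * w (e * (k * m)))"
   unfolding sum_distrib_left div_mult2_eq by (intro sum.cong refl) (simp add: mult_ac)
  also have "(\<Sum>m=1..M div e. \<Sum>k=1..(M div e) div m. of_real (mu k) * w (e * (k * m)))
    = (\<Sum>k=1..M div e. \<Sum>m=1..(M div e) div k. of_real (mu k) * w (e * (k * m)))"
   by (rule sum_hyperbola_swap)
  also have "... = (\<Sum>n=1..M div e. \<Sum>k | k dvd n. of_real (mu k) * w (e * n))"
   by (rule sum_dvd_swap[symmetric])
  also have "... = (\<Sum>n=1..M div e. if n = 1 then w e else 0)"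
  proof (intro sum.cong refl)
   fix n assume n: "n \<in> {1..M div e}"
   have "(\<Sum>k | k dvd n. of_real (mu k) * w (e * n)) = of_real (\<Sum>k | k dvd n. mu k) * w (e * n)"
    by (simp add: sum_distrib_right)
   also have "(\<Sum>k | k dvd n. mu k) = of_bool (n = 1)" using n by (intro sum_mu_dvd) auto
   finally show "(\<Sum>k | k dvd n. of_real (mu k) * w (e * n)) = (if n = 1 then w e else 0)" by simp
  qed
  also have "... = w e"
  proof -
   have "1 \<in> {1..M div e}" using e by (simp add: less_eq_div_iff_mult_less_eq Suc_le_eq div_greater_zero_iff)
   then show ?thesis by (subst sum.delta) auto
  qed
  finally show "(\<Sum>m=1..M div e. r e * (\<Sum>k=1..M div (e * m). of_real (mu k) * w (e * m * k))) = r e * w e" .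
 qed
 finally show ?thesis .
qed

text \<open>Moebius inversion of the complete sums over the divisors.\<close>
lemma ramanujan_weighted_sum:
 assumes Q: "Q > 0" and M: "M = nat \<lfloor>2 * Q\<rfloor>"
 shows "(\<Sum>q=1..M. of_real (W (real q / Q) / real q) * ramanujan q h)
   = of_real (\<Sum>d=1..M. if int d dvd h then mobius_sum W (real d / Q) else 0)"
proof -
 have "(\<Sum>q=1..M. of_real (W (real q / Q) / real q) * ramanujan q h)
   = (\<Sum>d=1..M. (\<Sum>e | e dvd d. ramanujan e h) * (\<Sum>k=1..M div d. of_real (mu k) * of_real (W (real (d * k) / Q) / real (d * k))))"
  by (subst mobius_inversion_sum) (simp add: mult.commute)
 also have "... = (\<Sum>d=1..M. of_real (if int d dvd h then mobius_sum W (real d / Q) else 0))"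
 proof (intro sum.cong refl)
  fix d assume "d \<in> {1..M}"
  then have d: "d > 0" by simp
  have "nat \<lfloor>2 / (real d / Q)\<rfloor> = M div d"
  proof -
   have "\<lfloor>2 / (real d / Q)\<rfloor> = \<lfloor>(2 * Q) / real_of_int (int d)\<rfloor>" by simp
   also have "... = \<lfloor>2 * Q\<rfloor> div int d" by (rule floor_divide_real_eq_div) simp
   finally show ?thesis using Q by (simp add: M nat_div_distrib)
  qed
  then have "mobius_sum W (real d / Q) = (\<Sum>k=1..M div d. mu k / real k * W (real k * (real d / Q)))"
   by (simp add: mobius_sum_def)
  also have "... = real d * (\<Sum>k=1..M div d. mu k * (W (real (d * k) / Q) / real (d * k)))"
   unfolding sum_distrib_left using d by (intro sum.cong) (auto simp: mult_ac)
  finally have "complex_of_real (mobius_sum W (real d / Q)) = of_nat d * (\<Sum>k=1..M div d. of_real (mu k) * of_real (W (real (d * k) / Q) / real (d * k)))"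
   by simp
  then show "(\<Sum>e | e dvd d. ramanujan e h) * (\<Sum>k=1..M div d. of_real (mu k) * of_real (W (real (d * k) / Q) / real (d * k)))
    = of_real (if int d dvd h then mobius_sum W (real d / Q) else 0)"
   unfolding sum_ramanujan_dvd[OF d] by simp
 qed
 finally show ?thesis by simp
qed

text \<open>The symmetry \<open>d \<mapsto> h/d\<close> of the divisors; the restriction \<open>d \<le> 2 Q\<close> is harmless since the Moebius sum vanishes beyond \<open>2\<close>.\<close>
lemma divisor_reflect:
 assumes h: "h > 0" and Q: "Q > 0" and M: "M = nat \<lfloor>2 * Q\<rfloor>"
 shows "(\<Sum>d=1..M. if d dvd h then mobius_sum W (real d / Q) else 0)
   = (\<Sum>l | l dvd h. mobius_sum W (real h / (real l * Q)))"
proof -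
 have "(\<Sum>d=1..M. if d dvd h then mobius_sum W (real d / Q) else 0) = (\<Sum>d\<in>{d\<in>{1..M}. d dvd h}. mobius_sum W (real d / Q))"
  by (rule sum.inter_filter[symmetric]) simp
 also have "... = (\<Sum>d | d dvd h. mobius_sum W (real d / Q))"
 proof (rule sum.mono_neutral_left)
  show "\<forall>i\<in>{d. d dvd h} - {d \<in> {1..M}. d dvd h}. mobius_sum W (real i / Q) = 0"
  proof
   fix i assume i: "i \<in> {d. d dvd h} - {d \<in> {1..M}. d dvd h}"
   then have "i > 0" using h by (auto intro: Nat.gr0I)
   then have "M < i" using i by auto
   then have "\<lfloor>2 * Q\<rfloor> < int i" by (simp add: M)
   then have "2 * Q < real i" by (simp add: floor_less_iff)
   then show "mobius_sum W (real i / Q) = 0" using Q by (intro mobius_sum_zero) (simp add: field_simps)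
  qed
 qed (use h in \<open>auto simp: finite_divisors_nat\<close>)
 also have "... = (\<Sum>l | l dvd h. mobius_sum W (real h / (real l * Q)))"
  by (rule sum.reindex_bij_witness[of _ "%l. h div l" "%d. h div d"]) (use h in \<open>auto elim!: dvdE\<close>)
 finally show ?thesis .
qed

text \<open>The reverse expansion of small divisors into characters. Only moduli up to \<open>L\<close> occur, each with a truncated divisor sum as weight.\<close>
lemma head_ramanujan_expansion:
 shows "of_real (\<Sum>l=1..L. if int l dvd h then mobius_sum W (x / (real l * Q)) else 0)
  = (\<Sum>q=1..L. ramanujan q h * of_real (divisor_sum (mobius_sum W) (L div q) (x / (real q * Q)) / real q))"
proof -
 have "of_real (\<Sum>l=1..L. if int l dvd h then mobius_sum W (x / (real l * Q)) else 0)
   = (\<Sum>l=1..L. \<Sum>q | q dvd l. ramanujan q h * of_real (mobius_sum W (x / (real l * Q)) / real l))"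
  unfolding of_real_sum
 proof (intro sum.cong refl)
  fix l assume "l \<in> {1..L}"
  then have l: "l > 0" by simp
  then show "of_real (if int l dvd h then mobius_sum W (x / (real l * Q)) else 0)
    = (\<Sum>q | q dvd l. ramanujan q h * of_real (mobius_sum W (x / (real l * Q)) / real l))"
   unfolding sum_distrib_right[symmetric] sum_ramanujan_dvd[OF l] by simp
 qed
 also have "... = (\<Sum>q=1..L. \<Sum>j=1..L div q. ramanujan q h * of_real (mobius_sum W (x / (real (q * j) * Q)) / real (q * j)))"
  by (rule sum_dvd_swap)
 also have "... = (\<Sum>q=1..L. ramanujan q h * of_real (divisor_sum (mobius_sum W) (L div q) (x / (real q * Q)) / real q))"
 proof (intro sum.cong refl)
  fix q
  have "divisor_sum (mobius_sum W) (L div q) (x / (real q * Q)) / real q = (\<Sum>j=1..L div q. mobius_sum W (x / (real (q * j) * Q)) / real (q * j))"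
   unfolding divisor_sum_def sum_divide_distrib by (intro sum.cong) (auto simp: mult_ac)
  then show "(\<Sum>j=1..L div q. ramanujan q h * of_real (mobius_sum W (x / (real (q * j) * Q)) / real (q * j)))
    = ramanujan q h * of_real (divisor_sum (mobius_sum W) (L div q) (x / (real q * Q)) / real q)"
   by (simp add: sum_distrib_left)
 qed
 finally show ?thesis .
qed

lemma infsum_weight_finite:
 fixes g :: "nat => real"
 assumes W: "!!u. u > 2 ==> W u = 0" and Q: "Q > 0" and M: "M = nat \<lfloor>2 * Q\<rfloor>"
  and g: "!!q. W (real q / Q) = 0 ==> g q = 0"
 shows "(\<Sum>\<^sub>\<infinity>q\<in>{1..}. g q) = (\<Sum>q=1..M. g q)"
proof -
 have "(\<Sum>\<^sub>\<infinity>q\<in>{1..}. g q) = (\<Sum>\<^sub>\<infinity>q\<in>{1..M}. g q)"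
 proof (rule infsum_cong_neutral)
  fix q assume "q \<in> {1..} - {1..M}"
  then have "\<lfloor>2 * Q\<rfloor> < int q" by (auto simp: M)
  then have "2 * Q < real q" by (simp add: floor_less_iff)
  then show "g q = 0" using Q by (intro g W) (simp add: field_simps)
 qed auto
 then show ?thesis by simp
qed

definition kernel :: "(real => real) => real => int => real" where
 "kernel W Q h = (\<Sum>l | l dvd nat \<bar>h\<bar>. mobius_sum W (real (nat \<bar>h\<bar>) / (real l * Q)))"

lemma I0_finite:
 assumes W: "!!u. u > 2 ==> W u = 0" and Q: "Q > 0"
 shows "I0 W Q = (\<Sum>q=1..nat \<lfloor>2 * Q\<rfloor>. real (totient q) * W (real q / Q) / (real q * Q))"
 unfolding I0_def by (rule infsum_weight_finite[OF W Q refl]) auto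

lemma cmod_trig_sum_sq:
 "of_real ((cmod (trig_sum N \<phi> x))\<^sup>2) = (\<Sum>m=1..N. \<Sum>n=1..N. \<phi> m * cnj (\<phi> n) * add_char (of_int (int m - int n) * x))"
proof -
 have "of_real ((cmod (trig_sum N \<phi> x))\<^sup>2) = trig_sum N \<phi> x * cnj (trig_sum N \<phi> x)" by (rule complex_norm_square)
 also have "... = (\<Sum>m=1..N. \<Sum>n=1..N. (\<phi> m * add_char (real m * x)) * cnj (\<phi> n * add_char (real n * x)))"
  unfolding trig_sum_def cnj_sum sum_product ..
 also have "... = (\<Sum>m=1..N. \<Sum>n=1..N. \<phi> m * cnj (\<phi> n) * add_char (of_int (int m - int n) * x))"
 proof (intro sum.cong refl)
  fix m n
  have "add_char (of_int (int m - int n) * x) = add_char (real m * x) * add_char (- (real n * x))"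
   by (simp add: left_diff_distrib flip: add_char_add)
  then show "(\<phi> m * add_char (real m * x)) * cnj (\<phi> n * add_char (real n * x)) = \<phi> m * cnj (\<phi> n) * add_char (of_int (int m - int n) * x)"
   by (simp add: cnj_add_char)
 qed
 finally show ?thesis .
qed

lemma sieve_sum_quadratic_form:
 assumes W: "!!u. u > 2 ==> W u = 0" and Q: "Q > 0" and I0: "I0 W Q ~= 0"
 shows "of_real (sieve_sum W N Q \<phi>) = of_real (sq_norm N \<phi>)
   + (\<Sum>m=1..N. \<Sum>n\<in>{1..N} - {m}. \<phi> m * cnj (\<phi> n) * of_real (kernel W Q (int m - int n) / (Q * I0 W Q)))"
proof -
 define M where "M = nat \<lfloor>2 * Q\<rfloor>"
 define c where "c = 1 / (Q * I0 W Q)"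
 have fin: "sieve_sum W N Q \<phi> = (\<Sum>q=1..M. W (real q / Q) / (real q * Q * I0 W Q) * (\<Sum>a\<in>totatives q. (cmod (trig_sum N \<phi> (real a / real q)))\<^sup>2))"
  unfolding sieve_sum_def by (rule infsum_weight_finite[OF W Q M_def]) auto
 have "complex_of_real (sieve_sum W N Q \<phi>) = (\<Sum>q=1..M. of_real (W (real q / Q) / (real q * Q * I0 W Q)) * (\<Sum>a\<in>totatives q. \<Sum>m=1..N. \<Sum>n=1..N. \<phi> m * cnj (\<phi> n) * add_char (of_int (int m - int n) * (real a / real q))))"
  by (simp only: fin of_real_sum of_real_mult cmod_trig_sum_sq)
 also have "... = (\<Sum>m=1..N. \<Sum>n=1..N. \<phi> m * cnj (\<phi> n) * (of_real c * (\<Sum>q=1..M. of_real (W (real q / Q) / real q) * ramanujan q (int m - int n))))"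
 proof -
  have "(\<Sum>a\<in>totatives q. \<Sum>m=1..N. \<Sum>n=1..N. \<phi> m * cnj (\<phi> n) * add_char (of_int (int m - int n) * (real a / real q)))
    = (\<Sum>m=1..N. \<Sum>n=1..N. \<phi> m * cnj (\<phi> n) * ramanujan q (int m - int n))" for q
   unfolding ramanujan_def sum_distrib_left by (rule trans[OF sum_swap3]) (intro sum.cong refl, simp)
  moreover have "complex_of_real (W (real q / Q) / (real q * Q * I0 W Q)) = of_real c * of_real (W (real q / Q) / real q)" for q
   by (simp add: c_def)
  ultimately have "(\<Sum>q=1..M. of_real (W (real q / Q) / (real q * Q * I0 W Q)) * (\<Sum>a\<in>totatives q. \<Sum>m=1..N. \<Sum>n=1..N. \<phi> m * cnj (\<phi> n) * add_char (of_int (int m - int n) * (real a / real q))))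
   = (\<Sum>q=1..M. \<Sum>m=1..N. \<Sum>n=1..N. \<phi> m * cnj (\<phi> n) * (of_real c * (of_real (W (real q / Q) / real q) * ramanujan q (int m - int n))))"
   by (simp only: sum_distrib_left mult_ac)
  also have "... = (\<Sum>m=1..N. \<Sum>n=1..N. \<Sum>q=1..M. \<phi> m * cnj (\<phi> n) * (of_real c * (of_real (W (real q / Q) / real q) * ramanujan q (int m - int n))))"
   by (rule sum_swap3)
  finally show ?thesis by (simp only: sum_distrib_left)
 qed
 also have "... = (\<Sum>m=1..N. \<phi> m * cnj (\<phi> m) + (\<Sum>n\<in>{1..N} - {m}. \<phi> m * cnj (\<phi> n) * of_real (kernel W Q (int m - int n) / (Q * I0 W Q))))"
 proof (intro sum.cong refl)
  fix m assume m: "m \<in> {1..N}"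
  let ?T = "%n. \<phi> m * cnj (\<phi> n) * (of_real c * (\<Sum>q=1..M. of_real (W (real q / Q) / real q) * ramanujan q (int m - int n)))"
  have "(\<Sum>n=1..N. ?T n) = ?T m + (\<Sum>n\<in>{1..N} - {m}. ?T n)" using m by (intro sum.remove) auto
  moreover have "?T m = \<phi> m * cnj (\<phi> m)"
  proof -
   have "(\<Sum>q=1..M. of_real (W (real q / Q) / real q) * ramanujan q (int m - int m)) = complex_of_real (Q * I0 W Q)"
   proof -
    have "Q * I0 W Q = (\<Sum>q=1..M. W (real q / Q) / real q * real (totient q))"
     unfolding M_def using Q by (subst I0_finite[OF W Q]) (auto simp: sum_distrib_left intro!: sum.cong)
    then show ?thesis by (simp add: ramanujan_def totient_def)
   qed
   then show ?thesis using Q I0 by (simp add: c_def)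
  qed
  moreover have "?T n = \<phi> m * cnj (\<phi> n) * of_real (kernel W Q (int m - int n) / (Q * I0 W Q))" if n: "n \<in> {1..N} - {m}" for n
  proof -
   define h where "h = nat \<bar>int m - int n\<bar>"
   have h: "h > 0" using n by (auto simp: h_def)
   have "(\<Sum>q=1..M. of_real (W (real q / Q) / real q) * ramanujan q (int m - int n)) = complex_of_real (\<Sum>d=1..M. if int d dvd (int m - int n) then mobius_sum W (real d / Q) else 0)"
    by (rule ramanujan_weighted_sum[OF Q M_def])
   also have "int d dvd (int m - int n) \<longleftrightarrow> d dvd h" for d unfolding h_def by (simp add: nat_dvd_iff flip: int_dvd_int_iff)
   then have "(\<Sum>d=1..M. if int d dvd (int m - int n) then mobius_sum W (real d / Q) else 0) = (\<Sum>d=1..M. if d dvd h then mobius_sum W (real d / Q) else 0)" by simp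
   also have "... = kernel W Q (int m - int n)" using divisor_reflect[OF h Q M_def, of W] unfolding kernel_def h_def .
   finally show ?thesis by (simp add: c_def)
  qed
  ultimately show "(\<Sum>n=1..N. ?T n) = \<phi> m * cnj (\<phi> m) + (\<Sum>n\<in>{1..N} - {m}. \<phi> m * cnj (\<phi> n) * of_real (kernel W Q (int m - int n) / (Q * I0 W Q)))"
   by simp
 qed
 also have "... = of_real (sq_norm N \<phi>) + (\<Sum>m=1..N. \<Sum>n\<in>{1..N} - {m}. \<phi> m * cnj (\<phi> n) * of_real (kernel W Q (int m - int n) / (Q * I0 W Q)))"
  by (simp only: sum.distrib sq_norm_def of_real_sum complex_norm_square)
 finally show ?thesis .
qed

section \<open>Size of the normalising constant\<close>

lemma riemann_sum_lipschitz:
 fixes g :: "real => real"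
 assumes lip: "!!x y. \<bar>g x - g y\<bar> <= B * \<bar>x - y\<bar>" and cont: "continuous_on UNIV g" and h: "h >= 0"
 shows "\<bar>(\<Sum>d=1..n. h * g (real d * h)) - integral {0..real n * h} g\<bar> <= real n * (B * h\<^sup>2)"
proof (induction n)
 case (Suc n)
 have int: "g integrable_on {a..b}" for a b by (intro integrable_continuous_real continuous_on_subset[OF cont]) auto
 let ?a = "real n * h" and ?b = "real (Suc n) * h"
 have ab: "0 <= ?a" "?a <= ?b" "?b - ?a = h" using h by (auto simp: algebra_simps)
 have "integral {0..?b} g = integral {0..?a} g + integral {?a..?b} g"
  using ab int by (intro Henstock_Kurzweil_Integration.integral_combine[symmetric]) auto
 moreover have "\<bar>h * g ?b - integral {?a..?b} g\<bar> <= B * h\<^sup>2"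
 proof -
  have i: "((%x. g ?b - g x) has_integral (h * g ?b - integral {?a..?b} g)) {?a..?b}"
   using has_integral_diff[OF has_integral_const_real[of "g ?b" ?a ?b] integrable_integral[OF int[of ?a ?b]]] ab h by simp
  have "norm (h * g ?b - integral {?a..?b} g) <= (B * h) * measure lborel {?a..?b}"
  proof (rule has_integral_bound_real[OF _ finite.emptyI i])
   have B: "0 <= B" using order_trans[OF abs_ge_zero lip[of 1 0]] by simp
   then show "0 <= B * h" using h by simp
   fix x assume "x \<in> {?a..?b} - {}"
   then have "\<bar>?b - x\<bar> <= h" using ab by auto
   then have "B * \<bar>?b - x\<bar> <= B * h" using B by (intro mult_left_mono) auto
   then show "norm (g ?b - g x) <= B * h" using lip[of ?b x] by simp
  qed
  then show ?thesis using ab h by (simp add: power2_eq_square)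
 qed
 ultimately have "\<bar>(\<Sum>d=1..Suc n. h * g (real d * h)) - integral {0..?b} g\<bar> <= real n * (B * h\<^sup>2) + B * h\<^sup>2"
  using Suc.IH by simp
 then show ?case by (simp add: algebra_simps)
qed simp

lemma weight_lipschitz:
 assumes "weight W"
 obtains B where "B >= 1" "!!x y. \<bar>W x - W y\<bar> <= B * \<bar>x - y\<bar>" "!!x. \<bar>W x\<bar> <= B"
proof -
 note w = weight_derivs[OF assms]
 have cont: "continuous_on {-2..2} (deriv W)" "continuous_on {-2..2} W"
  using DERIV_isCont[OF w(2)] DERIV_isCont[OF w(1)] by (auto intro: continuous_at_imp_continuous_on)
 have "bounded (deriv W ` {-2..2})" "bounded (W ` {-2..2})"
  using cont by (auto intro!: compact_imp_bounded compact_continuous_image)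
 then obtain B1 B2 where B: "!!x. x \<in> {-2..2} ==> \<bar>deriv W x\<bar> <= B1" "!!x. x \<in> {-2..2} ==> \<bar>W x\<bar> <= B2"
  unfolding bounded_iff by fastforce
 define B where "B = max 1 (max B1 B2)"
 have z: "deriv W u = 0" if "\<bar>u\<bar> > 2" for u
  by (rule DERIV_zero_open[OF w(1), of "{u. \<bar>u\<bar> > 2}"]) (use that w(5) in \<open>auto intro!: open_Collect_less continuous_intros\<close>)
 have dB: "\<bar>deriv W x\<bar> <= B" for x
  using B(1)[of x] z[of x] by (cases "\<bar>x\<bar> <= 2") (auto simp: B_def abs_le_iff)
 have WB: "\<bar>W x\<bar> <= B" for x
  using B(2)[of x] w(5)[of x] by (cases "\<bar>x\<bar> <= 2") (auto simp: B_def abs_le_iff)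
 have "norm (W x - W y) <= B * norm (x - y)" for x y
  by (rule field_differentiable_bound[of UNIV W "deriv W"]) (use w(1) dB in auto)
 then show ?thesis using that[of B] WB by (auto simp: B_def)
qed

lemma harmonic_le: "(\<Sum>k=1..n. 1 / real k) <= 1 + ln (real (max 1 n))"
proof (induction n)
 case (Suc n)
 show ?case
 proof (cases "n = 0")
  case False
  have "ln (real n / real (Suc n)) <= real n / real (Suc n) - 1" using False by (intro ln_le_minus_one) auto
  then have "1 / real (Suc n) <= ln (real (Suc n)) - ln (real n)" using False by (simp add: ln_div field_simps)
  then show ?thesis using Suc False by (simp add: max_def split: if_splits)
 qed simp
qed simp

lemma sum_mu_sq_lower: "(\<Sum>k=1..n. mu k / (real k)\<^sup>2) >= 1/4" if "n >= 1"
proof -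
 have tail: "(\<Sum>k=3..n. 1 / (real k)\<^sup>2) <= 1/2 - 1 / real (max 2 n)" for n
 proof (induction n)
  case (Suc n)
  show ?case
  proof (cases "n >= 2")
   case True
   then have "(\<Sum>k=3..Suc n. 1 / (real k)\<^sup>2) = (\<Sum>k=3..n. 1 / (real k)\<^sup>2) + 1 / (real (Suc n))\<^sup>2" by simp
   moreover have "1 / (real (Suc n))\<^sup>2 <= 1 / real n - 1 / real (Suc n)"
   proof -
    have "1 / real n - 1 / real (Suc n) = 1 / (real n * real (Suc n))" using True by (simp add: field_simps)
    moreover have "1 / (real (Suc n))\<^sup>2 <= 1 / (real n * real (Suc n))"
     unfolding power2_eq_square using True by (intro divide_left_mono mult_right_mono) auto
    ultimately show ?thesis by simp
   qed
   ultimately show ?thesis using Suc True by (simp add: max_def)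
  qed (simp add: max_def)
 qed simp
 have s: "(\<Sum>k=2..n. 1 / (real k)\<^sup>2) <= 3/4"
 proof (cases "n >= 2")
  case True
  then have "{2..n} = insert 2 {3..n}" by auto
  then have "(\<Sum>k=2..n. 1 / (real k)\<^sup>2) = 1/4 + (\<Sum>k=3..n. 1 / (real k)\<^sup>2)" by simp
  also have "(\<Sum>k=3..n. 1 / (real k)\<^sup>2) <= 1/2" by (rule order_trans[OF tail]) simp
  finally show ?thesis by simp
 qed simp
 have "{1..n} = insert 1 {2..n}" using that by auto
 then have "(\<Sum>k=1..n. mu k / (real k)\<^sup>2) = 1 + (\<Sum>k=2..n. mu k / (real k)\<^sup>2)" by simp
 moreover have "\<bar>\<Sum>k=2..n. mu k / (real k)\<^sup>2\<bar> <= (\<Sum>k=2..n. 1 / (real k)\<^sup>2)"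
  by (rule sum_abs[THEN order_trans]) (auto intro!: sum_mono divide_right_mono abs_mu_le)
 ultimately show ?thesis using s by linarith
qed

text \<open>As \<open>Q\<close> grows, \<open>I0 W Q\<close> approaches a nonzero multiple of the integral of \<open>W\<close>: expand \<open>\<phi>(q)/q\<close> by divisors and compare Riemann sums with the integral.\<close>
lemma I0_bounds:
 assumes "weight W"
 obtains Q0 c C where "Q0 >= 1" "c > 0" "C > 0" "!!Q. Q >= Q0 ==> c <= \<bar>I0 W Q\<bar> & \<bar>I0 W Q\<bar> <= C"
proof -
 note w = weight_derivs[OF assms]
 obtain B where B: "B >= 1" "!!x y. \<bar>W x - W y\<bar> <= B * \<bar>x - y\<bar>" "!!x. \<bar>W x\<bar> <= B"
  using weight_lipschitz[OF assms] by blast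
 have W2: "W u = 0" if "u > 2" for u using w(5) that by simp
 have W2': "W u = 0" if "u >= 2" for u
  using that W2 cont_zero_limit_right[OF DERIV_isCont[OF w(1)] W2] by (cases "u = 2") auto
 have contW: "continuous_on S W" for S
  using DERIV_isCont[OF w(1)] by (auto intro: continuous_at_imp_continuous_on)
 define A where "A = integral {0..2} W"
 have iA: "integral {0..b} W = A" if "b >= 2" for b
 proof -
  have "integral {0..b} W = integral {0..2} W + integral {2..b} W"
   using that by (intro Henstock_Kurzweil_Integration.integral_combine[symmetric] integrable_continuous_real contW) auto
  moreover have "integral {2..b} W = integral {2..b} (%_. 0)" by (intro integral_cong) (use W2' in auto)
  ultimately show ?thesis by (simp add: A_def)
 qed
 have A: "A ~= 0"
 proof -
  have "integral {0..2} W = integral {0..} W"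
  proof -
   have "(%x. if x \<in> {0..2} then W x else 0) = (%x. if x \<in> {0..} then W x else 0)"
    using W2 by (auto simp: fun_eq_iff)
   then show ?thesis using integral_restrict_UNIV[of "{0..2}" W] integral_restrict_UNIV[of "{0..}" W] by simp
  qed
  then show ?thesis using w(7) by (simp add: A_def)
 qed
 have main: "\<bar>I0 W Q - A * (\<Sum>k=1..nat \<lfloor>2 * Q\<rfloor>. mu k / (real k)\<^sup>2)\<bar> <= 4 * B * (1 + ln (2 * Q)) / Q" if Q: "Q >= 1" for Q
 proof -
  define M where "M = nat \<lfloor>2 * Q\<rfloor>"
  have M: "M >= 1" "real M <= 2 * Q" using Q by (auto simp: M_def le_nat_floor intro!: of_nat_floor)
  have Qp: "Q > 0" using Q by simp
  have "of_real (Q * I0 W Q) = (\<Sum>q=1..M. of_real (W (real q / Q) / real q) * ramanujan q 0)"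
  proof -
   have "Q * I0 W Q = (\<Sum>q=1..M. W (real q / Q) / real q * real (totient q))"
    unfolding M_def using Q by (subst I0_finite[OF W2 Qp]) (auto simp: sum_distrib_left intro!: sum.cong)
   then show ?thesis by (simp add: ramanujan_def totient_def)
  qed
  also have "... = of_real (\<Sum>d=1..M. mobius_sum W (real d / Q))"
   using ramanujan_weighted_sum[OF Qp M_def, of W 0] by simp
  finally have QI: "Q * I0 W Q = (\<Sum>d=1..M. mobius_sum W (real d / Q))" by (simp only: of_real_eq_iff)
  also have "... = (\<Sum>d=1..M. \<Sum>k=1..M div d. mu k / real k * W (real k * (real d / Q)))"
  proof (intro sum.cong refl)
   fix d assume d: "d \<in> {1..M}"
   have "\<lfloor>2 / (real d / Q)\<rfloor> = \<lfloor>(2 * Q) / real_of_int (int d)\<rfloor>" by simp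
   also have "... = \<lfloor>2 * Q\<rfloor> div int d" by (rule floor_divide_real_eq_div) simp
   finally have "nat \<lfloor>2 / (real d / Q)\<rfloor> = M div d" using Q by (simp add: M_def nat_div_distrib)
   then show "mobius_sum W (real d / Q) = (\<Sum>k=1..M div d. mu k / real k * W (real k * (real d / Q)))" by (simp add: mobius_sum_def)
  qed
  also have "... = (\<Sum>k=1..M. \<Sum>d=1..M div k. mu k / real k * W (real k * (real d / Q)))" by (rule sum_hyperbola_swap)
  also have "... = (\<Sum>k=1..M. Q * (mu k / (real k)\<^sup>2) * (\<Sum>d=1..M div k. (real k / Q) * W (real d * (real k / Q))))"
   unfolding sum_distrib_left using Q by (intro sum.cong refl) (auto simp: power2_eq_square mult_ac)
  finally have "Q * I0 W Q = Q * (\<Sum>k=1..M. (mu k / (real k)\<^sup>2) * (\<Sum>d=1..M div k. (real k / Q) * W (real d * (real k / Q))))"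
   unfolding sum_distrib_left[of Q] by (simp only: mult.assoc)
  then have I: "I0 W Q = (\<Sum>k=1..M. (mu k / (real k)\<^sup>2) * (\<Sum>d=1..M div k. (real k / Q) * W (real d * (real k / Q))))"
   by (rule iffD1[OF mult_left_cancel, rotated]) (use Qp in simp)
  have est: "\<bar>(\<Sum>d=1..M div k. (real k / Q) * W (real d * (real k / Q))) - A\<bar> <= 4 * B * (real k / Q)" if k: "k \<in> {1..M}" for k
  proof -
   let ?h = "real k / Q" and ?n = "Suc (M div k)"
   have k0: "k > 0" using k by simp
   have n1: "2 <= real ?n * ?h"
   proof -
    have "M < k * Suc (M div k)"
     using mult_div_mod_eq[of k M] mod_less_divisor[OF k0, of M] unfolding mult_Suc_right by linarith
    then have "M + 1 <= ?n * k" by (simp add: mult.commute)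
    then have "real M + 1 <= real ?n * real k" by (metis of_nat_1 of_nat_add of_nat_le_iff of_nat_mult)
    moreover have "2 * Q < real M + 1" using Q unfolding M_def by linarith
    ultimately show ?thesis using Q by (simp add: field_simps del: of_nat_Suc)
   qed
   have n2: "real ?n * ?h <= 4"
   proof -
    have "(M div k) * k <= M" by simp
    then have "real (M div k) * real k <= real M" by (metis of_nat_le_iff of_nat_mult)
    then have "real (M div k) * ?h <= 2" using M Q by (simp add: field_simps)
    moreover have "?h <= 2" using k M Q by (simp add: field_simps)
    ultimately show ?thesis unfolding of_nat_Suc distrib_right mult_1 by linarith
   qed
   have "\<bar>(\<Sum>d=1..?n. ?h * W (real d * ?h)) - integral {0..real ?n * ?h} W\<bar> <= real ?n * (B * ?h\<^sup>2)"
    by (rule riemann_sum_lipschitz) (use B contW Q in auto)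
   moreover have "(\<Sum>d=1..?n. ?h * W (real d * ?h)) = (\<Sum>d=1..M div k. ?h * W (real d * ?h))"
    using W2'[OF n1] by simp
   moreover have "real ?n * (B * ?h\<^sup>2) <= 4 * B * ?h"
   proof -
    have "(real ?n * ?h) * (B * ?h) <= 4 * (B * ?h)" using n2 B Q by (intro mult_right_mono) auto
    then show ?thesis by (simp add: power2_eq_square mult_ac)
   qed
   ultimately show ?thesis unfolding iA[OF n1] by linarith
  qed
  have "I0 W Q - A * (\<Sum>k=1..M. mu k / (real k)\<^sup>2) = (\<Sum>k=1..M. (mu k / (real k)\<^sup>2) * ((\<Sum>d=1..M div k. (real k / Q) * W (real d * (real k / Q))) - A))"
   unfolding I by (simp add: sum_distrib_left right_diff_distrib sum_subtractf mult_ac)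
  also have "\<bar>...\<bar> <= (\<Sum>k=1..M. (4 * B / Q) * (1 / real k))"
  proof (rule sum_abs[THEN order_trans], rule sum_mono)
   fix k assume k: "k \<in> {1..M}"
   have "\<bar>mu k / (real k)\<^sup>2\<bar> * \<bar>(\<Sum>d=1..M div k. (real k / Q) * W (real d * (real k / Q))) - A\<bar> <= (1 / (real k)\<^sup>2) * (4 * B * (real k / Q))"
    using est[OF k] abs_mu_le[of k] by (intro mult_mono) (auto simp: divide_right_mono)
   also have "... = (4 * B / Q) * (1 / real k)" using k Q by (simp add: power2_eq_square)
   finally show "\<bar>mu k / (real k)\<^sup>2 * ((\<Sum>d=1..M div k. (real k / Q) * W (real d * (real k / Q))) - A)\<bar> <= (4 * B / Q) * (1 / real k)"
    by (simp add: abs_mult)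
  qed
  also have "... = (4 * B / Q) * (\<Sum>k=1..M. 1 / real k)" by (simp add: sum_distrib_left)
  also have "... <= (4 * B / Q) * (1 + ln (2 * Q))"
  proof (rule mult_left_mono)
   have "ln (real (max 1 M)) <= ln (2 * Q)" using M Q by (simp add: max_def)
   then show "(\<Sum>k=1..M. 1 / real k) <= 1 + ln (2 * Q)" using harmonic_le[of M] by linarith
  qed (use B Q in auto)
  finally show ?thesis by (simp add: M_def)
 qed
 have "((%Q. 4 * B * (1 + ln (2 * Q)) / Q) \<longlongrightarrow> 0) at_top" by real_asymp
 then have "eventually (%Q. 4 * B * (1 + ln (2 * Q)) / Q < \<bar>A\<bar> / 8) at_top" by (rule order_tendstoD) (use A in simp)
 then obtain Q1 where Q1: "!!Q. Q >= Q1 ==> 4 * B * (1 + ln (2 * Q)) / Q < \<bar>A\<bar> / 8" unfolding eventually_at_top_linorder by blast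
 show ?thesis
 proof (rule that[of "max 1 Q1" "\<bar>A\<bar> / 8" "2 * B + 1"])
  fix Q assume "Q >= max 1 Q1"
  then have Q: "Q >= 1" "Q >= Q1" by auto
  let ?S = "\<Sum>k=1..nat \<lfloor>2 * Q\<rfloor>. mu k / (real k)\<^sup>2"
  have "?S >= 1/4" by (rule sum_mu_sq_lower) (use Q in \<open>simp add: le_nat_floor\<close>)
  then have "\<bar>A\<bar> * (1/4) <= \<bar>A\<bar> * \<bar>?S\<bar>" by (intro mult_left_mono) auto
  then have "\<bar>A\<bar> / 4 <= \<bar>A * ?S\<bar>" by (simp add: abs_mult)
  then have lo: "\<bar>A\<bar> / 8 <= \<bar>I0 W Q\<bar>" using main[OF Q(1)] Q1[OF Q(2)] by linarith
  have "\<bar>I0 W Q\<bar> <= (\<Sum>q=1..nat \<lfloor>2 * Q\<rfloor>. B / Q)"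
  proof (subst I0_finite[OF W2], assumption, use Q in simp, rule sum_abs[THEN order_trans], rule sum_mono)
   fix q assume q: "q \<in> {1..nat \<lfloor>2 * Q\<rfloor>}"
   have "\<bar>real (totient q) * W (real q / Q) / (real q * Q)\<bar> = (real (totient q) / real q) * (\<bar>W (real q / Q)\<bar> / Q)"
    using Q by (simp add: abs_mult)
   also have "... <= 1 * (B / Q)" using q Q B totient_le[of q] by (intro mult_mono divide_right_mono) auto
   finally show "\<bar>real (totient q) * W (real q / Q) / (real q * Q)\<bar> <= B / Q" by simp
  qed
  also have "... = real (nat \<lfloor>2 * Q\<rfloor>) * (B / Q)" by simp
  also have "... <= (2 * Q) * (B / Q)" using Q B by (intro mult_right_mono of_nat_floor) auto
  also have "... <= 2 * B + 1" using Q by simp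
  finally show "\<bar>A\<bar> / 8 <= \<bar>I0 W Q\<bar> & \<bar>I0 W Q\<bar> <= 2 * B + 1" using lo by simp
 qed (use A B in auto)
qed

section \<open>Hilbert-Schmidt operators and exponential sums\<close>

lemma bessel_finite:
 fixes v :: "nat => complex"
 assumes fin: "finite B" and norm1: "!!u. u \<in> B ==> (\<Sum>n=1..N. u n * cnj (u n)) = 1"
  and orth: "!!u w. u \<in> B ==> w \<in> B ==> u ~= w ==> (\<Sum>n=1..N. u n * cnj (w n)) = 0"
 shows "(\<Sum>u\<in>B. (cmod (\<Sum>n=1..N. v n * cnj (u n)))\<^sup>2) <= (\<Sum>n=1..N. (cmod (v n))\<^sup>2)"
proof -
 define d where "d = (%u. \<Sum>n=1..N. v n * cnj (u n))"
 define P where "P = (%n. \<Sum>u\<in>B. d u * u n)"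
 have vP: "(\<Sum>n=1..N. v n * cnj (P n)) = (\<Sum>u\<in>B. d u * cnj (d u))"
 proof -
  have "(\<Sum>n=1..N. v n * cnj (P n)) = (\<Sum>n=1..N. \<Sum>u\<in>B. cnj (d u) * (v n * cnj (u n)))"
   by (simp add: P_def sum_distrib_left mult_ac)
  also have "... = (\<Sum>u\<in>B. cnj (d u) * d u)"
   by (subst sum.swap) (simp add: d_def sum_distrib_left)
  finally show ?thesis by (simp add: mult.commute)
 qed
 have PP: "(\<Sum>n=1..N. P n * cnj (P n)) = (\<Sum>u\<in>B. d u * cnj (d u))"
 proof -
  have "(\<Sum>n=1..N. P n * cnj (P n)) = (\<Sum>n=1..N. \<Sum>u\<in>B. \<Sum>w\<in>B. d u * cnj (d w) * (u n * cnj (w n)))"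
   by (simp add: P_def sum_product mult_ac)
  also have "... = (\<Sum>u\<in>B. \<Sum>w\<in>B. \<Sum>n=1..N. d u * cnj (d w) * (u n * cnj (w n)))" by (rule sum_swap3)
  also have "... = (\<Sum>u\<in>B. \<Sum>w\<in>B. if w = u then d u * cnj (d u) else 0)"
  proof (intro sum.cong refl)
   fix u w assume "u \<in> B" "w \<in> B"
   then show "(\<Sum>n=1..N. d u * cnj (d w) * (u n * cnj (w n))) = (if w = u then d u * cnj (d u) else 0)"
    using norm1[of u] orth[of u w] by (auto simp flip: sum_distrib_left)
  qed
  also have "... = (\<Sum>u\<in>B. d u * cnj (d u))" using fin by simp
  finally show ?thesis .
 qed
 have "(\<Sum>n=1..N. P n * cnj (v n)) = cnj (\<Sum>n=1..N. v n * cnj (P n))" by (simp add: mult.commute)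
 also have "... = (\<Sum>u\<in>B. d u * cnj (d u))" unfolding vP by (simp add: mult.commute)
 finally have Pv: "(\<Sum>n=1..N. P n * cnj (v n)) = (\<Sum>u\<in>B. d u * cnj (d u))" .
 have "complex_of_real (\<Sum>n=1..N. (cmod (v n - P n))\<^sup>2) = (\<Sum>n=1..N. (v n - P n) * cnj (v n - P n))"
  by (simp only: of_real_sum complex_norm_square)
 also have "... = (\<Sum>n=1..N. v n * cnj (v n)) - (\<Sum>n=1..N. v n * cnj (P n)) - ((\<Sum>n=1..N. P n * cnj (v n)) - (\<Sum>n=1..N. P n * cnj (P n)))"
  by (simp add: algebra_simps sum.distrib sum_subtractf)
 also have "... = (\<Sum>n=1..N. v n * cnj (v n)) - (\<Sum>u\<in>B. d u * cnj (d u))" by (simp only: vP PP Pv) simp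
 also have "... = complex_of_real ((\<Sum>n=1..N. (cmod (v n))\<^sup>2) - (\<Sum>u\<in>B. (cmod (d u))\<^sup>2))"
  by (simp only: of_real_diff of_real_sum complex_norm_square)
 finally have "(\<Sum>n=1..N. (cmod (v n - P n))\<^sup>2) = (\<Sum>n=1..N. (cmod (v n))\<^sup>2) - (\<Sum>u\<in>B. (cmod (d u))\<^sup>2)" by (simp only: of_real_eq_iff)
 moreover have "0 <= (\<Sum>n=1..N. (cmod (v n - P n))\<^sup>2)" by (intro sum_nonneg) auto
 ultimately show ?thesis by (simp add: d_def)
qed

lemma herm_eq_0_iff: "N >= 1 ==> herm N \<phi> \<psi> = 0 \<longleftrightarrow> (\<Sum>n=1..N. \<phi> n * cnj (\<psi> n)) = 0"
 by (simp add: herm_def)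

text \<open>Choose a maximal orthonormal family on which the operator has size above \<open>\<epsilon>\<close> greedily: by Bessel's inequality its cardinality is at most \<open>H/\<epsilon>^2\<close>, and orthogonally to it the operator is small.\<close>
lemma hilbert_schmidt_subspace:
 fixes S :: "nat => nat => complex"
 assumes N: "N >= 1" and e: "\<epsilon> > 0" and H: "(\<Sum>m=1..N. \<Sum>n=1..N. (cmod (S m n))\<^sup>2) <= H"
 obtains B where "finite B" "B \<subseteq> seq_space N" "real (card B) <= H / \<epsilon>\<^sup>2"
  "!!\<phi>. \<phi> \<in> seq_space N ==> (\<forall>\<psi>\<in>B. herm N \<phi> \<psi> = 0) ==>
    (\<Sum>m=1..N. (cmod (\<Sum>n=1..N. S m n * \<phi> n))\<^sup>2) <= \<epsilon>\<^sup>2 * sq_norm N \<phi>"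
proof -
 define op where "op = (%u. \<Sum>m=1..N. (cmod (\<Sum>n=1..N. S m n * u n))\<^sup>2)"
 define ON where "ON = (%B. finite B & B \<subseteq> seq_space N & (\<forall>u\<in>B. (\<Sum>n=1..N. u n * cnj (u n)) = 1) \<and>
   (\<forall>u\<in>B. \<forall>w\<in>B. u ~= w --> (\<Sum>n=1..N. u n * cnj (w n)) = 0) & (\<forall>u\<in>B. op u > \<epsilon>\<^sup>2))"
 have bound: "real (card B) * \<epsilon>\<^sup>2 <= H" if "ON B" for B
 proof -
  have B: "finite B" "!!u. u \<in> B ==> (\<Sum>n=1..N. u n * cnj (u n)) = 1"
   "!!u w. u \<in> B ==> w \<in> B ==> u ~= w ==> (\<Sum>n=1..N. u n * cnj (w n)) = 0"
   "!!u. u \<in> B ==> \<epsilon>\<^sup>2 <= op u" using that by (auto simp: ON_def less_imp_le)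
  have "real (card B) * \<epsilon>\<^sup>2 <= (\<Sum>u\<in>B. op u)" using sum_mono[of B "%_. \<epsilon>\<^sup>2" op] B(4) by simp
  also have "... = (\<Sum>m=1..N. \<Sum>u\<in>B. (cmod (\<Sum>n=1..N. cnj (S m n) * cnj (u n)))\<^sup>2)"
  proof -
   have "cmod (\<Sum>n=1..N. cnj (S m n) * cnj (u n)) = cmod (\<Sum>n=1..N. S m n * u n)" for m u
    by (subst complex_mod_cnj[symmetric]) simp
   then show ?thesis unfolding op_def by (subst sum.swap) simp
  qed
  also have "... <= (\<Sum>m=1..N. \<Sum>n=1..N. (cmod (cnj (S m n)))\<^sup>2)"
   by (intro sum_mono bessel_finite B(1-3))
  also have "... <= H" using H by simp
  finally show ?thesis .
 qed
 have "ON {}" by (simp add: ON_def)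
 moreover have "card B <= nat \<lfloor>H / \<epsilon>\<^sup>2\<rfloor>" if "ON B" for B
 proof -
  have "real (card B) <= H / \<epsilon>\<^sup>2" using bound[OF that] e by (simp add: pos_le_divide_eq)
  then show ?thesis by (simp add: le_nat_floor)
 qed
 ultimately obtain B where B: "ON B" "!!B'. ON B' ==> card B' <= card B"
  using ex_has_greatest_nat[of ON "{}" card "Suc (nat \<lfloor>H / \<epsilon>\<^sup>2\<rfloor>)"] by (metis le_imp_less_Suc)
 show ?thesis
 proof (rule that[of B])
  show "finite B" "B \<subseteq> seq_space N" using B(1) by (auto simp: ON_def)
  show "real (card B) <= H / \<epsilon>\<^sup>2" using bound[OF B(1)] e by (simp add: pos_le_divide_eq)
  fix \<phi> assume p: "\<phi> \<in> seq_space N" "\<forall>\<psi>\<in>B. herm N \<phi> \<psi> = 0"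
  show "(\<Sum>m=1..N. (cmod (\<Sum>n=1..N. S m n * \<phi> n))\<^sup>2) <= \<epsilon>\<^sup>2 * sq_norm N \<phi>"
  proof (rule ccontr)
   assume "\<not> ?thesis"
   then have big: "op \<phi> > \<epsilon>\<^sup>2 * sq_norm N \<phi>" by (simp add: op_def)
   define s where "s = sqrt (sq_norm N \<phi>)"
   have sn0: "sq_norm N \<phi> >= 0" by (auto simp: sq_norm_def intro: sum_nonneg)
   have "sq_norm N \<phi> ~= 0"
   proof
    assume z: "sq_norm N \<phi> = 0"
    then have "\<forall>n\<in>{1..N}. (cmod (\<phi> n))\<^sup>2 = 0" unfolding sq_norm_def by (subst (asm) sum_nonneg_eq_0_iff) auto
    then have "op \<phi> = 0" by (simp add: op_def)
    then show False using big z by simp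
   qed
   then have s: "s > 0" "s\<^sup>2 = sq_norm N \<phi>" using sn0 by (auto simp: s_def)
   define u where "u = (%n. \<phi> n / of_real s)"
   have us: "u \<in> seq_space N" using p by (auto simp: u_def seq_space_def)
   have phi2: "(\<Sum>n=1..N. \<phi> n * cnj (\<phi> n)) = of_real (s\<^sup>2)"
    unfolding s(2) sq_norm_def by (simp only: of_real_sum complex_norm_square)
   have u1: "(\<Sum>n=1..N. u n * cnj (u n)) = 1"
   proof -
    have "(\<Sum>n=1..N. u n * cnj (u n)) = (\<Sum>n=1..N. \<phi> n * cnj (\<phi> n)) / of_real (s\<^sup>2)"
     by (simp add: u_def sum_divide_distrib power2_eq_square)
    then show ?thesis unfolding phi2 using s(1) by simp
   qed
   have uo: "(\<Sum>n=1..N. u n * cnj (w n)) = 0" if "w \<in> B" for w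
   proof -
    have "(\<Sum>n=1..N. u n * cnj (w n)) = (\<Sum>n=1..N. \<phi> n * cnj (w n)) / of_real s"
     by (simp add: u_def sum_divide_distrib)
    then show ?thesis using p(2) that herm_eq_0_iff[OF N] by simp
   qed
   have uo': "(\<Sum>n=1..N. w n * cnj (u n)) = 0" if "w \<in> B" for w
   proof -
    have "(\<Sum>n=1..N. w n * cnj (u n)) = cnj (\<Sum>n=1..N. u n * cnj (w n))" by (simp add: mult.commute)
    then show ?thesis unfolding uo[OF that] by simp
   qed
   have nB: "u \<notin> B" using u1 uo by force
   have opu: "op u > \<epsilon>\<^sup>2"
   proof -
    have "(cmod (\<Sum>n=1..N. S m n * u n))\<^sup>2 = (cmod (\<Sum>n=1..N. S m n * \<phi> n))\<^sup>2 / s\<^sup>2" for m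
    proof -
     have "(\<Sum>n=1..N. S m n * u n) = (\<Sum>n=1..N. S m n * \<phi> n) / of_real s" by (simp add: u_def sum_divide_distrib)
     then show ?thesis using s by (simp add: norm_divide power_divide)
    qed
    then have "op u = op \<phi> / s\<^sup>2" by (simp add: op_def sum_divide_distrib)
    moreover have "0 < s\<^sup>2" using s(1) by simp
    ultimately show ?thesis using big unfolding s(2) by (simp add: pos_less_divide_eq)
   qed
   have "ON (insert u B)"
    using B(1) us u1 uo uo' opu unfolding ON_def by auto
   then have "card (insert u B) <= card B" by (rule B(2))
   then show False using nB B(1) by (simp add: ON_def)
  qed
 qed
qed

lemma quadratic_form_le:
 assumes "(\<Sum>m=1..N. (cmod (\<Sum>n=1..N. S m n * \<phi> n))\<^sup>2) <= \<epsilon>\<^sup>2 * sq_norm N \<phi>" "\<epsilon> > 0"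
 shows "cmod (\<Sum>m=1..N. \<Sum>n=1..N. \<phi> n * cnj (\<phi> m) * S m n) <= \<epsilon> * sq_norm N \<phi>"
proof -
 have sn0: "sq_norm N \<phi> >= 0" by (auto simp: sq_norm_def intro: sum_nonneg)
 define T where "T = (%m. \<Sum>n=1..N. S m n * \<phi> n)"
 have "(\<Sum>m=1..N. \<Sum>n=1..N. \<phi> n * cnj (\<phi> m) * S m n) = (\<Sum>m=1..N. cnj (\<phi> m) * T m)"
  by (simp add: T_def sum_distrib_left mult_ac)
 then have "cmod (\<Sum>m=1..N. \<Sum>n=1..N. \<phi> n * cnj (\<phi> m) * S m n) <= (\<Sum>m=1..N. cmod (\<phi> m) * cmod (T m))"
  by (simp add: norm_mult sum_norm_le)
 also have "... <= sqrt ((\<epsilon> * sq_norm N \<phi>)\<^sup>2)"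
 proof (rule real_le_rsqrt)
  have "(\<Sum>m=1..N. cmod (\<phi> m) * cmod (T m))\<^sup>2 <= (\<Sum>m=1..N. (cmod (\<phi> m))\<^sup>2) * (\<Sum>m=1..N. (cmod (T m))\<^sup>2)"
   by (rule Cauchy_Schwarz_ineq_sum)
  also have "... <= sq_norm N \<phi> * (\<epsilon>\<^sup>2 * sq_norm N \<phi>)"
   using assms sn0 by (simp add: sq_norm_def T_def mult_left_mono)
  finally show "(\<Sum>m=1..N. cmod (\<phi> m) * cmod (T m))\<^sup>2 <= (\<epsilon> * sq_norm N \<phi>)\<^sup>2"
   by (simp add: power2_eq_square mult_ac)
 qed
 also have "... = \<epsilon> * sq_norm N \<phi>" using assms sn0 by simp
 finally show ?thesis .
qed

lemma root_of_unity_gap: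
 fixes z :: complex
 assumes "z ~= 1" "z ^ M = 1" "cmod z = 1" "M > 0"
 shows "1 / cmod (1 - z) <= real M"
proof -
 have g: "(\<Sum>k<M. z ^ k) = 0" using assms by (simp add: geometric_sum)
 have le: "cmod (1 - z ^ k) <= real k * cmod (1 - z)" for k
 proof (induction k)
  case (Suc k)
  have eq: "1 - z ^ Suc k = (1 - z) + z * (1 - z ^ k)" by (simp add: algebra_simps)
  have "cmod (z * (1 - z ^ k)) = cmod (1 - z ^ k)" unfolding norm_mult assms(3) by simp
  then have "cmod (1 - z ^ Suc k) <= cmod (1 - z) + cmod (1 - z ^ k)"
   unfolding eq using norm_triangle_ineq[of "1 - z" "z * (1 - z ^ k)"] by linarith
  moreover have "real (Suc k) * cmod (1 - z) = real k * cmod (1 - z) + cmod (1 - z)" by (simp add: algebra_simps)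
  ultimately show ?case using Suc.IH by linarith
 qed simp
 have "real M = cmod (\<Sum>k<M. 1 - z ^ k)" using g by (simp add: sum_subtractf)
 also have "... <= (\<Sum>k<M. real M * cmod (1 - z))"
  by (rule sum_norm_le) (rule order_trans[OF le], auto intro!: mult_right_mono)
 also have "... = real M * (real M * cmod (1 - z))" by simp
 finally have "1 <= real M * cmod (1 - z)" using assms by simp
 moreover have "cmod (1 - z) > 0" using assms by simp
 ultimately show ?thesis by (simp add: pos_divide_le_eq)
qed

lemma abel_variation_bound:
 fixes z :: complex and b :: "nat => real"
 assumes z: "cmod z = 1" "z ~= 1" and N: "N >= 1"
 shows "cmod (\<Sum>m=1..N. z ^ m * of_real (b m)) <= 2 / cmod (1 - z) * (\<bar>b N\<bar> + (\<Sum>m=1..<N. \<bar>b (Suc m) - b m\<bar>))"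
proof -
 define Z where "Z = (%k. \<Sum>m=1..k. z ^ m)"
 have Zb: "cmod (Z k) <= 2 / cmod (1 - z)" for k
 proof -
  have "(1 - z) * Z k = z * (1 - z ^ k)"
  proof (induction k)
   case (Suc k)
   have "(1 - z) * Z (Suc k) = (1 - z) * Z k + (1 - z) * z ^ Suc k" by (simp add: Z_def distrib_left)
   also have "... = z * (1 - z ^ k) + (1 - z) * z ^ Suc k" unfolding Suc.IH ..
   also have "... = z * (1 - z ^ Suc k)" by (simp add: algebra_simps)
   finally show ?case .
  qed (simp add: Z_def)
  then have "cmod (1 - z) * cmod (Z k) = cmod (1 - z ^ k)" using z by (metis norm_mult mult_1)
  also have "... <= 1 + 1" using norm_triangle_ineq4[of 1 "z ^ k"] z by (simp add: norm_power)
  finally show ?thesis using z by (simp add: pos_le_divide_eq mult.commute)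
 qed
 have "(\<Sum>m=1..N. z ^ m * of_real (b m)) = Z N * of_real (b N) - (\<Sum>m=1..<N. Z m * of_real (b (Suc m) - b m))"
  using N
 proof (induction N rule: dec_induct)
  case (step n)
  have "{1..<Suc n} = insert n {1..<n}" using step by auto
  then have "(\<Sum>m=1..<Suc n. Z m * of_real (b (Suc m) - b m)) = Z n * of_real (b (Suc n) - b n) + (\<Sum>m=1..<n. Z m * of_real (b (Suc m) - b m))" by simp
  moreover have "Z (Suc n) = Z n + z ^ Suc n" by (simp add: Z_def)
  ultimately show ?case using step by (simp add: algebra_simps)
 qed (simp add: Z_def)
 then have "cmod (\<Sum>m=1..N. z ^ m * of_real (b m)) <= cmod (Z N * of_real (b N)) + cmod (\<Sum>m=1..<N. Z m * of_real (b (Suc m) - b m))"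
  by (simp only: norm_triangle_ineq4)
 also have "cmod (Z N * of_real (b N)) <= 2 / cmod (1 - z) * \<bar>b N\<bar>"
  using mult_right_mono[OF Zb[of N] abs_ge_zero[of "b N"]] by (simp only: norm_mult norm_of_real)
 also have "cmod (\<Sum>m=1..<N. Z m * of_real (b (Suc m) - b m)) <= (\<Sum>m=1..<N. 2 / cmod (1 - z) * \<bar>b (Suc m) - b m\<bar>)"
  by (rule sum_norm_le) (simp only: norm_mult norm_of_real mult_right_mono[OF Zb abs_ge_zero])
 also have "... = 2 / cmod (1 - z) * (\<Sum>m=1..<N. \<bar>b (Suc m) - b m\<bar>)" by (simp add: sum_distrib_left)
 finally show ?thesis by (simp add: distrib_left)
qed

text \<open>Distinct fractions of denominators \<open>q\<close> and \<open>q'\<close> are at least \<open>1/(q q')\<close> apart, so the geometric sums are bounded and partial summation costs the variation of the coefficients.\<close>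
lemma exponential_sum_variation:
 assumes q: "q > 0" "q' > 0" and a: "a \<in> totatives q" "a' \<in> totatives q'" and ne: "(q, a) ~= (q', a')" and N: "N >= 1"
 shows "cmod (\<Sum>m=1..N. add_char (real m * (real a / real q - real a' / real q')) * of_real (b m))
   <= 2 * (real q * real q') * (\<bar>b N\<bar> + (\<Sum>m=1..<N. \<bar>b (Suc m) - b m\<bar>))"
proof -
 define x where "x = real a / real q - real a' / real q'"
 define z where "z = add_char x"
 have ax: "real a / real q = real a' / real q' ==> False"
 proof -
  assume "real a / real q = real a' / real q'"
  then have "real (a * q') = real (a' * q)" using q by (simp add: field_simps)
  then have eq: "a * q' = a' * q" by (simp only: of_nat_eq_iff)
  have "coprime a q" "coprime a' q'" using a by (auto simp: in_totatives_iff)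
  then have "q dvd q'" "q' dvd q"
   using eq by (metis coprime_commute coprime_dvd_mult_right_iff dvd_triv_right)+
  then have "q = q'" by (rule dvd_antisym)
  then show False using eq q ne by simp
 qed
 have "x \<notin> \<int>"
 proof
  assume "x \<in> \<int>"
  have "0 < real a / real q" "real a / real q <= 1" "0 < real a' / real q'" "real a' / real q' <= 1"
   using a q by (auto simp: in_totatives_iff)
  then have "\<bar>x\<bar> < 1" by (simp add: x_def abs_less_iff)
  then have "x = 0" using \<open>x \<in> \<int>\<close> by (simp add: Ints_eq_abs_less1)
  then show False using ax by (simp add: x_def)
 qed
 then have z1: "z ~= 1" by (simp add: z_def add_char_eq_1_iff)
 have "z ^ (q * q') = add_char (real (q * q') * x)" unfolding z_def add_char_power ..
 also have "real (q * q') * x = of_int (int (a * q') - int (a' * q))" using q by (simp add: x_def field_simps)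
 also have "add_char ... = 1" unfolding add_char_eq_1_iff by simp
 finally have zM: "z ^ (q * q') = 1" .
 have "1 / cmod (1 - z) <= real (q * q')" by (rule root_of_unity_gap[OF z1 zM]) (use q in \<open>auto simp: z_def\<close>)
 then have gap: "2 / cmod (1 - z) <= 2 * (real q * real q')" by simp
 have "add_char (real m * x) = z ^ m" for m by (simp add: z_def add_char_power)
 then have "cmod (\<Sum>m=1..N. add_char (real m * x) * of_real (b m)) <= 2 / cmod (1 - z) * (\<bar>b N\<bar> + (\<Sum>m=1..<N. \<bar>b (Suc m) - b m\<bar>))"
  using abel_variation_bound[OF _ z1 N, of b] by (simp add: z_def)
 also have "... <= 2 * (real q * real q') * (\<bar>b N\<bar> + (\<Sum>m=1..<N. \<bar>b (Suc m) - b m\<bar>))"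
  by (intro mult_right_mono gap add_nonneg_nonneg sum_nonneg) auto
 finally show ?thesis by (simp add: x_def)
qed

lemma real_div_le: "real (n div q) <= real n / real q"
proof (cases "q = 0")
 case False
 have "n div q * q <= n" by simp
 then have "real (n div q) * real q <= real n" by (metis of_nat_le_iff of_nat_mult)
 then show ?thesis using False by (simp add: pos_le_divide_eq)
qed simp

definition ndiv :: "nat => nat" where
 "ndiv h = card {l. l dvd h}"

lemma ndiv_mult_le: "a > 0 ==> b > 0 ==> ndiv (a * b) <= ndiv a * ndiv b"
proof -
 assume ab: "a > 0" "b > 0"
 have "{l. l dvd a * b} \<subseteq> (%(x, y). x * y) ` ({l. l dvd a} \<times> {l. l dvd b})"
  by (auto dest: division_decomp simp: image_iff)
 then have "ndiv (a * b) <= card ((%(x, y). x * y) ` ({l. l dvd a} \<times> {l. l dvd b}))"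
  unfolding ndiv_def using ab by (intro card_mono finite_imageI finite_cartesian_product finite_divisors_nat) auto
 also have "... <= card ({l. l dvd a} \<times> {l. l dvd b})"
  using ab by (intro card_image_le finite_cartesian_product finite_divisors_nat) auto
 finally show ?thesis by (simp add: ndiv_def card_cartesian_product)
qed

lemma sum_ndiv_sq_le:
 "(\<Sum>h=1..N. (real (ndiv h))\<^sup>2) <= real N * (1 + ln (real (max 1 N))) ^ 3"
proof -
 define H where "H = 1 + ln (real (max 1 N))"
 have H1: "H >= 1" by (simp add: H_def)
 have harm: "(\<Sum>k=1..n. 1 / real k) <= H" if "n <= N" for n
 proof -
  have "ln (real (max 1 n)) <= ln (real (max 1 N))" using that by simp
  then show ?thesis using harmonic_le[of n] unfolding H_def by linarith
 qed
 have nd: "real (ndiv h) = (\<Sum>l | l dvd h. 1)" for h by (simp add: ndiv_def)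
 have D1: "(\<Sum>j=1..n. real (ndiv j)) <= real n * H" if "n <= N" for n
 proof -
  have "(\<Sum>j=1..n. real (ndiv j)) = (\<Sum>q=1..n. \<Sum>j=1..n div q. 1)" unfolding nd by (rule sum_dvd_swap)
  also have "... = (\<Sum>q=1..n. real (n div q))" by simp
  also have "... <= (\<Sum>q=1..n. real n * (1 / real q))"
   by (intro sum_mono) (simp add: real_div_le)
  also have "... = real n * (\<Sum>q=1..n. 1 / real q)" by (simp add: sum_distrib_left)
  also have "... <= real n * H" using harm[OF that] by (intro mult_left_mono) auto
  finally show ?thesis .
 qed
 have D2: "(\<Sum>a=1..N. real (ndiv a) / real a) <= H * H"
 proof -
  have "(\<Sum>a=1..N. real (ndiv a) / real a) = (\<Sum>a=1..N. \<Sum>q | q dvd a. 1 / real a)" by (simp add: ndiv_def)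
  also have "... = (\<Sum>q=1..N. \<Sum>j=1..N div q. 1 / real (q * j))" by (rule sum_dvd_swap)
  also have "... = (\<Sum>q=1..N. (1 / real q) * (\<Sum>j=1..N div q. 1 / real j))" by (simp add: sum_distrib_left)
  also have "... <= (\<Sum>q=1..N. (1 / real q) * H)" by (intro sum_mono mult_left_mono harm div_le_dividend) auto
  also have "... = (\<Sum>q=1..N. 1 / real q) * H" by (simp add: sum_distrib_right)
  also have "... <= H * H" using harm[of N] H1 by (intro mult_right_mono) auto
  finally show ?thesis .
 qed
 have "(\<Sum>h=1..N. (real (ndiv h))\<^sup>2) = (\<Sum>h=1..N. \<Sum>a | a dvd h. real (ndiv h))" by (simp add: ndiv_def power2_eq_square)
 also have "... = (\<Sum>a=1..N. \<Sum>j=1..N div a. real (ndiv (a * j)))" by (rule sum_dvd_swap)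
 also have "... <= (\<Sum>a=1..N. \<Sum>j=1..N div a. real (ndiv a) * real (ndiv j))"
 proof (intro sum_mono)
  fix a j assume "a \<in> {1..N}" "j \<in> {1..N div a}"
  then have "ndiv (a * j) <= ndiv a * ndiv j" by (intro ndiv_mult_le) auto
  then show "real (ndiv (a * j)) <= real (ndiv a) * real (ndiv j)" by (simp flip: of_nat_mult)
 qed
 also have "... = (\<Sum>a=1..N. real (ndiv a) * (\<Sum>j=1..N div a. real (ndiv j)))" by (simp add: sum_distrib_left)
 also have "... <= (\<Sum>a=1..N. real (ndiv a) * (real N / real a * H))"
 proof (intro sum_mono mult_left_mono)
  fix a
  have "(\<Sum>j=1..N div a. real (ndiv j)) <= real (N div a) * H" by (rule D1) simp
  also have "... <= real N / real a * H" using H1 by (intro mult_right_mono real_div_le) auto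
  finally show "(\<Sum>j=1..N div a. real (ndiv j)) <= real N / real a * H" .
 qed auto
 also have "... = real N * H * (\<Sum>a=1..N. real (ndiv a) / real a)" by (simp add: sum_distrib_left mult_ac)
 also have "... <= real N * H * (H * H)" using D2 H1 by (intro mult_left_mono) auto
 finally show ?thesis by (simp add: H_def power3_eq_cube mult_ac)
qed

section \<open>Step approximations and near orthogonality of characters\<close>

definition tot_var :: "nat => (nat => real) => real" where
 "tot_var N b = (\<Sum>m=1..<N. \<bar>b (Suc m) - b m\<bar>)"

lemma tot_var_nonneg: "0 <= tot_var N b"
 by (auto simp: tot_var_def intro: sum_nonneg)

lemma tot_var_diff: "tot_var N (%m. b m - c m) <= tot_var N b + tot_var N c"
 unfolding tot_var_def sum.distrib[symmetric] by (intro sum_mono) linarith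

lemma tot_var_mult:
 assumes "!!m. \<bar>b m\<bar> <= B" "!!m. \<bar>c m\<bar> <= C"
 shows "tot_var N (%m. b m * c m) <= B * tot_var N c + C * tot_var N b"
proof -
 have "\<bar>b (Suc m) * c (Suc m) - b m * c m\<bar> <= B * \<bar>c (Suc m) - c m\<bar> + C * \<bar>b (Suc m) - b m\<bar>" for m
 proof -
  have "b (Suc m) * c (Suc m) - b m * c m = b (Suc m) * (c (Suc m) - c m) + c m * (b (Suc m) - b m)"
   by (simp add: algebra_simps)
  also have "\<bar>...\<bar> <= \<bar>b (Suc m)\<bar> * \<bar>c (Suc m) - c m\<bar> + \<bar>c m\<bar> * \<bar>b (Suc m) - b m\<bar>"
   by (simp add: abs_mult[symmetric])
  also have "... <= B * \<bar>c (Suc m) - c m\<bar> + C * \<bar>b (Suc m) - b m\<bar>"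
   using assms by (intro add_mono mult_right_mono) auto
  finally show ?thesis .
 qed
 then have "tot_var N (%m. b m * c m) <= (\<Sum>m=1..<N. B * \<bar>c (Suc m) - c m\<bar> + C * \<bar>b (Suc m) - b m\<bar>)"
  unfolding tot_var_def by (intro sum_mono)
 then show ?thesis by (simp add: tot_var_def sum.distrib sum_distrib_left)
qed

lemma tot_var_distance:
 fixes g :: "real => real"
 assumes g1: "!!x. \<bar>g x\<bar> <= C" and g2: "!!x y. x > 0 ==> y > 0 ==> \<bar>g x - g y\<bar> <= C * \<bar>x - y\<bar> / min x y"
  and Q: "Q > 0" and n: "n \<in> {1..N}"
 shows "tot_var N (%m. g (\<bar>real m - real n\<bar> / Q)) <= 4 * C * (1 + ln (real N))"
proof -
 have C: "C >= 0" using order_trans[OF abs_ge_zero g1] .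
 have key: "\<bar>g (real (Suc u) / Q) - g (real u / Q)\<bar> <= 2 * C * (1 / real (Suc u))" for u
 proof (cases "u = 0")
  case True
  have "\<bar>g (real (Suc u) / Q) - g (real u / Q)\<bar> <= \<bar>g (real (Suc u) / Q)\<bar> + \<bar>g (real u / Q)\<bar>" by (rule abs_triangle_ineq4)
  then show ?thesis using g1[of "real (Suc u) / Q"] g1[of "real u / Q"] True by simp
 next
  case False
  have "\<bar>g (real (Suc u) / Q) - g (real u / Q)\<bar> <= C * \<bar>real (Suc u) / Q - real u / Q\<bar> / min (real (Suc u) / Q) (real u / Q)"
   using False Q by (intro g2) auto
  also have "min (real (Suc u) / Q) (real u / Q) = real u / Q" using Q by (simp add: min_def field_simps)
  also have "\<bar>real (Suc u) / Q - real u / Q\<bar> = 1 / Q" using Q by (simp add: diff_divide_distrib[symmetric])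
  also have "C * (1 / Q) / (real u / Q) = C * (1 / real u)" using Q by simp
  also have "... <= C * (2 * (1 / real (Suc u)))" using False C by (intro mult_left_mono) (auto simp: field_simps)
  finally show ?thesis by (simp add: mult.commute)
 qed
 have "tot_var N (%m. g (\<bar>real m - real n\<bar> / Q)) <= (\<Sum>m=1..<N. if m < n then 2 * C * (1 / real (n - m)) else 2 * C * (1 / real (Suc (m - n))))"
  unfolding tot_var_def
 proof (rule sum_mono)
  fix m assume "m \<in> {1..<N}"
  show "\<bar>g (\<bar>real (Suc m) - real n\<bar> / Q) - g (\<bar>real m - real n\<bar> / Q)\<bar> <= (if m < n then 2 * C * (1 / real (n - m)) else 2 * C * (1 / real (Suc (m - n))))"
  proof (cases "m < n")
   case True
   then have "\<bar>real (Suc m) - real n\<bar> = real (n - m - 1)" "\<bar>real m - real n\<bar> = real (Suc (n - m - 1))" by auto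
   then show ?thesis using key[of "n - m - 1"] True by (simp add: abs_minus_commute del: of_nat_Suc)
  next
   case False
   then have "\<bar>real (Suc m) - real n\<bar> = real (Suc (m - n))" "\<bar>real m - real n\<bar> = real (m - n)" by auto
   then show ?thesis using key[of "m - n"] False by (simp del: of_nat_Suc)
  qed
 qed
 also have "... = (\<Sum>m\<in>{1..<N} \<inter> {m. m < n}. 2 * C * (1 / real (n - m))) + (\<Sum>m\<in>{1..<N} \<inter> - {m. m < n}. 2 * C * (1 / real (Suc (m - n))))"
  by (rule sum.If_cases) simp
 also have "(\<Sum>m\<in>{1..<N} \<inter> {m. m < n}. 2 * C * (1 / real (n - m))) = 2 * C * (\<Sum>m\<in>{1..<N} \<inter> {m. m < n}. 1 / real (n - m))" by (simp add: sum_distrib_left)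
 also have "(\<Sum>m\<in>{1..<N} \<inter> - {m. m < n}. 2 * C * (1 / real (Suc (m - n)))) = 2 * C * (\<Sum>m\<in>{1..<N} \<inter> - {m. m < n}. 1 / real (Suc (m - n)))" by (simp add: sum_distrib_left)
 also have "2 * C * (\<Sum>m\<in>{1..<N} \<inter> {m. m < n}. 1 / real (n - m)) + 2 * C * (\<Sum>m\<in>{1..<N} \<inter> - {m. m < n}. 1 / real (Suc (m - n)))
   <= 2 * C * (1 + ln (real N)) + 2 * C * (1 + ln (real N))"
 proof (intro add_mono mult_left_mono)
  have le: "(\<Sum>k\<in>A. 1 / real k) <= 1 + ln (real N)" if "A \<subseteq> {1..N}" for A
  proof -
   have "(\<Sum>k\<in>A. 1 / real k) <= (\<Sum>k=1..N. 1 / real k)" using that by (intro sum_mono2) auto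
   also have "... <= 1 + ln (real N)" using harmonic_le[of N] n by (simp add: max_def split: if_splits)
   finally show ?thesis .
  qed
  have "(\<Sum>m\<in>{1..<N} \<inter> {m. m < n}. 1 / real (n - m)) = (\<Sum>k\<in>(%m. n - m) ` ({1..<N} \<inter> {m. m < n}). 1 / real k)"
   by (subst sum.reindex) (auto simp: inj_on_def)
  also have "... <= 1 + ln (real N)" by (rule le) (use n in auto)
  finally show "(\<Sum>m\<in>{1..<N} \<inter> {m. m < n}. 1 / real (n - m)) <= 1 + ln (real N)" .
  have "(\<Sum>m\<in>{1..<N} \<inter> - {m. m < n}. 1 / real (Suc (m - n))) = (\<Sum>k\<in>(%m. Suc (m - n)) ` ({1..<N} \<inter> - {m. m < n}). 1 / real k)"
   by (subst sum.reindex) (auto simp: inj_on_def)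
  also have "... <= 1 + ln (real N)" by (rule le) (use n in auto)
  finally show "(\<Sum>m\<in>{1..<N} \<inter> - {m. m < n}. 1 / real (Suc (m - n))) <= 1 + ln (real N)" .
 qed (use C in auto)
 finally show ?thesis by (simp add: algebra_simps)
qed

lemma tot_var_step:
 fixes g :: "real => real"
 assumes g1: "!!x. \<bar>g x\<bar> <= C" and N: "N >= 1"
 shows "tot_var N (%m. g (\<bar>real (m div H) - y\<bar> * z)) <= 2 * C * real (N div H)"
proof -
 have C: "C >= 0" using order_trans[OF abs_ge_zero g1] .
 have "tot_var N (%m. g (\<bar>real (m div H) - y\<bar> * z)) <= (\<Sum>m=1..<N. 2 * C * (real (Suc m div H) - real (m div H)))"
  unfolding tot_var_def
 proof (rule sum_mono)
  fix m
  show "\<bar>g (\<bar>real (Suc m div H) - y\<bar> * z) - g (\<bar>real (m div H) - y\<bar> * z)\<bar> <= 2 * C * (real (Suc m div H) - real (m div H))"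
  proof (cases "Suc m div H = m div H")
   case False
   then have "Suc (m div H) <= Suc m div H" using div_le_mono[of m "Suc m" H] by linarith
   then have "1 <= real (Suc m div H) - real (m div H)" by linarith
   then have "2 * C * 1 <= 2 * C * (real (Suc m div H) - real (m div H))" using C by (intro mult_left_mono) auto
   then show ?thesis
    using abs_triangle_ineq4[of "g (\<bar>real (Suc m div H) - y\<bar> * z)" "g (\<bar>real (m div H) - y\<bar> * z)"] g1[of "\<bar>real (Suc m div H) - y\<bar> * z"] g1[of "\<bar>real (m div H) - y\<bar> * z"]
    by linarith
  qed simp
 qed
 also have "... = 2 * C * (\<Sum>m=1..<N. real (Suc m div H) - real (m div H))" by (simp add: sum_distrib_left)
 also have "(\<Sum>m=1..<N. real (Suc m div H) - real (m div H)) = real (N div H) - real (1 div H)"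
  using N by (rule sum_Suc_diff')
 also have "2 * C * (real (N div H) - real (1 div H)) <= 2 * C * real (N div H)" using C by (intro mult_left_mono) auto
 finally show ?thesis .
qed

lemma sum_inverse_sq_le: "(\<Sum>k<n. 1 / (real (Suc k))\<^sup>2) <= 2"
proof -
 have "(\<Sum>k<n. 1 / (real (Suc k))\<^sup>2) <= 2 - 1 / real (max 1 n)"
 proof (induction n)
  case (Suc n)
  show ?case
  proof (cases "n = 0")
   case False
   have "1 / real n - 1 / real (Suc n) = 1 / (real n * real (Suc n))" using False by (simp add: field_simps)
   moreover have "1 / (real (Suc n))\<^sup>2 <= 1 / (real n * real (Suc n))"
    unfolding power2_eq_square using False by (intro divide_left_mono mult_right_mono) auto
   ultimately show ?thesis using Suc False by (simp add: max_def split: if_splits del: of_nat_Suc)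
  qed simp
 qed simp
 then show ?thesis by (rule order_trans) simp
qed

text \<open>The Lipschitz constant of \<open>g\<close> deteriorates like \<open>1/x\<close> near the diagonal, so the squared error is summable at scale \<open>H\<close>.\<close>
lemma step_approximation_error:
 fixes g :: "real => real"
 assumes g1: "!!x. \<bar>g x\<bar> <= C" and g2: "!!x y. x > 0 ==> y > 0 ==> \<bar>g x - g y\<bar> <= C * \<bar>x - y\<bar> / min x y"
  and Q: "Q > 0" and H: "H > 0"
 shows "(\<Sum>m=1..N. (g (\<bar>real m - real n\<bar> / Q) - g (\<bar>real (m div H) - real (n div H)\<bar> * (real H / Q)))\<^sup>2) <= 144 * C\<^sup>2 * real H"
proof -
 have C: "C >= 0" using order_trans[OF abs_ge_zero g1] .
 define c where "c = n div H"
 define k where "k = (%j::nat. nat \<bar>int j - int c\<bar>)"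
 have kr: "\<bar>real j - real c\<bar> = real (k j)" for j unfolding k_def by simp
 define F where "F = (%j. 36 * C\<^sup>2 / (real (Suc (k j)))\<^sup>2)"
 have pt: "(g (\<bar>real m - real n\<bar> / Q) - g (\<bar>real (m div H) - real (n div H)\<bar> * (real H / Q)))\<^sup>2 <= F (m div H)" for m
 proof -
  let ?x = "\<bar>real m - real n\<bar> / Q" and ?y = "\<bar>real (m div H) - real (n div H)\<bar> * (real H / Q)"
  let ?k = "k (m div H)"
  have y: "?y = real ?k * (real H / Q)" using kr[of "m div H"] by (simp add: c_def)
  have ab: "\<bar>g ?x - g ?y\<bar> <= 6 * C / real (Suc ?k)"
  proof (cases "?k <= 1")
   case True
   have "\<bar>g ?x - g ?y\<bar> <= 2 * C" using abs_triangle_ineq4[of "g ?x" "g ?y"] g1[of ?x] g1[of ?y] by linarith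
   also have "... <= 6 * C / real (Suc ?k)" using True C by (simp add: field_simps mult_left_mono)
   finally show ?thesis .
  next
   case False
   define r s where "r = real (m mod H)" and "s = real (n mod H)"
   have mm: "real m = real (m div H) * real H + r" "real n = real (n div H) * real H + s"
    unfolding r_def s_def by (metis of_nat_add of_nat_mult div_mult_mod_eq)+
   have rs: "0 <= r" "r < real H" "0 <= s" "s < real H" using H by (auto simp: r_def s_def)
   define D where "D = real (m div H) * real H - real (n div H) * real H"
   have Dk: "\<bar>D\<bar> = real ?k * real H" using kr[of "m div H"] by (simp add: D_def c_def abs_mult flip: left_diff_distrib)
   have xD: "\<bar>real m - real n\<bar> = \<bar>D + (r - s)\<bar>" using mm by (simp add: D_def)
   have d: "\<bar>\<bar>real m - real n\<bar> - real ?k * real H\<bar> <= real H"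
    using xD Dk rs by linarith
   define kk where "kk = real ?k - 1"
   have kk: "kk >= 1" "real ?k = kk + 1" using False by (auto simp: kk_def)
   have lo: "kk * real H <= \<bar>real m - real n\<bar>" using d unfolding kk(2) distrib_right by linarith
   have k1: "kk * real H > 0" using kk H by simp
   then have "\<bar>real m - real n\<bar> > 0" using lo by linarith
   then have xp: "?x > 0" and yp: "?y > 0" using Q H kk unfolding y by auto
   have xy: "\<bar>?x - ?y\<bar> <= real H / Q"
   proof -
    have "?x - ?y = (\<bar>real m - real n\<bar> - real ?k * real H) / Q" unfolding y by (simp add: diff_divide_distrib)
    then show ?thesis using d Q by (simp add: divide_right_mono)
   qed
   have mn: "kk * real H / Q <= min ?x ?y"
   proof -
    have "kk * real H <= real ?k * real H" unfolding kk(2) by (intro mult_right_mono) auto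
    then show ?thesis using lo Q unfolding y by (simp add: divide_right_mono)
   qed
   have "\<bar>g ?x - g ?y\<bar> <= C * \<bar>?x - ?y\<bar> / min ?x ?y" by (rule g2[OF xp yp])
   also have "... <= C * (real H / Q) / (kk * real H / Q)"
   proof (rule frac_le)
    show "C * \<bar>?x - ?y\<bar> <= C * (real H / Q)" using xy C by (rule mult_left_mono)
    show "0 < kk * real H / Q" using k1 Q by (rule divide_pos_pos)
   qed (use mn C Q in auto)
   also have "... = C * (1 / kk)" using H Q by simp
   also have "... <= C * (6 / real (Suc ?k))"
    unfolding of_nat_Suc kk(2) using kk(1) C by (intro mult_left_mono) (auto simp: field_simps)
   finally show ?thesis by (simp add: mult.commute)
  qed
  have "(g ?x - g ?y)\<^sup>2 = \<bar>g ?x - g ?y\<bar>\<^sup>2" by simp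
  also have "... <= (6 * C / real (Suc ?k))\<^sup>2" using ab by (intro power_mono) auto
  also have "... = F (m div H)" by (simp add: F_def power_divide power_mult_distrib del: of_nat_Suc)
  finally show ?thesis .
 qed
 have F0: "0 <= F j" for j by (simp add: F_def)
 have "(\<Sum>m=1..N. (g (\<bar>real m - real n\<bar> / Q) - g (\<bar>real (m div H) - real (n div H)\<bar> * (real H / Q)))\<^sup>2) <= (\<Sum>m=1..N. F (m div H))"
  by (intro sum_mono pt)
 also have "... = (\<Sum>j\<le>N. \<Sum>m\<in>{m\<in>{1..N}. m div H = j}. F (m div H))"
  by (rule sum.group[symmetric]) (auto intro: order_trans[OF div_le_dividend])
 also have "... <= (\<Sum>j\<le>N. real H * F j)"
 proof (rule sum_mono)
  fix j
  have "{m\<in>{1..N}. m div H = j} \<subseteq> {j * H..<j * H + H}"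
   using H by (auto simp: div_times_less_eq_dividend dividend_less_div_times add.commute)
  then have "card {m\<in>{1..N}. m div H = j} <= card {j * H..<j * H + H}" by (intro card_mono) auto
  then have "real (card {m\<in>{1..N}. m div H = j}) * F j <= real H * F j" using F0 by (intro mult_right_mono) auto
  moreover have "(\<Sum>m\<in>{m\<in>{1..N}. m div H = j}. F (m div H)) = real (card {m\<in>{1..N}. m div H = j}) * F j" by simp
  ultimately show "(\<Sum>m\<in>{m\<in>{1..N}. m div H = j}. F (m div H)) <= real H * F j" by simp
 qed
 also have "... = real H * (\<Sum>j\<le>N. F j)" by (simp add: sum_distrib_left)
 also have "(\<Sum>j\<le>N. F j) <= 144 * C\<^sup>2"
 proof -
  have "(\<Sum>j\<le>N. F j) = (\<Sum>j\<in>{..N} \<inter> {j. j < c}. F j) + (\<Sum>j\<in>{..N} \<inter> - {j. j < c}. F j)"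
   using sum.Int_Diff[of "{..N}" F "{j. j < c}"] by (simp add: Diff_eq)
  also have "(\<Sum>j\<in>{..N} \<inter> {j. j < c}. F j) = (\<Sum>i\<in>k ` ({..N} \<inter> {j. j < c}). 36 * C\<^sup>2 * (1 / (real (Suc i))\<^sup>2))"
   by (subst sum.reindex) (auto simp: inj_on_def k_def F_def)
  also have "... <= (\<Sum>i<Suc (N + c). 36 * C\<^sup>2 * (1 / (real (Suc i))\<^sup>2))"
   by (intro sum_mono2) (auto simp: k_def)
  also have "(\<Sum>j\<in>{..N} \<inter> - {j. j < c}. F j) = (\<Sum>i\<in>k ` ({..N} \<inter> - {j. j < c}). 36 * C\<^sup>2 * (1 / (real (Suc i))\<^sup>2))"
   by (subst sum.reindex) (auto simp: inj_on_def k_def F_def)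
  also have "... <= (\<Sum>i<Suc (N + c). 36 * C\<^sup>2 * (1 / (real (Suc i))\<^sup>2))"
   by (intro sum_mono2) (auto simp: k_def)
  also have "(\<Sum>i<Suc (N + c). 36 * C\<^sup>2 * (1 / (real (Suc i))\<^sup>2)) = 36 * C\<^sup>2 * (\<Sum>i<Suc (N + c). 1 / (real (Suc i))\<^sup>2)"
   by (simp only: sum_distrib_left)
  also have "... <= 36 * C\<^sup>2 * 2" by (intro mult_left_mono sum_inverse_sq_le) auto
  finally show ?thesis by simp
 qed
 finally show ?thesis using H by (simp add: mult_left_mono mult.commute)
qed

text \<open>Expanding the square, the pairs of distinct fractions contribute only bounded exponential sums; there are at most \<open>L^4\<close> such pairs.\<close>
lemma near_orthogonality:
 fixes b :: "nat \<times> nat => nat => nat => real"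
 assumes Th: "Th \<subseteq> Sigma {1..L} totatives"
  and B: "!!t m n. t \<in> Th ==> \<bar>b t m n\<bar> <= B" and V: "!!t n. t \<in> Th ==> n \<in> {1..N} ==> tot_var N (%m. b t m n) <= V"
  and N: "N >= 1" and B0: "B >= 0" and V0: "V >= 0"
 shows "(\<Sum>m=1..N. \<Sum>n=1..N. (cmod (\<Sum>t\<in>Th. of_real (b t m n) * add_char ((real m - real n) * (real (snd t) / real (fst t)))))\<^sup>2)
  <= (\<Sum>t\<in>Th. \<Sum>m=1..N. \<Sum>n=1..N. (b t m n)\<^sup>2) + (real L) ^ 6 * (2 * real N * (B\<^sup>2 + 2 * B * V))"
proof -
 have finS: "finite (Sigma {1..L} totatives)" by auto
 then have fin: "finite Th" using Th finite_subset by blast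
 define x where "x = (%t::nat \<times> nat. real (snd t) / real (fst t))"
 define U where "U = (%t t'. \<Sum>m=1..N. \<Sum>n=1..N. of_real (b t m n * b t' m n) * add_char ((real m - real n) * (x t - x t')))"
 have card: "real (card Th) <= (real L)\<^sup>2"
 proof -
  have "card Th <= card (Sigma {1..L} totatives)" by (rule card_mono[OF finS Th])
  also have "... = (\<Sum>q=1..L. totient q)" by (simp add: card_SigmaI totient_def)
  also have "... <= (\<Sum>q=1..L. L)" by (intro sum_mono) (auto intro: order_trans[OF totient_le])
  finally have "card Th <= L * L" by simp
  then show ?thesis unfolding power2_eq_square by (metis of_nat_le_iff of_nat_mult)
 qed
 have expand: "complex_of_real (\<Sum>m=1..N. \<Sum>n=1..N. (cmod (\<Sum>t\<in>Th. of_real (b t m n) * add_char ((real m - real n) * x t)))\<^sup>2)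
   = (\<Sum>t\<in>Th. \<Sum>t'\<in>Th. U t t')"
 proof -
  have "complex_of_real ((cmod (\<Sum>t\<in>Th. of_real (b t m n) * add_char ((real m - real n) * x t)))\<^sup>2)
    = (\<Sum>t\<in>Th. \<Sum>t'\<in>Th. of_real (b t m n * b t' m n) * add_char ((real m - real n) * (x t - x t')))" for m n
  proof -
   have "complex_of_real ((cmod (\<Sum>t\<in>Th. of_real (b t m n) * add_char ((real m - real n) * x t)))\<^sup>2)
    = (\<Sum>t\<in>Th. \<Sum>t'\<in>Th. (of_real (b t m n) * add_char ((real m - real n) * x t)) * (of_real (b t' m n) * add_char (- ((real m - real n) * x t'))))"
    unfolding complex_norm_square cnj_sum sum_product by (simp add: cnj_add_char)
   also have "... = (\<Sum>t\<in>Th. \<Sum>t'\<in>Th. of_real (b t m n * b t' m n) * add_char ((real m - real n) * (x t - x t')))"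
   proof (intro sum.cong refl)
    fix t t'
    have "add_char ((real m - real n) * (x t - x t')) = add_char ((real m - real n) * x t) * add_char (- ((real m - real n) * x t'))"
     unfolding add_char_add[symmetric] by (simp add: right_diff_distrib)
    then show "(of_real (b t m n) * add_char ((real m - real n) * x t)) * (of_real (b t' m n) * add_char (- ((real m - real n) * x t')))
     = of_real (b t m n * b t' m n) * add_char ((real m - real n) * (x t - x t'))" by simp
   qed
   finally show ?thesis .
  qed
  then have "complex_of_real (\<Sum>m=1..N. \<Sum>n=1..N. (cmod (\<Sum>t\<in>Th. of_real (b t m n) * add_char ((real m - real n) * x t)))\<^sup>2)
    = (\<Sum>m=1..N. \<Sum>n=1..N. \<Sum>t\<in>Th. \<Sum>t'\<in>Th. of_real (b t m n * b t' m n) * add_char ((real m - real n) * (x t - x t')))"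
   by (simp only: of_real_sum)
  also have "... = (\<Sum>m=1..N. \<Sum>t\<in>Th. \<Sum>t'\<in>Th. \<Sum>n=1..N. of_real (b t m n * b t' m n) * add_char ((real m - real n) * (x t - x t')))"
   by (intro sum.cong[OF refl] sum_swap3)
  also have "... = (\<Sum>t\<in>Th. \<Sum>t'\<in>Th. U t t')"
   unfolding U_def by (rule sum_swap3)
  finally show ?thesis .
 qed
 have diag: "U t t = of_real (\<Sum>m=1..N. \<Sum>n=1..N. (b t m n)\<^sup>2)" for t
  by (simp add: U_def power2_eq_square)
 have off: "cmod (U t t') <= (real L)\<^sup>2 * (2 * real N * (B\<^sup>2 + 2 * B * V))" if t: "t \<in> Th" "t' \<in> Th" "t ~= t'" for t t'
 proof -
  obtain q a q' a' where qa: "t = (q, a)" "t' = (q', a')" by (cases t, cases t') auto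
  have q: "q \<in> {1..L}" "q' \<in> {1..L}" "a \<in> totatives q" "a' \<in> totatives q'" using Th t qa by auto
  have "U t t' = (\<Sum>n=1..N. add_char (- (real n * (x t - x t'))) * (\<Sum>m=1..N. add_char (real m * (x t - x t')) * of_real (b t m n * b t' m n)))"
  proof -
   have "add_char ((real m - real n) * (x t - x t')) = add_char (- (real n * (x t - x t'))) * add_char (real m * (x t - x t'))" for m n
    unfolding add_char_add[symmetric] by (simp add: left_diff_distrib)
   then have "U t t' = (\<Sum>m=1..N. \<Sum>n=1..N. add_char (- (real n * (x t - x t'))) * (add_char (real m * (x t - x t')) * of_real (b t m n * b t' m n)))"
    unfolding U_def by (simp only: mult_ac)
   then show ?thesis unfolding sum_distrib_left by (subst sum.swap)
  qed
  also have "cmod ... <= (\<Sum>n=1..N. 2 * (real L * real L) * (B\<^sup>2 + 2 * B * V))"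
  proof (rule sum_norm_le)
   fix n assume n: "n \<in> {1..N}"
   let ?b = "%m. b t m n * b t' m n"
   have "cmod (\<Sum>m=1..N. add_char (real m * (x t - x t')) * of_real (?b m)) <= 2 * (real q * real q') * (\<bar>?b N\<bar> + tot_var N ?b)"
    unfolding tot_var_def x_def qa using exponential_sum_variation[of q q' a a' N "%m. b (q, a) m n * b (q', a') m n"] q t N qa by auto
   also have "... <= 2 * (real L * real L) * (B * B + (B * V + B * V))"
   proof (intro mult_mono add_mono)
    show "\<bar>?b N\<bar> <= B * B" unfolding abs_mult using B t B0 by (intro mult_mono) auto
    have "tot_var N ?b <= B * tot_var N (%m. b t' m n) + B * tot_var N (%m. b t m n)"
     by (rule tot_var_mult) (use B t in auto)
    also have "... <= B * V + B * V" using V t n B0 by (intro add_mono mult_left_mono) auto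
    finally show "tot_var N ?b <= B * V + B * V" .
   qed (use q in \<open>auto intro!: add_nonneg_nonneg tot_var_nonneg\<close>)
   finally have "cmod (\<Sum>m=1..N. add_char (real m * (x t - x t')) * of_real (?b m)) <= 2 * (real L * real L) * (B\<^sup>2 + 2 * B * V)"
    by (simp add: power2_eq_square mult.assoc)
   then show "cmod (add_char (- (real n * (x t - x t'))) * (\<Sum>m=1..N. add_char (real m * (x t - x t')) * of_real (?b m))) <= 2 * (real L * real L) * (B\<^sup>2 + 2 * B * V)"
    by (simp only: norm_mult norm_add_char mult_1)
  qed
  also have "... = (real L)\<^sup>2 * (2 * real N * (B\<^sup>2 + 2 * B * V))" by (simp add: power2_eq_square)
  finally show ?thesis .
 qed
 let ?X = "\<Sum>m=1..N. \<Sum>n=1..N. (cmod (\<Sum>t\<in>Th. of_real (b t m n) * add_char ((real m - real n) * x t)))\<^sup>2"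
 let ?E = "(real L)\<^sup>2 * (2 * real N * (B\<^sup>2 + 2 * B * V))"
 have E0: "?E >= 0" using B0 V0 by simp
 have "?X = cmod (\<Sum>t\<in>Th. \<Sum>t'\<in>Th. U t t')"
  unfolding expand[symmetric] norm_of_real by (rule abs_of_nonneg[symmetric]) (intro sum_nonneg, simp)
 also have "... <= (\<Sum>t\<in>Th. \<Sum>t'\<in>Th. cmod (U t t'))"
  by (intro order_trans[OF norm_sum] sum_mono norm_sum)
 also have "... <= (\<Sum>t\<in>Th. (\<Sum>m=1..N. \<Sum>n=1..N. (b t m n)\<^sup>2) + real (card Th) * ?E)"
 proof (rule sum_mono)
  fix t assume t: "t \<in> Th"
  have "(\<Sum>t'\<in>Th. cmod (U t t')) = cmod (U t t) + (\<Sum>t'\<in>Th - {t}. cmod (U t t'))"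
   using fin t by (rule sum.remove)
  also have "cmod (U t t) = (\<Sum>m=1..N. \<Sum>n=1..N. (b t m n)\<^sup>2)"
   unfolding diag norm_of_real by (rule abs_of_nonneg) (intro sum_nonneg, simp)
  also have "(\<Sum>t'\<in>Th - {t}. cmod (U t t')) <= (\<Sum>t'\<in>Th - {t}. ?E)" using t by (intro sum_mono off) auto
  also have "... <= real (card Th) * ?E"
   using E0 fin by (simp add: mult_right_mono card_Diff1_le)
  finally show "(\<Sum>t'\<in>Th. cmod (U t t')) <= (\<Sum>m=1..N. \<Sum>n=1..N. (b t m n)\<^sup>2) + real (card Th) * ?E" by simp
 qed
 also have "... = (\<Sum>t\<in>Th. \<Sum>m=1..N. \<Sum>n=1..N. (b t m n)\<^sup>2) + real (card Th) * (real (card Th) * ?E)"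
  by (simp add: sum.distrib)
 also have "... <= (\<Sum>t\<in>Th. \<Sum>m=1..N. \<Sum>n=1..N. (b t m n)\<^sup>2) + (real L)\<^sup>2 * ((real L)\<^sup>2 * ?E)"
  using card E0 B0 V0 by (intro add_left_mono mult_mono) auto
 also have "(real L)\<^sup>2 * ((real L)\<^sup>2 * ?E) = (real L) ^ 6 * (2 * real N * (B\<^sup>2 + 2 * B * V))"
  by (simp add: eval_nat_numeral)
 finally show ?thesis unfolding x_def .
qed

section \<open>Head and tail of the kernel\<close>

definition farey :: "nat => (nat \<times> nat) set" where
 "farey L = Sigma {1..L} totatives"

definition frac_of :: "nat \<times> nat => real" where
 "frac_of t = real (snd t) / real (fst t)"

definition block :: "(real => real) => nat => nat => real => real" where
 "block W L q x = gsum W (L div q) (x / real q)"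

definition head_kernel :: "(real => real) => real => nat => nat => nat => complex" where
 "head_kernel W Q L m n = (\<Sum>t\<in>farey L. of_real (block W L (fst t) (\<bar>real m - real n\<bar> / Q) / real (fst t)) * add_char ((real m - real n) * frac_of t))"

definition tail_kernel :: "(real => real) => real => nat => nat => nat => real" where
 "tail_kernel W Q L m n = (if m = n then 0 else
   (\<Sum>l | l dvd nat \<bar>int m - int n\<bar> & l > L. mobius_sum W (real (nat \<bar>int m - int n\<bar>) / (real l * Q))))"

lemma finite_farey [simp]: "finite (farey L)"
 by (auto simp: farey_def)

lemma head_kernel_diag: "head_kernel W Q L m m = 0"
 by (simp add: head_kernel_def block_def gsum_def)

text \<open>Divisors up to \<open>L\<close> form the head, the remaining ones the tail.\<close>
lemma kernel_split:
 assumes mn: "m ~= n" and Q: "Q > 0"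
 shows "of_real (kernel W Q (int m - int n)) = head_kernel W Q L m n + of_real (tail_kernel W Q L m n)"
proof -
 define h where "h = nat \<bar>int m - int n\<bar>"
 have h0: "h > 0" using mn by (auto simp: h_def)
 have hr: "real h = \<bar>real m - real n\<bar>" by (simp add: h_def)
 let ?f = "%l. mobius_sum W (real h / (real l * Q))"
 have fin: "finite {l. l dvd h}" using h0 by (simp add: finite_divisors_nat)
 have "kernel W Q (int m - int n) = (\<Sum>l | l dvd h. ?f l)" by (simp add: kernel_def h_def)
 also have "... = (\<Sum>l\<in>{l. l dvd h & l <= L} \<union> {l. l dvd h & l > L}. ?f l)"
  by (rule arg_cong[of _ _ "sum ?f"]) auto
 also have "... = (\<Sum>l\<in>{l. l dvd h & l <= L}. ?f l) + (\<Sum>l\<in>{l. l dvd h & l > L}. ?f l)"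
  using fin by (intro sum.union_disjoint) auto
 also have "(\<Sum>l\<in>{l. l dvd h & l > L}. ?f l) = tail_kernel W Q L m n" using mn by (simp add: tail_kernel_def h_def)
 also have "{l. l dvd h & l <= L} = {l\<in>{1..L}. l dvd h}" using h0 by (auto intro: Nat.gr0I simp: Suc_le_eq)
 also have "(\<Sum>l\<in>{l\<in>{1..L}. l dvd h}. ?f l) = (\<Sum>l=1..L. if l dvd h then ?f l else 0)"
  by (rule sum.inter_filter) simp
 also have "... = (\<Sum>l=1..L. if int l dvd (int m - int n) then ?f l else 0)"
 proof -
  have "l dvd h \<longleftrightarrow> int l dvd (int m - int n)" for l unfolding h_def by (simp add: nat_dvd_iff flip: int_dvd_int_iff)
  then show ?thesis by simp
 qed
 finally have "complex_of_real (kernel W Q (int m - int n)) = of_real (\<Sum>l=1..L. if int l dvd (int m - int n) then ?f l else 0) + of_real (tail_kernel W Q L m n)"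
  by (simp only: of_real_add)
 also have "complex_of_real (\<Sum>l=1..L. if int l dvd (int m - int n) then ?f l else 0)
   = (\<Sum>q=1..L. ramanujan q (int m - int n) * of_real (divisor_sum (mobius_sum W) (L div q) (real h / (real q * Q)) / real q))"
  by (rule head_ramanujan_expansion)
 also have "... = (\<Sum>q=1..L. \<Sum>a\<in>totatives q. of_real (block W L q (\<bar>real m - real n\<bar> / Q) / real q) * add_char ((real m - real n) * frac_of (q, a)))"
 proof (intro sum.cong refl)
  fix q assume q: "q \<in> {1..L}"
  have "block W L q (\<bar>real m - real n\<bar> / Q) = divisor_sum (mobius_sum W) (L div q) (real h / (real q * Q))"
   using q h0 Q unfolding block_def gsum_def hr[symmetric] by (simp add: mult.commute)
  then show "ramanujan q (int m - int n) * of_real (divisor_sum (mobius_sum W) (L div q) (real h / (real q * Q)) / real q)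
    = (\<Sum>a\<in>totatives q. of_real (block W L q (\<bar>real m - real n\<bar> / Q) / real q) * add_char ((real m - real n) * frac_of (q, a)))"
   by (simp add: ramanujan_def frac_of_def sum_distrib_left sum_divide_distrib mult.commute[of "sum _ _"])
 qed
 also have "... = head_kernel W Q L m n"
  unfolding head_kernel_def farey_def by (subst sum.Sigma) (auto simp: case_prod_beta)
 finally show ?thesis .
qed

lemma sieve_sum_split:
 assumes W: "!!u. u > 2 ==> W u = 0" and Q: "Q > 0" and I0: "I0 W Q ~= 0"
 shows "of_real (sieve_sum W N Q \<phi>) = of_real (sq_norm N \<phi>)
   + (\<Sum>m=1..N. \<Sum>n=1..N. \<phi> m * cnj (\<phi> n) * ((head_kernel W Q L m n + of_real (tail_kernel W Q L m n)) / of_real (Q * I0 W Q)))"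
proof -
 have key: "(\<Sum>n\<in>{1..N} - {m}. \<phi> m * cnj (\<phi> n) * of_real (kernel W Q (int m - int n) / (Q * I0 W Q)))
  = (\<Sum>n=1..N. \<phi> m * cnj (\<phi> n) * ((head_kernel W Q L m n + of_real (tail_kernel W Q L m n)) / of_real (Q * I0 W Q)))" if m: "m \<in> {1..N}" for m
 proof -
  have "(\<Sum>n=1..N. \<phi> m * cnj (\<phi> n) * ((head_kernel W Q L m n + of_real (tail_kernel W Q L m n)) / of_real (Q * I0 W Q)))
   = (\<Sum>n\<in>{1..N} - {m}. \<phi> m * cnj (\<phi> n) * ((head_kernel W Q L m n + of_real (tail_kernel W Q L m n)) / of_real (Q * I0 W Q)))"
   using m by (subst sum.remove[of _ m]) (auto simp: head_kernel_diag tail_kernel_def)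
  also have "... = (\<Sum>n\<in>{1..N} - {m}. \<phi> m * cnj (\<phi> n) * of_real (kernel W Q (int m - int n) / (Q * I0 W Q)))"
   by (intro sum.cong refl) (simp add: kernel_split[OF _ Q, of _ _ W L])
  finally show ?thesis by simp
 qed
 have base: "of_real (sieve_sum W N Q \<phi>) = of_real (sq_norm N \<phi>)
   + (\<Sum>m=1..N. \<Sum>n\<in>{1..N} - {m}. \<phi> m * cnj (\<phi> n) * of_real (kernel W Q (int m - int n) / (Q * I0 W Q)))"
  by (rule sieve_sum_quadratic_form[OF W Q I0])
 show ?thesis unfolding base
  by (rule arg_cong[where f = "%x. of_real (sq_norm N \<phi>) + x"], rule sum.cong[OF refl], erule key)
qed

lemma sum_distance_le:
 fixes F :: "nat => real"
 assumes F: "!!h. F h >= 0" and m: "m \<in> {1..N}"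
 shows "(\<Sum>n\<in>{1..N} - {m}. F (nat \<bar>int m - int n\<bar>)) <= 2 * (\<Sum>h=1..N. F h)"
proof -
 let ?g = "%n. F (nat \<bar>int m - int n\<bar>)"
 have "(\<Sum>n\<in>{1..N} - {m}. ?g n) = (\<Sum>n\<in>{1..<m} \<union> {Suc m..N}. ?g n)" using m by (intro sum.cong) auto
 also have "... = (\<Sum>n\<in>{1..<m}. ?g n) + (\<Sum>n\<in>{Suc m..N}. ?g n)" by (intro sum.union_disjoint) auto
 also have "(\<Sum>n\<in>{1..<m}. ?g n) = (\<Sum>h\<in>(%n. nat \<bar>int m - int n\<bar>) ` {1..<m}. F h)" by (subst sum.reindex) (auto simp: inj_on_def)
 also have "... <= (\<Sum>h=1..N. F h)" using m F by (intro sum_mono2) auto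
 also have "(\<Sum>n\<in>{Suc m..N}. ?g n) = (\<Sum>h\<in>(%n. nat \<bar>int m - int n\<bar>) ` {Suc m..N}. F h)" by (subst sum.reindex) (auto simp: inj_on_def)
 also have "... <= (\<Sum>h=1..N. F h)" using m F by (intro sum_mono2) auto
 finally show ?thesis by simp
qed

text \<open>The number of divisors is bounded in mean square by powers of the logarithm, which the decay of the Moebius sum at \<open>L Q/N\<close> overcomes.\<close>
lemma tail_kernel_hs:
 assumes f: "!!x. x > 0 ==> \<bar>mobius_sum W x\<bar> <= C * rho 3 (1 / x)" and C: "C >= 0" and Q: "Q > 0" and L: "L >= 1" and N: "N >= 1"
 shows "(\<Sum>m=1..N. \<Sum>n=1..N. (tail_kernel W Q L m n)\<^sup>2) <= 2 * (real N)\<^sup>2 * (1 + ln (real N)) ^ 3 * (C * rho 3 (real L * Q / real N))\<^sup>2"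
proof -
 define r where "r = C * rho 3 (real L * Q / real N)"
 have r0: "r >= 0" using C by (simp add: r_def)
 have pt: "(tail_kernel W Q L m n)\<^sup>2 <= (real (ndiv (nat \<bar>int m - int n\<bar>)))\<^sup>2 * r\<^sup>2" if mn: "m \<in> {1..N}" "n \<in> {1..N}" "m ~= n" for m n
 proof -
  define h where "h = nat \<bar>int m - int n\<bar>"
  have h: "h > 0" "h <= N" using mn by (auto simp: h_def)
  have fin: "finite {l. l dvd h}" using h by (simp add: finite_divisors_nat)
  have "\<bar>tail_kernel W Q L m n\<bar> <= (\<Sum>l | l dvd h & l > L. \<bar>mobius_sum W (real h / (real l * Q))\<bar>)"
   using mn by (simp add: tail_kernel_def h_def sum_abs)
  also have "... <= (\<Sum>l | l dvd h & l > L. r)"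
  proof (rule sum_mono)
   fix l assume l: "l \<in> {l. l dvd h & l > L}"
   then have l0: "l > 0" using L by auto
   have "\<bar>mobius_sum W (real h / (real l * Q))\<bar> <= C * rho 3 (1 / (real h / (real l * Q)))" using h l0 Q by (intro f) auto
   also have "... <= r" unfolding r_def
   proof (intro mult_left_mono rho_antimono C)
    show "0 < real L * Q / real N" using L Q N by simp
    have "real L * Q / real N <= real l * Q / real h" using l h Q L by (intro frac_le mult_right_mono) auto
    then show "real L * Q / real N <= 1 / (real h / (real l * Q))" by simp
   qed
   finally show "\<bar>mobius_sum W (real h / (real l * Q))\<bar> <= r" .
  qed
  also have "... = real (card {l. l dvd h & l > L}) * r" by simp
  also have "... <= real (ndiv h) * r"
   unfolding ndiv_def using r0 fin by (intro mult_right_mono) (auto intro!: card_mono)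
  finally have "\<bar>tail_kernel W Q L m n\<bar> <= real (ndiv h) * r" .
  then have "\<bar>tail_kernel W Q L m n\<bar>\<^sup>2 <= (real (ndiv h) * r)\<^sup>2" by (intro power_mono) auto
  then show ?thesis by (simp add: h_def power_mult_distrib)
 qed
 have "(\<Sum>m=1..N. \<Sum>n=1..N. (tail_kernel W Q L m n)\<^sup>2) <= (\<Sum>m=1..N. 2 * (\<Sum>h=1..N. (real (ndiv h))\<^sup>2 * r\<^sup>2))"
 proof (rule sum_mono)
  fix m assume m: "m \<in> {1..N}"
  have "(\<Sum>n=1..N. (tail_kernel W Q L m n)\<^sup>2) = (\<Sum>n\<in>{1..N} - {m}. (tail_kernel W Q L m n)\<^sup>2)"
   using m by (subst sum.remove[of _ m]) (auto simp: tail_kernel_def)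
  also have "... <= (\<Sum>n\<in>{1..N} - {m}. (real (ndiv (nat \<bar>int m - int n\<bar>)))\<^sup>2 * r\<^sup>2)" using m by (intro sum_mono pt) auto
  also have "... <= 2 * (\<Sum>h=1..N. (real (ndiv h))\<^sup>2 * r\<^sup>2)" using m by (intro sum_distance_le) auto
  finally show "(\<Sum>n=1..N. (tail_kernel W Q L m n)\<^sup>2) <= 2 * (\<Sum>h=1..N. (real (ndiv h))\<^sup>2 * r\<^sup>2)" .
 qed
 also have "... = 2 * real N * r\<^sup>2 * (\<Sum>h=1..N. (real (ndiv h))\<^sup>2)" by (simp add: sum_distrib_left mult_ac)
 also have "... <= 2 * real N * r\<^sup>2 * (real N * (1 + ln (real N)) ^ 3)"
  using sum_ndiv_sq_le[of N] N by (intro mult_left_mono) (auto simp: max_def split: if_splits)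
 finally show ?thesis by (simp add: r_def power2_eq_square mult_ac)
qed

lemma rho_sum_le:
 assumes T: "T > 0" and P: "P >= 1"
 shows "(\<Sum>q\<in>{q\<in>{1..L}. real q > T * P}. rho 3 (real q / T) / real q) <= 2 * rho 2 P"
proof (cases "{q\<in>{1..L}. real q > T * P} = {}")
 case False
 let ?A = "{q\<in>{1..L}. real q > T * P}"
 define Z where "Z = Min ?A"
 have ZA: "Z \<in> ?A" unfolding Z_def using False by (intro Min_in) auto
 have ZT: "P <= real Z / T" using ZA T by (simp add: field_simps)
 have "?A \<subseteq> insert Z {Suc Z..L}"
 proof
  fix q assume q: "q \<in> ?A"
  then have "Z <= q" unfolding Z_def by (intro Min_le) auto
  then show "q \<in> insert Z {Suc Z..L}" using q by auto
 qed
 then have "(\<Sum>q\<in>?A. rho 3 (real q / T) / real q) <= (\<Sum>q\<in>insert Z {Suc Z..L}. rho 3 (real q / T) / real q)"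
  by (intro sum_mono2) auto
 also have "... = rho 3 (real Z / T) / real Z + (\<Sum>q=Suc Z..L. rho 3 (real q * (1 / T)) / real q)" by simp
 also have "(\<Sum>q=Suc Z..L. rho 3 (real q * (1 / T)) / real q) <= (rho 2 (real Z * (1 / T)) - rho 2 (real L * (1 / T))) / 2"
 proof (rule rho_telescope)
  show "1 <= real Z * (1 / T)" using ZT P by simp
 qed (use ZA T in auto)
 also have "... <= rho 2 (real Z / T)"
 proof -
  have le: "(a - b) / 2 <= a" if "0 <= a" "0 <= b" for a b :: real using that by simp
  show ?thesis unfolding mult_1_right times_divide_eq_right by (rule le; rule rho_nonneg)
 qed
 also have "... <= rho 2 P" using ZT P by (intro rho_antimono) auto
 also have "rho 3 (real Z / T) / real Z <= rho 2 P"
 proof -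
  have "rho 3 (real Z / T) / real Z <= rho 3 (real Z / T) / 1" using ZA by (intro divide_left_mono) auto
  also have "... <= rho 2 (real Z / T)" using rho_mono_exp[of 2 3] by simp
  also have "... <= rho 2 P" using ZT P by (intro rho_antimono) auto
  finally show ?thesis .
 qed
 finally show ?thesis by simp
next
 case True
 then show ?thesis by (simp only: sum.empty) simp
qed

definition cell_len :: "real => real => nat => nat" where
 "cell_len Q J q = nat \<lceil>real q * Q / J\<rceil>"

definition step_part :: "(real => real) => real => nat => real => real => nat => nat => nat => real" where
 "step_part W Q L J D q m n = (if real q <= D
   then block W L q (\<bar>real (m div cell_len Q J q) - real (n div cell_len Q J q)\<bar> * (real (cell_len Q J q) / Q)) else 0)"

lemma cell_len_bounds:
 assumes "q >= 1" "1 <= J" "J <= Q"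
 shows "cell_len Q J q >= 1" "real q * Q / J <= real (cell_len Q J q)" "real (cell_len Q J q) <= 2 * (real q * Q / J)"
proof -
 have "1 * 1 <= real q * (Q / J)" using assms by (intro mult_mono) auto
 then have x: "1 <= real q * Q / J" by simp
 define y where "y = real q * Q / J"
 have "1 <= y" using x by (simp add: y_def)
 then have "nat \<lceil>y\<rceil> >= 1" "y <= real (nat \<lceil>y\<rceil>)" "real (nat \<lceil>y\<rceil>) <= 2 * y" by linarith+
 then show "cell_len Q J q >= 1" "real q * Q / J <= real (cell_len Q J q)" "real (cell_len Q J q) <= 2 * (real q * Q / J)"
  unfolding cell_len_def y_def by simp_all
qed

text \<open>The three terms are the step approximation error for denominators up to \<open>T P\<close>, the size of the discarded larger denominators, and the interaction of distinct fractions.\<close>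
lemma head_residual_hs:
 assumes g1: "!!Y x. x > 0 ==> \<bar>gsum W Y x\<bar> <= C * rho 2 (1 / x)" and g2: "!!Y x. \<bar>gsum W Y x\<bar> <= C"
  and g3: "!!Y x y. x > 0 ==> y > 0 ==> \<bar>gsum W Y x - gsum W Y y\<bar> <= C * \<bar>x - y\<bar> / min x y"
  and Q: "Q > 0" and N: "N >= 1" and J: "1 <= J" "J <= Q" and P: "P >= 1"
 defines "T \<equiv> real N / Q"
 shows "(\<Sum>m=1..N. \<Sum>n=1..N. (cmod (\<Sum>t\<in>farey L. of_real ((block W L (fst t) (\<bar>real m - real n\<bar> / Q) - step_part W Q L J (T * P) (fst t) m n) / real (fst t)) * add_char ((real m - real n) * frac_of t)))\<^sup>2)
  <= 288 * C\<^sup>2 * real N * Q * T * P / J + 2 * C\<^sup>2 * (real N)\<^sup>2 * rho 2 P + (real L) ^ 6 * (2 * real N * (4 * C\<^sup>2 * (5 + 4 * ln (real N) + 2 * T * J)))"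
proof -
 have C: "C >= 0" using order_trans[OF abs_ge_zero g2] .
 have T: "T > 0" using N Q by (simp add: T_def)
 have blk1: "\<bar>block W L q x\<bar> <= C" for q x unfolding block_def by (rule g2)
 have blk2: "\<bar>block W L q x - block W L q y\<bar> <= C * \<bar>x - y\<bar> / min x y" if "q >= 1" "x > 0" "y > 0" for q x y
 proof -
  have q0: "real q > 0" using that by simp
  have "\<bar>block W L q x - block W L q y\<bar> <= C * \<bar>x / real q - y / real q\<bar> / min (x / real q) (y / real q)"
   unfolding block_def using that q0 by (intro g3) auto
  also have "min (x / real q) (y / real q) = min x y / real q" using q0 by (auto simp: min_def field_simps)
  also have "\<bar>x / real q - y / real q\<bar> = \<bar>x - y\<bar> / real q" using q0 by (simp add: diff_divide_distrib[symmetric])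
  finally show ?thesis using q0 by simp
 qed
 define b where "b = (%(t::nat\<times>nat) m n. (block W L (fst t) (\<bar>real m - real n\<bar> / Q) - step_part W Q L J (T * P) (fst t) m n) / real (fst t))"
 have fq: "fst t \<in> {1..L}" "snd t \<in> totatives (fst t)" if "t \<in> farey L" for t using that by (auto simp: farey_def)
 have sp: "\<bar>step_part W Q L J (T * P) q m n\<bar> <= C" for q m n using blk1 C by (simp add: step_part_def)
 define V where "V = 4 * C * (1 + ln (real N)) + 2 * C * (T * J)"
 have lnN: "ln (real N) >= 0" using N by simp
 have V0: "V >= 0" using C T J lnN by (simp add: V_def)
 have B: "\<bar>b t m n\<bar> <= 2 * C" if "t \<in> farey L" for t m n
 proof -
  have "\<bar>b t m n\<bar> = \<bar>block W L (fst t) (\<bar>real m - real n\<bar> / Q) - step_part W Q L J (T * P) (fst t) m n\<bar> / real (fst t)" by (simp add: b_def)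
  also have "... <= (2 * C) / 1"
   using fq[OF that] abs_triangle_ineq4[of "block W L (fst t) (\<bar>real m - real n\<bar> / Q)" "step_part W Q L J (T * P) (fst t) m n"]
    blk1[of "fst t" "\<bar>real m - real n\<bar> / Q"] sp[of "fst t" m n] C by (intro frac_le) auto
  finally show ?thesis by simp
 qed
 have TV: "tot_var N (%m. b t m n) <= V" if t: "t \<in> farey L" and n: "n \<in> {1..N}" for t n
 proof -
  define q where "q = fst t"
  have q: "q >= 1" using fq[OF t] by (simp add: q_def)
  have "tot_var N (%m. b t m n) = tot_var N (%m. block W L q (\<bar>real m - real n\<bar> / Q) - step_part W Q L J (T * P) q m n) / real q"
   by (simp add: tot_var_def b_def q_def sum_divide_distrib diff_divide_distrib[symmetric])
  also have "... <= tot_var N (%m. block W L q (\<bar>real m - real n\<bar> / Q) - step_part W Q L J (T * P) q m n) / 1"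
   using q tot_var_nonneg by (intro divide_left_mono) auto
  also have "... <= tot_var N (%m. block W L q (\<bar>real m - real n\<bar> / Q)) + tot_var N (%m. step_part W Q L J (T * P) q m n)"
   using tot_var_diff by simp
  also have "tot_var N (%m. block W L q (\<bar>real m - real n\<bar> / Q)) <= 4 * C * (1 + ln (real N))"
   by (rule tot_var_distance[OF blk1 blk2[OF q] Q n])
  also have "tot_var N (%m. step_part W Q L J (T * P) q m n) <= 2 * C * (T * J)"
  proof (cases "real q <= T * P")
   case True
   note cl = cell_len_bounds[OF q J]
   have "tot_var N (%m. step_part W Q L J (T * P) q m n) <= 2 * C * real (N div cell_len Q J q)"
    using True tot_var_step[where g = "block W L q" and C = C and H = "cell_len Q J q" and y = "real (n div cell_len Q J q)" and z = "real (cell_len Q J q) / Q", OF blk1 N] by (simp add: step_part_def)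
   also have "... <= 2 * C * (T * J)"
   proof (intro mult_left_mono)
    have "real (N div cell_len Q J q) <= real N / real (cell_len Q J q)" by (rule real_div_le)
    also have "... <= real N / (real q * Q / J)" using cl q Q J by (intro divide_left_mono mult_pos_pos) auto
    also have "... = (T * J) / real q" by (simp add: T_def)
    also have "... <= (T * J) / 1" using q T J by (intro divide_left_mono) auto
    finally show "real (N div cell_len Q J q) <= T * J" by simp
   qed (use C in auto)
   finally show ?thesis .
  next
   case False
   then show ?thesis using C T J by (simp add: step_part_def tot_var_def)
  qed
  finally show ?thesis by (simp add: V_def)
 qed
 have no: "(\<Sum>m=1..N. \<Sum>n=1..N. (cmod (\<Sum>t\<in>farey L. of_real (b t m n) * add_char ((real m - real n) * (real (snd t) / real (fst t)))))\<^sup>2)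
  <= (\<Sum>t\<in>farey L. \<Sum>m=1..N. \<Sum>n=1..N. (b t m n)\<^sup>2) + (real L) ^ 6 * (2 * real N * ((2 * C)\<^sup>2 + 2 * (2 * C) * V))"
  by (rule near_orthogonality) (use B TV N C V0 in \<open>auto simp: farey_def\<close>)
 have e: "(2 * C)\<^sup>2 + 2 * (2 * C) * V = 4 * C\<^sup>2 * (5 + 4 * ln (real N) + 2 * T * J)"
  by (simp add: V_def power2_eq_square algebra_simps)
 define s where "s = (%q m n. block W L q (\<bar>real m - real n\<bar> / Q) - step_part W Q L J (T * P) q m n)"
 have "(\<Sum>t\<in>farey L. \<Sum>m=1..N. \<Sum>n=1..N. (b t m n)\<^sup>2) = (\<Sum>q=1..L. \<Sum>a\<in>totatives q. (\<Sum>m=1..N. \<Sum>n=1..N. (s q m n)\<^sup>2) / (real q)\<^sup>2)"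
  unfolding farey_def by (subst sum.Sigma) (auto simp: case_prod_beta b_def s_def power_divide sum_divide_distrib)
 also have "... = (\<Sum>q=1..L. real (totient q) * ((\<Sum>m=1..N. \<Sum>n=1..N. (s q m n)\<^sup>2) / (real q)\<^sup>2))"
  by (simp add: totient_def)
 also have "... <= (\<Sum>q=1..L. (if real q <= T * P then 288 * C\<^sup>2 * real N * Q / J else 0) + (if real q > T * P then C\<^sup>2 * (real N)\<^sup>2 * (rho 3 (real q / T) / real q) else 0))"
 proof (rule sum_mono)
  fix q assume "q \<in> {1..L}"
  then have q: "q >= 1" by simp
  let ?X = "\<Sum>m=1..N. \<Sum>n=1..N. (s q m n)\<^sup>2"
  have "real (totient q) * (?X / (real q)\<^sup>2) <= real q * (?X / (real q)\<^sup>2)"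
   by (intro mult_right_mono) (auto simp: totient_le intro!: divide_nonneg_nonneg sum_nonneg)
  also have "... = ?X / real q" using q by (simp add: power2_eq_square)
  also have "... <= (if real q <= T * P then 288 * C\<^sup>2 * real N * Q / J else 0) + (if real q > T * P then C\<^sup>2 * (real N)\<^sup>2 * (rho 3 (real q / T) / real q) else 0)"
  proof (cases "real q <= T * P")
   case True
   note cl = cell_len_bounds[OF q J]
   have "?X = (\<Sum>n=1..N. \<Sum>m=1..N. (s q m n)\<^sup>2)" by (rule sum.swap)
   also have "... <= (\<Sum>n=1..N. 144 * C\<^sup>2 * real (cell_len Q J q))"
   proof (rule sum_mono)
    fix n
    show "(\<Sum>m=1..N. (s q m n)\<^sup>2) <= 144 * C\<^sup>2 * real (cell_len Q J q)"
     using step_approximation_error[where g = "block W L q" and C = C and H = "cell_len Q J q" and N = N and n = n, OF blk1 blk2[OF q] Q] cl True by (simp add: s_def step_part_def)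
   qed
   also have "... = real N * (144 * C\<^sup>2 * real (cell_len Q J q))" by simp
   also have "... <= real N * (144 * C\<^sup>2 * (2 * (real q * Q / J)))" using cl by (intro mult_left_mono) auto
   finally have "?X / real q <= real N * (144 * C\<^sup>2 * (2 * (real q * Q / J))) / real q" by (intro divide_right_mono) auto
   also have "... = 288 * C\<^sup>2 * real N * Q / J" using q by (simp add: mult_ac)
   finally show ?thesis using True by simp
  next
   case False
   have "?X <= (\<Sum>m=1..N. \<Sum>n=1..N. C\<^sup>2 * rho 3 (real q / T))"
   proof (intro sum_mono)
    fix m n assume mn: "m \<in> {1..N}" "n \<in> {1..N}"
    have s: "s q m n = block W L q (\<bar>real m - real n\<bar> / Q)" using False by (simp add: s_def step_part_def)
    show "(s q m n)\<^sup>2 <= C\<^sup>2 * rho 3 (real q / T)"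
    proof (cases "m = n")
     case True
     then have "s q m n = 0" using s by (simp add: block_def gsum_def)
     then show ?thesis by simp
    next
     case False
     define x where "x = \<bar>real m - real n\<bar> / Q / real q"
     have d: "0 < \<bar>real m - real n\<bar>" "\<bar>real m - real n\<bar> <= real N" using mn False by auto
     then have x: "x > 0" using Q q by (simp add: x_def)
     have "\<bar>s q m n\<bar> <= C * rho 2 (1 / x)" using g1[OF x, of "L div q"] by (simp add: s block_def x_def)
     also have "... <= C * rho 2 (real q / T)"
     proof (intro mult_left_mono rho_antimono C)
      show "0 < real q / T" using q T by simp
      have "\<bar>real m - real n\<bar> / Q <= T" using d Q by (simp add: T_def divide_right_mono)
      then have "x <= T / real q" unfolding x_def using q by (intro divide_right_mono) auto
      then have "1 / (T / real q) <= 1 / x" using x by (intro divide_left_mono mult_pos_pos) (use q T in auto)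
      then show "real q / T <= 1 / x" by simp
     qed
     finally have "\<bar>s q m n\<bar>\<^sup>2 <= (C * rho 2 (real q / T))\<^sup>2" by (intro power_mono) auto
     also have "... = C\<^sup>2 * rho 4 (real q / T)" by (simp add: rho_def power_mult_distrib power_divide flip: power_mult)
     also have "... <= C\<^sup>2 * rho 3 (real q / T)" by (intro mult_left_mono rho_mono_exp) auto
     finally show ?thesis by simp
    qed
   qed
   also have "... = C\<^sup>2 * (real N)\<^sup>2 * rho 3 (real q / T)" by (simp add: power2_eq_square)
   finally have "?X / real q <= C\<^sup>2 * (real N)\<^sup>2 * rho 3 (real q / T) / real q" by (intro divide_right_mono) auto
   then show ?thesis using False by simp
  qed
  finally show "real (totient q) * (?X / (real q)\<^sup>2) <= (if real q <= T * P then 288 * C\<^sup>2 * real N * Q / J else 0) + (if real q > T * P then C\<^sup>2 * (real N)\<^sup>2 * (rho 3 (real q / T) / real q) else 0)" .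
 qed
 also have "... = (\<Sum>q\<in>{q\<in>{1..L}. real q <= T * P}. 288 * C\<^sup>2 * real N * Q / J) + (\<Sum>q\<in>{q\<in>{1..L}. real q > T * P}. C\<^sup>2 * (real N)\<^sup>2 * (rho 3 (real q / T) / real q))"
  unfolding sum.distrib by (simp only: sum.inter_filter[OF finite_atLeastAtMost])
 also have "(\<Sum>q\<in>{q\<in>{1..L}. real q <= T * P}. 288 * C\<^sup>2 * real N * Q / J) <= (T * P) * (288 * C\<^sup>2 * real N * Q / J)"
 proof -
  have "card {q\<in>{1..L}. real q <= T * P} <= card {1..nat \<lfloor>T * P\<rfloor>}"
   using T P by (intro card_mono) (auto simp: le_nat_floor)
  then have "real (card {q\<in>{1..L}. real q <= T * P}) <= real (nat \<lfloor>T * P\<rfloor>)" by simp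
  also have "... <= T * P" using T P by (intro of_nat_floor) auto
  finally have "real (card {q\<in>{1..L}. real q <= T * P}) * (288 * C\<^sup>2 * real N * Q / J) <= (T * P) * (288 * C\<^sup>2 * real N * Q / J)"
   using Q J by (intro mult_right_mono) auto
  then show ?thesis by simp
 qed
 also have "(\<Sum>q\<in>{q\<in>{1..L}. real q > T * P}. C\<^sup>2 * (real N)\<^sup>2 * (rho 3 (real q / T) / real q)) = C\<^sup>2 * (real N)\<^sup>2 * (\<Sum>q\<in>{q\<in>{1..L}. real q > T * P}. rho 3 (real q / T) / real q)"
  by (rule sum_distrib_left[symmetric])
 also have "... <= C\<^sup>2 * (real N)\<^sup>2 * (2 * rho 2 P)" by (intro mult_left_mono rho_sum_le T P) auto
 finally have "(\<Sum>t\<in>farey L. \<Sum>m=1..N. \<Sum>n=1..N. (b t m n)\<^sup>2) <= (T * P) * (288 * C\<^sup>2 * real N * Q / J) + C\<^sup>2 * (real N)\<^sup>2 * (2 * rho 2 P)" by simp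
 with no show ?thesis unfolding e by (simp add: b_def frac_of_def mult_ac)
qed

section \<open>The exceptional subspace\<close>

text \<open>The restriction of the character of a Farey fraction to one cell; the step kernel factors through these vectors.\<close>
definition cell_vec :: "nat => nat => nat \<times> nat => nat => nat => complex" where
 "cell_vec N H t i m = (if m \<in> {1..N} & m div H = i then add_char (- (real m * frac_of t)) else 0)"

definition step_kernel :: "(real => real) => real => nat => real => real => nat => nat => complex" where
 "step_kernel W Q L J D m n = (\<Sum>t\<in>farey L. of_real (step_part W Q L J D (fst t) m n / real (fst t)) * add_char ((real m - real n) * frac_of t))"

definition step_space :: "nat => real => nat => real => real => (nat => complex) set" where
 "step_space N Q L J D = (\<Union>t\<in>{t\<in>farey L. real (fst t) <= D}. cell_vec N (cell_len Q J (fst t)) t ` {..N div cell_len Q J (fst t)})"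

text \<open>The step kernel is constant on products of cells, up to the characters, hence vanishes on vectors orthogonal to all restricted characters.\<close>
lemma step_form_zero:
 assumes N: "N >= 1" and orth: "!!\<psi>. \<psi> \<in> step_space N Q L J D ==> herm N \<phi> \<psi> = 0"
 shows "(\<Sum>m=1..N. \<Sum>n=1..N. \<phi> m * cnj (\<phi> n) * step_kernel W Q L J D m n) = 0"
proof -
 have "(\<Sum>m=1..N. \<Sum>n=1..N. \<phi> m * cnj (\<phi> n) * step_kernel W Q L J D m n)
   = (\<Sum>m=1..N. \<Sum>n=1..N. \<Sum>t\<in>farey L. \<phi> m * cnj (\<phi> n) * (of_real (step_part W Q L J D (fst t) m n / real (fst t)) * add_char ((real m - real n) * frac_of t)))"
  by (simp only: step_kernel_def sum_distrib_left)
 also have "... = (\<Sum>t\<in>farey L. \<Sum>m=1..N. \<Sum>n=1..N. \<phi> m * cnj (\<phi> n) * (of_real (step_part W Q L J D (fst t) m n / real (fst t)) * add_char ((real m - real n) * frac_of t)))"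
  by (rule sum_swap3[symmetric])
 also have "... = 0"
 proof (rule sum.neutral, rule ballI)
  fix t assume t: "t \<in> farey L"
  show "(\<Sum>m=1..N. \<Sum>n=1..N. \<phi> m * cnj (\<phi> n) * (of_real (step_part W Q L J D (fst t) m n / real (fst t)) * add_char ((real m - real n) * frac_of t))) = 0"
  proof (cases "real (fst t) <= D")
   case True
   define H where "H = cell_len Q J (fst t)"
   define G where "G = (%i j. block W L (fst t) (\<bar>real i - real j\<bar> * (real H / Q)) / real (fst t))"
   have cell0: "(\<Sum>m\<in>{m\<in>{1..N}. m div H = i}. \<phi> m * add_char (real m * frac_of t)) = 0" if i: "i <= N div H" for i
   proof -
    have "cell_vec N H t i \<in> step_space N Q L J D"
     unfolding step_space_def by (rule UN_I[of t]) (use t True i in \<open>simp_all add: H_def\<close>)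
    then have "(\<Sum>m=1..N. \<phi> m * cnj (cell_vec N H t i m)) = 0" using orth herm_eq_0_iff[OF N] by blast
    moreover have "(\<Sum>m=1..N. \<phi> m * cnj (cell_vec N H t i m)) = (\<Sum>m=1..N. if m div H = i then \<phi> m * add_char (real m * frac_of t) else 0)"
     by (intro sum.cong refl) (auto simp: cell_vec_def cnj_add_char)
    ultimately show ?thesis unfolding sum.inter_filter[OF finite_atLeastAtMost] by simp
   qed
   have inner: "(\<Sum>m=1..N. \<phi> m * (of_real (G (m div H) j) * add_char (real m * frac_of t))) = 0" for j
   proof -
    have "(\<Sum>m=1..N. \<phi> m * (of_real (G (m div H) j) * add_char (real m * frac_of t)))
     = (\<Sum>i\<le>N div H. \<Sum>m\<in>{m\<in>{1..N}. m div H = i}. \<phi> m * (of_real (G (m div H) j) * add_char (real m * frac_of t)))"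
     by (rule sum.group[symmetric]) (auto intro: div_le_mono)
    also have "... = (\<Sum>i\<le>N div H. of_real (G i j) * (\<Sum>m\<in>{m\<in>{1..N}. m div H = i}. \<phi> m * add_char (real m * frac_of t)))"
     unfolding sum_distrib_left by (intro sum.cong refl) auto
    also have "... = 0" by (rule sum.neutral) (use cell0 in auto)
    finally show ?thesis .
   qed
   have "(\<Sum>m=1..N. \<Sum>n=1..N. \<phi> m * cnj (\<phi> n) * (of_real (step_part W Q L J D (fst t) m n / real (fst t)) * add_char ((real m - real n) * frac_of t)))
    = (\<Sum>m=1..N. \<Sum>n=1..N. cnj (\<phi> n) * add_char (- (real n * frac_of t)) * (\<phi> m * (of_real (G (m div H) (n div H)) * add_char (real m * frac_of t))))"
   proof (intro sum.cong refl)
    fix m n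
    have "add_char ((real m - real n) * frac_of t) = add_char (real m * frac_of t) * add_char (- (real n * frac_of t))"
     unfolding add_char_add[symmetric] by (simp add: left_diff_distrib)
    moreover have "step_part W Q L J D (fst t) m n / real (fst t) = G (m div H) (n div H)"
     using True by (simp add: step_part_def G_def H_def)
    ultimately show "\<phi> m * cnj (\<phi> n) * (of_real (step_part W Q L J D (fst t) m n / real (fst t)) * add_char ((real m - real n) * frac_of t))
     = cnj (\<phi> n) * add_char (- (real n * frac_of t)) * (\<phi> m * (of_real (G (m div H) (n div H)) * add_char (real m * frac_of t)))"
     by (simp only: mult_ac)
   qed
   also have "... = (\<Sum>n=1..N. cnj (\<phi> n) * add_char (- (real n * frac_of t)) * (\<Sum>m=1..N. \<phi> m * (of_real (G (m div H) (n div H)) * add_char (real m * frac_of t))))"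
    unfolding sum_distrib_left by (rule sum.swap)
   also have "... = 0" unfolding inner by simp
   finally show ?thesis .
  qed (simp add: step_part_def)
 qed
 finally show ?thesis .
qed

text \<open>There are at most \<open>N J/(q Q) + 1\<close> cells for each of the at most \<open>q\<close> fractions of denominator \<open>q \<le> D\<close>.\<close>
lemma step_space_card:
 assumes J: "1 <= J" "J <= Q" and D: "D >= 0"
 shows "finite (step_space N Q L J D)" "step_space N Q L J D \<subseteq> seq_space N"
  "real (card (step_space N Q L J D)) <= D * (real N / Q * J) + D * D"
proof -
 let ?A = "{t\<in>farey L. real (fst t) <= D}"
 show "step_space N Q L J D \<subseteq> seq_space N" by (auto simp: step_space_def cell_vec_def seq_space_def)
 show fin: "finite (step_space N Q L J D)" unfolding step_space_def by auto
 have Q: "Q > 0" using J by linarith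
 have "card (step_space N Q L J D) <= (\<Sum>t\<in>?A. card (cell_vec N (cell_len Q J (fst t)) t ` {..N div cell_len Q J (fst t)}))"
  unfolding step_space_def by (rule card_UN_le) auto
 then have "real (card (step_space N Q L J D)) <= (\<Sum>t\<in>?A. real (card (cell_vec N (cell_len Q J (fst t)) t ` {..N div cell_len Q J (fst t)})))"
  by (simp flip: of_nat_sum)
 also have "... <= (\<Sum>t\<in>?A. real N / Q * J / real (fst t) + 1)"
 proof (rule sum_mono)
  fix t assume t: "t \<in> ?A"
  define q where "q = fst t"
  have q: "q >= 1" using t by (auto simp: farey_def q_def)
  note cl = cell_len_bounds[OF q J]
  have "real (card (cell_vec N (cell_len Q J q) t ` {..N div cell_len Q J q})) <= real (N div cell_len Q J q) + 1"
   using card_image_le[of "{..N div cell_len Q J q}" "cell_vec N (cell_len Q J q) t"] by simp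
  also have "real (N div cell_len Q J q) <= real N / real (cell_len Q J q)" by (rule real_div_le)
  also have "real N / real (cell_len Q J q) <= real N / (real q * Q / J)" using cl q Q J by (intro divide_left_mono mult_pos_pos) auto
  also have "real N / (real q * Q / J) = real N / Q * J / real q" by simp
  finally show "real (card (cell_vec N (cell_len Q J (fst t)) t ` {..N div cell_len Q J (fst t)})) <= real N / Q * J / real (fst t) + 1"
   by (simp add: q_def)
 qed
 also have "... = (\<Sum>t\<in>Sigma {q\<in>{1..L}. real q <= D} totatives. real N / Q * J / real (fst t) + 1)"
  by (intro sum.cong refl) (auto simp: farey_def)
 also have "... = (\<Sum>q\<in>{q\<in>{1..L}. real q <= D}. \<Sum>a\<in>totatives q. real N / Q * J / real q + 1)"
  by (subst sum.Sigma) (auto simp: case_prod_beta)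
 also have "... = (\<Sum>q\<in>{q\<in>{1..L}. real q <= D}. real (totient q) * (real N / Q * J / real q + 1))" by (simp add: totient_def)
 also have "... <= (\<Sum>q\<in>{q\<in>{1..L}. real q <= D}. real N / Q * J + D)"
 proof (rule sum_mono)
  fix q assume q: "q \<in> {q\<in>{1..L}. real q <= D}"
  have "real (totient q) * (real N / Q * J / real q + 1) <= real q * (real N / Q * J / real q + 1)"
   using J Q by (intro mult_right_mono add_nonneg_nonneg) (auto simp: totient_le)
  also have "... = real N / Q * J + real q" using q by (simp add: field_simps)
  also have "... <= real N / Q * J + D" using q by simp
  finally show "real (totient q) * (real N / Q * J / real q + 1) <= real N / Q * J + D" .
 qed
 also have "... = real (card {q\<in>{1..L}. real q <= D}) * (real N / Q * J + D)" by simp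
 also have "... <= D * (real N / Q * J + D)"
 proof (rule mult_right_mono)
  have "card {q\<in>{1..L}. real q <= D} <= card {1..nat \<lfloor>D\<rfloor>}" using D by (intro card_mono) (auto simp: le_nat_floor)
  then have "real (card {q\<in>{1..L}. real q <= D}) <= real (nat \<lfloor>D\<rfloor>)" by simp
  also have "... <= D" using D by (intro of_nat_floor) auto
  finally show "real (card {q\<in>{1..L}. real q <= D}) <= D" .
  show "0 <= real N / Q * J + D" using J Q D by simp
 qed
 finally show "real (card (step_space N Q L J D)) <= D * (real N / Q * J) + D * D" by (simp add: distrib_left)
qed

lemma seq_space_subspace: "seq.subspace (seq_space N)"
 by (auto simp: seq.subspace_def seq_space_def seq_scale_def)

text \<open>Combine the vectors that annihilate the step kernel with the large singular directions of the remainder.\<close>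
lemma exceptional_subspace:
 assumes W: "!!u. u > 2 ==> W u = 0" and I0: "I0 W Q ~= 0" and J: "1 <= J" "J <= Q" and D: "D >= 0"
  and N: "N >= 1" and e: "\<epsilon> > 0"
  and hs: "2 / (Q * I0 W Q)\<^sup>2 * ((\<Sum>m=1..N. \<Sum>n=1..N. (cmod (head_kernel W Q L m n - step_kernel W Q L J D m n))\<^sup>2) + (\<Sum>m=1..N. \<Sum>n=1..N. (tail_kernel W Q L m n)\<^sup>2)) <= Hs"
 obtains V where "seq.subspace V" "V \<subseteq> seq_space N" "real (seq.dim V) <= D * (real N / Q * J) + D * D + Hs / \<epsilon>\<^sup>2"
  "!!\<phi>. \<phi> \<in> seq_space N ==> (\<forall>\<psi>\<in>V. herm N \<phi> \<psi> = 0) ==> \<bar>sieve_sum W N Q \<phi> - sq_norm N \<phi>\<bar> <= \<epsilon> * sq_norm N \<phi>"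
proof -
 have Q: "Q > 0" using J by linarith
 define R where "R = (%m n. (head_kernel W Q L m n - step_kernel W Q L J D m n + of_real (tail_kernel W Q L m n)) / of_real (Q * I0 W Q))"
 have pt: "(cmod (R m n))\<^sup>2 <= 2 / (Q * I0 W Q)\<^sup>2 * ((cmod (head_kernel W Q L m n - step_kernel W Q L J D m n))\<^sup>2 + (tail_kernel W Q L m n)\<^sup>2)" for m n
 proof -
  let ?a = "cmod (head_kernel W Q L m n - step_kernel W Q L J D m n)" and ?b = "\<bar>tail_kernel W Q L m n\<bar>"
  have "cmod (head_kernel W Q L m n - step_kernel W Q L J D m n + of_real (tail_kernel W Q L m n)) <= ?a + ?b"
   by (rule order_trans[OF norm_triangle_ineq]) simp
  then have "(cmod (head_kernel W Q L m n - step_kernel W Q L J D m n + of_real (tail_kernel W Q L m n)))\<^sup>2 <= (?a + ?b)\<^sup>2"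
   by (intro power_mono) auto
  also have "... <= 2 * (?a\<^sup>2 + ?b\<^sup>2)" using sum_squares_bound[of ?a ?b] by (simp add: power2_sum)
  finally have "(cmod (head_kernel W Q L m n - step_kernel W Q L J D m n + of_real (tail_kernel W Q L m n)))\<^sup>2 / (Q * I0 W Q)\<^sup>2
    <= 2 * (?a\<^sup>2 + ?b\<^sup>2) / (Q * I0 W Q)\<^sup>2" by (intro divide_right_mono) auto
  then show ?thesis unfolding R_def norm_divide norm_of_real power_divide power2_abs by simp
 qed
 have "(\<Sum>m=1..N. \<Sum>n=1..N. (cmod (R n m))\<^sup>2) = (\<Sum>m=1..N. \<Sum>n=1..N. (cmod (R m n))\<^sup>2)" by (rule sum.swap)
 also have "... <= (\<Sum>m=1..N. \<Sum>n=1..N. 2 / (Q * I0 W Q)\<^sup>2 * ((cmod (head_kernel W Q L m n - step_kernel W Q L J D m n))\<^sup>2 + (tail_kernel W Q L m n)\<^sup>2))"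
  by (intro sum_mono pt)
 also have "... <= Hs" using hs by (simp only: sum_distrib_left[symmetric] sum.distrib)
 finally have H: "(\<Sum>m=1..N. \<Sum>n=1..N. (cmod (R n m))\<^sup>2) <= Hs" .
 obtain B where B: "finite B" "B \<subseteq> seq_space N" "real (card B) <= Hs / \<epsilon>\<^sup>2"
  "!!\<phi>. \<phi> \<in> seq_space N ==> (\<forall>\<psi>\<in>B. herm N \<phi> \<psi> = 0) ==>
    (\<Sum>m=1..N. (cmod (\<Sum>n=1..N. R n m * \<phi> n))\<^sup>2) <= \<epsilon>\<^sup>2 * sq_norm N \<phi>"
  by (rule hilbert_schmidt_subspace[OF N e H]) blast
 note S = step_space_card[OF J D, of N L]
 define V where "V = seq.span (step_space N Q L J D \<union> B)"
 show ?thesis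
 proof (rule that[of V])
  show "seq.subspace V" by (simp add: V_def)
  show "V \<subseteq> seq_space N" unfolding V_def using S(2) B(2) by (intro seq.span_minimal seq_space_subspace) auto
  have "seq.dim V <= card (step_space N Q L J D \<union> B)"
   unfolding V_def seq.dim_span using S(1) B(1) by (intro seq.dim_le_card') auto
  also have "... <= card (step_space N Q L J D) + card B" by (rule card_Un_le)
  finally have "real (seq.dim V) <= real (card (step_space N Q L J D)) + real (card B)" by (simp flip: of_nat_add)
  then show "real (seq.dim V) <= D * (real N / Q * J) + D * D + Hs / \<epsilon>\<^sup>2" using S(3) B(3) by linarith
  fix \<phi> assume p: "\<phi> \<in> seq_space N" "\<forall>\<psi>\<in>V. herm N \<phi> \<psi> = 0"
  have o1: "herm N \<phi> \<psi> = 0" if "\<psi> \<in> step_space N Q L J D" for \<psi> using p(2) that seq.span_base unfolding V_def by blast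
  have o2: "\<forall>\<psi>\<in>B. herm N \<phi> \<psi> = 0" using p(2) seq.span_base unfolding V_def by blast
  let ?c = "complex_of_real (Q * I0 W Q)"
  have "of_real (sieve_sum W N Q \<phi>) - of_real (sq_norm N \<phi>) = (\<Sum>m=1..N. \<Sum>n=1..N. \<phi> m * cnj (\<phi> n) * ((head_kernel W Q L m n + of_real (tail_kernel W Q L m n)) / ?c))"
   using sieve_sum_split[of W Q N \<phi> L, OF W Q I0] by simp
  also have "... = (\<Sum>m=1..N. \<Sum>n=1..N. \<phi> m * cnj (\<phi> n) * R m n + \<phi> m * cnj (\<phi> n) * step_kernel W Q L J D m n / ?c)"
  proof (intro sum.cong refl)
   fix m n
   have "(head_kernel W Q L m n + of_real (tail_kernel W Q L m n)) / ?c = R m n + step_kernel W Q L J D m n / ?c"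
    unfolding R_def by (simp add: add_divide_distrib diff_divide_distrib)
   then show "\<phi> m * cnj (\<phi> n) * ((head_kernel W Q L m n + of_real (tail_kernel W Q L m n)) / ?c) = \<phi> m * cnj (\<phi> n) * R m n + \<phi> m * cnj (\<phi> n) * step_kernel W Q L J D m n / ?c"
    by (simp add: distrib_left)
  qed
  also have "... = (\<Sum>m=1..N. \<Sum>n=1..N. \<phi> m * cnj (\<phi> n) * R m n) + (\<Sum>m=1..N. \<Sum>n=1..N. \<phi> m * cnj (\<phi> n) * step_kernel W Q L J D m n) / ?c"
   by (simp only: sum.distrib sum_divide_distrib)
  also have "... = (\<Sum>m=1..N. \<Sum>n=1..N. \<phi> m * cnj (\<phi> n) * R m n)" using step_form_zero[OF N o1] by simp
  also have "... = (\<Sum>m=1..N. \<Sum>n=1..N. \<phi> n * cnj (\<phi> m) * R n m)" by (rule sum.swap)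
  finally have eq: "complex_of_real (sieve_sum W N Q \<phi> - sq_norm N \<phi>) = (\<Sum>m=1..N. \<Sum>n=1..N. \<phi> n * cnj (\<phi> m) * R n m)" by simp
  have "\<bar>sieve_sum W N Q \<phi> - sq_norm N \<phi>\<bar> = cmod (complex_of_real (sieve_sum W N Q \<phi> - sq_norm N \<phi>))" by (simp only: norm_of_real)
  also have "... <= \<epsilon> * sq_norm N \<phi>" unfolding eq by (rule quadratic_form_le[OF B(4)[OF p(1) o2] e])
  finally show "\<bar>sieve_sum W N Q \<phi> - sq_norm N \<phi>\<bar> <= \<epsilon> * sq_norm N \<phi>" .
 qed
qed

lemma x_ln_inverse_le: "0 < x ==> x <= 1 ==> x * ln (1 / x) <= (1::real)"
 using ln_le_minus_one[of "1 / x"] by (simp add: field_simps)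

text \<open>The whole space serves as exceptional space whenever the required dimension exceeds \<open>N\<close>.\<close>
lemma seq_space_full:
 fixes N :: nat
 shows "real (seq.dim (seq_space N)) <= real N"
  and "\<phi> \<in> seq_space N ==> N >= 1 ==> (\<forall>\<psi>\<in>seq_space N. herm N \<phi> \<psi> = 0) ==> sq_norm N \<phi> = 0 & sieve_sum W N Q \<phi> = 0"
proof -
 define b where "b = (%i::nat. (%n::nat. if n = i then (1::complex) else 0))"
 have "seq_space N \<subseteq> seq.span (b ` {1..N})"
 proof
  fix f assume f: "f \<in> seq_space N"
  have "f = (\<Sum>i=1..N. seq_scale (f i) (b i))"
  proof
   fix n
   have sumfun: "(\<Sum>i\<in>A. g i) n = (\<Sum>i\<in>A. g i n)" for A :: "nat set" and g :: "nat => nat => complex"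
    by (induction A rule: infinite_finite_induct) auto
   have "(\<Sum>i=1..N. seq_scale (f i) (b i)) n = (\<Sum>i=1..N. if i = n then f n else 0)"
    unfolding sumfun by (intro sum.cong refl) (auto simp: seq_scale_def b_def)
   also have "... = f n" using f by (auto simp: seq_space_def)
   finally show "f n = (\<Sum>i=1..N. seq_scale (f i) (b i)) n" by simp
  qed
  also have "... \<in> seq.span (b ` {1..N})" by (intro seq.span_sum seq.span_scale seq.span_base) auto
  finally show "f \<in> seq.span (b ` {1..N})" .
 qed
 then have "seq.dim (seq_space N) <= card (b ` {1..N})" by (intro seq.dim_le_card) auto
 also have "... <= N" using card_image_le[of "{1..N}" b] by simp
 finally show "real (seq.dim (seq_space N)) <= real N" by simp
 assume p: "\<phi> \<in> seq_space N" "N >= 1" "\<forall>\<psi>\<in>seq_space N. herm N \<phi> \<psi> = 0"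
 then have "(\<Sum>n=1..N. \<phi> n * cnj (\<phi> n)) = 0" using herm_eq_0_iff by blast
 then have "complex_of_real (sq_norm N \<phi>) = 0" unfolding sq_norm_def by (simp only: of_real_sum complex_norm_square)
 then have z: "sq_norm N \<phi> = 0" by simp
 then have "\<forall>n\<in>{1..N}. (cmod (\<phi> n))\<^sup>2 = 0" unfolding sq_norm_def by (subst (asm) sum_nonneg_eq_0_iff) auto
 then have "trig_sum N \<phi> x = 0" for x by (simp add: trig_sum_def)
 then show "sq_norm N \<phi> = 0 & sieve_sum W N Q \<phi> = 0" using z by (simp add: sieve_sum_def)
qed

text \<open>Any sufficiently small power of \<open>Q\<close> would do: the sixth power of the cutoff must stay below \<open>Q\<close>, with room for \<open>\<tau>\<close> and the cell count.\<close>
definition cutoff :: "real => nat" where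
 "cutoff Q = nat \<lfloor>Q powr (1/20)\<rfloor>"

lemma cutoff_bounds:
 assumes "Q >= 1"
 shows "cutoff Q >= 1" "real (cutoff Q) <= Q powr (1/20)" "Q powr (1/20) <= 2 * real (cutoff Q)"
proof -
 define x where "x = Q powr (1/20)"
 have "x >= 1" using assms by (auto simp: x_def intro!: ge_one_powr_ge_zero)
 then have "\<lfloor>x\<rfloor> >= 1" "real (nat \<lfloor>x\<rfloor>) = real_of_int \<lfloor>x\<rfloor>" by simp_all
 then have "nat \<lfloor>x\<rfloor> >= 1" "real (nat \<lfloor>x\<rfloor>) <= x" "x <= 2 * real (nat \<lfloor>x\<rfloor>)" by linarith+
 then show "cutoff Q >= 1" "real (cutoff Q) <= Q powr (1/20)" "Q powr (1/20) <= 2 * real (cutoff Q)"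
  unfolding cutoff_def x_def by auto
qed

lemma tail_bound_asymptotic:
 obtains Q0 where "Q0 >= 3" "!!Q T N. Q >= Q0 ==> Q powr (-1/40) <= T ==> T <= Q powr (1/40) ==> real N = T * Q ==>
   (1 + ln (real N)) ^ 3 * (rho 3 (real (cutoff Q) * Q / real N))\<^sup>2 * (2 * ln Q) <= 1"
proof -
 have "((%Q::real. (1 + 2 * ln Q) ^ 3 * (1 / (1 + ln (Q powr (1/40) / 2)) ^ 3)\<^sup>2 * (2 * ln Q)) \<longlongrightarrow> 0) at_top" by real_asymp
 then have "eventually (%Q::real. (1 + 2 * ln Q) ^ 3 * (1 / (1 + ln (Q powr (1/40) / 2)) ^ 3)\<^sup>2 * (2 * ln Q) < 1) at_top"
  by (rule order_tendstoD) simp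
 moreover have "eventually (%Q::real. ln (Q powr (1/40) / 2) >= 0) at_top" by real_asymp
 ultimately have "eventually (%Q::real. (1 + 2 * ln Q) ^ 3 * (1 / (1 + ln (Q powr (1/40) / 2)) ^ 3)\<^sup>2 * (2 * ln Q) < 1 & ln (Q powr (1/40) / 2) >= 0) at_top"
  by (rule eventually_conj)
 then obtain Q0 where Q0: "!!Q::real. Q >= Q0 ==> (1 + 2 * ln Q) ^ 3 * (1 / (1 + ln (Q powr (1/40) / 2)) ^ 3)\<^sup>2 * (2 * ln Q) < 1 & ln (Q powr (1/40) / 2) >= 0"
  unfolding eventually_at_top_linorder by blast
 show ?thesis
 proof (rule that[of "max 3 Q0"])
  fix Q T N assume Q: "Q >= max 3 Q0" and T: "Q powr (-1/40) <= T" "T <= Q powr (1/40)" and N: "real N = T * Q"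
  have Q3: "Q >= 3" "Q >= Q0" using Q by auto
  have T0: "T > 0" using T(1) Q3 by (smt (verit) powr_gt_zero)
  have N0: "real N > 0" using N T0 Q3 by simp
  then have N1: "real N >= 1" by simp
  have lnN: "ln (real N) <= 2 * ln Q"
  proof -
   have "T <= Q powr 1" using T(2) Q3 by (intro order_trans[OF T(2)] powr_mono) auto
   then have "real N <= Q * Q" using N Q3 by simp
   then have "ln (real N) <= ln (Q * Q)" using N0 by (subst ln_le_cancel_iff) (use Q3 in auto)
   then show ?thesis using Q3 by (simp add: ln_mult)
  qed
  have q: "Q powr (1/40) / 2 <= real (cutoff Q) * Q / real N"
  proof -
   have "Q powr (1/40) * Q powr (1/40) = Q powr (1/20)" by (simp flip: powr_add)
   also have "... <= 2 * real (cutoff Q)" using cutoff_bounds(3)[of Q] Q3 by simp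
   finally have "Q powr (1/40) * T <= 2 * real (cutoff Q)"
    using mult_left_mono[OF T(2), of "Q powr (1/40)"] by simp
   then show ?thesis using N T0 Q3 by (simp add: field_simps)
  qed
  have "rho 3 (real (cutoff Q) * Q / real N) <= rho 3 (Q powr (1/40) / 2)" using q Q3 by (intro rho_antimono) auto
  also have "... = 1 / (1 + ln (Q powr (1/40) / 2)) ^ 3" using Q0[OF Q3(2)] by (simp add: rho_def)
  finally have r: "rho 3 (real (cutoff Q) * Q / real N) <= 1 / (1 + ln (Q powr (1/40) / 2)) ^ 3" .
  have "(1 + ln (real N)) ^ 3 * (rho 3 (real (cutoff Q) * Q / real N))\<^sup>2 * (2 * ln Q)
    <= (1 + 2 * ln Q) ^ 3 * (1 / (1 + ln (Q powr (1/40) / 2)) ^ 3)\<^sup>2 * (2 * ln Q)"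
   using lnN r N1 Q3 by (intro mult_right_mono mult_mono power_mono) auto
  also have "... <= 1" using Q0[OF Q3(2)] by simp
  finally show "(1 + ln (real N)) ^ 3 * (rho 3 (real (cutoff Q) * Q / real N))\<^sup>2 * (2 * ln Q) <= 1" .
 qed auto
qed

lemma off_diagonal_asymptotic:
 obtains Q0 where "Q0 >= 3" "!!Q T N J. Q >= Q0 ==> Q powr (-1/40) <= T ==> T <= Q powr (1/40) ==> real N = T * Q ==>
   1 <= J ==> J <= Q powr (1/2) ==> real (cutoff Q) ^ 6 * (8 * (5 + 4 * ln (real N) + 2 * T * J)) * (2 * ln Q) <= T * Q"
proof -
 have "((%Q::real. Q powr (3/10) * (8 * (5 + 8 * ln Q + 2 * (Q powr (1/40) * Q powr (1/2)))) * (2 * ln Q) / (Q powr (-1/40) * Q)) \<longlongrightarrow> 0) at_top" by real_asymp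
 then have "eventually (%Q::real. Q powr (3/10) * (8 * (5 + 8 * ln Q + 2 * (Q powr (1/40) * Q powr (1/2)))) * (2 * ln Q) / (Q powr (-1/40) * Q) < 1) at_top"
  by (rule order_tendstoD) simp
 then obtain Q0 where Q0: "!!Q::real. Q >= Q0 ==> Q powr (3/10) * (8 * (5 + 8 * ln Q + 2 * (Q powr (1/40) * Q powr (1/2)))) * (2 * ln Q) / (Q powr (-1/40) * Q) < 1"
  unfolding eventually_at_top_linorder by blast
 show ?thesis
 proof (rule that[of "max 3 Q0"])
  fix Q T N J assume Q: "Q >= max 3 Q0" and T: "Q powr (-1/40) <= T" "T <= Q powr (1/40)" and N: "real N = T * Q"
   and J: "1 <= J" "J <= Q powr (1/2)"
  have Q3: "Q >= 3" "Q >= Q0" using Q by auto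
  have T0: "T > 0" using T(1) Q3 by (smt (verit) powr_gt_zero)
  have N0: "real N > 0" using N T0 Q3 by simp
  then have N1: "real N >= 1" by simp
  have lnN: "ln (real N) <= 2 * ln Q"
  proof -
   have "T <= Q powr 1" using T(2) Q3 by (intro order_trans[OF T(2)] powr_mono) auto
   then have "real N <= Q * Q" using N Q3 by simp
   then have "ln (real N) <= ln (Q * Q)" using N0 by (subst ln_le_cancel_iff) (use Q3 in auto)
   then show ?thesis using Q3 by (simp add: ln_mult)
  qed
  have "real (cutoff Q) ^ 6 <= (Q powr (1/20)) ^ 6" using cutoff_bounds(2)[of Q] Q3 by (intro power_mono) auto
  also have "... = Q powr (3/10)" using Q3 powr_realpow[of "Q powr (1/20)" 6] by (simp add: powr_powr)
  finally have c6: "real (cutoff Q) ^ 6 <= Q powr (3/10)" .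
  have "2 * T * J <= 2 * (Q powr (1/40) * Q powr (1/2))"
   using mult_mono[OF T(2) J(2)] T0 J by simp
  then have "real (cutoff Q) ^ 6 * (8 * (5 + 4 * ln (real N) + 2 * T * J)) * (2 * ln Q)
    <= Q powr (3/10) * (8 * (5 + 8 * ln Q + 2 * (Q powr (1/40) * Q powr (1/2)))) * (2 * ln Q)"
   using c6 lnN N1 Q3 T0 J by (intro mult_right_mono mult_mono) auto
  also have "... <= Q powr (-1/40) * Q" using Q0[OF Q3(2)] Q3 by (simp add: pos_divide_less_eq)
  also have "... <= T * Q" using T Q3 by (intro mult_right_mono) auto
  finally show "real (cutoff Q) ^ 6 * (8 * (5 + 4 * ln (real N) + 2 * T * J)) * (2 * ln Q) <= T * Q" .
 qed auto
qed

text \<open>With \<open>1/\<epsilon> = exp l\<close>, keep denominators up to \<open>T exp(l/8)\<close> and \<open>exp(l/4)\<close> cells: the rank is at most \<open>2 T^2 exp l\<close>, which \<open>\<epsilon> l \<le> 1\<close> absorbs, and the remainder gains the factor \<open>1/l\<close>.\<close>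
lemma exceptional_subspace_weight:
 assumes wt: "weight W"
 obtains K Q0 where "K > 0" "Q0 >= 3"
  "!!\<epsilon> N Q. Q >= Q0 ==> N >= 1 ==> Q powr (-1/40) <= real N / Q ==> real N / Q <= Q powr (1/40) ==>
    0 < \<epsilon> ==> \<epsilon> <= 1/2 ==> 1 / \<epsilon> <= Q\<^sup>2 ==>
    \<exists>V. seq.subspace V & V \<subseteq> seq_space N & real (seq.dim V) <= K * ((real N / Q)\<^sup>2 / (\<epsilon>\<^sup>2 * ln (1 / \<epsilon>))) \<and>
     (\<forall>\<phi>\<in>seq_space N. (\<forall>\<psi>\<in>V. herm N \<phi> \<psi> = 0) --> \<bar>sieve_sum W N Q \<phi> - sq_norm N \<phi>\<bar> <= \<epsilon> * sq_norm N \<phi>)"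
proof -
 note w = weight_derivs[OF wt]
 obtain C where C: "C >= 1" "!!x. x > 0 ==> \<bar>mobius_sum W x\<bar> <= C * rho 3 (1 / x)"
  "!!Y x. x > 0 ==> \<bar>gsum W Y x\<bar> <= C * rho 2 (1 / x)"
  "!!Y x. \<bar>gsum W Y x\<bar> <= C"
  "!!Y x y. x > 0 ==> y > 0 ==> \<bar>gsum W Y x - gsum W Y y\<bar> <= C * \<bar>x - y\<bar> / min x y"
  by (rule weight_gsum_bounds[OF wt]) blast
 obtain Q1 c cc where I: "Q1 >= 1" "c > 0" "!!Q. Q >= Q1 ==> c <= \<bar>I0 W Q\<bar> & \<bar>I0 W Q\<bar> <= cc"
  by (rule I0_bounds[OF wt]) blast
 obtain Q2 where Q2: "Q2 >= 3" "!!Q T N. Q >= Q2 ==> Q powr (-1/40) <= T ==> T <= Q powr (1/40) ==> real N = T * Q ==>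
   (1 + ln (real N)) ^ 3 * (rho 3 (real (cutoff Q) * Q / real N))\<^sup>2 * (2 * ln Q) <= 1"
  by (rule tail_bound_asymptotic) blast
 obtain Q3 where Q3: "Q3 >= 3" "!!Q T N J. Q >= Q3 ==> Q powr (-1/40) <= T ==> T <= Q powr (1/40) ==> real N = T * Q ==>
   1 <= J ==> J <= Q powr (1/2) ==> real (cutoff Q) ^ 6 * (8 * (5 + 4 * ln (real N) + 2 * T * J)) * (2 * ln Q) <= T * Q"
  by (rule off_diagonal_asymptotic) blast
 define K0 where "K0 = 2 / c\<^sup>2 * (C\<^sup>2 * 2400)"
 have K0: "K0 > 0" using I C(1) by (simp add: K0_def)
 show ?thesis
 proof (rule that[of "2 + K0" "max Q1 (max Q2 Q3)"])
  show "2 + K0 > 0" "max Q1 (max Q2 Q3) >= 3" using K0 Q2 by auto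
  fix \<epsilon> Q :: real and N :: nat
  assume Q: "Q >= max Q1 (max Q2 Q3)" and N: "N >= 1" and T: "Q powr (-1/40) <= real N / Q" "real N / Q <= Q powr (1/40)"
   and e: "0 < \<epsilon>" "\<epsilon> <= 1/2" "1 / \<epsilon> <= Q\<^sup>2"
  define T where "T = real N / Q"
  have Qs: "Q >= Q1" "Q >= Q2" "Q >= Q3" "Q >= 3" using Q Q2 by auto
  have NT: "real N = T * Q" using Qs by (simp add: T_def)
  have T0: "T > 0" using N Qs by (simp add: T_def)
  have TT: "Q powr (-1/40) <= T" "T <= Q powr (1/40)" using T by (auto simp: T_def)
  define l where "l = ln (1 / \<epsilon>)"
  have "1 / \<epsilon> >= 2" using e by (simp add: field_simps)
  then have l0: "l > 0" unfolding l_def by (intro ln_gt_zero) linarith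
  have el: "1 / \<epsilon> = exp l" using e by (simp add: l_def)
  have lQ: "l <= 2 * ln Q"
  proof -
   have "l <= ln (Q\<^sup>2)" unfolding l_def using e Qs by (subst ln_le_cancel_iff) auto
   then show ?thesis using Qs by (simp add: ln_realpow)
  qed
  define P where "P = exp (l / 8)"
  define J where "J = exp (l / 4)"
  have P1: "P >= 1" "J >= 1" using l0 by (auto simp: P_def J_def)
  have JQ: "J <= Q powr (1/2)" using lQ Qs by (simp add: J_def powr_def)
  also have "... <= Q powr 1" using Qs by (intro powr_mono) auto
  finally have JQ': "J <= Q" using Qs by simp
  define L where "L = cutoff Q"
  have L1: "L >= 1" using cutoff_bounds(1) Qs by (simp add: L_def)
  have I0: "c <= \<bar>I0 W Q\<bar>" "I0 W Q ~= 0" using I(3)[OF Qs(1)] I(2) by auto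
  let ?hd = "\<Sum>m=1..N. \<Sum>n=1..N. (cmod (head_kernel W Q L m n - step_kernel W Q L J (T * P) m n))\<^sup>2"
  let ?tl = "\<Sum>m=1..N. \<Sum>n=1..N. (tail_kernel W Q L m n)\<^sup>2"
  have "head_kernel W Q L m n - step_kernel W Q L J (T * P) m n = (\<Sum>t\<in>farey L. of_real ((block W L (fst t) (\<bar>real m - real n\<bar> / Q) - step_part W Q L J (T * P) (fst t) m n) / real (fst t)) * add_char ((real m - real n) * frac_of t))" for m n
   unfolding head_kernel_def step_kernel_def sum_subtractf[symmetric] by (intro sum.cong refl) (simp add: diff_divide_distrib left_diff_distrib)
  then have "?hd <= 288 * C\<^sup>2 * real N * Q * T * P / J + 2 * C\<^sup>2 * (real N)\<^sup>2 * rho 2 P + (real L) ^ 6 * (2 * real N * (4 * C\<^sup>2 * (5 + 4 * ln (real N) + 2 * T * J)))"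
   using head_residual_hs[of W C Q N J P L, OF C(3) C(4) C(5) _ N P1(2) JQ' P1(1)] Qs unfolding T_def by simp
  also have "... <= C\<^sup>2 * T\<^sup>2 * Q\<^sup>2 * (2304 / l) + C\<^sup>2 * T\<^sup>2 * Q\<^sup>2 * (16 / l) + C\<^sup>2 * T\<^sup>2 * Q\<^sup>2 * (1 / l)"
  proof (intro add_mono)
   have l8: "l / 8 <= P" unfolding P_def using exp_ge_add_one_self[of "l/8"] by linarith
   have "J = P * P" by (simp add: P_def J_def flip: exp_add)
   then have "P / J = 1 / P" using P1 by simp
   also have "... <= 8 / l" using l8 l0 P1 by (simp add: field_simps)
   finally have PJ: "P / J <= 8 / l" .
   have "288 * C\<^sup>2 * real N * Q * T * P / J = (288 * C\<^sup>2 * T\<^sup>2 * Q\<^sup>2) * (P / J)" by (simp add: NT power2_eq_square)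
   also have "... <= (288 * C\<^sup>2 * T\<^sup>2 * Q\<^sup>2) * (8 / l)" using PJ by (intro mult_left_mono) auto
   finally show "288 * C\<^sup>2 * real N * Q * T * P / J <= C\<^sup>2 * T\<^sup>2 * Q\<^sup>2 * (2304 / l)" by (simp add: mult_ac)
   have "rho 2 P <= rho 1 P" by (rule rho_mono_exp) simp
   also have "... = 1 / (1 + l / 8)" using l0 by (simp add: rho_def P_def)
   also have "... <= 8 / l" using l0 by (simp add: field_simps)
   finally have "(2 * C\<^sup>2 * (real N)\<^sup>2) * rho 2 P <= (2 * C\<^sup>2 * (real N)\<^sup>2) * (8 / l)" by (intro mult_left_mono) auto
   then show "2 * C\<^sup>2 * (real N)\<^sup>2 * rho 2 P <= C\<^sup>2 * T\<^sup>2 * Q\<^sup>2 * (16 / l)" by (simp add: NT power_mult_distrib mult_ac)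
   have lnN: "ln (real N) >= 0" using N by simp
   have "real L ^ 6 * (8 * (5 + 4 * ln (real N) + 2 * T * J)) * l <= real L ^ 6 * (8 * (5 + 4 * ln (real N) + 2 * T * J)) * (2 * ln Q)"
    using lQ lnN T0 P1 by (intro mult_left_mono) auto
   also have "... <= T * Q" unfolding L_def by (rule Q3(2)[OF Qs(3) TT NT P1(2) JQ])
   finally have "real L ^ 6 * (8 * (5 + 4 * ln (real N) + 2 * T * J)) <= T * Q / l" using l0 by (simp add: pos_le_divide_eq)
   then have "(C\<^sup>2 * real N) * (real L ^ 6 * (8 * (5 + 4 * ln (real N) + 2 * T * J))) <= (C\<^sup>2 * real N) * (T * Q / l)" by (intro mult_left_mono) auto
   then show "(real L) ^ 6 * (2 * real N * (4 * C\<^sup>2 * (5 + 4 * ln (real N) + 2 * T * J))) <= C\<^sup>2 * T\<^sup>2 * Q\<^sup>2 * (1 / l)"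
    by (simp add: NT power2_eq_square mult_ac)
  qed
  finally have hd: "?hd <= C\<^sup>2 * T\<^sup>2 * Q\<^sup>2 * (2321 / l)" by (simp add: add_divide_distrib[symmetric] distrib_left[symmetric] mult_ac)
  have "?tl <= 2 * (real N)\<^sup>2 * (1 + ln (real N)) ^ 3 * (C * rho 3 (real L * Q / real N))\<^sup>2"
   by (rule tail_kernel_hs[OF C(2)]) (use C(1) Qs L1 N in auto)
  also have "... = (2 * C\<^sup>2 * T\<^sup>2 * Q\<^sup>2) * ((1 + ln (real N)) ^ 3 * (rho 3 (real L * Q / real N))\<^sup>2)"
   by (simp add: NT power_mult_distrib)
  also have "... <= (2 * C\<^sup>2 * T\<^sup>2 * Q\<^sup>2) * (1 / l)"
  proof (rule mult_left_mono)
   have lnN: "ln (real N) >= 0" using N by simp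
   have "(1 + ln (real N)) ^ 3 * (rho 3 (real L * Q / real N))\<^sup>2 * l <= (1 + ln (real N)) ^ 3 * (rho 3 (real L * Q / real N))\<^sup>2 * (2 * ln Q)"
    using lQ lnN by (intro mult_left_mono) auto
   also have "... <= 1" unfolding L_def by (rule Q2(2)[OF Qs(2) TT NT])
   finally show "(1 + ln (real N)) ^ 3 * (rho 3 (real L * Q / real N))\<^sup>2 <= 1 / l" using l0 by (simp add: pos_le_divide_eq)
  qed simp
  finally have tl: "?tl <= C\<^sup>2 * T\<^sup>2 * Q\<^sup>2 * (2 / l)" by (simp add: mult_ac)
  have "2 / (Q * I0 W Q)\<^sup>2 * (?hd + ?tl) <= 2 / (Q * c)\<^sup>2 * (C\<^sup>2 * T\<^sup>2 * Q\<^sup>2 * (2400 / l))"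
  proof (rule mult_mono)
   have "(Q * c)\<^sup>2 <= (Q * \<bar>I0 W Q\<bar>)\<^sup>2" using I0 I(2) Qs by (intro power_mono mult_left_mono) auto
   then have "(Q * c)\<^sup>2 <= (Q * I0 W Q)\<^sup>2" by (simp add: power_mult_distrib)
   then show "2 / (Q * I0 W Q)\<^sup>2 <= 2 / (Q * c)\<^sup>2" using I(2) Qs I0 by (intro divide_left_mono) auto
   have "?hd + ?tl <= C\<^sup>2 * T\<^sup>2 * Q\<^sup>2 * (2321 / l) + C\<^sup>2 * T\<^sup>2 * Q\<^sup>2 * (2 / l)" by (rule add_mono[OF hd tl])
   also have "... = C\<^sup>2 * T\<^sup>2 * Q\<^sup>2 * (2323 / l)" by (simp add: add_divide_distrib[symmetric] distrib_left[symmetric])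
   also have "... <= C\<^sup>2 * T\<^sup>2 * Q\<^sup>2 * (2400 / l)" using l0 by (intro mult_left_mono divide_right_mono) auto
   finally show "?hd + ?tl <= C\<^sup>2 * T\<^sup>2 * Q\<^sup>2 * (2400 / l)" .
   show "0 <= ?hd + ?tl" by (intro add_nonneg_nonneg sum_nonneg) auto
  qed (use Qs in auto)
  also have "... = K0 * T\<^sup>2 / l" using Qs by (simp add: K0_def power_mult_distrib)
  finally have hs: "2 / (Q * I0 W Q)\<^sup>2 * (?hd + ?tl) <= K0 * T\<^sup>2 / l" .
  have W2: "W u = 0" if "u > 2" for u using w(5)[of u] that by simp
  obtain V where V: "seq.subspace V" "V \<subseteq> seq_space N" "real (seq.dim V) <= T * P * (real N / Q * J) + T * P * (T * P) + (K0 * T\<^sup>2 / l) / \<epsilon>\<^sup>2"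
   "!!\<phi>. \<phi> \<in> seq_space N ==> (\<forall>\<psi>\<in>V. herm N \<phi> \<psi> = 0) ==> \<bar>sieve_sum W N Q \<phi> - sq_norm N \<phi>\<bar> <= \<epsilon> * sq_norm N \<phi>"
   by (rule exceptional_subspace[OF W2 I0(2) P1(2) JQ' _ N e(1) hs]) (use T0 P1 in auto)
  have ie: "exp l <= 1 / (\<epsilon>\<^sup>2 * l)"
  proof -
   have "\<epsilon> * l <= 1" using x_ln_inverse_le[of \<epsilon>] e by (simp add: l_def)
   then have "(1 / \<epsilon>) * (\<epsilon> * l) <= (1 / \<epsilon>) * 1" using e by (intro mult_left_mono) auto
   then have "l <= 1 / \<epsilon>" using e by simp
   then have "(1 / \<epsilon>) * (\<epsilon>\<^sup>2 * l) <= 1" using e by (simp add: power2_eq_square field_simps)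
   then show ?thesis unfolding el[symmetric] using e l0 by (simp add: pos_le_divide_eq)
  qed
  have "P * J <= exp l" "P * P <= exp l" using l0 by (auto simp: P_def J_def simp flip: exp_add)
  then have PJ: "P * J <= 1 / (\<epsilon>\<^sup>2 * l)" "P * P <= 1 / (\<epsilon>\<^sup>2 * l)" using ie by auto
  have "T * P * (real N / Q * J) + T * P * (T * P) = T\<^sup>2 * (P * J) + T\<^sup>2 * (P * P)" by (simp add: T_def power2_eq_square mult_ac)
  also have "... <= T\<^sup>2 * (1 / (\<epsilon>\<^sup>2 * l)) + T\<^sup>2 * (1 / (\<epsilon>\<^sup>2 * l))" using PJ by (intro add_mono mult_left_mono) auto
  finally have "real (seq.dim V) <= T\<^sup>2 * (1 / (\<epsilon>\<^sup>2 * l)) + T\<^sup>2 * (1 / (\<epsilon>\<^sup>2 * l)) + (K0 * T\<^sup>2 / l) / \<epsilon>\<^sup>2" using V(3) by linarith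
  also have "... = (2 + K0) * (T\<^sup>2 / (\<epsilon>\<^sup>2 * l))" by (simp add: distrib_right add_divide_distrib mult.commute)
  finally have "real (seq.dim V) <= (2 + K0) * ((real N / Q)\<^sup>2 / (\<epsilon>\<^sup>2 * ln (1 / \<epsilon>)))" by (simp add: T_def l_def)
  then show "\<exists>V. seq.subspace V & V \<subseteq> seq_space N & real (seq.dim V) <= (2 + K0) * ((real N / Q)\<^sup>2 / (\<epsilon>\<^sup>2 * ln (1 / \<epsilon>))) \<and>
     (\<forall>\<phi>\<in>seq_space N. (\<forall>\<psi>\<in>V. herm N \<phi> \<psi> = 0) --> \<bar>sieve_sum W N Q \<phi> - sq_norm N \<phi>\<bar> <= \<epsilon> * sq_norm N \<phi>)"
   using V by blast
 qed
qed

text \<open>This is where the condition relating \<open>log Q\<close> and \<open>log\<^sup>2(N/Q)\<close> is used: it places \<open>N/Q\<close> within a small power of \<open>Q\<close>.\<close>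
lemma exponent_range:
 fixes Q x :: real
 assumes Q: "ln Q >= 1" "Q > 0" and x: "x > 0" and h: "ln Q > 1600 * (ln x)\<^sup>2"
 shows "Q powr (-1/40) <= x" "x <= Q powr (1/40)"
proof -
 have "(40 * \<bar>ln x\<bar>)\<^sup>2 <= (ln Q)\<^sup>2"
 proof -
  have "(40 * \<bar>ln x\<bar>)\<^sup>2 = 1600 * (ln x)\<^sup>2" by (simp add: power_mult_distrib)
  also have "... <= ln Q" using h by simp
  also have "... <= (ln Q)\<^sup>2" using Q self_le_power[of "ln Q" 2] by simp
  finally show ?thesis .
 qed
 then have "40 * \<bar>ln x\<bar> <= ln Q" by (rule power2_le_imp_le) (use Q in linarith)
 then have b: "- 1 / 40 * ln Q <= ln x" "ln x <= 1 / 40 * ln Q" by linarith+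
 have "Q powr (-1/40) = exp (- 1 / 40 * ln Q)" "Q powr (1/40) = exp (1 / 40 * ln Q)" using Q(2) by (simp_all add: powr_def)
 moreover have "exp (- 1 / 40 * ln Q) <= exp (ln x)" "exp (ln x) <= exp (1 / 40 * ln Q)" using b by (simp_all only: exp_le_cancel_iff)
 moreover have "exp (ln x) = x" by (rule exp_ln[OF x])
 ultimately show "Q powr (-1/40) <= x" "x <= Q powr (1/40)" by simp_all
qed

text \<open>Outside the range of the previous results one of two trivial choices works: the zero space if the hypothesis on \<open>Q\<close> fails, and the whole space if \<open>N\<close> is below the allowed dimension. In the remaining case the failure of the latter forces \<open>1/\<epsilon> \<le> Q^2\<close>.\<close>
lemma large_sieve_exceptional_subspace:
 assumes wt: "weight W"
 obtains C where "C > 0"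
  "!!\<epsilon> N Q. \<epsilon> > 0 ==> N >= 1 ==> Q >= 1 ==>
   \<exists>V. seq.subspace V & V \<subseteq> seq_space N \<and>
    (\<epsilon> < 1 --> real (seq.dim V) <= C * ((real N / Q)\<^sup>2 / (\<epsilon>\<^sup>2 * ln (1 / \<epsilon>)))) \<and>
    (\<forall>\<phi>\<in>seq_space N. (\<forall>\<psi>\<in>V. herm N \<phi> \<psi> = 0) --> ln Q > 1600 * (ln (real N / Q))\<^sup>2 -->
     \<bar>sieve_sum W N Q \<phi> - sq_norm N \<phi>\<bar> <= \<epsilon> * sq_norm N \<phi>)"
proof -
 obtain K Q0 where K: "K > 0" "Q0 >= 3" "!!\<epsilon> N Q. Q >= Q0 ==> N >= 1 ==> Q powr (-1/40) <= real N / Q ==> real N / Q <= Q powr (1/40) ==>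
    0 < \<epsilon> ==> \<epsilon> <= 1/2 ==> 1 / \<epsilon> <= Q\<^sup>2 ==>
    \<exists>V. seq.subspace V & V \<subseteq> seq_space N & real (seq.dim V) <= K * ((real N / Q)\<^sup>2 / (\<epsilon>\<^sup>2 * ln (1 / \<epsilon>))) \<and>
     (\<forall>\<phi>\<in>seq_space N. (\<forall>\<psi>\<in>V. herm N \<phi> \<psi> = 0) --> \<bar>sieve_sum W N Q \<phi> - sq_norm N \<phi>\<bar> <= \<epsilon> * sq_norm N \<phi>)"
  by (rule exceptional_subspace_weight[OF wt]) blast
 define C where "C = 8 * K + Q0 ^ 3"
 have Q27: "Q0 ^ 3 >= 1" using K by (intro one_le_power) auto
 have C0: "C > 0" "C >= 8 * K" "C >= 1" using K(1) Q27 unfolding C_def by linarith+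
 show ?thesis
 proof (rule that[OF C0(1)])
  fix \<epsilon> Q :: real and N :: nat
  assume e: "\<epsilon> > 0" and N: "N >= 1" and Q: "Q >= 1"
  let ?P = "%V. seq.subspace V & V \<subseteq> seq_space N \<and>
    (\<epsilon> < 1 --> real (seq.dim V) <= C * ((real N / Q)\<^sup>2 / (\<epsilon>\<^sup>2 * ln (1 / \<epsilon>)))) \<and>
    (\<forall>\<phi>\<in>seq_space N. (\<forall>\<psi>\<in>V. herm N \<phi> \<psi> = 0) --> ln Q > 1600 * (ln (real N / Q))\<^sup>2 -->
     \<bar>sieve_sum W N Q \<phi> - sq_norm N \<phi>\<bar> <= \<epsilon> * sq_norm N \<phi>)"
  define l where "l = ln (1 / \<epsilon>)"
  define T where "T = real N / Q"
  have T0: "T > 0" using N Q by (simp add: T_def)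
  have whole: "?P (seq_space N)" if h: "\<epsilon> < 1 ==> real N <= C * (T\<^sup>2 / (\<epsilon>\<^sup>2 * l))"
  proof (intro conjI impI ballI)
   show "real (seq.dim (seq_space N)) <= C * ((real N / Q)\<^sup>2 / (\<epsilon>\<^sup>2 * ln (1 / \<epsilon>)))" if "\<epsilon> < 1"
    using seq_space_full(1)[of N] h[OF that] unfolding T_def l_def by linarith
   fix \<phi> assume "\<phi> \<in> seq_space N" "\<forall>\<psi>\<in>seq_space N. herm N \<phi> \<psi> = 0"
   then show "\<bar>sieve_sum W N Q \<phi> - sq_norm N \<phi>\<bar> <= \<epsilon> * sq_norm N \<phi>" using seq_space_full(2)[of \<phi> N W Q] N by simp
  qed (auto simp: seq_space_subspace)
  show "\<exists>V. ?P V"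
  proof (cases "\<epsilon> < 1 & C * (T\<^sup>2 / (\<epsilon>\<^sup>2 * l)) < real N & ln Q > 1600 * (ln (real N / Q))\<^sup>2")
   case False
   show ?thesis
   proof (cases "\<epsilon> < 1 & C * (T\<^sup>2 / (\<epsilon>\<^sup>2 * l)) < real N")
    case True
    then have nl: "\<not> ln Q > 1600 * (ln (real N / Q))\<^sup>2" and e1: "\<epsilon> < 1" using False by auto
    have "l >= 0" using e1 e by (simp add: l_def)
    have "seq.dim {0} = 0" using seq.dim_le_card[of "{0}" "{}"] by simp
    then have "?P {0}" using C0 \<open>l >= 0\<close> nl unfolding l_def by (auto simp: seq_space_def intro!: mult_nonneg_nonneg divide_nonneg_nonneg)
    then show ?thesis by blast
   next
    case F: False
    show ?thesis using whole F by (intro exI[of _ "seq_space N"]) linarith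
   qed
  next
   case True
   then have e1: "\<epsilon> < 1" and big: "C * (T\<^sup>2 / (\<epsilon>\<^sup>2 * l)) < real N" and lQ: "ln Q > 1600 * (ln T)\<^sup>2" by (auto simp: T_def)
   have l0: "l > 0" using e e1 by (simp add: l_def)
   have el: "\<epsilon> * l <= 1" using x_ln_inverse_le[of \<epsilon>] e e1 by (simp add: l_def)
   have NT: "real N = T * Q" using Q by (simp add: T_def)
   have "T * (C * T / (\<epsilon>\<^sup>2 * l)) < T * Q" using big NT by (simp add: power2_eq_square mult_ac)
   then have "C * T / (\<epsilon>\<^sup>2 * l) < Q" using T0 by (simp only: mult_less_cancel_left_pos)
   moreover have "\<epsilon>\<^sup>2 * l > 0" using e l0 by simp
   ultimately have CT: "C * T < Q * (\<epsilon>\<^sup>2 * l)" by (simp add: pos_divide_less_eq)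
   have e2: "\<epsilon>\<^sup>2 * l <= \<epsilon>" using mult_left_mono[OF el, of \<epsilon>] e by (simp add: power2_eq_square mult_ac)
   have CTe: "C * T < Q * \<epsilon>" using CT mult_left_mono[OF e2, of Q] Q by linarith
   have TQ: "1 <= T * Q" using NT N by simp
   have "C * (T * Q) < Q * \<epsilon> * Q" using mult_strict_right_mono[OF CTe, of Q] Q by (simp add: mult_ac)
   moreover have "C * 1 <= C * (T * Q)" using TQ C0 by (intro mult_left_mono) auto
   ultimately have CQ: "C < Q\<^sup>2 * \<epsilon>" by (simp add: power2_eq_square mult_ac)
   have eQ: "1 / \<epsilon> <= Q\<^sup>2" using CQ C0(3) e by (simp add: pos_divide_le_eq)
   have "C < Q\<^sup>2" using CQ e1 mult_left_mono[of \<epsilon> 1 "Q\<^sup>2"] by simp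
   moreover have "Q0\<^sup>2 <= C"
   proof -
    have "Q0\<^sup>2 <= Q0 ^ 3" using K(2) by (intro power_increasing) auto
    then show ?thesis using K(1) unfolding C_def by linarith
   qed
   ultimately have "Q0\<^sup>2 < Q\<^sup>2" by linarith
   then have QQ: "Q >= Q0" using Q power2_less_imp_less[of Q0 Q] by linarith
   then have Q3: "Q >= 3" using K by linarith
   have "exp 1 <= Q" using exp_le Q3 by linarith
   then have lnQ: "ln Q >= 1" using Q3 by (subst ln_ge_iff) auto
   note R = exponent_range[OF lnQ _ T0 lQ]
   have R': "Q powr (-1/40) <= real N / Q" "real N / Q <= Q powr (1/40)" using R Q3 by (auto simp: T_def)
   define d where "d = min \<epsilon> (1/2)"
   have d: "0 < d" "d <= 1/2" "d <= \<epsilon>" using e by (auto simp: d_def)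
   have dQ: "1 / d <= Q\<^sup>2"
   proof (cases "\<epsilon> <= 1/2")
    case True then show ?thesis using eQ by (simp add: d_def)
   next
    case False
    have "1 / d = 2" using False by (simp add: d_def)
    also have "... <= Q * 1" using Q3 by simp
    also have "... <= Q\<^sup>2" using Q3 unfolding power2_eq_square by (intro mult_left_mono) auto
    finally show ?thesis .
   qed
   obtain V where V: "seq.subspace V" "V \<subseteq> seq_space N" "real (seq.dim V) <= K * ((real N / Q)\<^sup>2 / (d\<^sup>2 * ln (1 / d)))"
     "\<forall>\<phi>\<in>seq_space N. (\<forall>\<psi>\<in>V. herm N \<phi> \<psi> = 0) --> \<bar>sieve_sum W N Q \<phi> - sq_norm N \<phi>\<bar> <= d * sq_norm N \<phi>"
    using K(3)[OF QQ N R' d(1) d(2) dQ] by blast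
   have inv: "1 / (d\<^sup>2 * ln (1 / d)) <= 8 / (\<epsilon>\<^sup>2 * l)"
   proof (cases "\<epsilon> <= 1/2")
    case True
    then have "d = \<epsilon>" by (simp add: d_def)
    then show ?thesis using e l0 by (simp add: l_def divide_right_mono)
   next
    case False
    then have dd: "d = 1/2" by (simp add: d_def)
    have "ln (2::real) >= 1/2" using ln2_ge_two_thirds by linarith
    then have "1 / (d\<^sup>2 * ln (1 / d)) <= 8" by (simp add: dd power2_eq_square field_simps)
    also have "8 <= 8 / (\<epsilon>\<^sup>2 * l)" using e2 e1 e l0 by (simp add: pos_le_divide_eq)
    finally show ?thesis .
   qed
   have "K * ((real N / Q)\<^sup>2 / (d\<^sup>2 * ln (1 / d))) = (K * T\<^sup>2) * (1 / (d\<^sup>2 * ln (1 / d)))" by (simp add: T_def)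
   also have "... <= (K * T\<^sup>2) * (8 / (\<epsilon>\<^sup>2 * l))" using inv K by (intro mult_left_mono) auto
   also have "... = (8 * K) * (T\<^sup>2 / (\<epsilon>\<^sup>2 * l))" by simp
   also have "... <= C * (T\<^sup>2 / (\<epsilon>\<^sup>2 * l))" using C0 l0 by (intro mult_right_mono) auto
   finally have dim: "real (seq.dim V) <= C * ((real N / Q)\<^sup>2 / (\<epsilon>\<^sup>2 * ln (1 / \<epsilon>)))" using V(3) unfolding T_def l_def by linarith
   have "\<bar>sieve_sum W N Q \<phi> - sq_norm N \<phi>\<bar> <= \<epsilon> * sq_norm N \<phi>" if p: "\<phi> \<in> seq_space N" "\<forall>\<psi>\<in>V. herm N \<phi> \<psi> = 0" for \<phi>
   proof -
    have "\<bar>sieve_sum W N Q \<phi> - sq_norm N \<phi>\<bar> <= d * sq_norm N \<phi>" using V(4) p by blast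
    also have "... <= \<epsilon> * sq_norm N \<phi>" using d by (intro mult_right_mono) (auto simp: sq_norm_def sum_nonneg)
    finally show ?thesis .
   qed
   then show ?thesis using V(1,2) dim by blast
  qed
 qed
qed

section \<open>Vanishing inverse-square moments\<close>

lemma mobius_sum_nonpos: "x <= 0 ==> mobius_sum V x = 0"
proof -
 assume "x <= 0"
 then have "2 / x <= 0" by (simp add: divide_nonneg_nonpos)
 then have "nat \<lfloor>2 / x\<rfloor> = 0" by linarith
 then show ?thesis by (simp add: mobius_sum_def)
qed

text \<open>Moebius inversion; only finitely many terms are nonzero because the weight vanishes beyond \<open>2\<close>.\<close>
lemma mobius_sum_inversion:
 assumes x: "x > 0" and K: "2 / x <= real K" and V: "!!u. u > 2 ==> V u = 0"
 shows "(\<Sum>k=1..K. mobius_sum V (real k * x) / real k) = V x"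
proof -
 have K1: "K >= 1" using x K by (cases K) (auto simp: divide_le_0_iff)
 have Vz: "V (real n * x) = 0" if "n > K" for n
 proof (rule V)
  have "2 <= real K * x" using K x by (simp add: field_simps)
  also have "... < real n * x" using that x by simp
  finally show "real n * x > 2" .
 qed
 have inner: "mobius_sum V (real k * x) / real k = (\<Sum>j=1..K div k. mu j * (V (real (j * k) * x) / real (j * k)))" if k: "k \<in> {1..K}" for k
 proof -
  have "2 / (real k * x) <= 2 / x" using x k by (intro divide_left_mono) auto
  then have "mobius_sum V (real k * x) = (\<Sum>j=1..K. mu j / real j * V (real j * (real k * x)))"
   using x k K V by (intro mobius_sum_eq) auto
  also have "... = (\<Sum>j=1..K div k. mu j / real j * V (real j * (real k * x)))"
  proof (rule sum.mono_neutral_right)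
   show "\<forall>i\<in>{1..K} - {1..K div k}. mu i / real i * V (real i * (real k * x)) = 0"
   proof
    fix i assume i: "i \<in> {1..K} - {1..K div k}"
    then have "i > K div k" by auto
    then have "i * k > K" using k by (simp add: div_less_iff_less_mult)
    then have "V (real (i * k) * x) = 0" by (rule Vz)
    then show "mu i / real i * V (real i * (real k * x)) = 0" by (simp add: mult.assoc)
   qed
  qed auto
  finally show ?thesis by (simp add: sum_divide_distrib mult.assoc)
 qed
 have "(\<Sum>k=1..K. mobius_sum V (real k * x) / real k) = (\<Sum>k=1..K. \<Sum>j=1..K div k. mu j * (V (real (j * k) * x) / real (j * k)))"
  by (intro sum.cong refl inner) auto
 also have "... = (\<Sum>j=1..K. \<Sum>k=1..K div j. mu j * (V (real (j * k) * x) / real (j * k)))"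
  by (rule sum_hyperbola_swap)
 also have "... = (\<Sum>l=1..K. \<Sum>q | q dvd l. mu q * (V (real l * x) / real l))" by (rule sum_dvd_swap[symmetric])
 also have "... = (\<Sum>l=1..K. if l = 1 then V x else 0)"
 proof (intro sum.cong refl)
  fix l assume l: "l \<in> {1..K}"
  have "(\<Sum>q | q dvd l. mu q * (V (real l * x) / real l)) = (\<Sum>q | q dvd l. mu q) * (V (real l * x) / real l)"
   by (rule sum_distrib_right[symmetric])
  also have "(\<Sum>q | q dvd l. mu q) = of_bool (l = 1)" using l by (intro sum_mu_dvd) auto
  finally show "(\<Sum>q | q dvd l. mu q * (V (real l * x) / real l)) = (if l = 1 then V x else 0)" by auto
 qed
 also have "... = V x" using K1 by simp
 finally show ?thesis .
qed

text \<open>The logarithm of \<open>sinh(pi t)/(pi t)\<close>, written so that its expansion for large \<open>t\<close> is visible.\<close>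
definition log_sinhc :: "real => real" where
 "log_sinhc t = pi * t - ln (2 * pi * t) + ln (1 - exp (- (2 * pi * t)))"

text \<open>Euler's product for the sine at an imaginary argument.\<close>
lemma log_sinhc_product:
 assumes t: "t > 0"
 shows "(%K. \<Sum>k=1..K. ln (1 + (t / real k)\<^sup>2)) \<longlonglongrightarrow> log_sinhc t"
proof -
 let ?P = "%K. \<Prod>k=1..K. 1 + (t / real k)\<^sup>2"
 have "(%n. of_real pi * (\<i> * of_real t) * (\<Prod>k=1..n. 1 - (\<i> * of_real t)\<^sup>2 / of_nat k ^ 2)) \<longlonglongrightarrow> sin (of_real pi * (\<i> * of_real t :: complex))"
  by (rule sin_product_formula_complex)
 then have "(%n. Im (of_real pi * (\<i> * of_real t) * (\<Prod>k=1..n. 1 - (\<i> * of_real t)\<^sup>2 / of_nat k ^ 2))) \<longlonglongrightarrow> Im (sin (of_real pi * (\<i> * of_real t :: complex)))"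
  by (rule tendsto_Im)
 moreover have "Im (of_real pi * (\<i> * of_real t) * (\<Prod>k=1..n. 1 - (\<i> * of_real t)\<^sup>2 / of_nat k ^ 2)) = pi * t * ?P n" for n
 proof -
  have "(\<Prod>k=1..n. 1 - (\<i> * complex_of_real t)\<^sup>2 / of_nat k ^ 2) = complex_of_real (?P n)"
   unfolding of_real_prod by (intro prod.cong refl) (simp add: power_mult_distrib power_divide)
  moreover have "Im (of_real pi * (\<i> * of_real t) * complex_of_real X) = pi * t * X" for X by simp
  ultimately show ?thesis by (simp only:)
 qed
 moreover have "Im (sin (of_real pi * (\<i> * of_real t :: complex))) = (exp (pi * t) - exp (- (pi * t))) / 2"
  by (simp add: Im_sin)
 ultimately have "(%n. pi * t * ?P n) \<longlonglongrightarrow> (exp (pi * t) - exp (- (pi * t))) / 2" by (simp only:)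
 then have "(%n. pi * t * ?P n / (pi * t)) \<longlonglongrightarrow> (exp (pi * t) - exp (- (pi * t))) / 2 / (pi * t)"
  using t by (intro tendsto_divide tendsto_const) auto
 then have lim: "?P \<longlonglongrightarrow> (exp (pi * t) - exp (- (pi * t))) / 2 / (pi * t)" using t by simp
 have pos: "(exp (pi * t) - exp (- (pi * t))) / 2 / (pi * t) > 0" using t by simp
 have "(%K. ln (?P K)) \<longlonglongrightarrow> ln ((exp (pi * t) - exp (- (pi * t))) / 2 / (pi * t))"
  using lim pos by (intro tendsto_ln) auto
 moreover have "ln (?P K) = (\<Sum>k=1..K. ln (1 + (t / real k)\<^sup>2))" for K
 proof (rule ln_prod)
  show "1 + (t / real k)\<^sup>2 ~= 0" for k using zero_le_power2[of "t / real k"] by linarith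
 qed simp
 moreover have "ln ((exp (pi * t) - exp (- (pi * t))) / 2 / (pi * t)) = log_sinhc t"
 proof -
  have "(exp (pi * t) - exp (- (pi * t))) / 2 / (pi * t) = exp (pi * t) * (1 - exp (- (2 * pi * t))) / (2 * pi * t)"
   by (simp add: right_diff_distrib flip: exp_add)
  moreover have "ln ... = log_sinhc t" using t by (simp add: log_sinhc_def ln_div ln_mult)
  ultimately show ?thesis by simp
 qed
 ultimately show ?thesis by simp
qed

text \<open>Second differences along \<open>w, 2 w, 4 w\<close> eliminate the logarithm and the constant.\<close>
lemma log_linear_coefficients_zero:
 fixes a b c :: real
 assumes lim: "((%w. a * w + b * ln w + c) \<longlongrightarrow> 0) at_top"
 shows "a = 0" "b = 0" "c = 0"
proof -
 let ?E = "%w. a * w + b * ln w + c"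
 have scale: "((%w. ?E (m * w)) \<longlongrightarrow> 0) at_top" if "m > 0" for m
  by (rule filterlim_compose[OF lim]) (use that in \<open>auto intro!: filterlim_tendsto_pos_mult_at_top[OF tendsto_const] filterlim_ident\<close>)
 have ev: "eventually (%w::real. w > 0) at_top" by (rule eventually_gt_at_top)
 have "((%w. (?E (4 * w) - 2 * ?E (2 * w) + ?E w) * (1 / w)) \<longlongrightarrow> (0 - 2 * 0 + 0) * 0) at_top"
  by (intro tendsto_mult tendsto_add tendsto_diff tendsto_const scale lim tendsto_divide_0[OF tendsto_const] filterlim_at_top_imp_at_infinity filterlim_ident) auto
 moreover have "eventually (%w. (?E (4 * w) - 2 * ?E (2 * w) + ?E w) * (1 / w) = a) at_top"
  using ev
 proof eventually_elim
  case (elim w)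
  have l4: "ln (4 * w) = 2 * ln 2 + ln w" using elim ln_mult[of 4 w] ln_realpow[of 2 2] by simp
  have l2: "ln (2 * w) = ln 2 + ln w" using elim ln_mult[of 2 w] by simp
  have eq: "?E (4 * w) - 2 * ?E (2 * w) + ?E w = a * w" unfolding l4 l2 by (simp add: algebra_simps)
  show ?case by (subst eq) (use elim in simp)
 qed
 ultimately have "((%w::real. a) \<longlongrightarrow> 0) at_top" by (simp add: tendsto_cong)
 then show a: "a = 0" by (simp add: tendsto_const_iff)
 have "((%w. ?E (2 * w) - ?E w) \<longlongrightarrow> 0 - 0) at_top" by (intro tendsto_diff scale lim) auto
 moreover have "eventually (%w. ?E (2 * w) - ?E w = b * ln 2) at_top"
  using ev
 proof eventually_elim
  case (elim w)
  then show ?case using a ln_mult[of 2 w] by (simp add: algebra_simps)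
 qed
 ultimately have "((%w::real. b * ln 2) \<longlongrightarrow> 0) at_top" by (simp add: tendsto_cong)
 then show b: "b = 0" by (simp add: tendsto_const_iff)
 show "c = 0" using lim a b by (simp add: tendsto_const_iff)
qed

lemma ln_one_plus_taylor:
 fixes z :: real
 assumes z: "z >= 0"
 shows "\<bar>ln (1 + z) - (\<Sum>j=1..n. (-1) ^ (j - 1) / real j * z ^ j)\<bar> <= z ^ Suc n"
proof (cases "z = 0")
 case True
 then show ?thesis by (simp add: zero_power)
next
 case False
 define D where "D = (%z::real. ln (1 + z) - (\<Sum>j=1..n. (-1) ^ (j - 1) / real j * z ^ j))"
 have der: "(D has_real_derivative ((- x) ^ n / (1 + x))) (at x)" if x: "x >= 0" for x
 proof -
  have "(D has_real_derivative (1 / (1 + x) - (\<Sum>j=1..n. (-1) ^ (j - 1) / real j * (real j * x ^ (j - 1))))) (at x)"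
   unfolding D_def using x by (auto intro!: derivative_eq_intros) (simp add: mult.commute)
  moreover have "(\<Sum>j=1..n. (-1) ^ (j - 1) / real j * (real j * x ^ (j - 1))) = (\<Sum>j<n. (- x) ^ j)"
  proof -
   have "(\<Sum>j=1..n. (-1) ^ (j - 1) / real j * (real j * x ^ (j - 1))) = (\<Sum>j=1..n. (- x) ^ (j - 1))"
    by (intro sum.cong refl) (simp add: power_minus[of x])
   also have "... = (\<Sum>j<n. (- x) ^ j)" by (rule sum.reindex_bij_witness[of _ Suc "%j. j - 1"]) auto
   finally show ?thesis .
  qed
  moreover have "1 / (1 + x) - (\<Sum>j<n. (- x) ^ j) = (- x) ^ n / (1 + x)"
   using x one_diff_power_eq[of "- x" n] by (simp add: field_simps)
  ultimately show ?thesis by simp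
 qed
 have z0: "0 < z" using z False by simp
 have "\<exists>\<xi>. 0 < \<xi> & \<xi> < z & D z - D 0 = (z - 0) * ((- \<xi>) ^ n / (1 + \<xi>))"
  by (rule MVT2[OF z0]) (use der in auto)
 then obtain \<xi> where xi: "0 < \<xi>" "\<xi> < z" "D z - D 0 = z * ((- \<xi>) ^ n / (1 + \<xi>))" by auto
 have "D 0 = 0" by (auto simp: D_def intro!: sum.neutral)
 then have "\<bar>D z\<bar> = z * (\<xi> ^ n / (1 + \<xi>))" using xi z by (simp add: abs_mult power_abs)
 also have "... <= z * (z ^ n / 1)" using xi z by (intro mult_left_mono frac_le power_mono) auto
 finally show ?thesis by (simp add: D_def)
qed

text \<open>The transform has an asymptotic series in \<open>w^(-2)\<close> whose coefficients are nonzero multiples of the moments; a function that decays exponentially has all coefficients zero.\<close>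
lemma moments_zero_of_flat_log_transform:
 fixes q :: "real => real"
 assumes q: "continuous_on {1..2} q" and k: "\<kappa> > 0"
  and flat: "!!w. w >= w0 ==> \<bar>integral {1..2} (%x. q x * ln (1 + 1 / (x * w)\<^sup>2))\<bar> <= C * exp (- (\<kappa> * w))"
 shows "n >= 1 ==> integral {1..2} (%x. q x * (1 / x\<^sup>2) ^ n) = 0"
proof (induction n rule: less_induct)
 case (less n)
 define M where "M = (%j::nat. integral {1..2} (%x. q x * (1 / x\<^sup>2) ^ j))"
 have "bounded (q ` {1..2})" using q by (intro compact_imp_bounded compact_continuous_image) auto
 then obtain B where "\<forall>y\<in>q ` {1..2}. norm y <= B" unfolding bounded_iff by blast
 then have B: "!!x. x \<in> {1..2} ==> \<bar>q x\<bar> <= B" by auto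
 have cq: "continuous_on {1..2} (%x. q x * (1 / x\<^sup>2) ^ j)" for j by (intro continuous_intros q) auto
 have main: "\<bar>M n\<bar> <= real n * (B / w\<^sup>2 + C * (w ^ (2 * n) * exp (- (\<kappa> * w))))" if w: "w >= max 1 w0" for w
 proof -
  have w1: "w >= 1" "w >= w0" using w by auto
  define I where "I = integral {1..2} (%x. q x * ln (1 + 1 / (x * w)\<^sup>2))"
  define T where "T = (%x. \<Sum>j=1..n. (-1) ^ (j - 1) / real j * (1 / (x * w)\<^sup>2) ^ j)"
  have lnc: "continuous_on {1..2} (%x. ln (1 + 1 / (x * w)\<^sup>2))"
  proof (intro continuous_intros)
   show "\<forall>x\<in>{1..2}. (x * w)\<^sup>2 ~= 0" using w1 by auto
   show "\<forall>x\<in>{1..2}. 1 + 1 / (x * w)\<^sup>2 ~= 0" by (metis add_pos_nonneg divide_nonneg_nonneg less_irrefl zero_le_one zero_le_power2 zero_less_one)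
  qed
  have Tc: "continuous_on {1..2} T" unfolding T_def using w1 by (intro continuous_intros) auto
  have pt: "q x * T x = (\<Sum>j=1..n. ((-1) ^ (j - 1) / real j * (1 / w\<^sup>2) ^ j) * (q x * (1 / x\<^sup>2) ^ j))" for x
   unfolding T_def sum_distrib_left by (intro sum.cong refl) (simp add: power_mult_distrib power_one_over mult_ac)
  have "((%x. q x * T x) has_integral (\<Sum>j=1..n. ((-1) ^ (j - 1) / real j * (1 / w\<^sup>2) ^ j) * M j)) {1..2}"
   unfolding pt M_def
   by (intro has_integral_sum has_integral_mult_right integrable_integral integrable_continuous_real cq) auto
  moreover have "(\<Sum>j=1..n. ((-1) ^ (j - 1) / real j * (1 / w\<^sup>2) ^ j) * M j) = (-1) ^ (n - 1) / real n * (1 / w\<^sup>2) ^ n * M n"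
  proof -
   have "(\<Sum>j=1..n. ((-1) ^ (j - 1) / real j * (1 / w\<^sup>2) ^ j) * M j) = (\<Sum>j\<in>{n}. ((-1) ^ (j - 1) / real j * (1 / w\<^sup>2) ^ j) * M j)"
    by (rule sum.mono_neutral_right) (use less in \<open>auto simp: M_def\<close>)
   then show ?thesis by simp
  qed
  ultimately have iT: "integral {1..2} (%x. q x * T x) = (-1) ^ (n - 1) / real n * (1 / w\<^sup>2) ^ n * M n"
   by (simp add: integral_unique)
  have diff: "\<bar>I - integral {1..2} (%x. q x * T x)\<bar> <= B * (1 / w\<^sup>2) ^ Suc n"
  proof -
   have "I - integral {1..2} (%x. q x * T x) = integral {1..2} (%x. q x * ln (1 + 1 / (x * w)\<^sup>2) - q x * T x)"
    unfolding I_def by (rule integral_diff[symmetric]; intro integrable_continuous_real continuous_on_mult q lnc Tc)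
   moreover have "norm (integral {1..2} (%x. q x * ln (1 + 1 / (x * w)\<^sup>2) - q x * T x)) <= B * (1 / w\<^sup>2) ^ Suc n * (2 - 1)"
   proof (rule integral_bound)
    show "continuous_on {1..2} (%x. q x * ln (1 + 1 / (x * w)\<^sup>2) - q x * T x)"
     by (intro continuous_on_diff continuous_on_mult q lnc Tc)
    fix x :: real assume x: "x \<in> {1..2}"
    have "\<bar>ln (1 + 1 / (x * w)\<^sup>2) - T x\<bar> <= (1 / (x * w)\<^sup>2) ^ Suc n" unfolding T_def by (rule ln_one_plus_taylor) simp
    also have "... <= (1 / w\<^sup>2) ^ Suc n"
    proof (intro power_mono)
     have "1 * w <= x * w" using x w1 by (intro mult_right_mono) auto
     then have "w\<^sup>2 <= (x * w)\<^sup>2" using w1 by (intro power_mono) auto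
     then show "1 / (x * w)\<^sup>2 <= 1 / w\<^sup>2" using w1 x by (intro divide_left_mono) auto
    qed auto
    finally have d: "\<bar>ln (1 + 1 / (x * w)\<^sup>2) - T x\<bar> <= (1 / w\<^sup>2) ^ Suc n" .
    have "norm (q x * ln (1 + 1 / (x * w)\<^sup>2) - q x * T x) = \<bar>q x\<bar> * \<bar>ln (1 + 1 / (x * w)\<^sup>2) - T x\<bar>"
     by (simp add: abs_mult right_diff_distrib[symmetric])
    also have "... <= B * (1 / w\<^sup>2) ^ Suc n" using B[OF x] d by (intro mult_mono) auto
    finally show "norm (q x * ln (1 + 1 / (x * w)\<^sup>2) - q x * T x) <= B * (1 / w\<^sup>2) ^ Suc n" .
   qed simp
   ultimately show ?thesis by simp
  qed
  have fl: "\<bar>I\<bar> <= C * exp (- (\<kappa> * w))" unfolding I_def by (rule flat[OF w1(2)])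
  have "\<bar>integral {1..2} (%x. q x * T x)\<bar> <= B * (1 / w\<^sup>2) ^ Suc n + C * exp (- (\<kappa> * w))" using diff fl by linarith
  then have "1 / real n * (1 / w\<^sup>2) ^ n * \<bar>M n\<bar> <= B * (1 / w\<^sup>2) ^ Suc n + C * exp (- (\<kappa> * w))"
   unfolding iT by (simp add: abs_mult power_abs)
  then have "(real n * w ^ (2 * n)) * (1 / real n * (1 / w\<^sup>2) ^ n * \<bar>M n\<bar>) <= (real n * w ^ (2 * n)) * (B * (1 / w\<^sup>2) ^ Suc n + C * exp (- (\<kappa> * w)))"
   using w1 by (intro mult_left_mono) auto
  also have "(real n * w ^ (2 * n)) * (1 / real n * (1 / w\<^sup>2) ^ n * \<bar>M n\<bar>) = \<bar>M n\<bar>"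
   using less.prems w1 by (simp add: power_mult power_one_over)
  also have "(real n * w ^ (2 * n)) * (B * (1 / w\<^sup>2) ^ Suc n + C * exp (- (\<kappa> * w))) = real n * (B / w\<^sup>2 + C * (w ^ (2 * n) * exp (- (\<kappa> * w))))"
  proof -
   have wn: "w ^ (2 * n) * (1 / w\<^sup>2) ^ Suc n = 1 / w\<^sup>2" using w1 by (simp add: power_mult power_one_over)
   have "(real n * w ^ (2 * n)) * (B * (1 / w\<^sup>2) ^ Suc n + C * exp (- (\<kappa> * w))) = real n * (B * (w ^ (2 * n) * (1 / w\<^sup>2) ^ Suc n) + C * (w ^ (2 * n) * exp (- (\<kappa> * w))))"
    by (simp only: distrib_left mult_ac)
   then show ?thesis unfolding wn by simp
  qed
  finally show ?thesis .
 qed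
 have "((%w. real n * (B / w\<^sup>2 + C * (w ^ (2 * n) * exp (- (\<kappa> * w))))) \<longlongrightarrow> real n * (0 + C * 0)) at_top"
 proof (intro tendsto_mult tendsto_add tendsto_const)
  show "((%w::real. B / w\<^sup>2) \<longlongrightarrow> 0) at_top" by real_asymp
  show "((%w. w ^ (2 * n) * exp (- (\<kappa> * w))) \<longlongrightarrow> 0) at_top" using k by real_asymp
 qed
 then have "\<bar>M n\<bar> <= real n * (0 + C * 0)"
  by (rule tendsto_lowerbound) (auto intro!: eventually_mono[OF eventually_ge_at_top[of "max 1 w0"]] main)
 then show ?case by (simp add: M_def)
qed

text \<open>Weierstrass approximation in the variable \<open>1/x^2\<close>.\<close>
lemma zero_of_inverse_square_moments_zero:
 fixes V :: "real => real"
 assumes V: "continuous_on {1..2} V"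
  and mom: "!!n. n >= 1 ==> integral {1..2} (%x. V x / x\<^sup>2 * (1 / x\<^sup>2) ^ n) = 0" and x: "x \<in> {1..2}"
 shows "V x = 0"
proof -
 define r where "r = (%t::real. V (1 / sqrt t))"
 define J where "J = integral {1..2} (%x. (V x)\<^sup>2 / x ^ 4)"
 have "bounded (V ` {1..2})" using V by (intro compact_imp_bounded compact_continuous_image) auto
 then obtain B where "\<forall>y\<in>V ` {1..2}. norm y <= B" unfolding bounded_iff by blast
 then have B: "!!x. x \<in> {1..2} ==> \<bar>V x\<bar> <= B" by auto
 have B0: "B >= 0" using B[of 1] by simp
 have rc: "continuous_on {1/4..1} r"
  unfolding r_def
 proof (rule continuous_on_compose2[OF V])
  show "continuous_on {1/4..1} (%t::real. 1 / sqrt t)" by (intro continuous_intros) auto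
  show "(%t. 1 / sqrt t) ` {1/4..1} \<subseteq> {1..2}"
  proof clarify
   fix t :: real assume t: "t \<in> {1/4..1}"
   have "1/2 <= sqrt t" using t by (intro real_le_rsqrt) (auto simp: power2_eq_square)
   moreover have "sqrt t <= 1" "sqrt t > 0" using t by simp_all
   ultimately show "1 / sqrt t \<in> {1..2}" by (auto simp: field_simps)
  qed
 qed
 have small: "J <= B * e" if e: "e > 0" for e
 proof -
  obtain p where p: "real_polynomial_function p" "!!t. t \<in> {1/4..1} ==> \<bar>r t - p t\<bar> < e"
   by (rule Stone_Weierstrass_real_polynomial_function[OF _ rc e]) auto
  obtain a n where pe: "p = (%t. \<Sum>i\<le>n. a i * t ^ i)" using p(1) real_polynomial_function_iff_sum by blast
  have c1: "continuous_on {1..2} (%x. V x / x\<^sup>2 * (1 / x\<^sup>2) ^ j)" for j by (intro continuous_intros V) auto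
  have pt: "V x / x ^ 4 * p (1 / x\<^sup>2) = (\<Sum>i\<le>n. a i * (V x / x\<^sup>2 * (1 / x\<^sup>2) ^ Suc i))" for x
   unfolding pe sum_distrib_left by (intro sum.cong refl) (simp add: power4_eq_xxxx power2_eq_square mult_ac)
  have "((%x. V x / x ^ 4 * p (1 / x\<^sup>2)) has_integral (\<Sum>i\<le>n. a i * integral {1..2} (%x. V x / x\<^sup>2 * (1 / x\<^sup>2) ^ Suc i))) {1..2}"
   unfolding pt by (intro has_integral_sum has_integral_mult_right integrable_integral integrable_continuous_real c1) auto
  moreover have "(\<Sum>i\<le>n. a i * integral {1..2} (%x. V x / x\<^sup>2 * (1 / x\<^sup>2) ^ Suc i)) = 0"
  proof (rule sum.neutral, rule ballI)
   fix i show "a i * integral {1..2} (%x. V x / x\<^sup>2 * (1 / x\<^sup>2) ^ Suc i) = 0" using mom[of "Suc i"] by simp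
  qed
  ultimately have i0: "((%x. V x / x ^ 4 * p (1 / x\<^sup>2)) has_integral 0) {1..2}" by (simp only:)
  have J: "((%x. (V x)\<^sup>2 / x ^ 4) has_integral J) {1..2}"
   unfolding J_def by (intro integrable_integral integrable_continuous_real continuous_intros V) auto
  have "((%x. (V x)\<^sup>2 / x ^ 4 - V x / x ^ 4 * p (1 / x\<^sup>2)) has_integral (J - 0)) {1..2}" by (rule has_integral_diff[OF J i0])
  moreover have "((%x::real. B * e) has_integral (B * e)) {1..2}" using has_integral_const_real[of "B * e" 1 2] by simp
  ultimately have "J - 0 <= B * e"
  proof (rule has_integral_le)
   fix x :: real assume x: "x \<in> {1..2}"
   have "1 ^ 2 <= x\<^sup>2" "x\<^sup>2 <= 2 ^ 2" using x by (intro power_mono; auto)+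
   then have t: "1 / x\<^sup>2 \<in> {1/4..1}" using x by (auto simp: field_simps)
   have "r (1 / x\<^sup>2) = V x" using x by (simp add: r_def real_sqrt_divide)
   then have d: "\<bar>V x - p (1 / x\<^sup>2)\<bar> <= e" using p(2)[OF t] by simp
   have "1 / x ^ 4 <= 1" using x by simp
   have "(V x)\<^sup>2 / x ^ 4 - V x / x ^ 4 * p (1 / x\<^sup>2) = (V x * (V x - p (1 / x\<^sup>2))) * (1 / x ^ 4)"
    by (simp add: power2_eq_square diff_divide_distrib right_diff_distrib)
   also have "... <= \<bar>V x * (V x - p (1 / x\<^sup>2))\<bar> * (1 / x ^ 4)" by (intro mult_right_mono) auto
   also have "... <= (B * e) * 1" unfolding abs_mult using B[OF x] d e B0 \<open>1 / x ^ 4 <= 1\<close> by (intro mult_mono) auto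
   finally show "(V x)\<^sup>2 / x ^ 4 - V x / x ^ 4 * p (1 / x\<^sup>2) <= B * e" by simp
  qed
  then show ?thesis by simp
 qed
 have "J <= 0"
 proof (rule field_le_epsilon)
  fix e :: real assume e: "0 < e"
  have "J <= B * (e / (B + 1))" by (rule small) (use e B0 in auto)
  also have "... <= e" using e B0 by (simp add: field_simps)
  finally show "J <= 0 + e" by simp
 qed
 moreover have "J >= 0" unfolding J_def by (rule integral_nonneg) (auto intro!: integrable_continuous_real continuous_intros V)
 ultimately have "integral {1..2} (%x. (V x)\<^sup>2 / x ^ 4) = 0" by (simp add: J_def)
 moreover have "continuous_on {1..2} (%x. (V x)\<^sup>2 / x ^ 4)" by (intro continuous_intros V) auto
 ultimately have "\<forall>x\<in>{1..2}. (V x)\<^sup>2 / x ^ 4 = 0" by (subst (asm) integral_eq_0_iff) auto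
 then show ?thesis using x by auto
qed

section \<open>The Moebius sum does not vanish near zero\<close>

lemma mobius_sum_continuous:
 assumes "!!u. (V has_real_derivative V1 u) (at u)" and "!!u. u > 2 ==> V u = 0"
 shows "continuous_on {0<..} (mobius_sum V)"
proof -
 have "isCont (mobius_sum V) x" if "x > 0" for x
  by (rule DERIV_isCont[OF mobius_sum_DERIV]) (use assms that in auto)
 then show ?thesis by (auto intro: continuous_at_imp_continuous_on)
qed

text \<open>Both sides are the limit of the integrals of the partial sums over \<open>k\<close>: substituting \<open>v = k x\<close> in each term gives the right-hand side by inversion, while summing the logarithms gives the left-hand side by the product for sinh. The vanishing near \<open>0\<close> keeps all integrals proper and the partial sums uniformly bounded.\<close>
lemma mobius_sum_log_transform:
 fixes W :: "real => real"
 assumes V1: "!!u. (W has_real_derivative V1 u) (at u)" and W2: "!!u. u > 2 ==> W u = 0" and W1: "!!u. 0 <= u ==> u < 1 ==> W u = 0"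
  and B: "!!x. x > 0 ==> \<bar>mobius_sum W x\<bar> <= B"
  and d: "0 < \<delta>" "\<delta> <= 1" and zero: "!!x. 0 < x ==> x < \<delta> ==> mobius_sum W x = 0" and w: "w > 0"
 shows "integral {\<delta>..2} (%v. mobius_sum W v / v\<^sup>2 * log_sinhc (v * w)) = integral {1..2} (%x. W x / x\<^sup>2 * ln (1 + (x * w)\<^sup>2))"
proof -
 let ?f = "mobius_sum W"
 define h where "h = (%(k::nat) v. ?f v / v\<^sup>2 * ln (1 + (v * w / real k)\<^sup>2))"
 define g where "g = (%x. ln (1 + (x * w)\<^sup>2) / x\<^sup>2)"
 have fc: "continuous_on {\<delta>..2} ?f" by (rule continuous_on_subset[OF mobius_sum_continuous[OF V1 W2]]) (use d in auto)
 have B0: "B >= 0" using B[of 1] by linarith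
 have f0: "?f x = 0" if "x \<notin> {\<delta>..2}" for x
 proof -
  consider "x <= 0" | "0 < x" "x < \<delta>" | "x > 2" using \<open>x \<notin> {\<delta>..2}\<close> by fastforce
  then show ?thesis using mobius_sum_nonpos zero mobius_sum_zero by cases auto
 qed
 have pos: "1 + y\<^sup>2 ~= 0" for y :: real using add_pos_nonneg[of 1 "y\<^sup>2"] by simp
 have hc: "continuous_on {\<delta>..2} (h k)" for k
 proof -
  have "continuous_on {\<delta>..2} (%v. ln (1 + (v * w * (1 / real k))\<^sup>2))" by (intro continuous_intros) (auto simp: pos)
  then have lc: "continuous_on {\<delta>..2} (%v. ln (1 + (v * w / real k)\<^sup>2))" by simp
  have "continuous_on {\<delta>..2} (%v. ?f v / v\<^sup>2)" using d by (intro continuous_intros fc) auto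
  then show ?thesis unfolding h_def using lc by (rule continuous_on_mult)
 qed
 have Gterm: "((%x. ?f (real k * x) / real k * g x) has_integral integral {\<delta>..2} (h k)) {0..2}" if k: "k >= 1" for k
 proof -
  have "((%x. h k (real k * x)) has_integral (1 / \<bar>real k\<bar>) *\<^sub>R integral {\<delta>..2} (h k)) ((%x. x / real k) ` {\<delta>..2})"
   using k by (intro has_integral_stretch_real integrable_integral integrable_continuous_real hc) auto
  then have "((%x. real k * h k (real k * x)) has_integral (real k * ((1 / \<bar>real k\<bar>) *\<^sub>R integral {\<delta>..2} (h k)))) ((%x. x / real k) ` {\<delta>..2})"
   by (rule has_integral_mult_right)
  moreover have "real k * h k (real k * x) = ?f (real k * x) / real k * g x" for x
   using k by (simp add: h_def g_def power2_eq_square mult_ac)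
  ultimately have "((%x. ?f (real k * x) / real k * g x) has_integral integral {\<delta>..2} (h k)) ((%x. x / real k) ` {\<delta>..2})"
   using k by simp
  then show ?thesis
  proof (rule has_integral_on_superset)
   fix x assume x: "x \<notin> (%x. x / real k) ` {\<delta>..2}"
   have "real k * x \<notin> {\<delta>..2}"
   proof
    assume "real k * x \<in> {\<delta>..2}"
    then have "real k * x / real k \<in> (%x. x / real k) ` {\<delta>..2}" by (rule imageI)
    then show False using x k by simp
   qed
   then show "?f (real k * x) / real k * g x = 0" using f0 by simp
  next
   show "(%x. x / real k) ` {\<delta>..2} \<subseteq> {0..2}"
   proof clarify
    fix x assume x: "x \<in> {\<delta>..2}"
    have "x / real k <= x / 1" using x d k by (intro divide_left_mono) auto
    then show "x / real k \<in> {0..2}" using x d by auto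
   qed
  qed
 qed
 define L where "L = (%K v. \<Sum>k=1..K. h k v)"
 define R where "R = (%K x. (\<Sum>k=1..K. ?f (real k * x) / real k) * g x)"
 have Li: "(L K has_integral (\<Sum>k=1..K. integral {\<delta>..2} (h k))) {\<delta>..2}" for K
  unfolding L_def by (intro has_integral_sum integrable_integral integrable_continuous_real hc) auto
 have Ri: "(R K has_integral (\<Sum>k=1..K. integral {\<delta>..2} (h k))) {0..2}" for K
  unfolding R_def sum_distrib_right by (intro has_integral_sum Gterm) auto
 have LR: "integral {\<delta>..2} (L K) = integral {0..2} (R K)" for K by (simp only: integral_unique[OF Li] integral_unique[OF Ri])
 have Leq: "L K v = ?f v / v\<^sup>2 * (\<Sum>k=1..K. ln (1 + (v * w / real k)\<^sup>2))" for K v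
  unfolding L_def h_def by (simp add: sum_distrib_left)
 have lim: "(%K. \<Sum>k=1..K. ln (1 + (v * w / real k)\<^sup>2)) \<longlonglongrightarrow> log_sinhc (v * w)" if "v \<in> {\<delta>..2}" for v
  by (rule log_sinhc_product) (use that d w in auto)
 have lsc: "continuous_on {\<delta>..2} (%v. log_sinhc (v * w))"
  unfolding log_sinhc_def using d w by (intro continuous_intros) auto
 have "(%K. integral {\<delta>..2} (L K)) \<longlonglongrightarrow> integral {\<delta>..2} (%v. ?f v / v\<^sup>2 * log_sinhc (v * w))"
 proof (rule dominated_convergence(2))
  show "L k integrable_on {\<delta>..2}" for k using Li by blast
  show "(%v. \<bar>?f v\<bar> / v\<^sup>2 * log_sinhc (v * w)) integrable_on {\<delta>..2}"
   using d by (intro integrable_continuous_real continuous_intros fc lsc) auto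
  fix K v assume v: "v \<in> {\<delta>..2}"
  have "incseq (%K. \<Sum>k=1..K. ln (1 + (v * w / real k)\<^sup>2))" by (intro incseq_SucI) simp
  then have le: "(\<Sum>k=1..K. ln (1 + (v * w / real k)\<^sup>2)) <= log_sinhc (v * w)" by (rule incseq_le[OF _ lim[OF v]])
  have "0 <= (\<Sum>k=1..K. ln (1 + (v * w / real k)\<^sup>2))" by (intro sum_nonneg) auto
  then have "norm (L K v) = \<bar>?f v\<bar> / v\<^sup>2 * (\<Sum>k=1..K. ln (1 + (v * w / real k)\<^sup>2))" unfolding Leq by (simp add: abs_mult)
  also have "... <= \<bar>?f v\<bar> / v\<^sup>2 * log_sinhc (v * w)" using le by (intro mult_left_mono) auto
  finally show "norm (L K v) <= \<bar>?f v\<bar> / v\<^sup>2 * log_sinhc (v * w)" .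
 next
  fix v assume v: "v \<in> {\<delta>..2}"
  show "(%K. L K v) \<longlonglongrightarrow> ?f v / v\<^sup>2 * log_sinhc (v * w)" unfolding Leq by (intro tendsto_mult tendsto_const lim v)
 qed
 moreover have "(%K. integral {0..2} (R K)) \<longlonglongrightarrow> integral {0..2} (%x. if x \<in> {1..2} then W x / x\<^sup>2 * ln (1 + (x * w)\<^sup>2) else 0)"
 proof (rule dominated_convergence(2))
  show "R k integrable_on {0..2}" for k using Ri by blast
  show "(%x::real. 2 * B / \<delta> * w\<^sup>2) integrable_on {0..2}" by (rule integrable_const_ivl)
  fix K x assume x: "x \<in> {0..2::real}"
  show "norm (R K x) <= 2 * B / \<delta> * w\<^sup>2"
  proof (cases "x = 0")
   case True then show ?thesis using B0 d by (simp add: R_def g_def)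
  next
   case False
   then have x0: "x > 0" using x by simp
   define M where "M = nat \<lfloor>2 / x\<rfloor>"
   have M: "real M <= 2 / x" using x0 by (simp add: M_def)
   have z: "?f (real k * x) = 0" if "k > M" for k
   proof -
    have "\<lfloor>2 / x\<rfloor> < int k" using that unfolding M_def by linarith
    then have "2 / x < real k" by linarith
    then have "real k * x > 2" using x0 by (simp add: field_simps)
    then show ?thesis by (rule mobius_sum_zero)
   qed
   have "\<bar>\<Sum>k=1..K. ?f (real k * x) / real k\<bar> <= (\<Sum>k=1..K. if k <= M then B * x / \<delta> else 0)"
   proof (rule order_trans[OF sum_abs sum_mono])
    fix k assume k: "k \<in> {1..K}"
    show "\<bar>?f (real k * x) / real k\<bar> <= (if k <= M then B * x / \<delta> else 0)"
    proof (cases "k <= M")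
     case True
     show ?thesis
     proof (cases "real k * x < \<delta>")
      case True
      then have "?f (real k * x) = 0" using x0 k by (intro zero) auto
      then show ?thesis using B0 x0 d by simp
     next
      case False
      have "\<bar>?f (real k * x) / real k\<bar> <= B * (1 / real k)" using B[of "real k * x"] x0 k by (simp add: divide_right_mono)
      also have "... <= B * (x / \<delta>)" using False B0 d k by (intro mult_left_mono) (auto simp: field_simps)
      finally show ?thesis using \<open>k <= M\<close> by simp
     qed
    qed (simp add: z)
   qed
   also have "... <= (\<Sum>k=1..M. B * x / \<delta>)"
   proof -
    have "(\<Sum>k=1..K. if k <= M then B * x / \<delta> else 0) = (\<Sum>k\<in>{k\<in>{1..K}. k <= M}. B * x / \<delta>)" by (rule sum.inter_filter[symmetric]) simp
    also have "... <= (\<Sum>k=1..M. B * x / \<delta>)" using B0 x0 d by (intro sum_mono2) auto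
    finally show ?thesis .
   qed
   also have "... = real M * (B * x / \<delta>)" by simp
   also have "... <= 2 / x * (B * x / \<delta>)" using M B0 x0 d by (intro mult_right_mono) auto
   also have "... = 2 * B / \<delta>" using x0 by simp
   finally have 1: "\<bar>\<Sum>k=1..K. ?f (real k * x) / real k\<bar> <= 2 * B / \<delta>" .
   have "ln (1 + (x * w)\<^sup>2) <= (x * w)\<^sup>2" by (rule ln_add_one_self_le_self) simp
   then have "g x <= w\<^sup>2" using x0 by (simp add: g_def field_simps power_mult_distrib)
   moreover have "g x >= 0" by (simp add: g_def)
   ultimately have 2: "\<bar>g x\<bar> <= w\<^sup>2" by simp
   show ?thesis unfolding R_def real_norm_def abs_mult using 1 2 B0 d by (intro mult_mono) auto
  qed
 next
  fix x assume x: "x \<in> {0..2::real}"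
  show "(%K. R K x) \<longlonglongrightarrow> (if x \<in> {1..2} then W x / x\<^sup>2 * ln (1 + (x * w)\<^sup>2) else 0)"
  proof (cases "x = 0")
   case True then show ?thesis by (simp add: R_def g_def)
  next
   case False
   then have x0: "x > 0" using x by simp
   obtain K0 where K0: "2 / x <= real K0" using real_arch_simple by blast
   have "eventually (%K. R K x = (if x \<in> {1..2} then W x / x\<^sup>2 * ln (1 + (x * w)\<^sup>2) else 0)) sequentially"
    using eventually_ge_at_top[of K0]
   proof eventually_elim
    case (elim K)
    then have "2 / x <= real K" using K0 by linarith
    then have "R K x = W x * g x" unfolding R_def by (subst mobius_sum_inversion[OF x0 _ W2]) auto
    then show ?case using W1[of x] x by (auto simp: g_def)
   qed
   then show ?thesis by (rule tendsto_eventually)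
  qed
 qed
 ultimately have "integral {\<delta>..2} (%v. ?f v / v\<^sup>2 * log_sinhc (v * w)) = integral {0..2} (%x. if x \<in> {1..2} then W x / x\<^sup>2 * ln (1 + (x * w)\<^sup>2) else 0)"
  unfolding LR by (rule LIMSEQ_unique)
 also have "... = integral {1..2} (%x. W x / x\<^sup>2 * ln (1 + (x * w)\<^sup>2))" unfolding integral_restrict_Int by (rule arg_cong[where f = "%S. integral S _"]) auto
 finally show ?thesis .
qed

text \<open>If it vanished near \<open>0\<close>, the two evaluations of the logarithmic transform would differ only by an exponentially small quantity from a combination of \<open>w\<close>, \<open>log w\<close> and \<open>1\<close>, hence all inverse-square moments of \<open>W\<close>, and with them \<open>W\<close>, would be zero.\<close>
lemma mobius_sum_nonzero_near_0:
 assumes wt: "weight W" and d0: "\<delta> > 0"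
 shows "\<exists>x. 0 < x & x < \<delta> & mobius_sum W x ~= 0"
proof (rule ccontr)
 assume neg: "\<not> ?thesis"
 define d where "d = min \<delta> 1"
 have d: "0 < d" "d <= 1" using d0 by (auto simp: d_def)
 let ?f = "mobius_sum W"
 have zero: "?f x = 0" if "0 < x" "x < d" for x using neg that unfolding d_def by auto
 note w = weight_derivs[OF wt]
 have W2: "W u = 0" if "u > 2" for u using w(5)[of u] that by simp
 have W1: "W u = 0" if "0 <= u" "u < 1" for u using w(6)[of u] that by simp
 obtain C where C: "C >= 1" "!!x. x > 0 ==> \<bar>?f x\<bar> <= C * rho 3 (1 / x)"
  by (rule weight_gsum_bounds[OF wt]) blast
 have B: "\<bar>?f x\<bar> <= C" if "x > 0" for x
  using C(2)[OF that] mult_left_mono[OF rho_le_1[of 3 "1/x"], of C] C(1) by linarith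
 have Wc: "continuous_on {1..2} W" using w(1) by (intro continuous_at_imp_continuous_on ballI DERIV_isCont)
 have fc: "continuous_on {d..2} ?f" by (rule continuous_on_subset[OF mobius_sum_continuous[OF w(1) W2]]) (use d in auto)
 define q where "q = (%x. W x / x\<^sup>2)"
 have qc: "continuous_on {1..2} q" unfolding q_def by (intro continuous_intros Wc) auto
 define p where "p = (%v. ?f v / v\<^sup>2)"
 have pc: "continuous_on {d..2} p" unfolding p_def using d by (intro continuous_intros fc) auto
 define r where "r = (%w. integral {1..2} (%x. q x * ln (1 + 1 / (x * w)\<^sup>2)))"
 define s where "s = (%w. integral {d..2} (%v. p v * ln (1 - exp (- (2 * pi * (v * w))))))"
 define a b c where "a = integral {d..2} (%v. p v * (pi * v))"
  and "b = - integral {d..2} p - 2 * integral {1..2} q"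
  and "c = - integral {d..2} (%v. p v * ln (2 * pi * v)) - integral {1..2} (%x. q x * (2 * ln x))"
 have eq: "a * w + b * ln w + c = r w - s w" if w0: "w > 0" for w
 proof -
  have e1: "((%v. p v * (pi * v) * w) has_integral a * w) {d..2}"
   unfolding a_def by (intro has_integral_mult_left integrable_integral integrable_continuous_real continuous_intros pc)
  have e2: "((%v. p v * ln w) has_integral integral {d..2} p * ln w) {d..2}"
   by (intro has_integral_mult_left integrable_integral integrable_continuous_real pc)
  have e3: "((%v. p v * ln (2 * pi * v)) has_integral integral {d..2} (%v. p v * ln (2 * pi * v))) {d..2}"
   using d by (intro integrable_integral integrable_continuous_real continuous_intros pc) auto
  have e4: "((%v. p v * ln (1 - exp (- (2 * pi * (v * w))))) has_integral s w) {d..2}"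
   unfolding s_def using d w0 by (intro integrable_integral integrable_continuous_real continuous_intros pc) auto
  have "((%v. p v * (pi * v) * w - p v * ln w - p v * ln (2 * pi * v) + p v * ln (1 - exp (- (2 * pi * (v * w))))) has_integral
    (a * w - integral {d..2} p * ln w - integral {d..2} (%v. p v * ln (2 * pi * v)) + s w)) {d..2}"
   by (intro has_integral_add has_integral_diff e1 e2 e3 e4)
  moreover have "p v * (pi * v) * w - p v * ln w - p v * ln (2 * pi * v) + p v * ln (1 - exp (- (2 * pi * (v * w)))) = p v * log_sinhc (v * w)"
   if v: "v \<in> {d..2}" for v
  proof -
   have "ln (2 * pi * (v * w)) = ln (2 * pi * v) + ln w" using ln_mult[of "2 * pi * v" w] v d w0 by (simp add: mult.assoc)
   then show ?thesis unfolding log_sinhc_def by (simp add: algebra_simps)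
  qed
  ultimately have "((%v. p v * log_sinhc (v * w)) has_integral
    (a * w - integral {d..2} p * ln w - integral {d..2} (%v. p v * ln (2 * pi * v)) + s w)) {d..2}"
   by (rule has_integral_eq[rotated])
  then have L: "integral {d..2} (%v. p v * log_sinhc (v * w)) = a * w - integral {d..2} p * ln w - integral {d..2} (%v. p v * ln (2 * pi * v)) + s w"
   by (rule integral_unique)
  have f1: "((%x. q x * (2 * ln w)) has_integral integral {1..2} q * (2 * ln w)) {1..2}"
   by (intro has_integral_mult_left integrable_integral integrable_continuous_real qc)
  have f2: "((%x. q x * (2 * ln x)) has_integral integral {1..2} (%x. q x * (2 * ln x))) {1..2}"
   by (intro integrable_integral integrable_continuous_real continuous_intros qc) auto
  have f3: "((%x. q x * ln (1 + 1 / (x * w)\<^sup>2)) has_integral r w) {1..2}"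
  proof -
   have "1 + 1 / (x * w)\<^sup>2 ~= 0" for x using add_pos_nonneg[of 1 "1 / (x * w)\<^sup>2"] by simp
   then show ?thesis unfolding r_def using w0 by (intro integrable_integral integrable_continuous_real continuous_intros qc) auto
  qed
  have "((%x. q x * (2 * ln w) + q x * (2 * ln x) + q x * ln (1 + 1 / (x * w)\<^sup>2)) has_integral
    (integral {1..2} q * (2 * ln w) + integral {1..2} (%x. q x * (2 * ln x)) + r w)) {1..2}"
   by (intro has_integral_add f1 f2 f3)
  moreover have "q x * (2 * ln w) + q x * (2 * ln x) + q x * ln (1 + 1 / (x * w)\<^sup>2) = q x * ln (1 + (x * w)\<^sup>2)" if x: "x \<in> {1..2}" for x
  proof -
   have xw: "x * w > 0" using x w0 by simp
   have "1 + (x * w)\<^sup>2 = (x * w)\<^sup>2 * (1 + 1 / (x * w)\<^sup>2)" using x w0 by (simp add: distrib_left)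
   moreover have "0 <= 1 / (x * w)\<^sup>2" by simp
   then have "1 + 1 / (x * w)\<^sup>2 ~= 0" by linarith
   ultimately have "ln (1 + (x * w)\<^sup>2) = ln ((x * w)\<^sup>2) + ln (1 + 1 / (x * w)\<^sup>2)"
    using xw ln_mult[of "(x * w)\<^sup>2" "1 + 1 / (x * w)\<^sup>2"] by simp
   also have "ln ((x * w)\<^sup>2) = 2 * (ln x + ln w)" using ln_realpow[of "x * w" 2] xw ln_mult[of x w] x w0 by simp
   finally show ?thesis by (simp add: algebra_simps)
  qed
  ultimately have "((%x. q x * ln (1 + (x * w)\<^sup>2)) has_integral
    (integral {1..2} q * (2 * ln w) + integral {1..2} (%x. q x * (2 * ln x)) + r w)) {1..2}"
   by (rule has_integral_eq[rotated])
  then have R: "integral {1..2} (%x. q x * ln (1 + (x * w)\<^sup>2)) = integral {1..2} q * (2 * ln w) + integral {1..2} (%x. q x * (2 * ln x)) + r w"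
   by (rule integral_unique)
  have "integral {d..2} (%v. p v * log_sinhc (v * w)) = integral {1..2} (%x. q x * ln (1 + (x * w)\<^sup>2))"
   unfolding p_def q_def by (rule mobius_sum_log_transform[OF w(1) W2 W1 B d zero w0])
  then show ?thesis unfolding L R b_def c_def by (simp add: algebra_simps)
 qed
 have "bounded (p ` {d..2})" using pc by (intro compact_imp_bounded compact_continuous_image) auto
 then obtain P where "\<forall>y\<in>p ` {d..2}. norm y <= P" unfolding bounded_iff by blast
 then have P: "!!v. v \<in> {d..2} ==> \<bar>p v\<bar> <= P" by auto
 have "bounded (q ` {1..2})" using qc by (intro compact_imp_bounded compact_continuous_image) auto
 then obtain S where "\<forall>y\<in>q ` {1..2}. norm y <= S" unfolding bounded_iff by blast
 then have S: "!!x. x \<in> {1..2} ==> \<bar>q x\<bar> <= S" by auto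
 have P0: "P >= 0" using P[of 2] d by simp
 have sb: "\<bar>s w\<bar> <= 4 * P * exp (- (2 * pi * d * w))" if w0: "w >= 1 / d" for w
 proof -
  have wp: "w > 0" using w0 d by (smt (verit) divide_pos_pos)
  have "norm (s w) <= P * (2 * exp (- (2 * pi * d * w))) * (2 - d)"
   unfolding s_def
  proof (rule integral_bound)
   show "continuous_on {d..2} (%v. p v * ln (1 - exp (- (2 * pi * (v * w)))))" using d wp by (intro continuous_intros pc) auto
   fix v assume v: "v \<in> {d..2}"
   define u where "u = exp (- (2 * pi * (v * w)))"
   have "1 <= d * w" using w0 d by (simp add: field_simps)
   moreover have "d * w <= v * w" using v wp by (intro mult_right_mono) auto
   ultimately have vw: "1 <= v * w" "d * w <= v * w" by auto
   have "1 * 1 <= 2 * pi * (v * w)" using vw pi_gt3 by (intro mult_mono) auto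
   then have "exp 1 <= exp (2 * pi * (v * w))" by simp
   then have "2 <= exp (2 * pi * (v * w))" using exp_ge_add_one_self[of "1::real"] by linarith
   then have u: "0 <= u" "u <= 1/2" unfolding u_def exp_minus by (auto simp: field_simps)
   have "- u - 2 * u\<^sup>2 <= ln (1 - u)" by (rule ln_one_minus_pos_lower_bound[OF u])
   moreover have "u\<^sup>2 <= u * (1/2)" unfolding power2_eq_square using u by (intro mult_left_mono) auto
   moreover have "ln (1 - u) <= 0" using u by (intro ln_le_zero_iff[THEN iffD2]) auto
   ultimately have l: "\<bar>ln (1 - u)\<bar> <= 2 * u" by linarith
   have "2 * pi * d * w <= 2 * pi * (v * w)" using vw by (simp add: mult.assoc)
   then have "u <= exp (- (2 * pi * d * w))" by (simp add: u_def)
   then have l': "\<bar>ln (1 - u)\<bar> <= 2 * exp (- (2 * pi * d * w))" using l by linarith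
   show "norm (p v * ln (1 - exp (- (2 * pi * (v * w))))) <= P * (2 * exp (- (2 * pi * d * w)))"
    unfolding u_def[symmetric] real_norm_def abs_mult using l' P[OF v] P0 by (intro mult_mono) auto
  qed (use d in auto)
  also have "... <= P * (2 * exp (- (2 * pi * d * w))) * 2" using P0 d by (intro mult_left_mono) auto
  finally show ?thesis by simp
 qed
 have rb: "\<bar>r w\<bar> <= S / w\<^sup>2" if wp: "w > 0" for w
 proof -
  have pos: "1 + 1 / (x * w)\<^sup>2 ~= 0" for x using add_pos_nonneg[of 1 "1 / (x * w)\<^sup>2"] by simp
  have "norm (r w) <= S * (1 / w\<^sup>2) * (2 - 1)"
   unfolding r_def
  proof (rule integral_bound)
   show "continuous_on {1..2} (%x. q x * ln (1 + 1 / (x * w)\<^sup>2))" using wp pos by (intro continuous_intros qc) auto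
   fix x :: real assume x: "x \<in> {1..2}"
   have "1 * w <= x * w" using x wp by (intro mult_right_mono) auto
   then have "w\<^sup>2 <= (x * w)\<^sup>2" using wp by (intro power_mono) auto
   then have "1 / (x * w)\<^sup>2 <= 1 / w\<^sup>2" using wp x by (intro divide_left_mono) auto
   moreover have "ln (1 + 1 / (x * w)\<^sup>2) <= 1 / (x * w)\<^sup>2" by (rule ln_add_one_self_le_self) simp
   moreover have "0 <= ln (1 + 1 / (x * w)\<^sup>2)" by simp
   ultimately have "\<bar>ln (1 + 1 / (x * w)\<^sup>2)\<bar> <= 1 / w\<^sup>2" by linarith
   then show "norm (q x * ln (1 + 1 / (x * w)\<^sup>2)) <= S * (1 / w\<^sup>2)"
    unfolding real_norm_def abs_mult using S[OF x] by (intro mult_mono) auto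
  qed simp
  then show ?thesis by simp
 qed
 have "((%w. a * w + b * ln w + c) \<longlongrightarrow> 0) at_top"
 proof (rule Lim_null_comparison)
  show "eventually (%w. norm (a * w + b * ln w + c) <= S / w\<^sup>2 + 4 * P * exp (- (2 * pi * d * w))) at_top"
   using eventually_ge_at_top[of "1 / d"] eventually_gt_at_top[of 0]
  proof eventually_elim
   case (elim w)
   then show ?case using eq[of w] sb[of w] rb[of w] by simp
  qed
  define k where "k = 2 * pi * d"
  have "k > 0" using d by (simp add: k_def)
  then have "((%w. S / w\<^sup>2 + 4 * P * exp (- (k * w))) \<longlongrightarrow> 0) at_top" by real_asymp
  then show "((%w. S / w\<^sup>2 + 4 * P * exp (- (2 * pi * d * w))) \<longlongrightarrow> 0) at_top" by (simp add: k_def)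
 qed
 note abc = log_linear_coefficients_zero[OF this]
 have flat: "\<bar>integral {1..2} (%x. q x * ln (1 + 1 / (x * w)\<^sup>2))\<bar> <= 4 * P * exp (- (2 * pi * d * w))" if "w >= 1 / d" for w
 proof -
  have "1 / d > 0" using d by simp
  then have "w > 0" using that by linarith
  then have "r w = s w" using eq[of w] abc by simp
  then show ?thesis using sb[OF that] by (simp add: r_def)
 qed
 have "W x = 0" if "x \<in> {1..2}" for x
 proof (rule zero_of_inverse_square_moments_zero[OF Wc _ that])
  fix n :: nat assume "n >= 1"
  then show "integral {1..2} (%x. W x / x\<^sup>2 * (1 / x\<^sup>2) ^ n) = 0"
   using moments_zero_of_flat_log_transform[OF qc _ flat] d unfolding q_def by simp
 qed
 then have Wz: "W x = 0" if "x \<in> {0..}" for x using W1[of x] W2[of x] that by force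
 have "(W has_integral 0) {0..}" by (rule has_integral_is_0) (rule Wz)
 then show False using w(7) by (simp add: integral_unique)
qed

section \<open>The limiting profile\<close>

lemma rho_tendsto_0: "(rho 2 \<longlongrightarrow> 0) at_top"
proof -
 have "((%u::real. 1 / (1 + ln u)\<^sup>2) \<longlongrightarrow> 0) at_top" by real_asymp
 moreover have "eventually (%u. rho 2 u = 1 / (1 + ln u)\<^sup>2) at_top"
  using eventually_ge_at_top[of 1] by eventually_elim (simp add: rho_def)
 ultimately show ?thesis by (simp add: tendsto_cong)
qed

lemma rho_scaled_tendsto_0: "y > 0 ==> (%Z::nat. rho 2 (real Z / y)) \<longlonglongrightarrow> 0"
 by (rule filterlim_compose[OF rho_tendsto_0])
   (auto simp: divide_inverse intro!: filterlim_at_top_mult_tendsto_pos[OF tendsto_const] filterlim_real_sequentially)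

lemma gsum_limit:
 assumes tail: "!!Y Z x. x > 0 ==> Z >= 1 ==> x <= real Z ==> Z <= Y ==> \<bar>gsum W Y x - gsum W Z x\<bar> <= C * rho 2 (real Z / x)"
 obtains G where "!!x Z. x > 0 ==> Z >= 1 ==> x <= real Z ==> \<bar>gsum W Z x - G x\<bar> <= C * rho 2 (real Z / x)"
proof -
 have conv: "convergent (%Z. gsum W Z x)" if x: "x > 0" for x
 proof -
  have lim: "(%Z::nat. C * rho 2 (real Z / x)) \<longlonglongrightarrow> C * 0" by (intro tendsto_mult tendsto_const rho_scaled_tendsto_0 x)
  have "Cauchy (%Z. gsum W Z x)"
  proof (rule CauchyI)
   fix e :: real assume e: "0 < e"
   have "eventually (%Z::nat. C * rho 2 (real Z / x) < e / 2 & Z >= 1 & Z >= nat \<lceil>x\<rceil>) sequentially"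
    using order_tendstoD(2)[OF lim, of "e / 2"] e by (intro eventually_conj eventually_ge_at_top) auto
   then obtain Z :: nat where Z: "C * rho 2 (real Z / x) < e / 2" "Z >= 1" "Z >= nat \<lceil>x\<rceil>"
    by (auto simp: eventually_sequentially)
   have xZ: "x <= real Z" using Z(3) by linarith
   have close: "\<bar>gsum W Y x - gsum W Z x\<bar> < e / 2" if "Y >= Z" for Y
    using tail[OF x Z(2) xZ that] Z(1) by linarith
   show "\<exists>M. \<forall>m\<ge>M. \<forall>n\<ge>M. norm (gsum W m x - gsum W n x) < e"
   proof (intro exI allI impI)
    fix m n assume "m >= Z" "n >= Z"
    then show "norm (gsum W m x - gsum W n x) < e" using close[of m] close[of n] unfolding real_norm_def by linarith
   qed
  qed
  then show ?thesis by (rule Cauchy_convergent)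
 qed
 define G where "G = (%x. lim (%Z. gsum W Z x))"
 show ?thesis
 proof (rule that[of G])
  fix x :: real and Z :: nat assume a: "x > 0" "Z >= 1" "x <= real Z"
  have "(%Y. gsum W Y x) \<longlonglongrightarrow> G x" using conv[OF a(1)] by (simp add: G_def convergent_LIMSEQ_iff)
  then have "(%Y. \<bar>gsum W Y x - gsum W Z x\<bar>) \<longlonglongrightarrow> \<bar>G x - gsum W Z x\<bar>" by (intro tendsto_intros)
  then have "\<bar>G x - gsum W Z x\<bar> <= C * rho 2 (real Z / x)"
   by (rule tendsto_upperbound) (auto intro!: eventually_mono[OF eventually_ge_at_top[of Z]] tail a)
  then show "\<bar>gsum W Z x - G x\<bar> <= C * rho 2 (real Z / x)" by linarith
 qed
qed

lemma mobius_sum_from_gsum: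
 assumes x: "x > 0" and Y: "Y >= 1"
 shows "mobius_sum W x = (\<Sum>j=1..Y. mu j / real j * gsum W (Y div j) (x / real j))"
proof -
 let ?F = "%l. mobius_sum W (x / real l) / real l"
 have "(\<Sum>j=1..Y. mu j / real j * gsum W (Y div j) (x / real j)) = (\<Sum>j=1..Y. \<Sum>i=1..Y div j. mu j * ?F (j * i))"
 proof (rule sum.cong[OF refl])
  fix j assume j: "j \<in> {1..Y}"
  have "gsum W (Y div j) (x / real j) = (\<Sum>i=1..Y div j. mobius_sum W (x / real j / real i) / real i)"
   using x j by (simp add: gsum_def divisor_sum_def)
  then show "mu j / real j * gsum W (Y div j) (x / real j) = (\<Sum>i=1..Y div j. mu j * ?F (j * i))"
   by (simp add: sum_distrib_left)
 qed
 also have "... = (\<Sum>l=1..Y. \<Sum>q | q dvd l. mu q * ?F l)" by (rule sum_dvd_swap[symmetric])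
 also have "... = (\<Sum>l=1..Y. if l = 1 then mobius_sum W x else 0)"
 proof (intro sum.cong refl)
  fix l assume l: "l \<in> {1..Y}"
  have "(\<Sum>q | q dvd l. mu q * ?F l) = (\<Sum>q | q dvd l. mu q) * ?F l" by (rule sum_distrib_right[symmetric])
  also have "(\<Sum>q | q dvd l. mu q) = of_bool (l = 1)" using l by (intro sum_mu_dvd) auto
  finally show "(\<Sum>q | q dvd l. mu q * ?F l) = (if l = 1 then mobius_sum W x else 0)" by auto
 qed
 also have "... = mobius_sum W x" using Y by simp
 finally show ?thesis by simp
qed

text \<open>The Moebius sum is recovered from the profiles by inversion at level \<open>Y\<close>. If the limit vanished near \<open>0\<close>, every profile in this formula would be \<open>O(log(Y)^(-2))\<close>, while the weights sum to \<open>O(log Y)\<close>.\<close>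
lemma gsum_limit_nonzero_near_0:
 assumes wt: "weight W" and C: "C >= 0" and d: "\<delta> > 0"
  and G: "!!x Z. x > 0 ==> Z >= 1 ==> x <= real Z ==> \<bar>gsum W Z x - G x\<bar> <= C * rho 2 (real Z / x)"
 shows "\<exists>y. 0 < y & y < \<delta> & G y ~= 0"
proof (rule ccontr)
 assume neg: "\<not> ?thesis"
 have "mobius_sum W x = 0" if x: "0 < x" "x < min \<delta> 1" for x
 proof -
  have bound: "\<bar>mobius_sum W x\<bar> <= C * ((1 + ln (real Y)) * rho 2 (real Y / 2))" if Y: "Y >= 1" for Y :: nat
  proof -
   have "\<bar>mobius_sum W x\<bar> <= (\<Sum>j=1..Y. (1 / real j) * (C * rho 2 (real Y / 2)))"
    unfolding mobius_sum_from_gsum[OF x(1) Y, of W]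
   proof (rule order_trans[OF sum_abs sum_mono])
    fix j assume j: "j \<in> {1..Y}"
    define Z where "Z = Y div j"
    have Z1: "Z >= 1" using j by (simp add: Z_def div_greater_zero_iff Suc_le_eq)
    have j0: "0 < j" using j by simp
    have "Y < Z * j + j" using div_mult_mod_eq[of Y j] mod_less_divisor[OF j0, of Y] unfolding Z_def by linarith
    also have "... <= Z * j + Z * j" using Z1 by simp
    finally have "real Y <= 2 * (real Z * real j)" by (simp flip: of_nat_mult)
    then have Yh: "real Y / 2 <= real Z * real j" by simp
    have xj: "0 < x / real j" "x / real j <= x" "x / real j <= 1" using x j divide_left_mono[of 1 "real j" x] by (auto simp: field_simps)
    have G0: "G (x / real j) = 0" using neg xj x by (metis le_less_trans min_less_iff_conj)
    have "\<bar>gsum W Z (x / real j) - G (x / real j)\<bar> <= C * rho 2 (real Z / (x / real j))"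
     by (rule G) (use xj Z1 in auto)
    also have "... <= C * rho 2 (real Y / 2)"
    proof (intro mult_left_mono rho_antimono C)
     have "real Z * real j * 1 <= real Z * real j / x" using x mult_right_mono[of x 1 "real Z * real j"] by (simp add: field_simps)
     moreover have "real Z / (x / real j) = real Z * real j / x" by simp
     ultimately show "real Y / 2 <= real Z / (x / real j)" using Yh by linarith
     show "0 < real Y / 2" using Y by simp
    qed
    finally have g: "\<bar>gsum W Z (x / real j)\<bar> <= C * rho 2 (real Y / 2)" using G0 by simp
    have "\<bar>mu j / real j * gsum W Z (x / real j)\<bar> = (\<bar>mu j\<bar> / real j) * \<bar>gsum W Z (x / real j)\<bar>" by (simp add: abs_mult)
    also have "... <= (1 / real j) * (C * rho 2 (real Y / 2))"
     using g abs_mu_le[of j] by (intro mult_mono divide_right_mono) auto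
    finally show "\<bar>mu j / real j * gsum W (Y div j) (x / real j)\<bar> <= (1 / real j) * (C * rho 2 (real Y / 2))" by (simp add: Z_def)
   qed
   also have "... = (\<Sum>j=1..Y. 1 / real j) * (C * rho 2 (real Y / 2))" by (rule sum_distrib_right[symmetric])
   also have "... <= (1 + ln (real Y)) * (C * rho 2 (real Y / 2))"
    using harmonic_le[of Y] Y C by (intro mult_right_mono) (auto simp: max_def)
   finally show ?thesis by (simp add: mult_ac)
  qed
  have "(%Y::nat. C * ((1 + ln (real Y)) * (1 / (1 + ln (real Y / 2))\<^sup>2))) \<longlonglongrightarrow> C * 0"
   by (intro tendsto_mult tendsto_const) real_asymp
  moreover have "eventually (%Y::nat. C * ((1 + ln (real Y)) * (1 / (1 + ln (real Y / 2))\<^sup>2)) = C * ((1 + ln (real Y)) * rho 2 (real Y / 2))) sequentially"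
   using eventually_ge_at_top[of 2] by eventually_elim (simp add: rho_def)
  ultimately have "(%Y::nat. C * ((1 + ln (real Y)) * rho 2 (real Y / 2))) \<longlonglongrightarrow> C * 0" by (rule Lim_transform_eventually)
  then have "\<bar>mobius_sum W x\<bar> <= C * 0"
   by (rule tendsto_lowerbound) (auto intro!: eventually_mono[OF eventually_ge_at_top[of 1]] bound)
  then show ?thesis by simp
 qed
 moreover have "min \<delta> 1 > 0" using d by simp
 ultimately show False using mobius_sum_nonzero_near_0[OF wt, of "min \<delta> 1"] by blast
qed

section \<open>Resonating waves\<close>

text \<open>Two intervals of equal length, the second with sign \<open>\<sigma>\<close>.\<close>
definition pulse :: "nat => nat => real => nat => real" where
 "pulse M H \<sigma> n = (if n \<in> {1..M} then 1 else if n \<in> {H+1..H+M} then \<sigma> else 0)"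

definition wave :: "nat => nat => nat => nat => nat => real => nat => complex" where
 "wave N q M H b \<sigma> n = of_real (sqrt (real N / (2 * real M)) * pulse M H \<sigma> n) * add_char (real n * (real b / real q))"

lemma sum_pulse:
 fixes F :: "nat => 'a::real_algebra_1"
 assumes M: "M <= H" "H + M <= N"
 shows "(\<Sum>n=1..N. of_real (pulse M H \<sigma> n) * F n) = (\<Sum>n=1..M. F n) + of_real \<sigma> * (\<Sum>n=H+1..H+M. F n)"
proof -
 have "(\<Sum>n=1..N. of_real (pulse M H \<sigma> n) * F n) = (\<Sum>n\<in>{1..M} \<union> {H+1..H+M}. of_real (pulse M H \<sigma> n) * F n)"
  by (rule sum.mono_neutral_right) (use M in \<open>auto simp: pulse_def\<close>)
 also have "... = (\<Sum>n=1..M. of_real (pulse M H \<sigma> n) * F n) + (\<Sum>n=H+1..H+M. of_real (pulse M H \<sigma> n) * F n)"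
  by (rule sum.union_disjoint) (use M in auto)
 also have "(\<Sum>n=1..M. of_real (pulse M H \<sigma> n) * F n) = (\<Sum>n=1..M. F n)" by (intro sum.cong refl) (auto simp: pulse_def)
 also have "(\<Sum>n=H+1..H+M. of_real (pulse M H \<sigma> n) * F n) = of_real \<sigma> * (\<Sum>n=H+1..H+M. F n)"
  unfolding sum_distrib_left by (intro sum.cong refl) (use M in \<open>auto simp: pulse_def\<close>)
 finally show ?thesis .
qed

lemma pulse_mult: "M <= H ==> pulse M H \<sigma> n * pulse M H \<sigma>' n = pulse M H (\<sigma> * \<sigma>') n"
 by (simp add: pulse_def)

lemma abs_pulse: "\<bar>\<sigma>\<bar> = 1 ==> \<bar>pulse M H \<sigma> n\<bar> = pulse M H 1 n"
 by (simp add: pulse_def)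

lemma sum_pulse_1: "M <= H ==> H + M <= N ==> (\<Sum>n=1..N. pulse M H 1 n) = 2 * real M"
 using sum_pulse[of M H N 1 "%_. 1 :: real"] by simp

lemma tot_var_pulse:
 assumes s: "\<bar>\<sigma>\<bar> = 1"
 shows "tot_var N (pulse M H \<sigma>) <= 6"
proof -
 have "tot_var N (pulse M H \<sigma>) <= (\<Sum>m=1..<N. if m \<in> {M, H, H + M} then 2 else 0)"
  unfolding tot_var_def
 proof (rule sum_mono)
  fix m assume m: "m \<in> {1..<N}"
  have b: "\<bar>pulse M H \<sigma> n\<bar> <= 1" for n using s by (simp add: pulse_def)
  show "\<bar>pulse M H \<sigma> (Suc m) - pulse M H \<sigma> m\<bar> <= (if m \<in> {M, H, H + M} then 2 else 0)"
  proof (cases "m \<in> {M, H, H + M}")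
   case True
   then show ?thesis using b[of m] b[of "Suc m"] by simp
  next
   case False
   then have "pulse M H \<sigma> (Suc m) = pulse M H \<sigma> m" using m by (auto simp: pulse_def)
   then show ?thesis using False by simp
  qed
 qed
 also have "... = (\<Sum>m\<in>{m\<in>{1..<N}. m \<in> {M, H, H + M}}. 2)" by (rule sum.inter_filter[symmetric]) simp
 also have "... <= (\<Sum>m\<in>{M, H, H + M}. 2)" by (intro sum_mono2) auto
 also have "... <= 2 * real (card {M, H, H + M})" by simp
 also have "card {M, H, H + M} <= 3" using card_length[of "[M, H, H + M]"] by simp
 finally show ?thesis by simp
qed

lemma sum_add_char_periods:
 assumes q: "q > 0" and h: "\<not> int q dvd h"
 shows "(\<Sum>n=s+1..s+q*r. add_char (real n * (of_int h / real q))) = 0"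
proof (induction r)
 case (Suc r)
 have per: "(\<Sum>n=x+1..x+q. add_char (real n * (of_int h / real q))) = 0" for x
 proof -
  have "(\<Sum>n=x+1..x+q. add_char (real n * (of_int h / real q))) = (\<Sum>a=1..q. add_char (real (a + x) * (of_int h / real q)))"
   using sum.shift_bounds_cl_nat_ivl[of "%n. add_char (real n * (of_int h / real q))" 1 x q] by (simp add: add.commute)
  also have "... = (\<Sum>a=1..q. add_char (real x * (of_int h / real q)) * add_char (of_int h * real a / real q))"
   by (intro sum.cong refl) (simp add: add_char_add[symmetric] add_divide_distrib algebra_simps)
  also have "... = add_char (real x * (of_int h / real q)) * (\<Sum>a=1..q. add_char (of_int h * real a / real q))"
   by (rule sum_distrib_left[symmetric])
  also have "... = 0" using sum_add_char_complete[OF q, of h] h by simp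
  finally show ?thesis .
 qed
 have "{s+1..s+q*Suc r} = {s+1..s+q*r} \<union> {s+q*r+1..s+q*r+q}" by auto
 then have "(\<Sum>n=s+1..s+q*Suc r. add_char (real n * (of_int h / real q)))
   = (\<Sum>n=s+1..s+q*r. add_char (real n * (of_int h / real q))) + (\<Sum>n=s+q*r+1..s+q*r+q. add_char (real n * (of_int h / real q)))"
  by (simp only:) (rule sum.union_disjoint; auto)
 then show ?case using Suc per[of "s + q * r"] by simp
qed simp

lemma wave_product:
 assumes M: "M <= H" and N: "N >= 1"
 shows "wave N q M H b \<sigma> m * cnj (wave N q M H b' \<sigma>' n)
  = of_real (real N / (2 * real M) * (pulse M H \<sigma> m * pulse M H \<sigma>' n)) * add_char (real m * (real b / real q) - real n * (real b' / real q))"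
proof -
 have "add_char (real m * (real b / real q) - real n * (real b' / real q)) = add_char (real m * (real b / real q)) * add_char (- (real n * (real b' / real q)))"
  unfolding add_char_add[symmetric] by simp
 moreover have "sqrt (real N / (2 * real M)) * sqrt (real N / (2 * real M)) = real N / (2 * real M)" by simp
 then have "complex_of_real (real N / (2 * real M)) = of_real (sqrt (real N / (2 * real M))) * of_real (sqrt (real N / (2 * real M)))"
  by (simp only: of_real_mult[symmetric])
 ultimately show ?thesis unfolding wave_def complex_cnj_mult complex_cnj_complex_of_real cnj_add_char
  by (simp only: of_real_mult mult_ac)
qed

text \<open>The intervals have length a multiple of \<open>q\<close>, so different frequencies are exactly orthogonal, and so are different signs at different frequencies.\<close>
lemma wave_herm:
 assumes q: "q > 0" and M: "M = q * r" "r >= 1" "M <= H" "H + M <= N" and b: "b \<in> {1..<q}" "b' \<in> {1..<q}"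
  and s: "\<bar>\<sigma>\<bar> = 1" and same: "b = b' ==> \<sigma> = \<sigma>'"
 shows "herm N (wave N q M H b \<sigma>) (wave N q M H b' \<sigma>') = of_bool (b = b')"
proof -
 have "1 * 1 <= q * r" using q M by (intro mult_le_mono) auto
 then have "1 <= M" using M(1) by simp
 then have M0: "M >= 1" "N >= 1" using M(3,4) by linarith+
 define h where "h = int b - int b'"
 have e: "real n * (real b / real q) - real n * (real b' / real q) = real n * (of_int h / real q)" for n
  by (simp add: h_def diff_divide_distrib right_diff_distrib)
 have "(\<Sum>n=1..N. wave N q M H b \<sigma> n * cnj (wave N q M H b' \<sigma>' n))
  = of_real (real N / (2 * real M)) * (\<Sum>n=1..N. of_real (pulse M H (\<sigma> * \<sigma>') n) * add_char (real n * (of_int h / real q)))"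
  unfolding wave_product[OF M(3) M0(2)] e pulse_mult[OF M(3)] sum_distrib_left by (intro sum.cong refl) (simp only: of_real_mult mult.assoc)
 also have "(\<Sum>n=1..N. of_real (pulse M H (\<sigma> * \<sigma>') n) * add_char (real n * (of_int h / real q)))
  = (\<Sum>n=1..M. add_char (real n * (of_int h / real q))) + of_real (\<sigma> * \<sigma>') * (\<Sum>n=H+1..H+M. add_char (real n * (of_int h / real q)))"
  by (rule sum_pulse[OF M(3,4)])
 also have "... = of_bool (b = b') * (2 * of_nat M)"
 proof (cases "b = b'")
  case True
  have "\<sigma> * \<sigma> = 1" using s by (metis abs_mult_self_eq mult_1)
  then show ?thesis using True same by (simp add: h_def add_char_0 flip: of_real_mult)
 next
  case False
  have nd: "\<not> int q dvd h"
  proof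
   assume "int q dvd h"
   then have "int q <= \<bar>h\<bar>" using False dvd_imp_le_int[of h "int q"] by (auto simp: h_def)
   then show False using b by (auto simp: h_def)
  qed
  have "(\<Sum>n=1..M. add_char (real n * (of_int h / real q))) = 0" using sum_add_char_periods[OF q nd, of 0 r] M by simp
  moreover have "(\<Sum>n=H+1..H+M. add_char (real n * (of_int h / real q))) = 0" using sum_add_char_periods[OF q nd, of H r] M by simp
  ultimately show ?thesis using False by simp
 qed
 finally show ?thesis using M0 by (simp add: herm_def)
qed

lemma wave_seq_space: "H + M <= N ==> wave N q M H b \<sigma> \<in> seq_space N"
 by (auto simp: seq_space_def wave_def pulse_def)

lemma sq_norm_of_herm:
 assumes "herm N \<phi> \<phi> = 1" "N >= 1"
 shows "sq_norm N \<phi> = real N"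
proof -
 have "(\<Sum>n=1..N. \<phi> n * cnj (\<phi> n)) = of_nat N" using assms by (simp add: herm_def field_simps)
 then have "complex_of_real (sq_norm N \<phi>) = complex_of_real (real N)" unfolding sq_norm_def by (simp add: complex_norm_square del: of_real_power)
 then show ?thesis by (simp only: of_real_eq_iff)
qed

lemma form_le_hilbert_schmidt:
 fixes t :: "nat => nat => real"
 assumes n: "sq_norm N \<phi> = real N" and h: "(\<Sum>m=1..N. \<Sum>n=1..N. (t m n)\<^sup>2) <= (real N)\<^sup>2 * \<kappa>\<^sup>2" and k: "\<kappa> > 0"
 shows "cmod (\<Sum>m=1..N. \<Sum>n=1..N. \<phi> m * cnj (\<phi> n) * of_real (t m n)) <= (real N)\<^sup>2 * \<kappa>"
proof -
 have pt: "cmod (\<phi> m * cnj (\<phi> n) * of_real (t m n)) <= \<kappa> / 2 * ((cmod (\<phi> m))\<^sup>2 * (cmod (\<phi> n))\<^sup>2) + 1 / (2 * \<kappa>) * (t m n)\<^sup>2" for m n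
 proof -
  define x y where "x = cmod (\<phi> m) * cmod (\<phi> n)" and "y = \<bar>t m n\<bar>"
  have "2 * (\<kappa> * x) * y <= (\<kappa> * x)\<^sup>2 + y\<^sup>2" by (rule sum_squares_bound)
  then have "(2 * (\<kappa> * x) * y) / (2 * \<kappa>) <= ((\<kappa> * x)\<^sup>2 + y\<^sup>2) / (2 * \<kappa>)" using k by (intro divide_right_mono) auto
  then have "x * y <= \<kappa> / 2 * x\<^sup>2 + 1 / (2 * \<kappa>) * y\<^sup>2" using k by (simp add: power2_eq_square add_divide_distrib mult_ac)
  then show ?thesis by (simp add: x_def y_def norm_mult power_mult_distrib)
 qed
 have "cmod (\<Sum>m=1..N. \<Sum>n=1..N. \<phi> m * cnj (\<phi> n) * of_real (t m n)) <= (\<Sum>m=1..N. \<Sum>n=1..N. \<kappa> / 2 * ((cmod (\<phi> m))\<^sup>2 * (cmod (\<phi> n))\<^sup>2) + 1 / (2 * \<kappa>) * (t m n)\<^sup>2)"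
  by (intro order_trans[OF norm_sum sum_mono] order_trans[OF norm_sum sum_mono] pt)
 also have "... = \<kappa> / 2 * (\<Sum>m=1..N. \<Sum>n=1..N. (cmod (\<phi> m))\<^sup>2 * (cmod (\<phi> n))\<^sup>2) + 1 / (2 * \<kappa>) * (\<Sum>m=1..N. \<Sum>n=1..N. (t m n)\<^sup>2)"
  by (simp only: sum.distrib sum_distrib_left)
 also have "(\<Sum>m=1..N. \<Sum>n=1..N. (cmod (\<phi> m))\<^sup>2 * (cmod (\<phi> n))\<^sup>2) = sq_norm N \<phi> * sq_norm N \<phi>" by (simp only: sq_norm_def sum_product)
 also have "\<kappa> / 2 * (sq_norm N \<phi> * sq_norm N \<phi>) + 1 / (2 * \<kappa>) * (\<Sum>m=1..N. \<Sum>n=1..N. (t m n)\<^sup>2) <= \<kappa> / 2 * (sq_norm N \<phi> * sq_norm N \<phi>) + 1 / (2 * \<kappa>) * ((real N)\<^sup>2 * \<kappa>\<^sup>2)"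
  using h k by (intro add_left_mono mult_left_mono) auto
 also have "... = (real N)\<^sup>2 * \<kappa>" using k n by (simp add: power2_eq_square)
 finally show ?thesis .
qed

text \<open>Pairs within one interval see the profile near \<open>0\<close>, where it is small; pairs across the intervals see it near \<open>\<gamma>\<close> and carry the sign \<open>\<sigma>\<close>.\<close>
lemma pulse_form:
 fixes g :: "nat => nat => real"
 assumes M: "M <= H" "H + M <= N" and s: "\<bar>\<sigma>\<bar> = 1"
  and near: "!!m n. m \<in> {1..M} & n \<in> {1..M} \<or> m \<in> {H+1..H+M} & n \<in> {H+1..H+M} ==> \<bar>g m n\<bar> <= E"
  and far: "!!m n. m \<in> {1..M} & n \<in> {H+1..H+M} \<or> m \<in> {H+1..H+M} & n \<in> {1..M} ==> \<bar>g m n - \<gamma>\<bar> <= E"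
 shows "\<bar>(\<Sum>m=1..N. \<Sum>n=1..N. pulse M H \<sigma> m * pulse M H \<sigma> n * g m n) - 2 * \<sigma> * (real M)\<^sup>2 * \<gamma>\<bar> <= 4 * (real M)\<^sup>2 * E"
proof -
 have sq: "\<bar>(\<Sum>m\<in>A. \<Sum>n\<in>A'. g m n) - (real M)\<^sup>2 * c\<bar> <= (real M)\<^sup>2 * E"
  if fin: "card A = M" "card A' = M" and cl: "!!m n. m \<in> A ==> n \<in> A' ==> \<bar>g m n - c\<bar> <= E" for A A' c
 proof -
  have "(\<Sum>m\<in>A. \<Sum>n\<in>A'. g m n) - (real M)\<^sup>2 * c = (\<Sum>m\<in>A. \<Sum>n\<in>A'. g m n - c)"
   using fin by (simp add: sum_subtractf power2_eq_square)
  also have "\<bar>...\<bar> <= (\<Sum>m\<in>A. \<Sum>n\<in>A'. E)"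
   by (intro order_trans[OF sum_abs sum_mono] order_trans[OF sum_abs sum_mono] cl)
  also have "... = (real M)\<^sup>2 * E" using fin by (simp add: power2_eq_square)
  finally show ?thesis .
 qed
 let ?I = "{1..M}" and ?I' = "{H+1..H+M}"
 have inner: "(\<Sum>n=1..N. pulse M H \<sigma> m * pulse M H \<sigma> n * g m n) = pulse M H \<sigma> m * ((\<Sum>n\<in>?I. g m n) + \<sigma> * (\<Sum>n\<in>?I'. g m n))" for m
  using sum_pulse[OF M, of \<sigma> "%n. g m n"] by (simp add: sum_distrib_left[symmetric] mult.assoc)
 have "(\<Sum>m=1..N. \<Sum>n=1..N. pulse M H \<sigma> m * pulse M H \<sigma> n * g m n)
   = (\<Sum>m\<in>?I. (\<Sum>n\<in>?I. g m n) + \<sigma> * (\<Sum>n\<in>?I'. g m n)) + \<sigma> * (\<Sum>m\<in>?I'. (\<Sum>n\<in>?I. g m n) + \<sigma> * (\<Sum>n\<in>?I'. g m n))"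
  unfolding inner using sum_pulse[OF M, of \<sigma> "%m. (\<Sum>n\<in>?I. g m n) + \<sigma> * (\<Sum>n\<in>?I'. g m n)"] by simp
 also have "... = (\<Sum>m\<in>?I. \<Sum>n\<in>?I. g m n) + \<sigma> * (\<Sum>m\<in>?I. \<Sum>n\<in>?I'. g m n) + \<sigma> * (\<Sum>m\<in>?I'. \<Sum>n\<in>?I. g m n) + (\<Sum>m\<in>?I'. \<Sum>n\<in>?I'. g m n)"
 proof -
  have ss: "\<sigma> * (\<sigma> * x) = x" for x using s by (auto simp: abs_if split: if_splits)
  show ?thesis unfolding sum.distrib sum_distrib_left[symmetric] distrib_left ss by linarith
 qed
 finally have S: "(\<Sum>m=1..N. \<Sum>n=1..N. pulse M H \<sigma> m * pulse M H \<sigma> n * g m n) = (\<Sum>m\<in>?I. \<Sum>n\<in>?I. g m n) + \<sigma> * (\<Sum>m\<in>?I. \<Sum>n\<in>?I'. g m n) + \<sigma> * (\<Sum>m\<in>?I'. \<Sum>n\<in>?I. g m n) + (\<Sum>m\<in>?I'. \<Sum>n\<in>?I'. g m n)" .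
 have 1: "\<bar>(\<Sum>m\<in>?I. \<Sum>n\<in>?I. g m n) - (real M)\<^sup>2 * 0\<bar> <= (real M)\<^sup>2 * E" by (rule sq) (use near in auto)
 have 2: "\<bar>(\<Sum>m\<in>?I'. \<Sum>n\<in>?I'. g m n) - (real M)\<^sup>2 * 0\<bar> <= (real M)\<^sup>2 * E" by (rule sq) (use near in auto)
 have 3: "\<bar>(\<Sum>m\<in>?I. \<Sum>n\<in>?I'. g m n) - (real M)\<^sup>2 * \<gamma>\<bar> <= (real M)\<^sup>2 * E" by (rule sq) (use far in auto)
 have 4: "\<bar>(\<Sum>m\<in>?I'. \<Sum>n\<in>?I. g m n) - (real M)\<^sup>2 * \<gamma>\<bar> <= (real M)\<^sup>2 * E" by (rule sq) (use far in auto)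
 define G c2 c3 where "G = (real M)\<^sup>2 * \<gamma>" and "c2 = \<sigma> * ((\<Sum>m\<in>?I. \<Sum>n\<in>?I'. g m n) - (real M)\<^sup>2 * \<gamma>)"
  and "c3 = \<sigma> * ((\<Sum>m\<in>?I'. \<Sum>n\<in>?I. g m n) - (real M)\<^sup>2 * \<gamma>)"
 have c: "\<bar>c2\<bar> <= (real M)\<^sup>2 * E" "\<bar>c3\<bar> <= (real M)\<^sup>2 * E" unfolding c2_def c3_def abs_mult s using 3 4 by simp_all
 have "(\<Sum>m=1..N. \<Sum>n=1..N. pulse M H \<sigma> m * pulse M H \<sigma> n * g m n) - 2 * \<sigma> * (real M)\<^sup>2 * \<gamma>
   = (\<Sum>m\<in>?I. \<Sum>n\<in>?I. g m n) + c2 + c3 + (\<Sum>m\<in>?I'. \<Sum>n\<in>?I'. g m n)"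
  unfolding S c2_def c3_def by (simp add: right_diff_distrib)
 then show ?thesis using 1 2 c by linarith
qed

lemma off_resonance_term:
 assumes g1: "!!Y x. \<bar>gsum W Y x\<bar> <= C"
  and g2: "!!Y x y. x > 0 ==> y > 0 ==> \<bar>gsum W Y x - gsum W Y y\<bar> <= C * \<bar>x - y\<bar> / min x y"
  and Q: "Q > 0" and N: "N >= 1" and s: "\<bar>\<sigma>\<bar> = 1" and M: "M <= H" "H + M <= N"
  and t: "t \<in> farey L" and t0: "t0 \<in> farey L" and ne: "t ~= t0"
 shows "cmod (\<Sum>m=1..N. \<Sum>n=1..N. of_real (pulse M H \<sigma> m * pulse M H \<sigma> n * (block W L (fst t) (\<bar>real m - real n\<bar> / Q) / real (fst t))) * add_char ((real m - real n) * (frac_of t - frac_of t0)))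
  <= real M * (4 * real (fst t0) * (C * (11 + 4 * ln (real N))))"
proof -
 define x where "x = frac_of t - frac_of t0"
 define q where "q = fst t"
 have C: "C >= 0" using order_trans[OF abs_ge_zero g1] .
 have q: "q >= 1" "fst t0 >= 1" "snd t \<in> totatives q" "snd t0 \<in> totatives (fst t0)" using t t0 by (auto simp: farey_def q_def)
 define b where "b = (%n m. pulse M H \<sigma> m * block W L q (\<bar>real m - real n\<bar> / Q))"
 have B1: "\<bar>block W L q y\<bar> <= C" for y unfolding block_def by (rule g1)
 have B2: "\<bar>block W L q y - block W L q z\<bar> <= C * \<bar>y - z\<bar> / min y z" if "y > 0" "z > 0" for y z
 proof -
  have "\<bar>block W L q y - block W L q z\<bar> <= C * \<bar>y / real q - z / real q\<bar> / min (y / real q) (z / real q)"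
   unfolding block_def using that q by (intro g2) auto
  also have "\<bar>y / real q - z / real q\<bar> = \<bar>y - z\<bar> / real q" by (simp add: diff_divide_distrib[symmetric])
  also have "min (y / real q) (z / real q) = min y z / real q" using q by (auto simp: min_def field_simps)
  also have "C * (\<bar>y - z\<bar> / real q) / (min y z / real q) = C * \<bar>y - z\<bar> / min y z" using q by simp
  finally show ?thesis .
 qed
 have lnN: "ln (real N) >= 0" using N by simp
 have p1: "\<bar>pulse M H \<sigma> m\<bar> <= 1" for m using s by (simp add: pulse_def)
 have sum_b: "cmod (\<Sum>m=1..N. add_char (real m * x) * of_real (b n m)) <= 2 * (real q * real (fst t0)) * (C * (11 + 4 * ln (real N)))" if n: "n \<in> {1..N}" for n
 proof -
  have "cmod (\<Sum>m=1..N. add_char (real m * (real (snd t) / real q - real (snd t0) / real (fst t0))) * of_real (b n m)) <= 2 * (real q * real (fst t0)) * (\<bar>b n N\<bar> + (\<Sum>m=1..<N. \<bar>b n (Suc m) - b n m\<bar>))"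
   by (rule exponential_sum_variation) (use q N ne in \<open>auto simp: q_def prod_eq_iff\<close>)
  also have "... <= 2 * (real q * real (fst t0)) * (C + (4 * C * (1 + ln (real N)) + C * 6))"
  proof (intro mult_left_mono add_mono)
   show "\<bar>b n N\<bar> <= C" unfolding b_def abs_mult using mult_mono[OF p1[of N] B1[of "\<bar>real N - real n\<bar> / Q"]] by simp
   have "(\<Sum>m=1..<N. \<bar>b n (Suc m) - b n m\<bar>) = tot_var N (%m. pulse M H \<sigma> m * block W L q (\<bar>real m - real n\<bar> / Q))"
    by (simp add: tot_var_def b_def)
   also have "... <= 1 * tot_var N (%m. block W L q (\<bar>real m - real n\<bar> / Q)) + C * tot_var N (pulse M H \<sigma>)"
    by (rule tot_var_mult) (use p1 B1 in auto)
   also have "... <= 1 * (4 * C * (1 + ln (real N))) + C * 6"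
    using tot_var_distance[where g = "block W L q", OF B1 B2 Q n] tot_var_pulse[OF s, of N M H] C by (intro add_mono mult_left_mono) auto
   finally show "(\<Sum>m=1..<N. \<bar>b n (Suc m) - b n m\<bar>) <= 4 * C * (1 + ln (real N)) + C * 6" by simp
  qed simp
  also have "C + (4 * C * (1 + ln (real N)) + C * 6) = C * (11 + 4 * ln (real N))" by (simp add: algebra_simps)
  finally show ?thesis by (simp add: x_def frac_of_def q_def)
 qed
 have eqn: "(\<Sum>m=1..N. \<Sum>n=1..N. of_real (pulse M H \<sigma> m * pulse M H \<sigma> n * (block W L q (\<bar>real m - real n\<bar> / Q) / real q)) * add_char ((real m - real n) * x))
   = (\<Sum>n=1..N. (of_real (pulse M H \<sigma> n / real q) * add_char (- (real n * x))) * (\<Sum>m=1..N. add_char (real m * x) * of_real (b n m)))"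
  unfolding sum_distrib_left
 proof (subst sum.swap, intro sum.cong refl)
  fix m n
  have "add_char ((real m - real n) * x) = add_char (real m * x) * add_char (- (real n * x))"
   unfolding add_char_add[symmetric] by (simp add: left_diff_distrib)
  then show "of_real (pulse M H \<sigma> m * pulse M H \<sigma> n * (block W L q (\<bar>real m - real n\<bar> / Q) / real q)) * add_char ((real m - real n) * x)
   = (of_real (pulse M H \<sigma> n / real q) * add_char (- (real n * x))) * (add_char (real m * x) * of_real (b n m))"
   by (simp add: b_def)
 qed
 have "cmod (\<Sum>m=1..N. \<Sum>n=1..N. of_real (pulse M H \<sigma> m * pulse M H \<sigma> n * (block W L q (\<bar>real m - real n\<bar> / Q) / real q)) * add_char ((real m - real n) * x)) <= (\<Sum>n=1..N. pulse M H 1 n / real q * (2 * (real q * real (fst t0)) * (C * (11 + 4 * ln (real N)))))"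
  unfolding eqn
 proof (rule order_trans[OF norm_sum sum_mono])
  fix n assume n: "n \<in> {1..N}"
  have "cmod ((of_real (pulse M H \<sigma> n / real q) * add_char (- (real n * x))) * (\<Sum>m=1..N. add_char (real m * x) * of_real (b n m)))
   = pulse M H 1 n / real q * cmod (\<Sum>m=1..N. add_char (real m * x) * of_real (b n m))"
   by (simp only: norm_mult norm_of_real norm_add_char abs_divide abs_pulse[OF s] abs_of_nat mult_1_right)
  also have "... <= pulse M H 1 n / real q * (2 * (real q * real (fst t0)) * (C * (11 + 4 * ln (real N))))"
   using sum_b[OF n] by (intro mult_left_mono) (auto simp: pulse_def)
  finally show "cmod ((of_real (pulse M H \<sigma> n / real q) * add_char (- (real n * x))) * (\<Sum>m=1..N. add_char (real m * x) * of_real (b n m))) <= pulse M H 1 n / real q * (2 * (real q * real (fst t0)) * (C * (11 + 4 * ln (real N))))" .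
 qed
 also have "... = (\<Sum>n=1..N. pulse M H 1 n) * (2 * real (fst t0) * (C * (11 + 4 * ln (real N))))"
  unfolding sum_distrib_right using q by (intro sum.cong refl) simp
 also have "... = real M * (4 * real (fst t0) * (C * (11 + 4 * ln (real N))))" unfolding sum_pulse_1[OF M] by simp
 finally show ?thesis by (simp add: x_def q_def)
qed

lemma farey_card: "real (card (farey L)) <= (real L)\<^sup>2"
proof -
 have "card (farey L) = (\<Sum>q=1..L. card (totatives q))" unfolding farey_def by (rule card_SigmaI) auto
 also have "... <= (\<Sum>q=1..L. L)"
 proof (rule sum_mono)
  fix q assume "q \<in> {1..L}"
  then show "card (totatives q) <= L" using totient_le[of q] by (simp add: totient_def)
 qed
 finally have "card (farey L) <= L * L" by simp
 then have "real (card (farey L)) <= real (L * L)" by (rule of_nat_mono)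
 then show ?thesis by (simp add: power2_eq_square)
qed

text \<open>Among all Farey fractions only \<open>(q - b)/q\<close> cancels the phase of the wave; its term is evaluated by the two-interval form, and the others are bounded individually.\<close>
lemma wave_sieve_sum:
 assumes W: "!!u. u > 2 ==> W u = 0"
  and g1: "!!Y x. \<bar>gsum W Y x\<bar> <= C"
  and g2: "!!Y x y. x > 0 ==> y > 0 ==> \<bar>gsum W Y x - gsum W Y y\<bar> <= C * \<bar>x - y\<bar> / min x y"
  and Q: "Q > 0" and I0: "I0 W Q ~= 0" and q: "q > 0" and M: "M = q * r" "r >= 1" "M <= H" "H + M <= N"
  and b: "b \<in> {1..<q}" "coprime b q" and s: "\<bar>\<sigma>\<bar> = 1" and L: "q <= L"
  and near: "!!h. real h <= real M ==> \<bar>gsum W (L div q) (real h / (real q * Q))\<bar> <= E"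
  and far: "!!h. \<bar>real h - real H\<bar> <= real M ==> \<bar>gsum W (L div q) (real h / (real q * Q)) - \<gamma>\<bar> <= E"
  and tail: "(\<Sum>m=1..N. \<Sum>n=1..N. (tail_kernel W Q L m n)\<^sup>2) <= (real N)\<^sup>2 * \<kappa>\<^sup>2" and k: "\<kappa> > 0"
 shows "\<bar>sieve_sum W N Q (wave N q M H b \<sigma>) - real N - real N * real M * \<sigma> * \<gamma> / (real q * Q * I0 W Q)\<bar>
  <= (2 * real N * real M * E / real q + (real L)\<^sup>2 * (2 * real N * real q * (C * (11 + 4 * ln (real N)))) + (real N)\<^sup>2 * \<kappa>) / (Q * \<bar>I0 W Q\<bar>)"
proof -
 define \<phi> where "\<phi> = wave N q M H b \<sigma>"
 define A where "A = real N / (2 * real M)"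
 have "1 * 1 <= q * r" using q M by (intro mult_le_mono) auto
 then have "1 <= M" using M(1) by simp
 then have M0: "M >= 1" "N >= 1" using M(3,4) by linarith+
 have C: "C >= 0" using order_trans[OF abs_ge_zero g1] .
 have lnN: "ln (real N) >= 0" using M0 by simp
 have h1: "herm N \<phi> \<phi> = 1" using wave_herm[OF q M b(1) b(1) s, of \<sigma>] by (simp add: \<phi>_def)
 have nN: "sq_norm N \<phi> = real N" by (rule sq_norm_of_herm[OF h1 M0(2)])
 define t0 where "t0 = (q, q - b)"
 have "coprime (q - b) q" using b coprime_diff_one_left by (metis atLeastLessThan_iff coprime_commute gcd_diff2_nat coprime_iff_gcd_eq_1 less_imp_le)
 then have t0: "t0 \<in> farey L" using b q L by (auto simp: t0_def farey_def totatives_def)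
 let ?c = "complex_of_real (Q * I0 W Q)"
 let ?bk = "%t m n. block W L (fst t) (\<bar>real m - real n\<bar> / Q)"
 define T where "T = (%t. \<Sum>m=1..N. \<Sum>n=1..N. of_real (pulse M H \<sigma> m * pulse M H \<sigma> n * (?bk t m n / real (fst t))) * add_char ((real m - real n) * (frac_of t - frac_of t0)))"
 define Tl where "Tl = (\<Sum>m=1..N. \<Sum>n=1..N. \<phi> m * cnj (\<phi> n) * of_real (tail_kernel W Q L m n))"
 define S where "S = (\<Sum>m=1..N. \<Sum>n=1..N. pulse M H \<sigma> m * pulse M H \<sigma> n * gsum W (L div q) (real (nat \<bar>int m - int n\<bar>) / (real q * Q)))"
 have head: "\<phi> m * cnj (\<phi> n) * head_kernel W Q L m n = of_real A * (\<Sum>t\<in>farey L. of_real (pulse M H \<sigma> m * pulse M H \<sigma> n * (?bk t m n / real (fst t))) * add_char ((real m - real n) * (frac_of t - frac_of t0)))" for m n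
 proof -
  have ph: "add_char (real m * (real b / real q) - real n * (real b / real q)) * add_char ((real m - real n) * frac_of t) = add_char ((real m - real n) * (frac_of t - frac_of t0))" for t
  proof -
   have ft: "frac_of t0 = 1 - real b / real q" using b q by (simp add: t0_def frac_of_def of_nat_diff diff_divide_distrib)
   have "x * u - z * u + (x - z) * v = (x - z) * (v - (1 - u)) + (x - z)" for x z u v :: real by (simp add: algebra_simps)
   then have "real m * (real b / real q) - real n * (real b / real q) + (real m - real n) * frac_of t = (real m - real n) * (frac_of t - frac_of t0) + (real m - real n)"
    unfolding ft .
   moreover have "add_char (real m - real n) = 1" unfolding add_char_eq_1_iff by simp
   ultimately show ?thesis unfolding add_char_add[symmetric] by (simp add: add_char_add)
  qed
  have "\<phi> m * cnj (\<phi> n) * head_kernel W Q L m n = (\<Sum>t\<in>farey L. of_real (A * (pulse M H \<sigma> m * pulse M H \<sigma> n)) * of_real (?bk t m n / real (fst t)) * (add_char (real m * (real b / real q) - real n * (real b / real q)) * add_char ((real m - real n) * frac_of t)))"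
   unfolding \<phi>_def wave_product[OF M(3) M0(2)] head_kernel_def sum_distrib_left A_def by (intro sum.cong refl) (simp only: mult_ac)
  then show ?thesis unfolding ph by (simp only: sum_distrib_left of_real_mult mult_ac)
 qed
 have T0: "T t0 = of_real (S / real q)"
 proof -
  have "T t0 = (\<Sum>m=1..N. \<Sum>n=1..N. of_real (pulse M H \<sigma> m * pulse M H \<sigma> n * gsum W (L div q) (real (nat \<bar>int m - int n\<bar>) / (real q * Q)) / real q))"
   unfolding T_def by (intro sum.cong refl) (simp add: add_char_0 block_def t0_def mult.commute)
  then show ?thesis unfolding S_def by (simp only: of_real_sum[symmetric] sum_divide_distrib[symmetric])
 qed
 have hd: "(\<Sum>m=1..N. \<Sum>n=1..N. \<phi> m * cnj (\<phi> n) * head_kernel W Q L m n) = of_real A * (of_real (S / real q) + (\<Sum>t\<in>farey L - {t0}. T t))"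
 proof -
  have "(\<Sum>m=1..N. \<Sum>n=1..N. \<phi> m * cnj (\<phi> n) * head_kernel W Q L m n)
   = of_real A * (\<Sum>m=1..N. \<Sum>n=1..N. \<Sum>t\<in>farey L. of_real (pulse M H \<sigma> m * pulse M H \<sigma> n * (?bk t m n / real (fst t))) * add_char ((real m - real n) * (frac_of t - frac_of t0)))"
   unfolding head by (simp only: sum_distrib_left)
  moreover have "(\<Sum>m=1..N. \<Sum>n=1..N. \<Sum>t\<in>farey L. of_real (pulse M H \<sigma> m * pulse M H \<sigma> n * (?bk t m n / real (fst t))) * add_char ((real m - real n) * (frac_of t - frac_of t0)))
   = (\<Sum>t\<in>farey L. T t)"
   unfolding T_def by (rule sum_swap3[symmetric])
  moreover have "(\<Sum>t\<in>farey L. T t) = T t0 + (\<Sum>t\<in>farey L - {t0}. T t)" by (rule sum.remove) (use t0 in auto)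
  ultimately show ?thesis by (simp only: T0)
 qed
 have form: "(\<Sum>m=1..N. \<Sum>n=1..N. \<phi> m * cnj (\<phi> n) * ((head_kernel W Q L m n + of_real (tail_kernel W Q L m n)) / ?c))
   = ((\<Sum>m=1..N. \<Sum>n=1..N. \<phi> m * cnj (\<phi> n) * head_kernel W Q L m n) + Tl) / ?c"
  unfolding Tl_def by (simp only: sum.distrib[symmetric] sum_divide_distrib distrib_left times_divide_eq_right)
 have eq: "of_real (sieve_sum W N Q \<phi>) = complex_of_real (real N) + (of_real A * (of_real (S / real q) + (\<Sum>t\<in>farey L - {t0}. T t)) + Tl) / ?c"
  using sieve_sum_split[of W Q N \<phi> L, OF W Q I0] unfolding form hd nN .
 have off: "cmod (of_real A * (\<Sum>t\<in>farey L - {t0}. T t)) <= (real L)\<^sup>2 * (2 * real N * real q * (C * (11 + 4 * ln (real N))))"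
 proof -
  have A0: "A >= 0" by (simp add: A_def)
  have "cmod (\<Sum>t\<in>farey L - {t0}. T t) <= (\<Sum>t\<in>farey L - {t0}. real M * (4 * real q * (C * (11 + 4 * ln (real N)))))"
  proof (rule order_trans[OF norm_sum sum_mono])
   fix t assume t: "t \<in> farey L - {t0}"
   have "cmod (T t) <= real M * (4 * real (fst t0) * (C * (11 + 4 * ln (real N))))"
    unfolding T_def by (rule off_resonance_term[OF g1 g2 Q M0(2) s M(3) M(4) _ t0]) (use t in auto)
   then show "cmod (T t) <= real M * (4 * real q * (C * (11 + 4 * ln (real N))))" by (simp add: t0_def)
  qed
  also have "... = real (card (farey L - {t0})) * (real M * (4 * real q * (C * (11 + 4 * ln (real N)))))" by simp
  also have "... <= (real L)\<^sup>2 * (real M * (4 * real q * (C * (11 + 4 * ln (real N)))))"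
  proof (rule mult_right_mono)
   have "card (farey L - {t0}) <= card (farey L)" by (intro card_mono) auto
   then show "real (card (farey L - {t0})) <= (real L)\<^sup>2" using farey_card[of L] by linarith
  qed (use C lnN in simp)
  finally have "A * cmod (\<Sum>t\<in>farey L - {t0}. T t) <= A * ((real L)\<^sup>2 * (real M * (4 * real q * (C * (11 + 4 * ln (real N))))))" using A0 by (rule mult_left_mono)
  also have "... = (real L)\<^sup>2 * (2 * real N * real q * (C * (11 + 4 * ln (real N))))" using M0 by (simp add: A_def)
  finally show ?thesis using A0 by (simp add: norm_mult)
 qed
 have tl: "cmod Tl <= (real N)\<^sup>2 * \<kappa>" unfolding Tl_def by (rule form_le_hilbert_schmidt[OF nN tail k])
 have S: "\<bar>S - 2 * \<sigma> * (real M)\<^sup>2 * \<gamma>\<bar> <= 4 * (real M)\<^sup>2 * E"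
  unfolding S_def
 proof (rule pulse_form[OF M(3,4) s])
  fix m n assume "m \<in> {1..M} & n \<in> {1..M} \<or> m \<in> {H+1..H+M} & n \<in> {H+1..H+M}"
  then have "nat \<bar>int m - int n\<bar> <= M" by auto
  then show "\<bar>gsum W (L div q) (real (nat \<bar>int m - int n\<bar>) / (real q * Q))\<bar> <= E" by (intro near) simp
 next
  fix m n assume "m \<in> {1..M} & n \<in> {H+1..H+M} \<or> m \<in> {H+1..H+M} & n \<in> {1..M}"
  then have "\<bar>real (nat \<bar>int m - int n\<bar>) - real H\<bar> <= real M" using M(3) by (auto simp: abs_if)
  then show "\<bar>gsum W (L div q) (real (nat \<bar>int m - int n\<bar>) / (real q * Q)) - \<gamma>\<bar> <= E" by (rule far)
 qed
 have AS: "\<bar>A * (S / real q) - real N * real M * \<sigma> * \<gamma> / real q\<bar> <= 2 * real N * real M * E / real q"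
 proof -
  have "A * (S / real q) - real N * real M * \<sigma> * \<gamma> / real q = (A / real q) * (S - 2 * \<sigma> * (real M)\<^sup>2 * \<gamma>)"
   using M0 q by (simp add: A_def field_simps power2_eq_square)
  also have "\<bar>...\<bar> = (A / real q) * \<bar>S - 2 * \<sigma> * (real M)\<^sup>2 * \<gamma>\<bar>" by (simp add: abs_mult A_def)
  also have "... <= (A / real q) * (4 * (real M)\<^sup>2 * E)" using S by (intro mult_left_mono) (auto simp: A_def)
  also have "... = 2 * real N * real M * E / real q" using M0 by (simp add: A_def power2_eq_square)
  finally show ?thesis .
 qed
 have e2: "complex_of_real (sieve_sum W N Q \<phi> - real N - real N * real M * \<sigma> * \<gamma> / (real q * Q * I0 W Q))
  = (of_real (A * (S / real q) - real N * real M * \<sigma> * \<gamma> / real q) + of_real A * (\<Sum>t\<in>farey L - {t0}. T t) + Tl) / ?c"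
 proof -
  have "complex_of_real (real N * real M * \<sigma> * \<gamma> / (real q * Q * I0 W Q)) = of_real (real N * real M * \<sigma> * \<gamma> / real q) / ?c"
   by (simp only: of_real_divide[symmetric]) (simp add: mult.assoc)
  then show ?thesis unfolding of_real_diff eq of_real_mult[of A "S / real q"] by (simp only: add_divide_distrib diff_divide_distrib distrib_left) simp
 qed
 let ?R = "complex_of_real (A * (S / real q) - real N * real M * \<sigma> * \<gamma> / real q) + of_real A * (\<Sum>t\<in>farey L - {t0}. T t) + Tl"
 have R: "cmod ?R <= 2 * real N * real M * E / real q + (real L)\<^sup>2 * (2 * real N * real q * (C * (11 + 4 * ln (real N)))) + (real N)\<^sup>2 * \<kappa>"
 proof (intro norm_triangle_le add_mono)
  show "cmod (of_real (A * (S / real q) - real N * real M * \<sigma> * \<gamma> / real q)) <= 2 * real N * real M * E / real q" unfolding norm_of_real by (rule AS)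
 qed (rule off, rule tl)
 have "\<bar>sieve_sum W N Q \<phi> - real N - real N * real M * \<sigma> * \<gamma> / (real q * Q * I0 W Q)\<bar> = cmod (?R / ?c)"
  unfolding e2[symmetric] norm_of_real ..
 moreover have "cmod (?R / ?c) = cmod ?R / (Q * \<bar>I0 W Q\<bar>)" using Q by (simp only: norm_divide norm_of_real abs_mult)
 moreover have "cmod ?R / (Q * \<bar>I0 W Q\<bar>) <= (2 * real N * real M * E / real q + (real L)\<^sup>2 * (2 * real N * real q * (C * (11 + 4 * ln (real N)))) + (real N)\<^sup>2 * \<kappa>) / (Q * \<bar>I0 W Q\<bar>)"
  by (rule divide_right_mono[OF R]) (use Q in simp)
 ultimately show ?thesis unfolding \<phi>_def by (simp only:)
qed

text \<open>The distance \<open>t Q\<close> of the intervals is chosen with \<open>G(t/q) \<noteq> 0\<close>, and their length \<open>w Q\<close> so small that the profile is nearly constant across them and nearly zero within them. The sign \<open>\<sigma>\<close> decides the direction of the shift.\<close>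
lemma resonant_waves:
 assumes wt: "weight W" and a: "a > 0" and K: "K >= (1::nat)"
 shows "\<exists>e>0. \<forall>B. \<exists>Q1. \<forall>(N::nat) Q. Q >= Q1 --> a <= real N / Q --> real N / Q <= B -->
  (\<exists>\<alpha> \<beta> :: nat => nat => complex.
    (\<forall>k\<in>{1..K}. \<alpha> k \<in> seq_space N & \<beta> k \<in> seq_space N) \<and>
    (\<forall>i\<in>{1..K} <+> {1..K}. \<forall>j\<in>{1..K} <+> {1..K}. herm N (case_sum \<alpha> \<beta> i) (case_sum \<alpha> \<beta> j) = of_bool (i = j)) \<and>
    (\<forall>k\<in>{1..K}. sieve_sum W N Q (\<alpha> k) > (1 + e) * sq_norm N (\<alpha> k)) \<and>
    (\<forall>k\<in>{1..K}. sieve_sum W N Q (\<beta> k) < (1 - e) * sq_norm N (\<beta> k)))"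
 (is "\<exists>e>0. \<forall>B. ?P e B")
proof -
 note wd = weight_derivs[OF wt]
 have W2: "W u = 0" if "u > 2" for u using wd(5)[of u] that by simp
 obtain C where C: "C >= 1" "!!x. x > 0 ==> \<bar>mobius_sum W x\<bar> <= C * rho 3 (1 / x)"
  "!!Y x. x > 0 ==> \<bar>gsum W Y x\<bar> <= C * rho 2 (1 / x)"
  "!!Y x. \<bar>gsum W Y x\<bar> <= C"
  "!!Y x y. x > 0 ==> y > 0 ==> \<bar>gsum W Y x - gsum W Y y\<bar> <= C * \<bar>x - y\<bar> / min x y"
  "!!Y Z x. x > 0 ==> Z >= 1 ==> x <= real Z ==> Z <= Y ==> \<bar>gsum W Y x - gsum W Z x\<bar> <= C * rho 2 (real Z / x)"
  by (rule weight_gsum_bounds[OF wt]) blast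
 have "\<exists>G. \<forall>x Z. x > 0 --> Z >= 1 --> x <= real Z --> \<bar>gsum W Z x - G x\<bar> <= C * rho 2 (real Z / x)"
  by (rule gsum_limit[OF C(6)]) auto
 then obtain G where G: "!!x Z. x > 0 ==> Z >= 1 ==> x <= real Z ==> \<bar>gsum W Z x - G x\<bar> <= C * rho 2 (real Z / x)" by blast
 obtain Qc c cc where I: "Qc >= 1" "c > 0" "cc > 0" "!!Q. Q >= Qc ==> c <= \<bar>I0 W Q\<bar> & \<bar>I0 W Q\<bar> <= cc"
  by (rule I0_bounds[OF wt]) blast
 obtain Qt where Qt: "Qt >= 3" "!!Q T N. Q >= Qt ==> Q powr (-1/40) <= T ==> T <= Q powr (1/40) ==> real N = T * Q ==>
   (1 + ln (real N)) ^ 3 * (rho 3 (real (cutoff Q) * Q / real N))\<^sup>2 * (2 * ln Q) <= 1"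
  by (rule tail_bound_asymptotic) blast
 obtain q where q: "prime q" "q > 2 * K" using bigger_prime by blast
 have q0: "q > 0" "real q > 0" "q >= 1" using q by (auto simp: prime_gt_0_nat Suc_le_eq)
 have C0: "C >= 0" using C(1) by simp
 obtain y where y: "0 < y" "y < a / (2 * real q)" "G y ~= 0"
  using gsum_limit_nonzero_near_0[OF wt C0 _ G, of "a / (2 * real q)"] a q0 by auto
 define \<gamma> where "\<gamma> = G y"
 define E where "E = \<bar>\<gamma>\<bar> / 8"
 have E0: "E > 0" using y by (simp add: E_def \<gamma>_def)
 have "eventually (%u. rho 2 u < E / (2 * C)) at_top" using order_tendstoD(2)[OF rho_tendsto_0, of "E / (2 * C)"] E0 C(1) by simp
 then have "eventually (%u. C * rho 2 u <= E / 2) at_top" by eventually_elim (use C(1) in \<open>simp add: field_simps\<close>)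
 then obtain U' where U': "!!u. u >= U' ==> C * rho 2 u <= E / 2" unfolding eventually_at_top_linorder by blast
 define U where "U = max 1 U'"
 have U: "U >= 1" "!!u. u >= U ==> C * rho 2 u <= E / 2" using U' by (auto simp: U_def)
 define t where "t = real q * y"
 have t: "t > 0" "t < a / 2" "y = t / real q"
 proof -
  show "t > 0" unfolding t_def by (rule mult_pos_pos[OF q0(2) y(1)])
  have "real q * y < real q * (a / (2 * real q))" using y(2) q0(2) by (rule mult_strict_left_mono)
  also have "real q * (a / (2 * real q)) = a / 2" using q0(2) by simp
  finally show "t < a / 2" by (simp only: t_def)
  show "y = t / real q" using q0(2) by (simp add: t_def)
 qed
 define w where "w = Min {real q / U, t * E / (8 * C), t / 4, a / 4}"
 have w0: "w > 0" using q0 U t E0 C a by (auto simp: w_def)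
 have w: "w <= real q / U" "w <= t * E / (8 * C)" "w <= t / 4" "w <= a / 4" unfolding w_def by (rule Min_le; simp)+
 define e where "e = w * \<bar>\<gamma>\<bar> / (16 * real q * cc)"
 have e0: "e > 0" using w0 q0 I(3) y by (simp add: e_def \<gamma>_def)
 show ?thesis
 proof (rule exI[of _ e], rule conjI[OF e0], rule allI)
  fix B :: real
  define X where "X = 4 * real q * (2 + U * y + y)"
  have "eventually (%Q::real. Q powr (1/20) >= X) at_top" by real_asymp
  moreover have "((%Q::real. Q powr (-1/40)) \<longlongrightarrow> 0) at_top" by real_asymp
  then have "eventually (%Q::real. Q powr (-1/40) < a) at_top" by (rule order_tendstoD) (rule a)
  moreover have "eventually (%Q::real. Q powr (1/40) >= B) at_top" by real_asymp
  moreover have "((%Q::real. \<bar>B\<bar> * C / c * (1 / sqrt (ln Q))) \<longlongrightarrow> \<bar>B\<bar> * C / c * 0) at_top"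
   by (intro tendsto_mult tendsto_const) real_asymp
  then have "eventually (%Q::real. \<bar>B\<bar> * C / c * (1 / sqrt (ln Q)) < e) at_top" by (rule order_tendstoD) (use e0 in simp)
  moreover have "((%Q::real. 2 * real q * C / c * (Q powr (1/10) * (11 + 8 * ln Q) / Q)) \<longlongrightarrow> 2 * real q * C / c * 0) at_top"
   by (intro tendsto_mult tendsto_const) real_asymp
  then have "eventually (%Q::real. 2 * real q * C / c * (Q powr (1/10) * (11 + 8 * ln Q) / Q) < e) at_top" by (rule order_tendstoD) (use e0 in simp)
  moreover have "eventually (%Q::real. Q >= Max {3, Qc, Qt, 1 / w, 2 * real q / w, 4 / a}) at_top" by (rule eventually_ge_at_top)
  ultimately have "eventually (%Q. Q powr (1/20) >= X & Q powr (-1/40) < a & Q powr (1/40) >= B & \<bar>B\<bar> * C / c * (1 / sqrt (ln Q)) < e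
    & 2 * real q * C / c * (Q powr (1/10) * (11 + 8 * ln Q) / Q) < e & Q >= Max {3, Qc, Qt, 1 / w, 2 * real q / w, 4 / a}) at_top"
   by eventually_elim blast
  then obtain Q1 where Q1: "!!Q. Q >= Q1 ==> Q powr (1/20) >= X & Q powr (-1/40) < a & Q powr (1/40) >= B & \<bar>B\<bar> * C / c * (1 / sqrt (ln Q)) < e
    & 2 * real q * C / c * (Q powr (1/10) * (11 + 8 * ln Q) / Q) < e & Q >= Max {3, Qc, Qt, 1 / w, 2 * real q / w, 4 / a}"
   unfolding eventually_at_top_linorder by blast
  show "?P e B"
  proof (intro exI[of _ Q1] allI impI)
   fix N :: nat and Q :: real
   assume QQ: "Q >= Q1" and TA: "a <= real N / Q" and TB: "real N / Q <= B"
   note R = Q1[OF QQ]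
   have "Max {3, Qc, Qt, 1 / w, 2 * real q / w, 4 / a} <= Q" using R by blast
   then have Qs: "Q >= 3" "Q >= Qc" "Q >= Qt" "Q >= 1 / w" "Q >= 2 * real q / w" "Q >= 4 / a" by (simp_all add: Max_le_iff)
   have Q0: "Q > 0" using Qs by linarith
   have wQ: "w * Q >= 1" "w * Q >= 2 * real q" "a * Q >= 4" using Qs w0 a by (simp_all add: field_simps)
   have aN: "a * Q <= real N" "real N <= B * Q" using TA TB Q0 by (simp_all add: field_simps)
   have N1: "N >= 1" using aN wQ by (cases N) auto
   have N0: "real N > 0" using N1 by simp
   have I0: "c <= \<bar>I0 W Q\<bar>" "\<bar>I0 W Q\<bar> <= cc" "I0 W Q ~= 0" using I(4)[OF Qs(2)] I(2) by auto
   define r where "r = nat \<lfloor>w * Q / real q\<rfloor>"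
   define M where "M = q * r"
   define H where "H = nat \<lceil>t * Q\<rceil>"
   define L where "L = cutoff Q"
   have wq: "w * Q / real q >= 2" using wQ q0 by (simp add: field_simps)
   then have fl: "real r = real_of_int \<lfloor>w * Q / real q\<rfloor>" unfolding r_def by simp
   have r: "r >= 1" "real r <= w * Q / real q" "w * Q / real q - 1 <= real r" using wq fl by linarith+
   have M1: "real M <= w * Q"
    using mult_left_mono[OF r(2), of "real q"] q0 by (simp add: M_def)
   have "real q * (w * Q / real q - 1) <= real M" using mult_left_mono[OF r(3), of "real q"] q0 by (simp add: M_def)
   then have M2: "w * Q / 2 <= real M" using wQ q0 by (simp add: right_diff_distrib)
   have tQ: "t * Q > 0" using t Q0 by simp
   then have H1: "t * Q <= real H" "real H <= t * Q + 1" unfolding H_def by linarith+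
   have wt4: "w * Q <= t * Q / 4" "w * Q <= a * Q / 4" "t * Q <= a * Q / 2" using w t Q0 mult_right_mono[of w "t/4" Q] mult_right_mono[of w "a/4" Q] mult_right_mono[of t "a/2" Q] by auto
   have MH: "M <= H"
   proof -
    have "real M <= real H" using M1 wt4 H1 tQ by linarith
    then show ?thesis by simp
   qed
   have HM: "H + M <= N"
   proof -
    have "real H + real M <= real N" using M1 wt4 H1 wQ aN by linarith
    then show ?thesis by linarith
   qed
   have L2: "2 * real q * (2 + U * y + y) <= real L" using cutoff_bounds(3)[of Q] R Qs unfolding L_def X_def by linarith
   have Ldiv: "real (L div q) >= 1 + U * y + y"
   proof -
    have "L < L div q * q + q" using div_mult_mod_eq[of L q] mod_less_divisor[OF q0(1), of L] by linarith
    then have "L < (L div q + 1) * q" by simp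
    then have "real L < real ((L div q + 1) * q)" by (simp only: of_nat_less_iff)
    then have "real L < (real (L div q) + 1) * real q" by (simp add: distrib_right add.commute)
    then have "2 * real q * (2 + U * y + y) < (real (L div q) + 1) * real q" using L2 by linarith
    then have "real q * (2 * (2 + U * y + y)) < real q * (real (L div q) + 1)" by (simp add: mult_ac)
    then have "2 * (2 + U * y + y) < real (L div q) + 1" using q0 by (simp only: mult_less_cancel_left_pos)
    moreover have "U * y > 0" using U y by simp
    ultimately show ?thesis using y(1) by argo
   qed
   have Uy: "U * y > 0" using U y by simp
   have Lq: "q <= L"
   proof -
    have "L div q ~= 0" using Ldiv Uy y by (cases "L div q") auto
    then show ?thesis by (simp add: div_eq_0_iff)
   qed
   have Ld: "L div q >= 1" "y <= real (L div q)" "U <= real (L div q) / y" using Ldiv Uy y by (auto simp: field_simps)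
   have near: "\<bar>gsum W (L div q) (real h / (real q * Q))\<bar> <= E" if h: "real h <= real M" for h
   proof (cases "h = 0")
    case True then show ?thesis using E0 by (simp add: gsum_def)
   next
    case False
    have "\<bar>gsum W (L div q) (real h / (real q * Q))\<bar> <= C * rho 2 (1 / (real h / (real q * Q)))"
     by (rule C(3)) (use False q0 Q0 in simp)
    also have "... <= E / 2"
    proof (rule U(2))
     have "U * real h <= U * (w * Q)" using h M1 U by (intro mult_left_mono) auto
     also have "... <= real q * Q" using w(1) U(1) Q0 q0 mult_right_mono[of "U * w" "real q" Q] by (simp add: field_simps)
     finally have "U * real h <= real q * Q" .
     moreover have "1 / (real h / (real q * Q)) = real q * Q / real h" by simp
     ultimately show "U <= 1 / (real h / (real q * Q))" using False by (simp only: pos_le_divide_eq of_nat_0_less_iff neq0_conv)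
    qed
    finally show ?thesis using E0 by linarith
   qed
   have far: "\<bar>gsum W (L div q) (real h / (real q * Q)) - \<gamma>\<bar> <= E" if h: "\<bar>real h - real H\<bar> <= real M" for h
   proof -
    define x where "x = real h / (real q * Q)"
    have "x - y = (real h - t * Q) / (real q * Q)" using t q0 Q0 by (simp add: x_def diff_divide_distrib)
    then have "\<bar>x - y\<bar> = \<bar>real h - t * Q\<bar> / (real q * Q)" using q0 Q0 by (simp add: abs_mult)
    also have "... <= (2 * w * Q) / (real q * Q)"
    proof (rule divide_right_mono)
     have "\<bar>real H - t * Q\<bar> <= w * Q" using H1 wQ by linarith
     then show "\<bar>real h - t * Q\<bar> <= 2 * w * Q" using h M1 by linarith
     show "0 <= real q * Q" using q0 Q0 by (intro mult_nonneg_nonneg) linarith+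
    qed
    also have "... = 2 * w / real q" using Q0 by simp
    finally have d: "\<bar>x - y\<bar> <= 2 * w / real q" .
    have "2 * w / real q <= y / 2" using w(3) q0 unfolding t(3) by (simp add: field_simps)
    then have x0: "x >= y / 2" "x > 0" using d y by linarith+
    have "\<bar>gsum W (L div q) x - gsum W (L div q) y\<bar> <= C * \<bar>x - y\<bar> / min x y" by (rule C(5)[OF x0(2) y(1)])
    also have "... <= C * (2 * w / real q) / (y / 2)" using d x0 y C0 w0 q0 by (intro frac_le mult_left_mono) auto
    also have "... = 4 * C * w / t" unfolding t_def using q0(2) y(1) by (simp add: field_simps)
    also have "... <= E / 2" using w(2) C t by (simp add: field_simps)
    finally have 1: "\<bar>gsum W (L div q) x - gsum W (L div q) y\<bar> <= E / 2" .
    have "\<bar>gsum W (L div q) y - G y\<bar> <= C * rho 2 (real (L div q) / y)" by (rule G[OF y(1) Ld(1,2)])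
    also have "... <= E / 2" by (rule U(2)[OF Ld(3)])
    finally show ?thesis using 1 unfolding x_def[symmetric] \<gamma>_def by linarith
   qed
   define T where "T = real N / Q"
   have NT: "real N = T * Q" using Q0 by (simp add: T_def)
   have TT: "Q powr (-1/40) <= T" "T <= Q powr (1/40)" using R TA TB unfolding T_def by linarith+
   have lnQ: "ln Q > 0" using Qs by simp
   define \<kappa> where "\<kappa> = C / sqrt (ln Q)"
   have k0: "\<kappa> > 0" using C lnQ by (simp add: \<kappa>_def)
   have tail: "(\<Sum>m=1..N. \<Sum>n=1..N. (tail_kernel W Q L m n)\<^sup>2) <= (real N)\<^sup>2 * \<kappa>\<^sup>2"
   proof -
    define Z where "Z = (1 + ln (real N)) ^ 3 * (rho 3 (real L * Q / real N))\<^sup>2"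
    have L1: "L >= 1" using Lq q0 by linarith
    have "(\<Sum>m=1..N. \<Sum>n=1..N. (tail_kernel W Q L m n)\<^sup>2) <= 2 * (real N)\<^sup>2 * (1 + ln (real N)) ^ 3 * (C * rho 3 (real L * Q / real N))\<^sup>2"
     by (rule tail_kernel_hs[OF C(2) C0 Q0 L1 N1])
    also have "... = (real N)\<^sup>2 * C\<^sup>2 * (2 * Z)" by (simp add: Z_def power_mult_distrib)
    also have "... <= (real N)\<^sup>2 * C\<^sup>2 * (1 / ln Q)"
    proof (rule mult_left_mono)
     have "Z * (2 * ln Q) <= 1" unfolding Z_def L_def by (rule Qt(2)[OF Qs(3) TT NT])
     then show "2 * Z <= 1 / ln Q" using lnQ by (simp add: pos_le_divide_eq mult_ac)
    qed simp
    also have "... = (real N)\<^sup>2 * \<kappa>\<^sup>2" using lnQ by (simp add: \<kappa>_def power_divide)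
    finally show ?thesis .
   qed
   define \<Lambda> where "\<Lambda> = real N * real M * \<bar>\<gamma>\<bar> / (real q * Q * \<bar>I0 W Q\<bar>)"
   have QI: "Q * \<bar>I0 W Q\<bar> > 0" "Q * c > 0" "Q * c <= Q * \<bar>I0 W Q\<bar>" using Q0 I0 I(2) by auto
   have \<Lambda>8: "\<Lambda> >= 8 * e * real N"
   proof -
    have "8 * e * real N = real N * (w * Q / 2) * \<bar>\<gamma>\<bar> / (real q * Q * cc)" using Q0 by (simp add: e_def mult_ac)
    also have "... <= \<Lambda>" unfolding \<Lambda>_def using M2 I0 Q0 q0 w0 I(2,3)
     by (intro frac_le mult_mono mult_right_mono mult_left_mono) auto
    finally show ?thesis .
   qed
   have err: "(2 * real N * real M * E / real q + (real L)\<^sup>2 * (2 * real N * real q * (C * (11 + 4 * ln (real N)))) + (real N)\<^sup>2 * \<kappa>) / (Q * \<bar>I0 W Q\<bar>) <= \<Lambda> / 4 + 2 * e * real N"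
   proof -
    have 1: "2 * real N * real M * E / real q / (Q * \<bar>I0 W Q\<bar>) = \<Lambda> / 4" by (simp add: \<Lambda>_def E_def mult_ac)
    have 2: "(real L)\<^sup>2 * (2 * real N * real q * (C * (11 + 4 * ln (real N)))) / (Q * \<bar>I0 W Q\<bar>) <= e * real N"
    proof -
     have "Q powr (1/40) <= Q powr 1" using Qs by (intro powr_mono) auto
     then have "B <= Q" using R Q0 by simp
     then have "B * Q <= Q * Q" using Q0 by (intro mult_right_mono) auto
     then have "real N <= Q * Q" using aN by linarith
     then have "ln (real N) <= ln (Q * Q)" using N0 Q0 by (subst ln_le_cancel_iff) auto
     then have lnN: "ln (real N) <= 2 * ln Q" using Q0 by (simp add: ln_mult)
     have lnN0: "ln (real N) >= 0" using N1 by simp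
     have "(real L)\<^sup>2 <= (Q powr (1/20))\<^sup>2" unfolding L_def using cutoff_bounds(2)[of Q] Qs by (intro power_mono) auto
     also have "... = Q powr (1/10)" using Q0 by (simp add: power2_eq_square flip: powr_add)
     finally have LL: "(real L)\<^sup>2 <= Q powr (1/10)" .
     have "(real L)\<^sup>2 * (2 * real N * real q * (C * (11 + 4 * ln (real N)))) / (Q * \<bar>I0 W Q\<bar>)
       <= Q powr (1/10) * (2 * real N * real q * (C * (11 + 8 * ln Q))) / (Q * c)"
      using LL lnN lnN0 C0 QI(2) I0(1) I(2) Q0 lnQ by (intro frac_le mult_mono mult_left_mono) auto
     also have "... = real N * (2 * real q * C / c * (Q powr (1/10) * (11 + 8 * ln Q) / Q))" by (simp add: mult_ac)
     also have "... <= real N * e" using R by (intro mult_left_mono) auto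
     finally show ?thesis by (simp add: mult.commute)
    qed
    have 3: "(real N)\<^sup>2 * \<kappa> / (Q * \<bar>I0 W Q\<bar>) <= e * real N"
    proof -
     have "(real N)\<^sup>2 * \<kappa> / (Q * \<bar>I0 W Q\<bar>) <= (real N)\<^sup>2 * \<kappa> / (Q * c)" by (rule divide_left_mono[OF QI(3)]) (use QI(1,2) k0 in \<open>simp_all add: mult_pos_pos\<close>)
     also have "... = real N * ((real N / Q) * (C / c * (1 / sqrt (ln Q))))" by (simp add: \<kappa>_def power2_eq_square mult_ac)
     also have "... <= real N * (\<bar>B\<bar> * (C / c * (1 / sqrt (ln Q))))"
     proof (intro mult_left_mono mult_right_mono)
      show "real N / Q <= \<bar>B\<bar>" using TB by linarith
      show "0 <= C / c * (1 / sqrt (ln Q))" using C0 I(2) lnQ by simp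
     qed simp
     also have "... = real N * (\<bar>B\<bar> * C / c * (1 / sqrt (ln Q)))" by simp
     also have "... <= real N * e"
     proof (rule mult_left_mono)
      show "\<bar>B\<bar> * C / c * (1 / sqrt (ln Q)) <= e" using R by linarith
     qed simp
     finally show ?thesis by (simp add: mult.commute)
    qed
    show ?thesis unfolding add_divide_distrib using 1 2 3 by linarith
   qed
   define \<sigma> where "\<sigma> = (if \<gamma> * I0 W Q > 0 then 1 else -1 :: real)"
   have s: "\<bar>\<sigma>\<bar> = 1" "\<bar>- \<sigma>\<bar> = 1" by (auto simp: \<sigma>_def)
   have g0: "\<gamma> ~= 0" using y by (simp add: \<gamma>_def)
   have sg: "\<sigma> * \<gamma> / I0 W Q = \<bar>\<gamma>\<bar> / \<bar>I0 W Q\<bar>"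
    using g0 I0(3) by (auto simp: \<sigma>_def zero_less_mult_iff abs_if field_simps)
   have lam: "real N * real M * \<sigma> * \<gamma> / (real q * Q * I0 W Q) = \<Lambda>"
   proof -
    have "real N * real M * \<sigma> * \<gamma> / (real q * Q * I0 W Q) = real N * real M / (real q * Q) * (\<sigma> * \<gamma> / I0 W Q)" by simp
    then show ?thesis unfolding sg by (simp add: \<Lambda>_def)
   qed
   then have lam': "real N * real M * (- \<sigma>) * \<gamma> / (real q * Q * I0 W Q) = - \<Lambda>" by simp
   have cop: "coprime b q" if "b \<in> {1..<q}" for b
    using q(1) that by (metis atLeastLessThan_iff coprime_commute prime_imp_coprime_nat nat_dvd_not_less less_le_trans zero_less_one)
   define \<alpha> where "\<alpha> = (%k. wave N q M H k \<sigma>)"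
   define \<beta> where "\<beta> = (%k. wave N q M H (K + k) (- \<sigma>))"
   have herm_w: "herm N (wave N q M H b s1) (wave N q M H b' s2) = of_bool (b = b')"
    if "b \<in> {1..<q}" "b' \<in> {1..<q}" "\<bar>s1\<bar> = 1" "b = b' ==> s1 = s2" for b b' s1 s2
    by (rule wave_herm[OF q0(1) M_def r(1) MH HM that])
   have sv: "\<bar>sieve_sum W N Q (wave N q M H b s1) - real N - real N * real M * s1 * \<gamma> / (real q * Q * I0 W Q)\<bar> <= \<Lambda> / 4 + 2 * e * real N"
    if b: "b \<in> {1..<q}" and s1: "\<bar>s1\<bar> = 1" for b s1
    by (rule order_trans[OF wave_sieve_sum[OF W2 C(4) C(5) Q0 I0(3) q0(1) M_def r(1) MH HM b cop[OF b] s1 Lq near far tail k0] err])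
   have nrm: "sq_norm N (wave N q M H b s1) = real N" if "b \<in> {1..<q}" "\<bar>s1\<bar> = 1" for b s1
    by (rule sq_norm_of_herm[OF _ N1]) (use herm_w[OF that(1) that(1) that(2)] in simp)
   have eN: "e * real N > 0" using e0 N0 by simp
   have idx: "k \<in> {1..<q}" "K + k \<in> {1..<q}" if "k \<in> {1..K}" for k using that q(2) by auto
   show "\<exists>\<alpha> \<beta> :: nat => nat => complex.
    (\<forall>k\<in>{1..K}. \<alpha> k \<in> seq_space N & \<beta> k \<in> seq_space N) \<and>
    (\<forall>i\<in>{1..K} <+> {1..K}. \<forall>j\<in>{1..K} <+> {1..K}. herm N (case_sum \<alpha> \<beta> i) (case_sum \<alpha> \<beta> j) = of_bool (i = j)) \<and>
    (\<forall>k\<in>{1..K}. sieve_sum W N Q (\<alpha> k) > (1 + e) * sq_norm N (\<alpha> k)) \<and>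
    (\<forall>k\<in>{1..K}. sieve_sum W N Q (\<beta> k) < (1 - e) * sq_norm N (\<beta> k))"
   proof (rule exI[of _ \<alpha>], rule exI[of _ \<beta>], intro conjI ballI)
    fix k assume k: "k \<in> {1..K}"
    show "\<alpha> k \<in> seq_space N" "\<beta> k \<in> seq_space N" unfolding \<alpha>_def \<beta>_def by (rule wave_seq_space[OF HM])+
    have "\<bar>sieve_sum W N Q (\<alpha> k) - real N - \<Lambda>\<bar> <= \<Lambda> / 4 + 2 * e * real N"
     using sv[OF idx(1)[OF k] s(1)] unfolding lam \<alpha>_def .
    then have "sieve_sum W N Q (\<alpha> k) > real N + e * real N" using \<Lambda>8 eN by linarith
    then show "sieve_sum W N Q (\<alpha> k) > (1 + e) * sq_norm N (\<alpha> k)"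
     using nrm[OF idx(1)[OF k] s(1)] by (simp add: \<alpha>_def distrib_right)
    have "\<bar>sieve_sum W N Q (\<beta> k) - real N - (- \<Lambda>)\<bar> <= \<Lambda> / 4 + 2 * e * real N"
     using sv[OF idx(2)[OF k] s(2)] unfolding lam' \<beta>_def .
    then have "sieve_sum W N Q (\<beta> k) < real N - e * real N" using \<Lambda>8 eN by linarith
    then show "sieve_sum W N Q (\<beta> k) < (1 - e) * sq_norm N (\<beta> k)"
     using nrm[OF idx(2)[OF k] s(2)] by (simp add: \<beta>_def left_diff_distrib)
   next
    fix i j assume ij: "i \<in> {1..K} <+> {1..K}" "j \<in> {1..K} <+> {1..K}"
    define ix where "ix = case_sum (%k. k) (%k. K + k)"
    define sx where "sx = case_sum (%k::nat. \<sigma>) (%k::nat. - \<sigma>)"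
    have cs: "case_sum \<alpha> \<beta> z = wave N q M H (ix z) (sx z)" for z by (cases z) (auto simp: \<alpha>_def \<beta>_def ix_def sx_def)
    have inx: "ix z \<in> {1..<q}" if "z \<in> {1..K} <+> {1..K}" for z using that idx by (cases z) (auto simp: ix_def)
    have inj: "ix i = ix j \<longleftrightarrow> i = j" using ij by (cases i; cases j) (auto simp: ix_def)
    have sxa: "\<bar>sx i\<bar> = 1" using s by (cases i) (auto simp: sx_def)
    have "herm N (wave N q M H (ix i) (sx i)) (wave N q M H (ix j) (sx j)) = of_bool (ix i = ix j)"
     by (rule herm_w[OF inx[OF ij(1)] inx[OF ij(2)] sxa]) (simp add: inj)
    then show "herm N (case_sum \<alpha> \<beta> i) (case_sum \<alpha> \<beta> j) = of_bool (i = j)" unfolding cs inj .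
   qed
  qed
 qed
qed

theorem corollary1p8:
  fixes W :: "real \<Rightarrow> real"
  assumes "weight W"
  shows "\<exists>c4::real. c4 > 0 \<and>
    (\<exists>C::real. C > 0 \<and>
      (\<forall>(\<epsilon>::real) (N::nat) (Q::real). \<epsilon> > 0 \<longrightarrow> N \<ge> 1 \<longrightarrow> Q \<ge> 1 \<longrightarrow>
        (let \<tau> = real N / Q in
          \<exists>V. seq.subspace V \<and> V \<subseteq> seq_space N \<and>
            (\<epsilon> < 1 \<longrightarrow> real (seq.dim V) \<le> C * (\<tau>\<^sup>2 / (\<epsilon>\<^sup>2 * ln (1 / \<epsilon>)))) \<and>
            (\<forall>\<phi>\<in>seq_space N. (\<forall>\<psi>\<in>V. herm N \<phi> \<psi> = 0) \<longrightarrow> ln Q > c4 * (ln (real N / Q))\<^sup>2 \<longrightarrow>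
              (1 - \<epsilon>) * sq_norm N \<phi> \<le> sieve_sum W N Q \<phi> \<and>
              sieve_sum W N Q \<phi> \<le> (1 + \<epsilon>) * sq_norm N \<phi>)))) \<and>
    (\<exists>\<epsilon>\<^sub>0 :: real \<Rightarrow> nat \<Rightarrow> real. (\<forall>\<tau> K. \<tau> > 0 \<longrightarrow> K \<ge> 1 \<longrightarrow> \<epsilon>\<^sub>0 \<tau> K > 0) \<and>
      (\<forall>(A::real) (B::real) (K::nat). 0 < A \<longrightarrow> A \<le> B \<longrightarrow> K \<ge> 1 \<longrightarrow>
        (\<exists>(C::real) (N\<^sub>0::nat). C > 0 \<and>
          (\<forall>(N::nat) (Q::real). N \<ge> 1 \<longrightarrow> N \<ge> N\<^sub>0 \<longrightarrow> Q \<ge> 1 \<longrightarrow>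
            (let \<tau> = real N / Q in A \<le> \<tau> \<longrightarrow> \<tau> \<le> B \<longrightarrow>
              (\<exists>\<alpha> \<beta> :: nat \<Rightarrow> nat \<Rightarrow> complex.
                (\<forall>k\<in>{1..K}. \<alpha> k \<in> seq_space N \<and> \<beta> k \<in> seq_space N \<and>
                   herm N (\<alpha> k) (\<alpha> k) = 1 \<and> herm N (\<beta> k) (\<beta> k) = 1) \<and>
                (\<forall>i \<in> {1..K} <+> {1..K}. \<forall>j \<in> {1..K} <+> {1..K}.
                   cmod (herm N (case_sum \<alpha> \<beta> i) (case_sum \<alpha> \<beta> j) - of_bool (i = j))
                     \<le> C * exp (- c4 * sqrt (ln (real N)))) \<and>
                (\<forall>k\<in>{1..K}. sieve_sum W N Q (\<alpha> k) > (1 + \<epsilon>\<^sub>0 \<tau> K) * sq_norm N (\<alpha> k)) \<and>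
                (\<forall>k\<in>{1..K}. sieve_sum W N Q (\<beta> k) < (1 - \<epsilon>\<^sub>0 \<tau> K) * sq_norm N (\<beta> k))))))))"
proof -
 let ?ortho = "%N K \<alpha> \<beta>. (\<forall>k\<in>{1..K}. \<alpha> k \<in> seq_space N & \<beta> k \<in> seq_space N) \<and>
    (\<forall>i\<in>{1..K} <+> {1..K}. \<forall>j\<in>{1..K} <+> {1..K}. herm N (case_sum \<alpha> \<beta> i) (case_sum \<alpha> \<beta> j) = of_bool (i = j))"
 let ?sv = "%e N K Q \<alpha> \<beta>. (\<forall>k\<in>{1..K}. sieve_sum W N Q (\<alpha> k) > (1 + e) * sq_norm N (\<alpha> k)) \<and>
    (\<forall>k\<in>{1..K}. sieve_sum W N Q (\<beta> k) < (1 - e) * sq_norm N (\<beta> k))"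
 obtain D where D: "D > 0" "!!\<epsilon> N Q. \<epsilon> > 0 ==> N >= 1 ==> Q >= 1 ==>
   \<exists>V. seq.subspace V & V \<subseteq> seq_space N \<and>
    (\<epsilon> < 1 --> real (seq.dim V) <= D * ((real N / Q)\<^sup>2 / (\<epsilon>\<^sup>2 * ln (1 / \<epsilon>)))) \<and>
    (\<forall>\<phi>\<in>seq_space N. (\<forall>\<psi>\<in>V. herm N \<phi> \<psi> = 0) --> ln Q > 1600 * (ln (real N / Q))\<^sup>2 -->
     \<bar>sieve_sum W N Q \<phi> - sq_norm N \<phi>\<bar> <= \<epsilon> * sq_norm N \<phi>)"
  by (rule large_sieve_exceptional_subspace[OF assms]) blast
 have one: "(1 - \<epsilon>) * y <= x & x <= (1 + \<epsilon>) * y" if "\<bar>x - y\<bar> <= \<epsilon> * y" for x y \<epsilon> :: real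
  using that by (simp add: left_diff_distrib distrib_right abs_le_iff)
 have "\<forall>(i::nat) K. \<exists>e>0. i >= 1 --> K >= 1 --> (\<forall>B. \<exists>Q1. \<forall>(N::nat) Q. Q >= Q1 --> 1 / real i <= real N / Q --> real N / Q <= B -->
   (\<exists>\<alpha> \<beta> :: nat => nat => complex. ?ortho N K \<alpha> \<beta> & ?sv e N K Q \<alpha> \<beta>))"
 proof (intro allI)
  fix i K :: nat
  show "\<exists>e>0. i >= 1 --> K >= 1 --> (\<forall>B. \<exists>Q1. \<forall>(N::nat) Q. Q >= Q1 --> 1 / real i <= real N / Q --> real N / Q <= B -->
   (\<exists>\<alpha> \<beta> :: nat => nat => complex. ?ortho N K \<alpha> \<beta> & ?sv e N K Q \<alpha> \<beta>))"
  proof (cases "i >= 1 & K >= 1")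
   case True
   then show ?thesis using resonant_waves[OF assms, of "1 / real i" K] by (simp add: conj_assoc)
  next
   case False
   then show ?thesis by (intro exI[of _ 1]) auto
  qed
 qed
 then obtain e where e: "!!(i::nat) K. e i K > 0" "!!i K B. i >= 1 ==> K >= 1 ==> \<exists>Q1. \<forall>(N::nat) Q. Q >= Q1 --> 1 / real i <= real N / Q --> real N / Q <= B -->
   (\<exists>\<alpha> \<beta> :: nat => nat => complex. ?ortho N K \<alpha> \<beta> & ?sv (e i K) N K Q \<alpha> \<beta>)"
  by metis
 define \<epsilon>0 where "\<epsilon>0 = (%(\<tau>::real) (K::nat). e (nat \<lceil>1 / \<tau>\<rceil>) K)"
 have second: "\<exists>N0. \<forall>(N::nat) (Q::real). N >= 1 --> N >= N0 --> Q >= 1 --> A <= real N / Q --> real N / Q <= B -->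
   (\<exists>\<alpha> \<beta> :: nat => nat => complex. ?ortho N K \<alpha> \<beta> & ?sv (\<epsilon>0 (real N / Q) K) N K Q \<alpha> \<beta>)"
  if AB: "0 < A" "A <= B" "K >= 1" for A B :: real and K :: nat
 proof -
  have "\<forall>i\<in>{1::nat..}. \<exists>Q1. \<forall>(N::nat) Q. Q >= Q1 --> 1 / real i <= real N / Q --> real N / Q <= B -->
   (\<exists>\<alpha> \<beta> :: nat => nat => complex. ?ortho N K \<alpha> \<beta> & ?sv (e i K) N K Q \<alpha> \<beta>)"
   using e(2) AB(3) by simp
  then obtain q where q: "\<forall>i\<in>{1::nat..}. \<forall>(N::nat) Q. Q >= q i --> 1 / real i <= real N / Q --> real N / Q <= B -->
   (\<exists>\<alpha> \<beta> :: nat => nat => complex. ?ortho N K \<alpha> \<beta> & ?sv (e i K) N K Q \<alpha> \<beta>)"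
   unfolding bchoice_iff by blast
  define I where "I = nat \<lceil>1 / A\<rceil>"
  define N0 where "N0 = nat \<lceil>B * Max (insert 1 (q ` {1..I}))\<rceil>"
  show ?thesis
  proof (intro exI[of _ N0] allI impI)
   fix N :: nat and Q :: real
   assume a: "N >= 1" "N >= N0" "Q >= 1" "A <= real N / Q" "real N / Q <= B"
   define i where "i = nat \<lceil>1 / (real N / Q)\<rceil>"
   have T0: "real N / Q > 0" using a by simp
   have iT: "1 / (real N / Q) <= real i" unfolding i_def by linarith
   have "0 < 1 / (real N / Q)" using T0 by (rule divide_pos_pos[OF zero_less_one])
   then have i1: "i >= 1" using iT by linarith
   have "1 / (real N / Q) <= 1 / A" using a AB T0 by (intro divide_left_mono mult_pos_pos) auto
   then have iI: "i <= I" unfolding i_def I_def by (intro nat_mono ceiling_mono)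
   have "B * Max (insert 1 (q ` {1..I})) <= real N" using a(2) unfolding N0_def by linarith
   moreover have "real N <= B * Q" using a by (simp add: field_simps)
   ultimately have "B * Max (insert 1 (q ` {1..I})) <= B * Q" by linarith
   then have "Max (insert 1 (q ` {1..I})) <= Q" using AB by simp
   moreover have "q i <= Max (insert 1 (q ` {1..I}))" using i1 iI by (intro Max_ge) auto
   ultimately have Qq: "Q >= q i" by linarith
   have i0: "0 < real i" using i1 by simp
   have "1 <= real i * (real N / Q)" using iT unfolding pos_divide_le_eq[OF T0] .
   then have "1 <= (real N / Q) * real i" by (simp only: mult.commute)
   then have ai: "1 / real i <= real N / Q" unfolding pos_divide_le_eq[OF i0] .
   have "\<exists>\<alpha> \<beta> :: nat => nat => complex. ?ortho N K \<alpha> \<beta> & ?sv (e i K) N K Q \<alpha> \<beta>" using q i1 Qq ai a(5) by simp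
   then show "\<exists>\<alpha> \<beta> :: nat => nat => complex. ?ortho N K \<alpha> \<beta> & ?sv (\<epsilon>0 (real N / Q) K) N K Q \<alpha> \<beta>"
    unfolding \<epsilon>0_def i_def .
  qed
 qed
 show ?thesis
  unfolding Let_def
 proof (rule exI[of _ 1600], intro conjI)
  show "(1600::real) > 0" by simp
  show "\<exists>C::real. C > 0 \<and>
   (\<forall>(\<epsilon>::real) (N::nat) (Q::real). \<epsilon> > 0 --> N >= 1 --> Q >= 1 -->
     (\<exists>V. seq.subspace V & V \<subseteq> seq_space N \<and>
      (\<epsilon> < 1 --> real (seq.dim V) <= C * ((real N / Q)\<^sup>2 / (\<epsilon>\<^sup>2 * ln (1 / \<epsilon>)))) \<and>
      (\<forall>\<phi>\<in>seq_space N. (\<forall>\<psi>\<in>V. herm N \<phi> \<psi> = 0) --> ln Q > 1600 * (ln (real N / Q))\<^sup>2 -->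
       (1 - \<epsilon>) * sq_norm N \<phi> <= sieve_sum W N Q \<phi> & sieve_sum W N Q \<phi> <= (1 + \<epsilon>) * sq_norm N \<phi>)))"
  proof (intro exI[of _ D] conjI allI impI D(1))
   fix \<epsilon> Q :: real and N :: nat
   assume h: "\<epsilon> > 0" "N >= 1" "Q >= 1"
   obtain V where V: "seq.subspace V" "V \<subseteq> seq_space N" "\<epsilon> < 1 --> real (seq.dim V) <= D * ((real N / Q)\<^sup>2 / (\<epsilon>\<^sup>2 * ln (1 / \<epsilon>)))"
    "\<forall>\<phi>\<in>seq_space N. (\<forall>\<psi>\<in>V. herm N \<phi> \<psi> = 0) --> ln Q > 1600 * (ln (real N / Q))\<^sup>2 --> \<bar>sieve_sum W N Q \<phi> - sq_norm N \<phi>\<bar> <= \<epsilon> * sq_norm N \<phi>"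
    using D(2)[OF h] by blast
   show "\<exists>V. seq.subspace V & V \<subseteq> seq_space N \<and>
      (\<epsilon> < 1 --> real (seq.dim V) <= D * ((real N / Q)\<^sup>2 / (\<epsilon>\<^sup>2 * ln (1 / \<epsilon>)))) \<and>
      (\<forall>\<phi>\<in>seq_space N. (\<forall>\<psi>\<in>V. herm N \<phi> \<psi> = 0) --> ln Q > 1600 * (ln (real N / Q))\<^sup>2 -->
       (1 - \<epsilon>) * sq_norm N \<phi> <= sieve_sum W N Q \<phi> & sieve_sum W N Q \<phi> <= (1 + \<epsilon>) * sq_norm N \<phi>)"
    by (rule exI[of _ V]) (use V one in blast)
  qed
  show "\<exists>\<epsilon>\<^sub>0 :: real => nat => real. (\<forall>\<tau> K. \<tau> > 0 --> K >= 1 --> \<epsilon>\<^sub>0 \<tau> K > 0) \<and>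
   (\<forall>(A::real) (B::real) (K::nat). 0 < A --> A <= B --> K >= 1 -->
    (\<exists>(C::real) (N\<^sub>0::nat). C > 0 \<and>
     (\<forall>(N::nat) (Q::real). N >= 1 --> N >= N\<^sub>0 --> Q >= 1 -->
      (A <= real N / Q --> real N / Q <= B -->
       (\<exists>\<alpha> \<beta> :: nat => nat => complex.
        (\<forall>k\<in>{1..K}. \<alpha> k \<in> seq_space N & \<beta> k \<in> seq_space N \<and>
          herm N (\<alpha> k) (\<alpha> k) = 1 & herm N (\<beta> k) (\<beta> k) = 1) \<and>
        (\<forall>i \<in> {1..K} <+> {1..K}. \<forall>j \<in> {1..K} <+> {1..K}.
          cmod (herm N (case_sum \<alpha> \<beta> i) (case_sum \<alpha> \<beta> j) - of_bool (i = j))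
           <= C * exp (- 1600 * sqrt (ln (real N)))) \<and>
        (\<forall>k\<in>{1..K}. sieve_sum W N Q (\<alpha> k) > (1 + \<epsilon>\<^sub>0 (real N / Q) K) * sq_norm N (\<alpha> k)) \<and>
        (\<forall>k\<in>{1..K}. sieve_sum W N Q (\<beta> k) < (1 - \<epsilon>\<^sub>0 (real N / Q) K) * sq_norm N (\<beta> k)))))))"
  proof (intro exI[of _ \<epsilon>0] conjI allI impI)
   show "\<epsilon>0 \<tau> K > 0" for \<tau> K unfolding \<epsilon>0_def by (rule e(1))
   fix A B :: real and K :: nat
   assume AB: "0 < A" "A <= B" "K >= 1"
   obtain N0 where N0: "!!(N::nat) (Q::real). N >= 1 ==> N >= N0 ==> Q >= 1 ==> A <= real N / Q ==> real N / Q <= B ==>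
    \<exists>\<alpha> \<beta> :: nat => nat => complex. ?ortho N K \<alpha> \<beta> & ?sv (\<epsilon>0 (real N / Q) K) N K Q \<alpha> \<beta>"
    using second[OF AB] by blast
   show "\<exists>(C::real) (N\<^sub>0::nat). C > 0 \<and>
     (\<forall>(N::nat) (Q::real). N >= 1 --> N >= N\<^sub>0 --> Q >= 1 -->
      (A <= real N / Q --> real N / Q <= B -->
       (\<exists>\<alpha> \<beta> :: nat => nat => complex.
        (\<forall>k\<in>{1..K}. \<alpha> k \<in> seq_space N & \<beta> k \<in> seq_space N \<and>
          herm N (\<alpha> k) (\<alpha> k) = 1 & herm N (\<beta> k) (\<beta> k) = 1) \<and>
        (\<forall>i \<in> {1..K} <+> {1..K}. \<forall>j \<in> {1..K} <+> {1..K}.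
          cmod (herm N (case_sum \<alpha> \<beta> i) (case_sum \<alpha> \<beta> j) - of_bool (i = j))
           <= C * exp (- 1600 * sqrt (ln (real N)))) & ?sv (\<epsilon>0 (real N / Q) K) N K Q \<alpha> \<beta>)))"
   proof (rule exI[of _ 1], rule exI[of _ N0], rule conjI[OF zero_less_one], intro allI impI)
    fix N :: nat and Q :: real
    assume h: "N >= 1" "N >= N0" "Q >= 1" "A <= real N / Q" "real N / Q <= B"
    obtain \<alpha> \<beta> where w: "?ortho N K \<alpha> \<beta>" "?sv (\<epsilon>0 (real N / Q) K) N K Q \<alpha> \<beta>" using N0[OF h] by blast
    have aa: "herm N (\<alpha> k) (\<alpha> k) = 1" "herm N (\<beta> k) (\<beta> k) = 1" if "k \<in> {1..K}" for k
    proof -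
     have m: "Inl k \<in> {1..K} <+> {1..K}" "Inr k \<in> {1..K} <+> {1..K}" using that by (auto intro: InlI InrI)
     show "herm N (\<alpha> k) (\<alpha> k) = 1" "herm N (\<beta> k) (\<beta> k) = 1"
      using w(1)[THEN conjunct2, rule_format, OF m(1) m(1)] w(1)[THEN conjunct2, rule_format, OF m(2) m(2)] by simp_all
    qed
    show "\<exists>\<alpha> \<beta> :: nat => nat => complex.
        (\<forall>k\<in>{1..K}. \<alpha> k \<in> seq_space N & \<beta> k \<in> seq_space N \<and>
          herm N (\<alpha> k) (\<alpha> k) = 1 & herm N (\<beta> k) (\<beta> k) = 1) \<and>
        (\<forall>i \<in> {1..K} <+> {1..K}. \<forall>j \<in> {1..K} <+> {1..K}.
          cmod (herm N (case_sum \<alpha> \<beta> i) (case_sum \<alpha> \<beta> j) - of_bool (i = j))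
           <= 1 * exp (- 1600 * sqrt (ln (real N)))) & ?sv (\<epsilon>0 (real N / Q) K) N K Q \<alpha> \<beta>"
    proof (rule exI[of _ \<alpha>], rule exI[of _ \<beta>], rule conjI[OF _ conjI[OF _ w(2)]])
     show "\<forall>k\<in>{1..K}. \<alpha> k \<in> seq_space N & \<beta> k \<in> seq_space N & herm N (\<alpha> k) (\<alpha> k) = 1 & herm N (\<beta> k) (\<beta> k) = 1"
      using w(1) aa by blast
     show "\<forall>i \<in> {1..K} <+> {1..K}. \<forall>j \<in> {1..K} <+> {1..K}.
          cmod (herm N (case_sum \<alpha> \<beta> i) (case_sum \<alpha> \<beta> j) - of_bool (i = j)) <= 1 * exp (- 1600 * sqrt (ln (real N)))"
      using w(1)[THEN conjunct2] by simp
    qed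
   qed
  qed
 qed
qed

end
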